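(* Let $(M,\omega,L,h)$ be a polarized toric Kähler manifold of complex dimension $m$ with Delzant polytope $P\subset\mathbb{R}^m$, open orbit $M^o$, moment map $\mu_h$ and Kähler potential $\varphi$ on $M^o$. Let $z\in M^o$, and for $k\ge 1$ let $$D_{\sqrt{k}}\tilde{\mu}_k^z=\frac{1}{\Pi_{h^k}(z,z)}\sum_{\alpha\in kP\cap\mathbb{Z}^m}\frac{|s_\alpha(z)|_{h^k}^2}{\|s_\alpha\|_{h^k}^2}\,\delta_{\sqrt{k}\left(\frac{\alpha}{k}-\mu_h(z)\right)}.$$ Let $f\in C_0(\mathbb{R}^m)$ have Fourier transform $\hat f\in L^1(\mathbb{R}^m)$ that is bounded by a radially decreasing $L^1$ function, i.e. $|\hat f(t)|\le g(|t|)$ for a nonincreasing function $g$ on $(0,\infty)$ with $t\mapsto g(|t|)$ in $L^1(\mathbb{R}^m)$. Then, as $k\to\infty$, $$\int_{\mathbb{R}^m} f(x)\, d\big(D_{\sqrt{k}}\tilde{\mu}_k^z\big)(x)=\int_{\mathbb{R}^m} f(x)\,d\gamma_{0,\mathrm{Hess}\,\varphi(z)}(x)+O_f\!\left(\frac{1}{\sqrt{k}}\right),$$ where the implied constant depends on $f$ (and on $z$ and the geometric data) but not on $k$.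
   Context: Setting. $(M,\omega)$ is a smooth projective toric Kähler manifold of complex dimension $m$: $(\mathbb{C}^* )^m$ acts holomorphically with an open dense orbit $M^o$, identified with $(\mathbb{C}^* )^m$ by choosing a base point, and the real torus $\mathbf{T}^m$ acts in a Hamiltonian way. $L\to M$ is an ample toric (equivariant) line bundle, and $h$ is a smooth $\mathbf{T}^m$-invariant Hermitian metric on $L$ with positive curvature form $\omega$. $P\subset\mathbb{R}^m$ is the associated Delzant (convex lattice) polytope: there is an invariant holomorphic frame $e_L$ of $L$ over $M^o$ such that, for every $k\ge1$, the sections $s_\alpha=z^\alpha e_L^{\otimes k}$, $\alpha\in kP\cap\mathbb{Z}^m$, extend to $M$ and form a basis of $H^0(M,L^k)$. Kähler potential and moment map. On $M^o$ write $|e_L|_h^2=e^{-\varphi}$, so $\omega=i\partial\bar\partial\varphi$ and $|s_\alpha(z)|_{h^k}^2=|z^\alpha|^2e^{-k\varphi(z)}$. Use coordinates $z_j=e^{\rho_j/2+i\theta_j}$ on $M^o$, i.e. $\rho_j=\log|z_j|^2$. By invariance $\varphi$ is a function of $\rho\in\mathbb{R}^m$ only, and it is convex. The moment map on $M^o$ is $\mu_h(z)=\nabla_\rho\varphi(\rho)=(\partial_{\rho_1}\varphi,\dots,\partial_{\rho_m}\varphi)$, and $\mu_h(M)=P$. $\mathrm{Hess}\,\varphi(z)$ is the $m\times m$ matrix $\big(\partial^2\varphi/\partial\rho_i\partial\rho_j\big)$ at the point $\rho$ corresponding to $z$. Norms and kernel. $\|s_\alpha\|_{h^k}^2=\int_M|s_\alpha|_{h^k}^2\,\omega^m/m!$.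 The $s_\alpha$ are orthogonal for the corresponding inner product, and the Bergman/Szegő density is $\Pi_{h^k}(z,z)=\sum_{\alpha\in kP\cap\mathbb{Z}^m}|s_\alpha(z)|_{h^k}^2/\|s_\alpha\|_{h^k}^2$. Notation. $C_0(\mathbb{R}^m)$ is the space of continuous functions vanishing at infinity. The Fourier transform is normalized so that $f(x)=\int_{\mathbb{R}^m}\hat f(t)e^{-i\langle t,x\rangle}\,dt$ (in general understood in the sense of tempered distributions; the hypothesis does not depend on the normalization). $\gamma_{\vec m,\Sigma}$ is the Gaussian probability measure on $\mathbb{R}^m$ with mean $\vec m$ and covariance matrix $\Sigma$, with density $(2\pi)^{-m/2}(\det\Sigma)^{-1/2}e^{-\frac12\langle\Sigma^{-1}(x-\vec m),x-\vec m\rangle}$. *)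

theory Defs
  imports "HOL-Analysis.Analysis" "HOL-Library.Landau_Symbols"
begin

text \<open>\<open>imult\<close> is multiplication by the imaginary unit.  A holomorphic map is one that is real
  differentiable with a derivative commuting with \<open>imult\<close>.\<close>

class complex_structure = real_normed_vector +
  fixes imult :: "'a \<Rightarrow> 'a"
  assumes imult_add: "imult (x + y) = imult x + imult y"
    and imult_scaleR: "imult (r *\<^sub>R x) = r *\<^sub>R imult x"
    and imult_imult: "imult (imult x) = - x"

instantiation complex :: complex_structure
begin
definition imult_complex :: "complex \<Rightarrow> complex" where "imult_complex z = \<i> * z"
instance by standard (simp_all add: imult_complex_def algebra_simps flip: mult.assoc)
end

instantiation vec :: (complex_structure, finite) complex_structure
begin
definition imult_vec :: "'a ^ 'b \<Rightarrow> 'a ^ 'b" where "imult_vec v = (\<chi> j. imult (v $ j))"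
instance by standard
  (simp_all add: imult_vec_def vec_eq_iff imult_add imult_scaleR imult_imult)
end

instantiation prod :: (complex_structure, complex_structure) complex_structure
begin
definition imult_prod :: "'a \<times> 'b \<Rightarrow> 'a \<times> 'b" where "imult_prod p = (imult (fst p), imult (snd p))"
instance by standard
  (simp_all add: imult_prod_def prod_eq_iff imult_add imult_scaleR imult_imult)
end

definition holo_on :: "'a::complex_structure set \<Rightarrow> ('a \<Rightarrow> 'b::complex_structure) \<Rightarrow> bool" where
  "holo_on S f \<longleftrightarrow>
     (\<forall>x\<in>S. \<exists>D. (f has_derivative D) (at x) \<and> (\<forall>v. D (imult v) = imult (D v)))"

primrec Ck_on ::
    "nat \<Rightarrow> 'a::real_normed_vector set \<Rightarrow> ('a \<Rightarrow> 'b::real_normed_vector) \<Rightarrow> bool" where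
  "Ck_on 0 S f \<longleftrightarrow> continuous_on S f"
| "Ck_on (Suc n) S f \<longleftrightarrow> (\<forall>x\<in>S. f differentiable (at x)) \<and>
     (\<forall>v. Ck_on n S (\<lambda>x. frechet_derivative f (at x) v))"

definition smooth_on :: "'a::real_normed_vector set \<Rightarrow> ('a \<Rightarrow> 'b::real_normed_vector) \<Rightarrow> bool" where
  "smooth_on S f \<longleftrightarrow> (\<forall>n. Ck_on n S f)"

text \<open>The Wirtinger operators, and the coefficient matrix \<open>(\<partial>\<^sup>2f / \<partial>w\<^sub>a \<partial>cnj w\<^sub>b)\<close> of \<open>\<partial>\<partial>\<^sup>-f\<close>.\<close>

definition wirtinger :: "'m::finite \<Rightarrow> (complex^'m \<Rightarrow> complex) \<Rightarrow> complex^'m \<Rightarrow> complex" where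
  "wirtinger a F w = (frechet_derivative F (at w) (axis a 1)
      - \<i> * frechet_derivative F (at w) (axis a \<i>)) / 2"

definition wirtinger_bar :: "'m::finite \<Rightarrow> (complex^'m \<Rightarrow> complex) \<Rightarrow> complex^'m \<Rightarrow> complex" where
  "wirtinger_bar a F w = (frechet_derivative F (at w) (axis a 1)
      + \<i> * frechet_derivative F (at w) (axis a \<i>)) / 2"

definition complex_hessian :: "(complex^'m::finite \<Rightarrow> real) \<Rightarrow> complex^'m \<Rightarrow> complex^'m^'m" where
  "complex_hessian f w =
     (\<chi> a b. wirtinger a (wirtinger_bar b (\<lambda>u. complex_of_real (f u))) w)"

text \<open>The manifold is the whole type \<open>'a\<close>, with an atlas indexed by \<open>'i\<close>.\<close>

record ('i, 'a, 'm::finite) atlas =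
  chart_dom :: "'i \<Rightarrow> 'a set"
  chart :: "'i \<Rightarrow> 'a \<Rightarrow> complex^'m"

definition cinv :: "('i, 'a, 'm::finite) atlas \<Rightarrow> 'i \<Rightarrow> complex^'m \<Rightarrow> 'a" where
  "cinv M i = inv_into (chart_dom M i) (chart M i)"

definition complex_manifold :: "('i, 'a::t2_space, 'm::finite) atlas \<Rightarrow> bool" where
  "complex_manifold M \<longleftrightarrow>
     (\<Union>i. chart_dom M i) = UNIV \<and>
     (\<forall>i. open (chart_dom M i) \<and> open (chart M i ` chart_dom M i) \<and>
        homeomorphism (chart_dom M i) (chart M i ` chart_dom M i) (chart M i) (cinv M i)) \<and>
     (\<forall>i j. holo_on (chart M i ` (chart_dom M i \<inter> chart_dom M j)) (chart M j \<circ> cinv M i))"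

definition holo_fun_on ::
    "('i, 'a::t2_space, 'm::finite) atlas \<Rightarrow> 'a set \<Rightarrow> ('a \<Rightarrow> complex) \<Rightarrow> bool" where
  "holo_fun_on M W f \<longleftrightarrow> (\<forall>i. holo_on (chart M i ` (W \<inter> chart_dom M i)) (f \<circ> cinv M i))"

text \<open>A holomorphic line bundle is given by a trivialising open cover indexed by \<open>'j\<close> and a
  holomorphic cocycle: a vector with coordinate \<open>c\<close> in the trivialisation \<open>j\<close> has coordinate
  \<open>transit i j p * c\<close> in the trivialisation \<open>i\<close>.\<close>

record ('j, 'a) cocycle =
  triv :: "'j \<Rightarrow> 'a set"
  transit :: "'j \<Rightarrow> 'j \<Rightarrow> 'a \<Rightarrow> complex"

definition line_bundle ::
    "('i, 'a::t2_space, 'm::finite) atlas \<Rightarrow> ('j, 'a) cocycle \<Rightarrow> bool" where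
  "line_bundle M L \<longleftrightarrow>
     (\<Union>j. triv L j) = UNIV \<and> (\<forall>j. open (triv L j)) \<and>
     (\<forall>i j. holo_fun_on M (triv L i \<inter> triv L j) (transit L i j)) \<and>
     (\<forall>i j. \<forall>p \<in> triv L i \<inter> triv L j. transit L i j p \<noteq> 0) \<and>
     (\<forall>i. \<forall>p \<in> triv L i. transit L i i p = 1) \<and>
     (\<forall>i j l. \<forall>p \<in> triv L i \<inter> triv L j \<inter> triv L l.
        transit L i j p * transit L j l p = transit L i l p)"

text \<open>Holomorphic sections of the tensor power \<open>L\<^sup>k\<close> over an open set \<open>W\<close>, as families of local
  coordinates.  Global sections are normalised to be \<open>0\<close> off the trivialising sets, so that
  equality of families is equality of sections.\<close>

definition holo_section ::
    "('i, 'a::t2_space, 'm::finite) atlas \<Rightarrow> ('j, 'a) cocycle \<Rightarrow> nat \<Rightarrow> 'a set \<Rightarrow>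
     ('j \<Rightarrow> 'a \<Rightarrow> complex) \<Rightarrow> bool" where
  "holo_section M L k W s \<longleftrightarrow>
     (\<forall>j. holo_fun_on M (W \<inter> triv L j) (s j)) \<and>
     (\<forall>i j. \<forall>p \<in> W \<inter> triv L i \<inter> triv L j. s i p = transit L i j p ^ k * s j p)"

definition H0 ::
    "('i, 'a::t2_space, 'm::finite) atlas \<Rightarrow> ('j, 'a) cocycle \<Rightarrow> nat \<Rightarrow> ('j \<Rightarrow> 'a \<Rightarrow> complex) set" where
  "H0 M L k = {s. holo_section M L k UNIV s \<and> (\<forall>j p. p \<notin> triv L j \<longrightarrow> s j p = 0)}"

definition vanishes_at :: "('j, 'a) cocycle \<Rightarrow> ('j \<Rightarrow> 'a \<Rightarrow> complex) \<Rightarrow> 'a \<Rightarrow> bool" where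
  "vanishes_at L s p \<longleftrightarrow> (\<forall>j. p \<in> triv L j \<longrightarrow> s j p = 0)"

text \<open>On a compact manifold, \<open>L\<^sup>k\<close> is very ample (its sections define an embedding into a
  projective space) iff it has no base points and its sections separate points and tangent
  vectors.\<close>

definition very_ample_power ::
    "('i, 'a::t2_space, 'm::finite) atlas \<Rightarrow> ('j, 'a) cocycle \<Rightarrow> nat \<Rightarrow> bool" where
  "very_ample_power M L k \<longleftrightarrow>
     (\<forall>p. \<exists>s \<in> H0 M L k. \<not> vanishes_at L s p) \<and>
     (\<forall>p q. p \<noteq> q \<longrightarrow> (\<exists>s \<in> H0 M L k. vanishes_at L s p \<and> \<not> vanishes_at L s q)) \<and>
     (\<forall>i j. \<forall>p \<in> chart_dom M i \<inter> triv L j. \<forall>v. v \<noteq> 0 \<longrightarrow>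
        (\<exists>s \<in> H0 M L k. vanishes_at L s p \<and>
           frechet_derivative (s j \<circ> cinv M i) (at (chart M i p)) v \<noteq> 0))"

definition ample :: "('i, 'a::t2_space, 'm::finite) atlas \<Rightarrow> ('j, 'a) cocycle \<Rightarrow> bool" where
  "ample M L \<longleftrightarrow> (\<exists>k\<ge>1. very_ample_power M L k)"

text \<open>\<open>h j p\<close> is the squared norm at \<open>p\<close> of the frame of the trivialisation \<open>j\<close>.\<close>

definition hermitian_metric ::
    "('i, 'a::t2_space, 'm::finite) atlas \<Rightarrow> ('j, 'a) cocycle \<Rightarrow> ('j \<Rightarrow> 'a \<Rightarrow> real) \<Rightarrow> bool" where
  "hermitian_metric M L h \<longleftrightarrow>
     (\<forall>j. \<forall>p \<in> triv L j. h j p > 0) \<and>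
     (\<forall>i j. \<forall>p \<in> triv L i \<inter> triv L j. h j p = (cmod (transit L i j p))\<^sup>2 * h i p) \<and>
     (\<forall>i j. smooth_on (chart M i ` (chart_dom M i \<inter> triv L j)) (h j \<circ> cinv M i))"

text \<open>The squared pointwise norm of a section of \<open>L\<^sup>k\<close>; it does not depend on the choice of \<open>j\<close>.\<close>

definition norm2_at ::
    "('j, 'a) cocycle \<Rightarrow> ('j \<Rightarrow> 'a \<Rightarrow> real) \<Rightarrow> nat \<Rightarrow> ('j \<Rightarrow> 'a \<Rightarrow> complex) \<Rightarrow> 'a \<Rightarrow> real" where
  "norm2_at L h k s p = (let j = (SOME j. p \<in> triv L j) in h j p ^ k * (cmod (s j p))\<^sup>2)"

text \<open>The matrix \<open>G\<close> of the curvature form \<open>\<omega> = i \<Sum> G\<^sub>a\<^sub>b dw\<^sub>a \<and> cnj dw\<^sub>b = - i \<partial>\<partial>\<^sup>- log h\<close> in the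
  chart \<open>i\<close>, computed in the trivialisation \<open>j\<close> (it does not depend on \<open>j\<close>).\<close>

definition curvature_matrix ::
    "('i, 'a::t2_space, 'm::finite) atlas \<Rightarrow> ('j \<Rightarrow> 'a \<Rightarrow> real) \<Rightarrow> 'i \<Rightarrow> 'j \<Rightarrow> 'a \<Rightarrow> complex^'m^'m" where
  "curvature_matrix M h i j p = complex_hessian (\<lambda>w. - ln (h j (cinv M i w))) (chart M i p)"

definition positively_curved ::
    "('i, 'a::t2_space, 'm::finite) atlas \<Rightarrow> ('j, 'a) cocycle \<Rightarrow> ('j \<Rightarrow> 'a \<Rightarrow> real) \<Rightarrow> bool" where
  "positively_curved M L h \<longleftrightarrow>
     (\<forall>i j. \<forall>p \<in> chart_dom M i \<inter> triv L j. \<forall>v. v \<noteq> 0 \<longrightarrow>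
        (\<Sum>a\<in>UNIV. \<Sum>b\<in>UNIV. curvature_matrix M h i j p $ a $ b * v $ a * cnj (v $ b)) \<in> \<real> \<and>
        Re (\<Sum>a\<in>UNIV. \<Sum>b\<in>UNIV. curvature_matrix M h i j p $ a $ b * v $ a * cnj (v $ b)) > 0)"

text \<open>The Borel measure defined by the volume form \<open>\<omega>\<^sup>m / m!\<close>.  In a chart with \<open>w = x + i y\<close> this
  form is \<open>det G \<Prod> i dw\<^sub>a \<and> cnj dw\<^sub>a = 2\<^sup>m det G \<Prod> dx\<^sub>a dy\<^sub>a\<close>.\<close>

definition kaehler_volume ::
    "('i, 'a::t2_space, 'm::finite) atlas \<Rightarrow> ('j, 'a) cocycle \<Rightarrow> ('j \<Rightarrow> 'a \<Rightarrow> real) \<Rightarrow>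
     'a measure \<Rightarrow> bool" where
  "kaehler_volume M L h vol \<longleftrightarrow>
     sets vol = sets borel \<and>
     (\<forall>i j. \<forall>A \<in> sets borel. A \<subseteq> chart_dom M i \<inter> triv L j \<longrightarrow>
        emeasure vol A = (\<integral>\<^sup>+ w. ennreal (2 ^ CARD('m) * Re (det (curvature_matrix M h i j (cinv M i w))))
            * indicator (chart M i ` A) w \<partial>lborel))"

definition section_norm2 ::
    "('j, 'a::t2_space) cocycle \<Rightarrow> ('j \<Rightarrow> 'a \<Rightarrow> real) \<Rightarrow> 'a measure \<Rightarrow> nat \<Rightarrow>
     ('j \<Rightarrow> 'a \<Rightarrow> complex) \<Rightarrow> real" where
  "section_norm2 L h vol k s = (LINT p|vol. norm2_at L h k s p)"

text \<open>Products and \<open>1\<close> in \<open>complex^'m\<close> are componentwise, so these are the groups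
  \<open>(\<complex>\<^sup>*)\<^sup>m\<close> and \<open>T\<^sup>m\<close>.\<close>

definition ctorus :: "(complex^'m::finite) set" where
  "ctorus = {t. \<forall>a. t $ a \<noteq> 0}"

definition rtorus :: "(complex^'m::finite) set" where
  "rtorus = {t. \<forall>a. cmod (t $ a) = 1}"

definition holo_action ::
    "('i, 'a::t2_space, 'm::finite) atlas \<Rightarrow> (complex^'m \<Rightarrow> 'a \<Rightarrow> 'a) \<Rightarrow> bool" where
  "holo_action M act \<longleftrightarrow>
     (\<forall>p. act 1 p = p) \<and>
     (\<forall>s\<in>ctorus. \<forall>t\<in>ctorus. \<forall>p. act (s * t) p = act s (act t p)) \<and>
     continuous_on (ctorus \<times> UNIV) (\<lambda>(t, p). act t p) \<and>
     (\<forall>i j. holo_on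
        {(t, w). t \<in> ctorus \<and> w \<in> chart M i ` chart_dom M i \<and> act t (cinv M i w) \<in> chart_dom M j}
        (\<lambda>(t, w). chart M j (act t (cinv M i w))))"

definition open_orbit :: "(complex^'m::finite \<Rightarrow> 'a \<Rightarrow> 'a) \<Rightarrow> 'a \<Rightarrow> 'a set" where
  "open_orbit act p0 = (\<lambda>t. act t p0) ` ctorus"

definition toric_manifold ::
    "('i, 'a::t2_space, 'm::finite) atlas \<Rightarrow> (complex^'m \<Rightarrow> 'a \<Rightarrow> 'a) \<Rightarrow> 'a \<Rightarrow> bool" where
  "toric_manifold M act p0 \<longleftrightarrow>
     complex_manifold M \<and> compact (UNIV :: 'a set) \<and> holo_action M act \<and>
     open (open_orbit act p0) \<and> closure (open_orbit act p0) = UNIV \<and>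
     inj_on (\<lambda>t. act t p0) ctorus"

text \<open>A lift of the action to \<open>L\<close>: for \<open>p \<in> triv L i\<close> and \<open>act t p \<in> triv L j\<close>, the linear
  isomorphism from the fibre at \<open>p\<close> to the fibre at \<open>act t p\<close> is multiplication by \<open>lift t i j p\<close> in
  the coordinates of the trivialisations \<open>i\<close> and \<open>j\<close>.  Compatibility with changes of
  trivialisation follows from the group law (take \<open>s = 1\<close> or \<open>t = 1\<close>).\<close>

definition linearization ::
    "('i, 'a::t2_space, 'm::finite) atlas \<Rightarrow> (complex^'m \<Rightarrow> 'a \<Rightarrow> 'a) \<Rightarrow> ('j, 'a) cocycle \<Rightarrow>
     (complex^'m \<Rightarrow> 'j \<Rightarrow> 'j \<Rightarrow> 'a \<Rightarrow> complex) \<Rightarrow> bool" where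
  "linearization M act L lift \<longleftrightarrow>
     (\<forall>i j. \<forall>p \<in> triv L i \<inter> triv L j. lift 1 i j p = transit L j i p) \<and>
     (\<forall>s\<in>ctorus. \<forall>t\<in>ctorus. \<forall>i j l p.
        p \<in> triv L i \<and> act t p \<in> triv L j \<and> act (s * t) p \<in> triv L l \<longrightarrow>
        lift (s * t) i l p = lift s j l (act t p) * lift t i j p) \<and>
     (\<forall>c i j. holo_on
        {(t, w). t \<in> ctorus \<and> w \<in> chart M c ` chart_dom M c \<and>
           cinv M c w \<in> triv L i \<and> act t (cinv M c w) \<in> triv L j}
        (\<lambda>(t, w). lift t i j (cinv M c w)))"

definition torus_invariant_metric ::
    "(complex^'m::finite \<Rightarrow> 'a \<Rightarrow> 'a) \<Rightarrow> ('j, 'a) cocycle \<Rightarrow>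
     (complex^'m \<Rightarrow> 'j \<Rightarrow> 'j \<Rightarrow> 'a \<Rightarrow> complex) \<Rightarrow> ('j \<Rightarrow> 'a \<Rightarrow> real) \<Rightarrow> bool" where
  "torus_invariant_metric act L lift h \<longleftrightarrow>
     (\<forall>t\<in>rtorus. \<forall>i j p. p \<in> triv L i \<and> act t p \<in> triv L j \<longrightarrow>
        h j (act t p) * (cmod (lift t i j p))\<^sup>2 = h i p)"

definition invariant_frame ::
    "('i, 'a::t2_space, 'm::finite) atlas \<Rightarrow> (complex^'m \<Rightarrow> 'a \<Rightarrow> 'a) \<Rightarrow> 'a \<Rightarrow> ('j, 'a) cocycle \<Rightarrow>
     (complex^'m \<Rightarrow> 'j \<Rightarrow> 'j \<Rightarrow> 'a \<Rightarrow> complex) \<Rightarrow> ('j \<Rightarrow> 'a \<Rightarrow> complex) \<Rightarrow> bool" where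
  "invariant_frame M act p0 L lift e \<longleftrightarrow>
     holo_section M L 1 (open_orbit act p0) e \<and>
     (\<forall>j. \<forall>p \<in> open_orbit act p0 \<inter> triv L j. e j p \<noteq> 0) \<and>
     (\<forall>t\<in>ctorus. \<forall>i j. \<forall>p \<in> open_orbit act p0.
        p \<in> triv L i \<and> act t p \<in> triv L j \<longrightarrow> e j (act t p) = lift t i j p * e i p)"

text \<open>The Kaehler form is the curvature form of \<open>h\<close>.  Since \<open>h\<close> and the lift are invariant, the
  action of \<open>rtorus\<close> preserves it and is Hamiltonian, with moment map obtained by differentiating
  \<open>log h\<close> along invariant local data (\<open>moment_map\<close> below on the open orbit).  Projectivity is
  ampleness of \<open>L\<close>.\<close>

definition polarized_toric_kaehler ::
    "('i, 'a::t2_space, 'm::finite) atlas \<Rightarrow> (complex^'m \<Rightarrow> 'a \<Rightarrow> 'a) \<Rightarrow> 'a \<Rightarrow> ('j, 'a) cocycle \<Rightarrow>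
     (complex^'m \<Rightarrow> 'j \<Rightarrow> 'j \<Rightarrow> 'a \<Rightarrow> complex) \<Rightarrow> ('j \<Rightarrow> 'a \<Rightarrow> real) \<Rightarrow> 'a measure \<Rightarrow> bool" where
  "polarized_toric_kaehler M act p0 L lift h vol \<longleftrightarrow>
     toric_manifold M act p0 \<and>
     line_bundle M L \<and> ample M L \<and> linearization M act L lift \<and>
     hermitian_metric M L h \<and> torus_invariant_metric act L lift h \<and> positively_curved M L h \<and>
     kaehler_volume M L h vol"

definition rvec :: "int^'m \<Rightarrow> real^'m::finite" where
  "rvec \<alpha> = (\<chi> a. real_of_int (\<alpha> $ a))"

definition delzant_polytope :: "(real^'m::finite) set \<Rightarrow> bool" where
  "delzant_polytope P \<longleftrightarrow>
     polytope P \<and> P \<noteq> {} \<and>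
     (\<forall>v. v extreme_point_of P \<longrightarrow> v \<in> range rvec \<and>
        (\<exists>u :: 'm \<Rightarrow> int^'m. \<exists>c :: 'm \<Rightarrow> real.
           (\<forall>x :: int^'m. \<exists>!n :: 'm \<Rightarrow> int. x = (\<Sum>a\<in>UNIV. n a *s u a)) \<and>
           (\<forall>a. c a > 0) \<and>
           {e. e edge_of P \<and> v \<in> e} =
             range (\<lambda>a. closed_segment v (v + c a *\<^sub>R rvec (u a)))))"

definition lattice_points :: "(real^'m::finite) set \<Rightarrow> nat \<Rightarrow> (int^'m) set" where
  "lattice_points P k = {\<alpha>. rvec \<alpha> \<in> (\<lambda>x. real k *\<^sub>R x) ` P}"

definition monomial :: "int^'m \<Rightarrow> complex^'m::finite \<Rightarrow> complex" where
  "monomial \<alpha> z = (\<Prod>a\<in>UNIV. z $ a powi (\<alpha> $ a))"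

text \<open>\<open>P\<close> is the polytope associated with \<open>L\<close> and the frame \<open>e\<close> over the open orbit, and \<open>s k \<alpha>\<close> is
  the extension to \<open>M\<close> of the section \<open>z\<^sup>\<alpha> e\<^sup>k\<close>, where \<open>z\<close> are the coordinates of the point
  \<open>act z p0\<close>.\<close>

definition monomial_basis ::
    "('i, 'a::t2_space, 'm::finite) atlas \<Rightarrow> (complex^'m \<Rightarrow> 'a \<Rightarrow> 'a) \<Rightarrow> 'a \<Rightarrow> ('j, 'a) cocycle \<Rightarrow>
     ('j \<Rightarrow> 'a \<Rightarrow> complex) \<Rightarrow> (real^'m) set \<Rightarrow> (nat \<Rightarrow> int^'m \<Rightarrow> 'j \<Rightarrow> 'a \<Rightarrow> complex) \<Rightarrow> bool" where
  "monomial_basis M act p0 L e P s \<longleftrightarrow>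
     (\<forall>k\<ge>1.
        (\<forall>\<alpha> \<in> lattice_points P k. s k \<alpha> \<in> H0 M L k \<and>
           (\<forall>z\<in>ctorus. \<forall>j. act z p0 \<in> triv L j \<longrightarrow>
              s k \<alpha> j (act z p0) = monomial \<alpha> z * e j (act z p0) ^ k)) \<and>
        (\<forall>\<sigma> \<in> H0 M L k. \<exists>!c. c \<in> lattice_points P k \<rightarrow>\<^sub>E UNIV \<and>
           \<sigma> = (\<lambda>j p. \<Sum>\<alpha>\<in>lattice_points P k. c \<alpha> * s k \<alpha> j p)))"

text \<open>The Kaehler potential \<open>\<phi> = - log |e|\<^sup>2\<close> as a function of \<open>\<rho>\<close>, evaluated at the point with
  \<open>\<theta> = 0\<close>; by invariance of \<open>h\<close> and \<open>e\<close> its value does not depend on \<open>\<theta>\<close>.\<close>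

definition kaehler_potential ::
    "(complex^'m::finite \<Rightarrow> 'a \<Rightarrow> 'a) \<Rightarrow> 'a \<Rightarrow> ('j, 'a) cocycle \<Rightarrow> ('j \<Rightarrow> 'a \<Rightarrow> real) \<Rightarrow>
     ('j \<Rightarrow> 'a \<Rightarrow> complex) \<Rightarrow> real^'m \<Rightarrow> real" where
  "kaehler_potential act p0 L h e \<rho> =
     - ln (norm2_at L h 1 e (act (\<chi> a. complex_of_real (exp (\<rho> $ a / 2))) p0))"

definition log_coords :: "complex^'m::finite \<Rightarrow> real^'m" where
  "log_coords z = (\<chi> a. ln ((cmod (z $ a))\<^sup>2))"

definition gradient :: "(real^'m::finite \<Rightarrow> real) \<Rightarrow> real^'m \<Rightarrow> real^'m" where
  "gradient F x = (\<chi> a. frechet_derivative F (at x) (axis a 1))"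

definition hessian :: "(real^'m::finite \<Rightarrow> real) \<Rightarrow> real^'m \<Rightarrow> real^'m^'m" where
  "hessian F x = (\<chi> a b.
     frechet_derivative (\<lambda>y. frechet_derivative F (at y) (axis b 1)) (at x) (axis a 1))"

definition moment_map ::
    "(complex^'m::finite \<Rightarrow> 'a \<Rightarrow> 'a) \<Rightarrow> 'a \<Rightarrow> ('j, 'a) cocycle \<Rightarrow> ('j \<Rightarrow> 'a \<Rightarrow> real) \<Rightarrow>
     ('j \<Rightarrow> 'a \<Rightarrow> complex) \<Rightarrow> complex^'m \<Rightarrow> real^'m" where
  "moment_map act p0 L h e z = gradient (kaehler_potential act p0 L h e) (log_coords z)"

definition potential_hessian ::
    "(complex^'m::finite \<Rightarrow> 'a \<Rightarrow> 'a) \<Rightarrow> 'a \<Rightarrow> ('j, 'a) cocycle \<Rightarrow> ('j \<Rightarrow> 'a \<Rightarrow> real) \<Rightarrow>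
     ('j \<Rightarrow> 'a \<Rightarrow> complex) \<Rightarrow> complex^'m \<Rightarrow> real^'m^'m" where
  "potential_hessian act p0 L h e z = hessian (kaehler_potential act p0 L h e) (log_coords z)"

definition szego_weight ::
    "('j, 'a::t2_space) cocycle \<Rightarrow> ('j \<Rightarrow> 'a \<Rightarrow> real) \<Rightarrow> 'a measure \<Rightarrow>
     (nat \<Rightarrow> int^'m \<Rightarrow> 'j \<Rightarrow> 'a \<Rightarrow> complex) \<Rightarrow> nat \<Rightarrow> int^'m::finite \<Rightarrow> 'a \<Rightarrow> real" where
  "szego_weight L h vol s k \<alpha> p =
     norm2_at L h k (s k \<alpha>) p / section_norm2 L h vol k (s k \<alpha>)"

definition szego_density ::
    "('j, 'a::t2_space) cocycle \<Rightarrow> ('j \<Rightarrow> 'a \<Rightarrow> real) \<Rightarrow> 'a measure \<Rightarrow>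
     (nat \<Rightarrow> int^'m \<Rightarrow> 'j \<Rightarrow> 'a \<Rightarrow> complex) \<Rightarrow> (real^'m::finite) set \<Rightarrow> nat \<Rightarrow> 'a \<Rightarrow> real" where
  "szego_density L h vol s P k p = (\<Sum>\<alpha>\<in>lattice_points P k. szego_weight L h vol s k \<alpha> p)"

text \<open>The sum of weighted point masses \<open>\<Sum> c\<^sub>\<alpha> \<delta>\<^bsub>x(\<alpha>)\<^esub>\<close> over a finite index set is the image under
  \<open>x\<close> of the point measure with masses \<open>c\<^sub>\<alpha>\<close>.\<close>

definition rescaled_measure ::
    "(complex^'m::finite \<Rightarrow> 'a::t2_space \<Rightarrow> 'a) \<Rightarrow> 'a \<Rightarrow> ('j, 'a) cocycle \<Rightarrow> ('j \<Rightarrow> 'a \<Rightarrow> real) \<Rightarrow>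
     'a measure \<Rightarrow> ('j \<Rightarrow> 'a \<Rightarrow> complex) \<Rightarrow> (real^'m) set \<Rightarrow>
     (nat \<Rightarrow> int^'m \<Rightarrow> 'j \<Rightarrow> 'a \<Rightarrow> complex) \<Rightarrow> complex^'m \<Rightarrow> nat \<Rightarrow> (real^'m) measure" where
  "rescaled_measure act p0 L h vol e P s z k =
     distr
       (point_measure (lattice_points P k)
          (\<lambda>\<alpha>. ennreal (szego_weight L h vol s k \<alpha> (act z p0)
                         / szego_density L h vol s P k (act z p0))))
       borel
       (\<lambda>\<alpha>. sqrt (real k) *\<^sub>R ((1 / real k) *\<^sub>R rvec \<alpha> - moment_map act p0 L h e z))"

definition gaussian_measure :: "real^'m::finite \<Rightarrow> real^'m^'m \<Rightarrow> (real^'m) measure" where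
  "gaussian_measure mean \<Sigma> = density lborel (\<lambda>x. ennreal (
     (2 * pi) powr (- real CARD('m) / 2) * (det \<Sigma>) powr (- 1 / 2) *
     exp (- ((matrix_inv \<Sigma> *v (x - mean)) \<bullet> (x - mean)) / 2)))"

definition C0 :: "('a::real_normed_vector \<Rightarrow> complex) \<Rightarrow> bool" where
  "C0 f \<longleftrightarrow> continuous_on UNIV f \<and> (f \<longlongrightarrow> 0) at_infinity"

text \<open>\<open>F\<close> is an integrable Fourier transform of the bounded continuous function \<open>f\<close>.  As \<open>F\<close> is
  integrable, the inversion formula in the sense of tempered distributions is an equality of
  continuous functions.\<close>

definition fourier_transform_L1 :: "('a::euclidean_space \<Rightarrow> complex) \<Rightarrow> ('a \<Rightarrow> complex) \<Rightarrow> bool" where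
  "fourier_transform_L1 f F \<longleftrightarrow> integrable lborel F \<and>
     (\<forall>x. f x = (LINT t|lborel. F t * exp (- \<i> * complex_of_real (t \<bullet> x))))"

definition radially_dominated :: "('a::euclidean_space \<Rightarrow> complex) \<Rightarrow> bool" where
  "radially_dominated F \<longleftrightarrow> (\<exists>g :: real \<Rightarrow> real.
     (\<forall>r s. 0 < r \<and> r \<le> s \<longrightarrow> g s \<le> g r) \<and>
     integrable lborel (\<lambda>t :: 'a. g (norm t)) \<and>
     (AE t in lborel. cmod (F t) \<le> g (norm t)))"

end

theory Submission
  imports Defs "HOL-Probability.Sinc_Integral" "HOL-Probability.Distributions" "HOL-Complex_Analysis.Complex_Analysis"
begin

text \<open>The weight of the point \<open>\<alpha>\<close> is the reciprocal of \<open>J(\<alpha>) = \<parallel>s\<^sub>\<alpha>\<parallel>\<^sup>2 / |s\<^sub>\<alpha>(z)|\<^sup>2\<close>, and no asymptotics of the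
  Bergman kernel are needed: in logarithmic coordinates \<open>r\<close> centred at \<open>z\<close>, \<open>J\<close> is the Laplace integral of
  \<open>exp (\<surd>k \<langle>y, r\<rangle> - k \<psi> r)\<close> with \<open>y = \<surd>k (\<alpha>/k - \<mu>)\<close> against the density \<open>det Hess \<phi>\<close>, where \<open>\<psi>\<close> is \<open>\<phi>\<close>
  minus its first order Taylor polynomial.  So the weights are Gaussian up to a relative error
  \<open>O(1/\<surd>k)\<close>, uniformly after multiplication by a slightly wider Gaussian, and it remains to compare
  Gaussian Riemann sums of \<open>f\<close> over a lattice of mesh \<open>h = 1/\<surd>k\<close> with the integral.  By Fourier inversion
  this is a bound for characters \<open>exp (- i \<langle>t, x\<rangle>)\<close>, integrated against \<open>fhat\<close>: for frequencies below
  \<open>\<pi>/h\<close> the error is \<open>O(h)\<close>, and for higher ones the radial majorant of \<open>fhat\<close> gives the decay.\<close>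


text \<open>Since |t| \<open>fhat\<close> need not be integrable, the error at frequency t has to be
  O(h) uniformly in t, while the direct estimate is only h (1 + |t|). Multiplication by exp (i t h)
  - 1 turns a bump into its first difference, which gains a factor h, and below \<pi>/h this
  multiplier is at least |t| h / 2, which cancels the growth in t. A Gaussian with a general
  covariance does not split over the coordinates of the lattice; it is therefore written as an
  average of translates of one isotropic Gaussian, and all one-dimensional bounds are uniform in the
  centre. Division by the Bergman density is the same comparison for the function 1. Three geometric
  facts carry the rest. The Hessian of \<phi> is positive definite, because the curvature pulls back
  along an immersion. The point \<mu> keeps a positive distance from the complement of P, as
  otherwise the lattice sum would be cut off inside the bulk of the Gaussian. The part of a norm
  that comes from far away in M, points off the open orbit included, is exponentially small relative
  to |s_\<alpha>(z)|^2 when \<alpha>/k is near \<mu>; for the other \<alpha> a lower bound on the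
  norm is enough.\<close>

no_notation fps_nth (infixl "$" 75)

section \<open>Oscillatory integrals of rounded variables in dimension one\<close>

text \<open>The envelope of all bumps below. Its integral does not depend on the centre
  \<open>v\<close>, which makes the later constants uniform in \<open>v\<close>.\<close>

lemma integral_inverse_1_plus_square:
  "integrable lborel (\<lambda>x::real. 1 / (1 + (x - v)\<^sup>2))"
  "(LINT x|lborel. 1 / (1 + (x - v)\<^sup>2)) = pi"
proof -
  have 1: "has_bochner_integral lborel (\<lambda>x::real. 1 / (1 + x\<^sup>2)) pi"
    using LBINT_inverse_1_plus_square integrable_inverse_1_plus_square
    by (simp add: interval_lebesgue_integral_def set_integrable_def set_lebesgue_integral_def
           einterval_eq_UNIV has_bochner_integral_iff inverse_eq_divide)
  show "integrable lborel (\<lambda>x::real. 1 / (1 + (x - v)\<^sup>2))"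
    "(LINT x|lborel. 1 / (1 + (x - v)\<^sup>2)) = pi"
    using lborel_has_bochner_integral_real_affine_iff[of 1 "\<lambda>x. 1 / (1 + (x-v)\<^sup>2)" pi v] 1
    by (auto simp: has_bochner_integral_iff)
qed

lemma lint_shift:
  fixes f :: "real \<Rightarrow> complex"
  shows "(LINT x|lborel. f (x + c)) = (LINT x|lborel. f x)"
  using lborel_integral_real_affine[of 1 f c] by (simp add: add.commute)

text \<open>A non-integrable \<open>f\<close> has integral 0 by convention, and the right-hand side
  is nonnegative.\<close>

lemma lint_bound:
  fixes f :: "'a::euclidean_space \<Rightarrow> complex" and g :: "'a \<Rightarrow> real"
  assumes "integrable lborel g" "\<And>x. norm (f x) \<le> g x"
  shows "norm (LINT x|lborel. f x) \<le> (LINT x|lborel. g x)"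
  using Bochner_Integration.integral_norm_bound_integral[of lborel f g] assms
  by (metis (no_types, lifting) integral_nonneg_AE norm_ge_zero not_integrable_integral_eq norm_zero order_trans AE_I2)


text \<open>When \<open>\<rho>\<close> rounds to a lattice of mesh h, this is h times the lattice
  sum of \<delta>(a) exp (- i t a), because every lattice value is taken on an interval of length h.
  When \<open>\<rho>\<close> is the identity, it is the Fourier transform. Sum and integral thus
  obey the same identities.\<close>

definition osc :: "(real \<Rightarrow> real) \<Rightarrow> (real \<Rightarrow> real) \<Rightarrow> real \<Rightarrow> complex" where
  "osc \<rho> \<delta> t = (LINT x|lborel. complex_of_real (\<delta> (\<rho> x)) * exp (- \<i> * complex_of_real (t * \<rho> x)))"

text \<open>\<open>step\<close> carries the lattice structure: rounding commutes with translation by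
  h. The identity has this property as well.\<close>

locale rounding =
  fixes \<rho> :: "real \<Rightarrow> real" and h :: real
  assumes rmeas [measurable]: "\<rho> \<in> borel_measurable borel"
    and h: "0 < h" "h \<le> 1" and near: "\<And>x. \<bar>\<rho> x - x\<bar> \<le> h" and step: "\<And>x. \<rho> (x + h) = \<rho> x + h"
begin

lemma near1: "\<bar>\<rho> x - x\<bar> \<le> 1" using near[of x] h by linarith

text \<open>Replace x by x + h and use \<open>step\<close>: the character picks up a factor
  independent of x. Summation by parts rests on this.\<close>

lemma osc_shift:
  "exp (\<i> * complex_of_real (t * h)) * osc \<rho> \<delta> t = osc \<rho> (\<lambda>a. \<delta> (a + h)) t"
proof -
  have "osc \<rho> \<delta> t = (LINT x|lborel. complex_of_real (\<delta> (\<rho> x + h)) * exp (- \<i> * complex_of_real (t * (\<rho> x + h))))"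
    unfolding osc_def by (subst lint_shift[of _ h, symmetric]) (simp add: step)
  then have "exp (\<i> * complex_of_real (t * h)) * osc \<rho> \<delta> t
     = (LINT x|lborel. exp (\<i> * complex_of_real (t * h)) * (complex_of_real (\<delta> (\<rho> x + h)) * exp (- \<i> * complex_of_real (t * (\<rho> x + h)))))"
    by simp
  also have "(\<lambda>x. exp (\<i> * complex_of_real (t * h)) * (complex_of_real (\<delta> (\<rho> x + h)) * exp (- \<i> * complex_of_real (t * (\<rho> x + h)))))
     = (\<lambda>x. complex_of_real (\<delta> (\<rho> x + h)) * exp (- \<i> * complex_of_real (t * \<rho> x)))"
    by (simp add: fun_eq_iff exp_add[symmetric] algebra_simps)
  finally show ?thesis by (simp add: osc_def)
qed

end

lemma rounding_id: "0 < h \<Longrightarrow> h \<le> 1 \<Longrightarrow> rounding (\<lambda>x. x) h"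
  by unfold_locales auto

lemma norm_exp_minus_1: "norm (exp (\<i> * complex_of_real x) - 1) ^ 2 = 2 * (1 - cos x)"
proof -
  have "norm (exp (\<i> * complex_of_real x) - 1) ^ 2 = (cos x - 1)\<^sup>2 + (sin x)\<^sup>2"
    by (simp add: cmod_power2 Re_exp Im_exp)
  also have "\<dots> = 2 * (1 - cos x)"
    using sin_cos_squared_add[of x] by (simp add: power2_eq_square algebra_simps)
  finally show ?thesis .
qed

lemma norm_exp_neg_ii [simp]: "norm (exp (- \<i> * complex_of_real x)) = 1"
  using norm_exp_i_times[of "-x"] by simp

lemma norm_exp_minus_1_le: "norm (exp (\<i> * complex_of_real x) - 1) \<le> \<bar>x\<bar>"
proof (rule power2_le_imp_le)
  have "1 - cos x = 2 * (sin (x/2))\<^sup>2"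
    using cos_double_sin[of "x/2"] by simp
  also have "(sin (x/2))\<^sup>2 \<le> (x/2)\<^sup>2"
    using abs_sin_x_le_abs_x[of "x/2"] by (metis abs_le_square_iff)
  finally show "norm (exp (\<i> * complex_of_real x) - 1) ^ 2 \<le> \<bar>x\<bar>^2"
    unfolding norm_exp_minus_1 by (simp add: power2_eq_square)
qed simp

text \<open>With y = |x|/2 the chord has length 2 sin y, and sin y \<ge> y - y^3/6 \<ge> y/2 as long
  as y^2 \<le> 3, which includes all y \<le> \<pi>/2.\<close>

lemma norm_exp_minus_1_ge:
  assumes "\<bar>x\<bar> \<le> pi" shows "\<bar>x\<bar> / 2 \<le> norm (exp (\<i> * complex_of_real x) - 1)"
proof (rule power2_le_imp_le)
  define y where "y = \<bar>x\<bar> / 2"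
  have y: "0 \<le> y" "y \<le> 1.6" using assms pi_less_4 pi_approx by (auto simp: y_def)
  have "y / 2 \<le> y - y^3/6"
  proof -
    have "y * y\<^sup>2 \<le> y * 3" using y power_mono[OF y(2) y(1), of 2]
      by (intro mult_left_mono) (auto simp: power2_eq_square)
    then show ?thesis by (simp add: power3_eq_cube power2_eq_square)
  qed
  also have "\<dots> \<le> sin y"
    using Maclaurin_sin_bound[of y 3] y by (simp add: eval_nat_numeral sin_coeff_def field_simps) (simp add: abs_if split: if_splits)
  finally have "y / 2 \<le> sin y" .
  then have "(y/2)\<^sup>2 \<le> (sin y)\<^sup>2" using y by (intro power_mono) auto
  moreover have "1 - cos x = 2 * (sin y)\<^sup>2"
    using cos_double_sin[of y] by (simp add: y_def)
  ultimately show "(\<bar>x\<bar> / 2)\<^sup>2 \<le> norm (exp (\<i> * complex_of_real x) - 1) ^ 2"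
    unfolding norm_exp_minus_1 by (simp add: y_def power2_eq_square)
qed simp

lemma norm_exp_diff_le:
  "norm (exp (- \<i> * complex_of_real (t * x)) - exp (- \<i> * complex_of_real (t * y))) \<le> \<bar>t\<bar> * \<bar>x - y\<bar>"
proof -
  have "exp (- \<i> * complex_of_real (t * x)) - exp (- \<i> * complex_of_real (t * y))
      = exp (- \<i> * complex_of_real (t * y)) * (exp (\<i> * complex_of_real (t * (y - x))) - 1)"
    by (simp add: right_diff_distrib exp_add[symmetric] algebra_simps)
  then show ?thesis
    using norm_exp_minus_1_le[of "t * (y - x)"]
    by (simp only: norm_mult norm_exp_neg_ii) (simp add: abs_mult abs_minus_commute)
qed

lemma osc_approx_bound: "norm (complex_of_real a * exp (- \<i> * complex_of_real (t * x)) - complex_of_real b * exp (- \<i> * complex_of_real (t * y)))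
   \<le> \<bar>a - b\<bar> + \<bar>b\<bar> * (\<bar>t\<bar> * \<bar>x - y\<bar>)"
proof -
  have "complex_of_real a * exp (- \<i> * complex_of_real (t * x)) - complex_of_real b * exp (- \<i> * complex_of_real (t * y))
     = complex_of_real (a - b) * exp (- \<i> * complex_of_real (t * x)) + complex_of_real b * (exp (- \<i> * complex_of_real (t * x)) - exp (- \<i> * complex_of_real (t * y)))"
    by (simp add: algebra_simps)
  also have "norm \<dots> \<le> \<bar>a - b\<bar> + \<bar>b\<bar> * norm (exp (- \<i> * complex_of_real (t * x)) - exp (- \<i> * complex_of_real (t * y)))"
    by (rule order_trans[OF norm_triangle_ineq]) (simp only: norm_mult norm_exp_neg_ii norm_of_real mult_1_right order_refl)
  also have "\<dots> \<le> \<bar>a - b\<bar> + \<bar>b\<bar> * (\<bar>t\<bar> * \<bar>x - y\<bar>)"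
    using norm_exp_diff_le by (intro add_left_mono mult_left_mono) auto
  finally show ?thesis .
qed

text \<open>The radius 3 leaves room for |\<rho> x - x| \<le> 1 and for two steps of length h \<le>
  1, so that second differences of \<gamma> at the rounded point are controlled by the envelope at x
  itself.\<close>

locale smooth_bump =
  fixes \<gamma> \<gamma>' \<gamma>'' :: "real \<Rightarrow> real" and K v :: real
  assumes d1: "\<And>x. (\<gamma> has_real_derivative \<gamma>' x) (at x)"
    and d2: "\<And>x. (\<gamma>' has_real_derivative \<gamma>'' x) (at x)"
    and bd: "\<And>x s. \<bar>s - x\<bar> \<le> 3 \<Longrightarrow> \<bar>\<gamma> s\<bar> \<le> K / (1 + (x - v)\<^sup>2)"
      "\<And>x s. \<bar>s - x\<bar> \<le> 3 \<Longrightarrow> \<bar>\<gamma>' s\<bar> \<le> K / (1 + (x - v)\<^sup>2)"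
      "\<And>x s. \<bar>s - x\<bar> \<le> 3 \<Longrightarrow> \<bar>\<gamma>'' s\<bar> \<le> K / (1 + (x - v)\<^sup>2)"
begin

definition "W x = K / (1 + (x - v)\<^sup>2)"

lemmas bdW = bd[folded W_def]

lemma W: "integrable lborel W" "(LINT x|lborel. W x) = K * pi"
proof -
  have "has_bochner_integral lborel (\<lambda>x. K * (1 / (1 + (x - v)\<^sup>2))) (K * pi)"
    using integral_inverse_1_plus_square[of v]
    by (intro has_bochner_integral_mult_right) (auto simp: has_bochner_integral_iff)
  then show "integrable lborel W" "(LINT x|lborel. W x) = K * pi"
    by (auto simp: W_def[abs_def] has_bochner_integral_iff)
qed

lemma W_nonneg: "0 \<le> W x"
  using bdW(1)[of x x] by linarith

lemma K_nonneg: "0 \<le> K"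
  using W_nonneg[of v] by (simp add: W_def)

lemma meas [measurable]: "\<gamma> \<in> borel_measurable borel"
  by (auto intro!: borel_measurable_continuous_onI continuous_at_imp_continuous_on
      intro: DERIV_isCont d1)

lemma lip: 
  assumes "\<And>x. (f has_real_derivative f' x) (at x)" "\<And>x s. \<bar>s - x\<bar> \<le> 3 \<Longrightarrow> \<bar>f' s\<bar> \<le> W x"
    "\<bar>a - x\<bar> \<le> 3" "\<bar>b - x\<bar> \<le> 3"
  shows "\<bar>f a - f b\<bar> \<le> W x * \<bar>a - b\<bar>"
proof -
  have "norm (f a - f b) \<le> W x * norm (a - b)"
    by (rule field_differentiable_bound[of "{x-3..x+3}" f f'])
      (use assms in \<open>auto intro: DERIV_subset\<close>)
  then show ?thesis by simp
qed

text \<open>A mixed second difference: the mean value inequality for \<gamma>' gives the factor h,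
  and the one for the function \<gamma>(y + h) - \<gamma>(y) of y gives the distance of a and
  b.\<close>

lemma diff2:
  assumes "\<bar>a - x\<bar> \<le> 2" "\<bar>b - x\<bar> \<le> 2" "0 \<le> h" "h \<le> 1"
  shows "\<bar>(\<gamma> (a + h) - \<gamma> a) - (\<gamma> (b + h) - \<gamma> b)\<bar> \<le> W x * h * \<bar>a - b\<bar>"
proof -
  have *: "((\<lambda>y. \<gamma> (y + h) - \<gamma> y) has_real_derivative (\<gamma>' (y + h) - \<gamma>' y)) (at y)" for y
    by (auto intro!: derivative_eq_intros DERIV_shift[THEN iffD1] d1)
  have "norm ((\<gamma> (a + h) - \<gamma> a) - (\<gamma> (b + h) - \<gamma> b)) \<le> (W x * h) * norm (a - b)"
  proof (rule field_differentiable_bound[of "{x-2..x+2}" "\<lambda>y. \<gamma> (y + h) - \<gamma> y"])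
    show "norm (\<gamma>' (y + h) - \<gamma>' y) \<le> W x * h" if "y \<in> {x-2..x+2}" for y
      using lip[OF d2 bdW(3), of "y + h" x y] that assms by (auto simp: abs_le_iff)
  qed (use * assms in \<open>auto intro: DERIV_subset simp: abs_le_iff\<close>)
  then show ?thesis by simp
qed

lemma integrable_osc:
  assumes [measurable]: "\<rho> \<in> borel_measurable borel" and "\<And>x. \<bar>\<rho> x + c - x\<bar> \<le> 3"
  shows "integrable lborel (\<lambda>x. complex_of_real (\<gamma> (\<rho> x + c)) * exp (- \<i> * complex_of_real (t * \<rho> x)))"
proof (rule Bochner_Integration.integrable_bound[OF W(1)])
  show "AE x in lborel. norm (complex_of_real (\<gamma> (\<rho> x + c)) * exp (- \<i> * complex_of_real (t * \<rho> x))) \<le> norm (W x)"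
    using bdW(1)[OF assms(2)] W_nonneg by (auto simp: norm_mult)
qed measurable

end

locale bump_rounding = smooth_bump + rounding
begin

lemma osc_bound: "norm (osc \<rho> \<gamma> t) \<le> K * pi"
proof -
  have "\<bar>\<rho> x - x\<bar> \<le> 3" for x using near1[of x] by linarith
  then show ?thesis
  unfolding osc_def W(2)[symmetric]
  by (intro lint_bound[OF W(1)]) (use bdW(1) in \<open>auto simp: norm_mult\<close>)
qed

lemma integrable_osc': assumes "\<bar>c\<bar> \<le> 2" 
  shows "integrable lborel (\<lambda>x. complex_of_real (\<gamma> (\<rho> x + c)) * exp (- \<i> * complex_of_real (t * \<rho> x)))"
proof (rule integrable_osc)
  show "\<bar>\<rho> x + c - x\<bar> \<le> 3" for x using near1[of x] assms by (auto simp: abs_le_iff)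
qed simp

lemma integrable_osc_diff:
  "integrable lborel (\<lambda>x. complex_of_real (\<gamma> (\<rho> x + h) - \<gamma> (\<rho> x)) * exp (- \<i> * complex_of_real (t * \<rho> x)))"
  unfolding of_real_diff left_diff_distrib
  using integrable_osc'[of 0 t] integrable_osc'[of h t] h
  by (intro Bochner_Integration.integrable_diff) auto

lemma osc_diff:
  "(exp (\<i> * complex_of_real (t * h)) - 1) * osc \<rho> \<gamma> t = osc \<rho> (\<lambda>a. \<gamma> (a + h) - \<gamma> a) t"
  unfolding left_diff_distrib osc_shift mult_1_left
  unfolding osc_def 
  by (subst Bochner_Integration.integral_diff[symmetric])
    (use integrable_osc'[of h t] integrable_osc'[of 0 t] h in \<open>auto simp: algebra_simps\<close>)

lemma osc_diff2:
  "(exp (\<i> * complex_of_real (t * h)) - 1)^2 * osc \<rho> \<gamma> t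
    = osc \<rho> (\<lambda>a. (\<gamma> (a + h + h) - \<gamma> (a + h)) - (\<gamma> (a + h) - \<gamma> a)) t"
  unfolding power2_eq_square mult.assoc osc_diff
  unfolding left_diff_distrib osc_shift mult_1_left
  unfolding osc_def 
  by (subst Bochner_Integration.integral_diff[symmetric])
    (use integrable_osc'[of h t] integrable_osc'[of 0 t]  integrable_osc'[of "h+h" t] h in \<open>auto simp: algebra_simps\<close>)

text \<open>The factor on the left is |exp (i t h) - 1|^2, so two summations by parts replace
  \<gamma> by its second difference, which is of size h^2. The bound is periodic in t, as befits a
  lattice sum.\<close>

lemma osc_bound2: "2 * (1 - cos (t * h)) * norm (osc \<rho> \<gamma> t) \<le> K * pi * h\<^sup>2"
proof -
  have "2 * (1 - cos (t * h)) * norm (osc \<rho> \<gamma> t) = norm (osc \<rho> (\<lambda>a. (\<gamma> (a + h + h) - \<gamma> (a + h)) - (\<gamma> (a + h) - \<gamma> a)) t)"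
    unfolding osc_diff2[symmetric] norm_mult norm_power norm_exp_minus_1 ..
  also have "\<dots> \<le> (LINT x|lborel. W x * h\<^sup>2)"
    unfolding osc_def
  proof (rule lint_bound)
    fix x
    show "norm (complex_of_real ((\<gamma> (\<rho> x + h + h) - \<gamma> (\<rho> x + h)) - (\<gamma> (\<rho> x + h) - \<gamma> (\<rho> x))) * exp (- \<i> * complex_of_real (t * \<rho> x))) \<le> W x * h\<^sup>2"
      unfolding norm_mult norm_exp_neg_ii norm_of_real
      using diff2[of "\<rho> x + h" x "\<rho> x" h] near1[of x] h by (auto simp: power2_eq_square abs_le_iff mult_ac)
  qed (use W(1) in auto)
  also have "\<dots> = K * pi * h\<^sup>2" using W by simp
  finally show ?thesis .
qed


text \<open>The crude comparison, sufficient only for bounded t.\<close>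

lemma osc_approx1: "norm (osc \<rho> \<gamma> t - osc (\<lambda>x. x) \<gamma> t) \<le> K * pi * (h * (1 + \<bar>t\<bar>))"
proof -
  have "osc \<rho> \<gamma> t - osc (\<lambda>x. x) \<gamma> t = (LINT x|lborel. complex_of_real (\<gamma> (\<rho> x)) * exp (- \<i> * complex_of_real (t * \<rho> x))
      - complex_of_real (\<gamma> x) * exp (- \<i> * complex_of_real (t * x)))"
    unfolding osc_def
    using Bochner_Integration.integral_diff[symmetric, OF integrable_osc'[of 0 t] integrable_osc[of "\<lambda>x. x" 0 t]]
    by (simp only: add_0_right) simp
  also have "norm \<dots> \<le> (LINT x|lborel. W x * (h * (1 + \<bar>t\<bar>)))"
  proof (rule lint_bound)
    fix x
    have "\<bar>\<gamma> (\<rho> x) - \<gamma> x\<bar> \<le> W x * \<bar>\<rho> x - x\<bar>"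
      using near1[of x] by (intro lip[OF d1 bdW(2)]) (auto simp: abs_le_iff)
    also have "\<dots> \<le> W x * h" using near W_nonneg by (intro mult_left_mono) auto
    finally have 1: "\<bar>\<gamma> (\<rho> x) - \<gamma> x\<bar> \<le> W x * h" .
    have 2: "\<bar>\<gamma> x\<bar> * (\<bar>t\<bar> * \<bar>\<rho> x - x\<bar>) \<le> W x * (\<bar>t\<bar> * h)"
      by (intro mult_mono mult_left_mono bdW(1) near W_nonneg) (use h in auto)
    show "norm (complex_of_real (\<gamma> (\<rho> x)) * exp (- \<i> * complex_of_real (t * \<rho> x))
      - complex_of_real (\<gamma> x) * exp (- \<i> * complex_of_real (t * x))) \<le> W x * (h * (1 + \<bar>t\<bar>))"
      using order_trans[OF osc_approx_bound add_mono[OF 1 2]] by (simp add: distrib_left mult_ac)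
  qed (intro integrable_mult_left W(1))
  also have "\<dots> = K * pi * (h * (1 + \<bar>t\<bar>))" using W(2) by (simp only: integral_mult_left_zero)
  finally show ?thesis .
qed

text \<open>Sum by parts once on both sides before comparing: the first difference of \<gamma> and
  its derivative are O(h), so the crude bound improves by one factor h.\<close>

lemma osc_approx2:
  "norm (exp (\<i> * complex_of_real (t * h)) - 1) * norm (osc \<rho> \<gamma> t - osc (\<lambda>x. x) \<gamma> t)
     \<le> K * pi * (h\<^sup>2 * (1 + \<bar>t\<bar>))"
proof -
  interpret id: bump_rounding \<gamma> \<gamma>' \<gamma>'' K v "\<lambda>x. x" h
    using rounding_id[OF h] by (intro bump_rounding.intro smooth_bump_axioms)
  let ?D = "\<lambda>x. \<gamma> (x + h) - \<gamma> x"
  have eq1: "(exp (\<i> * complex_of_real (t * h)) - 1) * (osc \<rho> \<gamma> t - osc (\<lambda>x. x) \<gamma> t)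
      = osc \<rho> ?D t - osc (\<lambda>x. x) ?D t"
    by (simp only: right_diff_distrib osc_diff id.osc_diff)
  have eq2: "osc \<rho> ?D t - osc (\<lambda>x. x) ?D t = (LINT x|lborel. complex_of_real (?D (\<rho> x)) * exp (- \<i> * complex_of_real (t * \<rho> x))
      - complex_of_real (?D x) * exp (- \<i> * complex_of_real (t * x)))"
    unfolding osc_def
    by (rule Bochner_Integration.integral_diff[symmetric, OF integrable_osc_diff id.integrable_osc_diff])
  have "norm (osc \<rho> ?D t - osc (\<lambda>x. x) ?D t) \<le> (LINT x|lborel. W x * (h\<^sup>2 * (1 + \<bar>t\<bar>)))"
    unfolding eq2
  proof (rule lint_bound)
    fix x
    have Wh: "0 \<le> W x * h" using W_nonneg h(1) by (intro mult_nonneg_nonneg) auto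
    have n2: "\<bar>\<rho> x - x\<bar> \<le> 2" using near1[of x] by linarith
    have "\<bar>?D (\<rho> x) - ?D x\<bar> \<le> W x * h * \<bar>\<rho> x - x\<bar>"
      by (rule diff2) (use n2 h in auto)
    also have "\<dots> \<le> W x * h * h" using near Wh by (rule mult_left_mono)
    finally have 1: "\<bar>?D (\<rho> x) - ?D x\<bar> \<le> W x * h * h" .
    have "\<bar>?D x\<bar> \<le> W x * \<bar>(x + h) - x\<bar>"
      by (rule lip[OF d1 bdW(2)]) (use h in auto)
    then have D: "\<bar>?D x\<bar> \<le> W x * h" using h by simp
    have 2: "\<bar>?D x\<bar> * (\<bar>t\<bar> * \<bar>\<rho> x - x\<bar>) \<le> (W x * h) * (\<bar>t\<bar> * h)"
      by (rule mult_mono[OF D mult_left_mono[OF near] Wh]) auto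
    have 3: "W x * (h\<^sup>2 * (1 + \<bar>t\<bar>)) = W x * h * h + (W x * h) * (\<bar>t\<bar> * h)"
      by (simp add: power2_eq_square distrib_left mult_ac)
    show "norm (complex_of_real (?D (\<rho> x)) * exp (- \<i> * complex_of_real (t * \<rho> x))
      - complex_of_real (?D x) * exp (- \<i> * complex_of_real (t * x))) \<le> W x * (h\<^sup>2 * (1 + \<bar>t\<bar>))"
      unfolding 3 by (rule order_trans[OF osc_approx_bound add_mono[OF 1 2]])
  qed (intro integrable_mult_left W(1))
  also have "\<dots> = K * pi * (h\<^sup>2 * (1 + \<bar>t\<bar>))" using W(2) by (simp only: integral_mult_left_zero)
  finally show ?thesis unfolding eq1[symmetric] norm_mult .
qed

text \<open>For |t| > 1 divide \<open>osc_approx2\<close> by |exp (i t h) - 1| \<ge> |t| h / 2: the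
  growth in t cancels and one factor h remains. For |t| \<le> 1 the crude bound is enough.\<close>

lemma osc_approx:
  assumes "\<bar>t\<bar> * h \<le> pi"
  shows "norm (osc \<rho> \<gamma> t - osc (\<lambda>x. x) \<gamma> t) \<le> 4 * K * pi * h"
proof (cases "\<bar>t\<bar> \<le> 1")
  case True
  have "K * pi * (h * (1 + \<bar>t\<bar>)) \<le> K * pi * (h * 2)"
    using True h K_nonneg by (intro mult_left_mono) auto
  also have "\<dots> \<le> 4 * K * pi * h"
    using mult_nonneg_nonneg[OF mult_nonneg_nonneg[OF K_nonneg pi_ge_zero], of h] h by (simp add: mult_ac)
  finally show ?thesis by (rule order_trans[OF osc_approx1])
next
  case False
  let ?N = "norm (osc \<rho> \<gamma> t - osc (\<lambda>x. x) \<gamma> t)"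
  have "\<bar>t * h\<bar> / 2 * ?N \<le> norm (exp (\<i> * complex_of_real (t * h)) - 1) * ?N"
    using norm_exp_minus_1_ge[of "t * h"] assms h by (intro mult_right_mono) (auto simp: abs_mult)
  also have "\<dots> \<le> K * pi * (h\<^sup>2 * (1 + \<bar>t\<bar>))" by (rule osc_approx2)
  also have "\<dots> \<le> K * pi * (h\<^sup>2 * (2 * \<bar>t\<bar>))"
    using False h K_nonneg by (intro mult_left_mono) auto
  also have "\<dots> = \<bar>t * h\<bar> / 2 * (4 * K * pi * h)"
    using h by (simp add: abs_mult power2_eq_square)
  finally show ?thesis
    by (rule mult_left_le_imp_le) (use False h in simp)
qed

end

context smooth_bump
begin

text \<open>The identity is a rounding for every step in (0, 1], so the step may be adapted to t:
  with \<open>\<tau>\<close> = \<pi> / |t| one has exp (i t \<tau>) = \<plusminus>1 with the minus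
  sign, the multiplier has norm 2, and one difference gains \<tau>.\<close>

lemma osc_id_decay:
  assumes "pi \<le> \<bar>t\<bar>" shows "norm (osc (\<lambda>x. x) \<gamma> t) \<le> K * pi * pi / \<bar>t\<bar>"
proof -
  define \<tau> where "\<tau> = pi / \<bar>t\<bar>"
  have \<tau>: "0 < \<tau>" "\<tau> \<le> 1" using assms pi_gt_zero by (auto simp: \<tau>_def simp del: pi_gt_zero)
  interpret id: bump_rounding \<gamma> \<gamma>' \<gamma>'' K v "\<lambda>x. x" \<tau>
    using rounding_id[OF \<tau>] by (intro bump_rounding.intro smooth_bump_axioms)
  have "t * \<tau> = pi \<or> t * \<tau> = - pi" using assms pi_gt_zero 
    by (cases "t \<ge> 0") (auto simp: \<tau>_def simp del: pi_gt_zero)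
  then have *: "exp (\<i> * complex_of_real (t * \<tau>)) - 1 = - 2"
    by (elim disjE) (simp_all only: exp_pi_i' of_real_minus mult_minus_right exp_minus, simp_all)
  have "norm (osc (\<lambda>x. x) \<gamma> t) \<le> norm ((exp (\<i> * complex_of_real (t * \<tau>)) - 1) * osc (\<lambda>x. x) \<gamma> t)"
    unfolding * by (simp add: norm_mult)
  also have "\<dots> = norm (osc (\<lambda>x. x) (\<lambda>x. \<gamma> (x + \<tau>) - \<gamma> x) t)"
    unfolding id.osc_diff ..
  also have "\<dots> \<le> (LINT x|lborel. W x * \<tau>)"
    unfolding osc_def
  proof (rule lint_bound)
    fix x
    show "norm (complex_of_real (\<gamma> (x + \<tau>) - \<gamma> x) * exp (- \<i> * complex_of_real (t * x))) \<le> W x * \<tau>"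
      unfolding norm_mult norm_exp_neg_ii norm_of_real
      using lip[OF d1 bdW(2), of "x + \<tau>" x x] \<tau> by (auto simp: abs_le_iff)
  qed (intro integrable_mult_left W(1))
  also have "\<dots> = K * pi * pi / \<bar>t\<bar>" using W by (simp add: \<tau>_def)
  finally show ?thesis .
qed

end

text \<open>exp (- l s^2 / 2) is below a multiple of (1 + s^2)^(-2), and the polynomial factors of
  the derivatives are at most (1 + l + l^2) (1 + s^2), which leaves the envelope 1 / (1 + s^2). For
  |s - x| \<le> 3 the weight 1 + x^2 is at most 21 (1 + s^2). The centre enters by translation only,
  so \<open>K\<close> serves every \<open>v\<close>.\<close>

lemma gauss_bump:
  assumes l: "0 < l"
  obtains K where "\<And>v. smooth_bump (\<lambda>x. exp (- l * (x - v)\<^sup>2 / 2)) (\<lambda>x. - l * (x - v) * exp (- l * (x - v)\<^sup>2 / 2))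
     (\<lambda>x. (l\<^sup>2 * (x - v)\<^sup>2 - l) * exp (- l * (x - v)\<^sup>2 / 2)) K v"
proof -
  define m where "m = min 1 (l/4)"
  have m: "0 < m" "m \<le> 1" "m \<le> l / 4" using l by (auto simp: m_def)
  have e: "exp (- l * s\<^sup>2 / 2) \<le> 1 / (m * (1 + s\<^sup>2))\<^sup>2" for s
  proof -
    have "m * (1 + s\<^sup>2) \<le> 1 + l * s\<^sup>2 / 4"
      using m mult_right_mono[OF m(3), of "s\<^sup>2"] by (simp add: algebra_simps)
    also have "\<dots> \<le> exp (l * s\<^sup>2 / 4)" by (rule exp_ge_add_one_self)
    finally have "(m * (1 + s\<^sup>2))\<^sup>2 \<le> (exp (l * s\<^sup>2 / 4))\<^sup>2" using m by (intro power_mono) auto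
    also have "\<dots> = exp (l * s\<^sup>2 / 2)" by (simp add: exp_double[symmetric])
    finally show ?thesis
      using m by (subst (asm) inverse_le_iff_le[symmetric]) 
        (auto simp: exp_minus inverse_eq_divide sum_power2_eq_zero_iff[of 1 s, simplified])
  qed
  define K where "K = 21 * (1 + l + l\<^sup>2) / m\<^sup>2"
  have main: "p * exp (- l * s\<^sup>2 / 2) \<le> K / (1 + (x)\<^sup>2)"
    if "\<bar>s - x\<bar> \<le> 3" "0 \<le> p" "p \<le> (1 + l + l\<^sup>2) * (1 + s\<^sup>2)" for p s x
  proof -
    have 1: "x\<^sup>2 \<le> 2 * s\<^sup>2 + 2 * (s - x)\<^sup>2"
      using zero_le_power2[of "2 * s - x"] by (simp add: power2_eq_square algebra_simps)
    have 2: "(s - x)\<^sup>2 \<le> 9" using that(1) abs_le_square_iff[of "s - x" 3] by simp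
    have "21 * (1 + s\<^sup>2) = 21 + 21 * s\<^sup>2" by simp
    then have x: "1 + x\<^sup>2 \<le> 21 * (1 + s\<^sup>2)"
      using 1 2 zero_le_power2[of s] by linarith
    have "p * exp (- l * s\<^sup>2 / 2) \<le> ((1 + l + l\<^sup>2) * (1 + s\<^sup>2)) * (1 / (m * (1 + s\<^sup>2))\<^sup>2)"
      using that(2,3) l by (intro mult_mono e) (simp_all add: add_nonneg_nonneg)
    also have "\<dots> = ((1 + l + l\<^sup>2) / m\<^sup>2) / (1 + s\<^sup>2)"
    proof -
      have "1 + s\<^sup>2 \<noteq> 0" by (metis add_pos_nonneg less_irrefl zero_le_power2 zero_less_one)
      then show ?thesis by (simp add: power_mult_distrib power2_eq_square[of "1 + s\<^sup>2"] divide_simps)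
    qed
    also have "\<dots> \<le> ((1 + l + l\<^sup>2) / m\<^sup>2) * (21 / (1 + x\<^sup>2))"
    proof -
      have "1 / (1 + s\<^sup>2) \<le> 21 / (1 + x\<^sup>2)"
        using x by (subst frac_le_eq) (auto simp: add_nonneg_eq_0_iff intro!: divide_nonpos_pos add_pos_nonneg mult_pos_pos)
      then show ?thesis using l mult_left_mono[of "1 / (1 + s\<^sup>2)" "21 / (1 + x\<^sup>2)" "(1 + l + l\<^sup>2) / m\<^sup>2"] by simp
    qed
    finally show ?thesis by (simp add: K_def algebra_simps)
  qed
  have b: "\<bar>s\<bar> \<le> 1 + s\<^sup>2" for s :: real
    using zero_le_power2[of "\<bar>s\<bar> - 1"] zero_le_power2[of s] by (simp add: power2_diff)
  have "smooth_bump (\<lambda>x. exp (- l * (x - v)\<^sup>2 / 2)) (\<lambda>x. - l * (x - v) * exp (- l * (x - v)\<^sup>2 / 2))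
     (\<lambda>x. (l\<^sup>2 * (x - v)\<^sup>2 - l) * exp (- l * (x - v)\<^sup>2 / 2)) K v" for v
  proof (unfold_locales, goal_cases)
    case (1 x)
    have "((\<lambda>x. exp (- l * (x - v)\<^sup>2 / 2)) has_real_derivative
       exp (- l * (x - v)\<^sup>2 / 2) * (- l * (x - v))) (at x)"
      by (rule derivative_eq_intros refl | simp)+
    then show ?case by (simp add: mult_ac)
  next
    case (2 x)
    have "((\<lambda>x. - l * (x - v) * exp (- l * (x - v)\<^sup>2 / 2)) has_real_derivative
       (- l) * exp (- l * (x - v)\<^sup>2 / 2) + (- l * (x - v)) * (exp (- l * (x - v)\<^sup>2 / 2) * (- l * (x - v)))) (at x)"
      by (rule derivative_eq_intros refl | simp)+
    then show ?case by (simp add: power2_eq_square left_diff_distrib mult_ac)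
  next
    case (3 x s)
    have "0 \<le> l + (l * (s-v)\<^sup>2 + (l\<^sup>2 + l\<^sup>2 * (s-v)\<^sup>2)) + (s-v)\<^sup>2" using l by simp
    then have "1 \<le> (1 + l + l\<^sup>2) * (1 + (s-v)\<^sup>2)" using l by (simp add: algebra_simps)
    then show ?case using main[of "s-v" "x-v" 1] 3 by simp
  next
    case (4 x s)
    have "l * \<bar>s - v\<bar> \<le> l * (1 + (s-v)\<^sup>2)" using b l by (intro mult_left_mono) auto
    also have "\<dots> \<le> (1 + l + l\<^sup>2) * (1 + (s-v)\<^sup>2)" using l by (intro mult_right_mono) auto
    finally show ?case using main[of "s-v" "x-v" "l * \<bar>s - v\<bar>"] 4 l by (simp add: abs_mult)
  next
    case (5 x s)
    have "\<bar>l\<^sup>2 * (s-v)\<^sup>2 - l\<bar> \<le> l\<^sup>2 * (s-v)\<^sup>2 + l" using l by (intro order_trans[OF abs_triangle_ineq4]) (simp add: abs_mult)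
    also have "\<dots> \<le> (1 + l + l\<^sup>2) * (1 + (s-v)\<^sup>2)" using l by (simp add: algebra_simps)
    finally show ?case using main[of "s-v" "x-v" "\<bar>l\<^sup>2 * (s-v)\<^sup>2 - l\<bar>"] 5 l by (simp add: abs_mult)
  qed
  then show thesis using that by blast
qed

section \<open>Product integrals, lattice rounding and the periodic weight\<close>

lemma borel_measurable_vec_nth [measurable (raw)]:
  fixes f :: "'a \<Rightarrow> real^'m::finite"
  assumes "f \<in> borel_measurable M"
  shows "(\<lambda>x. f x $ j) \<in> borel_measurable M"
  by (rule measurable_compose[OF assms borel_measurable_continuous_onI]) (intro continuous_intros)

lemma prod_Basis_cart:
  fixes f :: "real^'m::finite \<Rightarrow> 'b::comm_monoid_mult"
  shows "prod f Basis = (\<Prod>j\<in>UNIV. f (axis j 1))"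
proof -
  have "bij_betw (\<lambda>j::'m. axis j (1::real)) UNIV Basis"
    by (auto simp: Basis_vec_def bij_betw_def inj_on_def axis_eq_axis)
  from prod.reindex_bij_betw[OF this, of f] show ?thesis by simp
qed

lemma measurable_vec_lambda [measurable]:
  "(\<lambda>f. \<chi> j. f j) \<in> borel_measurable (Pi\<^sub>M UNIV (\<lambda>_::'m::finite. lborel :: real measure))"
  by (subst borel_measurable_euclidean_space)
    (auto simp: Basis_vec_def inner_axis intro!: measurable_component_singleton[where M="\<lambda>_. lborel", simplified])

lemma lborel_vec:
  "(lborel :: (real^'m::finite) measure) = distr (Pi\<^sub>M UNIV (\<lambda>_. lborel)) borel (\<lambda>f. \<chi> j. f j)"
proof (rule lborel_eqI)
  interpret product_sigma_finite "\<lambda>_::'m. lborel :: real measure" by unfold_locales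
  fix l u :: "real^'m" assume lu: "\<And>b. b \<in> Basis \<Longrightarrow> l \<bullet> b \<le> u \<bullet> b"
  have le: "l $ j \<le> u $ j" for j
    using lu[of "axis j 1"] by (auto simp: inner_axis)
  have "emeasure (distr (Pi\<^sub>M UNIV (\<lambda>_::'m. lborel)) borel (\<lambda>f. \<chi> j. f j)) (box l u)
     = emeasure (Pi\<^sub>M UNIV (\<lambda>_::'m. lborel :: real measure)) (Pi\<^sub>E UNIV (\<lambda>j. {l$j <..< u$j}))"
    by (subst emeasure_distr) (auto simp: mem_box_cart space_PiM PiE_def Pi_def intro!: arg_cong2[where f=emeasure])
  also have "\<dots> = (\<Prod>j\<in>UNIV. ennreal (u$j - l$j))"
    using le by (subst emeasure_PiM) auto
  also have "\<dots> = ennreal (\<Prod>b\<in>Basis. (u - l) \<bullet> b)"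
    using le by (simp add: prod_Basis_cart prod_ennreal inner_axis)
  finally show "emeasure (distr (Pi\<^sub>M UNIV (\<lambda>_::'m. lborel)) borel (\<lambda>f. \<chi> j. f j)) (box l u) =
     (\<Prod>b\<in>Basis. (u - l) \<bullet> b)" by simp
qed simp

lemma lint_vec_prod:
  fixes F :: "'m::finite \<Rightarrow> real \<Rightarrow> 'b::{real_normed_field,banach,second_countable_topology}"
  assumes F: "\<And>j. integrable lborel (F j)"
  shows "integrable lborel (\<lambda>x::real^'m. \<Prod>j\<in>UNIV. F j (x $ j))"
    "(LINT x|lborel. (\<Prod>j\<in>UNIV. F j ((x::real^'m) $ j))) = (\<Prod>j\<in>UNIV. (LINT x|lborel. F j x))"
proof -
  interpret product_sigma_finite "\<lambda>_::'m. lborel :: real measure" by unfold_locales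
  have [measurable]: "F j \<in> borel_measurable borel" for j using F[of j] by simp
  have m: "(\<lambda>x::real^'m. \<Prod>j\<in>UNIV. F j (x $ j)) \<in> borel_measurable borel" by measurable
  show "integrable lborel (\<lambda>x::real^'m. \<Prod>j\<in>UNIV. F j (x $ j))"
    unfolding lborel_vec using product_integrable_prod[of UNIV F] F m
    by (subst integrable_distr_eq) auto
  show "(LINT x|lborel. (\<Prod>j\<in>UNIV. F j ((x::real^'m) $ j))) = (\<Prod>j\<in>UNIV. (LINT x|lborel. F j x))"
    using product_integral_prod[of UNIV F] F m
    by (subst lborel_vec, subst integral_distr) auto
qed

lemma nn_integral_vec_prod:
  fixes F :: "'m::finite \<Rightarrow> real \<Rightarrow> ennreal"
  assumes F: "\<And>j. F j \<in> borel_measurable borel"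
  shows "(\<integral>\<^sup>+x. (\<Prod>j\<in>UNIV. F j ((x::real^'m) $ j)) \<partial>lborel) = (\<Prod>j\<in>UNIV. \<integral>\<^sup>+x. F j x \<partial>lborel)"
proof -
  interpret product_sigma_finite "\<lambda>_::'m. lborel :: real measure" by unfold_locales
  note [measurable] = F
  have m: "(\<lambda>x::real^'m. \<Prod>j\<in>UNIV. F j (x $ j)) \<in> borel_measurable borel" by measurable
  show ?thesis
    using product_nn_integral_prod[of UNIV F] F m
    by (subst lborel_vec, subst nn_integral_distr) auto
qed

lemma exp_inner_cart: 
  "exp (- \<i> * complex_of_real (t \<bullet> x)) = (\<Prod>j\<in>UNIV. exp (- \<i> * complex_of_real (t $ j * x $ j)))"
  for t x :: "real^'m::finite"
  by (simp add: inner_vec_def exp_sum[symmetric] sum_distrib_left sum_negf)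

text \<open>After division by A all factors lie in the unit disc, where the difference of two
  products is at most the sum of the differences of the factors; A \<ge> 1 lets the factor 1/A be
  dropped from each of these.\<close>

lemma norm_prod_diff_le:
  fixes a b :: "'i \<Rightarrow> complex"
  assumes "finite I" "\<And>i. i \<in> I \<Longrightarrow> norm (a i) \<le> A" "\<And>i. i \<in> I \<Longrightarrow> norm (b i) \<le> A"
    "\<And>i. i \<in> I \<Longrightarrow> norm (a i - b i) \<le> d" "1 \<le> A"
  shows "norm ((\<Prod>i\<in>I. a i) - (\<Prod>i\<in>I. b i)) \<le> real (card I) * A ^ card I * d"
proof -
  have A: "A > 0" using assms(5) by simp
  have "norm ((\<Prod>i\<in>I. a i / of_real A) - (\<Prod>i\<in>I. b i / of_real A)) \<le> (\<Sum>i\<in>I. norm (a i / of_real A - b i / of_real A))"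
    using assms A by (intro norm_prod_diff) (auto simp: norm_divide divide_simps)
  also have "\<dots> \<le> (\<Sum>i\<in>I. d)"
  proof (rule sum_mono)
    fix i assume i: "i \<in> I"
    have "norm (a i / of_real A - b i / of_real A) = norm (a i - b i) / A"
      using A by (simp add: diff_divide_distrib[symmetric] norm_divide)
    also have "\<dots> \<le> norm (a i - b i)" using divide_left_mono[OF assms(5), of "norm (a i - b i)"] A by simp
    also have "\<dots> \<le> d" by (rule assms(4)[OF i])
    finally show "norm (a i / of_real A - b i / of_real A) \<le> d" .
  qed
  finally have *: "norm ((\<Prod>i\<in>I. a i) - (\<Prod>i\<in>I. b i)) / A ^ card I \<le> real (card I) * d"
    using A by (simp add: prod_dividef prod_constant diff_divide_distrib[symmetric] norm_divide norm_power)
  then have "norm ((\<Prod>i\<in>I. a i) - (\<Prod>i\<in>I. b i)) / A ^ card I * A ^ card I \<le> real (card I) * d * A ^ card I"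
    using A by (intro mult_right_mono) auto
  then show ?thesis using A by (simp add: mult_ac)
qed

text \<open>Rounds down to the shifted lattice h (Z - c). For h = 1/sqrt k and c = k \<mu>_j it
  consists of the j-th coordinates of the points sqrt k (\<alpha>/k - \<mu>).\<close>

definition rnd :: "real \<Rightarrow> real \<Rightarrow> real \<Rightarrow> real" where
  "rnd h c x = h * (of_int \<lfloor>x / h + c\<rfloor> - c)"

lemma rounding_rnd: assumes "0 < h" "h \<le> 1" shows "rounding (rnd h c) h"
proof
  show "rnd h c \<in> borel_measurable borel" unfolding rnd_def[abs_def] by measurable
  show "\<bar>rnd h c x - x\<bar> \<le> h" for x
  proof -
    have 1: "rnd h c x - x = - h * (x / h + c - of_int \<lfloor>x / h + c\<rfloor>)"
      using assms by (simp add: rnd_def field_simps)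
    have 2: "0 \<le> x / h + c - of_int \<lfloor>x / h + c\<rfloor>" "x / h + c - of_int \<lfloor>x / h + c\<rfloor> \<le> 1" by linarith+
    have "\<bar>rnd h c x - x\<bar> = h * (x / h + c - of_int \<lfloor>x / h + c\<rfloor>)"
      unfolding 1 using assms 2(1) by (simp only: abs_mult abs_minus_cancel abs_of_pos abs_of_nonneg)
    also have "\<dots> \<le> h * 1" using 2 assms by (intro mult_left_mono) auto
    finally show ?thesis by simp
  qed
  show "rnd h c (x + h) = rnd h c x + h" for x
  proof -
    have "(x + h) / h + c = (x / h + c) + 1" using assms by (simp add: add_divide_distrib)
    then have "\<lfloor>(x + h) / h + c\<rfloor> = \<lfloor>x / h + c\<rfloor> + 1" by (simp only: one_add_floor)
    then show ?thesis by (simp add: rnd_def algebra_simps)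
  qed
qed (use assms in auto)

text \<open>A counterpart of 1 / (1 + s^2) with period 2\<pi>/h: the denominator is 1 + |exp (i s h)
  - 1|^2 / h^2. It merges \<open>osc_bound\<close> and \<open>osc_bound2\<close> into a single
  bound, \<open>osc_per_weight\<close>.\<close>

definition per_weight :: "real \<Rightarrow> real \<Rightarrow> real" where
  "per_weight h s = 1 / (1 + 2 * (1 - cos (s * h)) / h\<^sup>2)"

lemma per_weight_bounds: "0 \<le> per_weight h s" "per_weight h s \<le> 1"
proof -
  have "0 \<le> 2 * (1 - cos (s * h)) / h\<^sup>2" by (intro divide_nonneg_nonneg) auto
  then have "1 \<le> 1 + 2 * (1 - cos (s * h)) / h\<^sup>2" by linarith
  then show "0 \<le> per_weight h s" "per_weight h s \<le> 1"
    unfolding per_weight_def by (auto simp only: divide_le_eq_1 zero_le_divide_iff)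
qed

lemma per_weight_measurable [measurable]: "per_weight h \<in> borel_measurable borel"
  unfolding per_weight_def[abs_def] by measurable

lemma per_weight_periodic: assumes "0 < h" shows "per_weight h (s + of_int n * (2 * pi / h)) = per_weight h s"
proof -
  have "(s + of_int n * (2 * pi / h)) * h = s * h + 2 * pi * of_int n" using assms by (simp add: field_simps)
  then show ?thesis by (simp add: per_weight_def cos_add)
qed

lemma per_weight_le:
  assumes "0 < h" "\<bar>s * h\<bar> \<le> pi" shows "per_weight h s \<le> 4 * (1 / (1 + s\<^sup>2))"
proof -
  have "(\<bar>s * h\<bar> / 2)\<^sup>2 \<le> norm (exp (\<i> * complex_of_real (s * h)) - 1) ^ 2"
    using norm_exp_minus_1_ge[OF assms(2)] by (intro power_mono) auto
  then have "s\<^sup>2 / 4 * h\<^sup>2 \<le> 2 * (1 - cos (s * h))"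
    unfolding norm_exp_minus_1 by (simp add: power_divide power_mult_distrib)
  then have "s\<^sup>2 / 4 \<le> 2 * (1 - cos (s * h)) / h\<^sup>2" using assms(1) by (simp add: pos_le_divide_eq)
  then have "per_weight h s \<le> 1 / (1 + s\<^sup>2 / 4)"
    unfolding per_weight_def by (intro divide_left_mono mult_pos_pos add_pos_nonneg) (auto intro: order_trans[rotated])
  also have "\<dots> \<le> 1 / ((1 + s\<^sup>2) / 4)" by (intro divide_left_mono mult_pos_pos add_pos_nonneg divide_pos_pos) auto
  finally show ?thesis by simp
qed

lemma nn_integral_inverse_1_plus_square: "(\<integral>\<^sup>+x. ennreal (1 / (1 + (x - v)\<^sup>2)) \<partial>lborel) = ennreal pi"
  using integral_inverse_1_plus_square[of v] by (subst nn_integral_eq_integral) auto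

text \<open>The point is uniformity in h. Translation by a multiple of the period b moves the
  interval into [-b, b]; there s is within b/2 of one of -b, 0, b, so three translates of 4 / (1 +
  s^2) dominate, each with integral 4\<pi>.\<close>

lemma per_weight_integral:
  assumes h: "0 < h"
  shows "(\<integral>\<^sup>+s. ennreal (indicator {a - pi / h .. a + pi / h} s * per_weight h s) \<partial>lborel) \<le> ennreal (12 * pi)"
proof -
  define b where "b = 2 * pi / h"
  have b: "b > 0" using h by (simp add: b_def)
  have I: "(\<integral>\<^sup>+s. ennreal 4 * ennreal (1 / (1 + (s - c)\<^sup>2)) \<partial>lborel) = ennreal 4 * ennreal pi" for c
    unfolding nn_integral_inverse_1_plus_square[of c, symmetric] by (rule nn_integral_cmult) measurable
  define n where "n = \<lfloor>a / b + 1/2\<rfloor>"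
  have n: "\<bar>a - of_int n * b\<bar> \<le> b / 2"
  proof -
    have "\<bar>a / b - of_int n\<bar> \<le> 1/2" unfolding n_def by linarith
    then have "\<bar>a / b - of_int n\<bar> * b \<le> 1/2 * b" using b by (intro mult_right_mono) auto
    moreover have "a - of_int n * b = (a / b - of_int n) * b" using b by (simp add: left_diff_distrib)
    ultimately show ?thesis using b by (simp only: abs_mult abs_of_pos)
  qed
  have bound: "per_weight h s \<le> 4 * (1 / (1 + (s - (-b))\<^sup>2)) + (4 * (1 / (1 + (s - 0)\<^sup>2)) + 4 * (1 / (1 + (s - b)\<^sup>2)))"
    if "\<bar>s\<bar> \<le> b" for s
  proof -
    have pos: "0 \<le> 4 * (1 / (1 + (s - c)\<^sup>2))" for c by simp
    have key: "per_weight h s \<le> 4 * (1 / (1 + (s - of_int k * b)\<^sup>2))" if "\<bar>s - of_int k * b\<bar> \<le> b / 2" for k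
    proof -
      have "\<bar>(s - of_int k * b) * h\<bar> \<le> pi" 
        using mult_right_mono[OF that, of h] h by (simp add: abs_mult b_def)
      from per_weight_le[OF h this] per_weight_periodic[OF h, of "s - of_int k * b" k]
      show ?thesis by (simp add: b_def)
    qed
    have "\<bar>s\<bar> \<le> b/2 \<or> \<bar>s - b\<bar> \<le> b/2 \<or> \<bar>s + b\<bar> \<le> b/2" using that by linarith
    then show ?thesis
    proof (elim disjE)
      assume c: "\<bar>s\<bar> \<le> b/2"
      have "per_weight h s \<le> 4 * (1 / (1 + (s - 0)\<^sup>2))" using key[of "0"] c by simp
      then show ?thesis using pos[of "b"] pos[of "-b"] by linarith
    next
      assume c: "\<bar>s - b\<bar> \<le> b/2"
      have "per_weight h s \<le> 4 * (1 / (1 + (s - b)\<^sup>2))" using key[of "1"] c by simp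
      then show ?thesis using pos[of "0"] pos[of "-b"] by linarith
    next
      assume c: "\<bar>s + b\<bar> \<le> b/2"
      have "per_weight h s \<le> 4 * (1 / (1 + (s - (-b))\<^sup>2))" using key[of "-1"] c by simp
      then show ?thesis using pos[of "0"] pos[of "b"] by linarith
    qed
  qed
  have "(\<integral>\<^sup>+s. ennreal (indicator {a - pi / h .. a + pi / h} s * per_weight h s) \<partial>lborel)
     = (\<integral>\<^sup>+s. ennreal (indicator {a - pi / h .. a + pi / h} (of_int n * b + 1 * s) * per_weight h (of_int n * b + 1 * s)) \<partial>lborel)"
    by (subst nn_integral_real_affine[where c=1 and t="of_int n * b"]) auto
  also have "\<dots> \<le> (\<integral>\<^sup>+s. (ennreal 4 * ennreal (1 / (1 + (s - (-b))\<^sup>2)) + (ennreal 4 * ennreal (1 / (1 + (s - 0)\<^sup>2)) + ennreal 4 * ennreal (1 / (1 + (s - b)\<^sup>2)))) \<partial>lborel)"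
  proof (rule nn_integral_mono)
    fix s
    have p: "per_weight h (of_int n * b + 1 * s) = per_weight h s"
      using per_weight_periodic[OF h, of s n] by (simp add: b_def add.commute)
    have "indicator {a - pi / h .. a + pi / h} (of_int n * b + 1 * s) * per_weight h s
       \<le> 4 * (1 / (1 + (s - (-b))\<^sup>2)) + (4 * (1 / (1 + (s - 0)\<^sup>2)) + 4 * (1 / (1 + (s - b)\<^sup>2)))"
    proof (cases "of_int n * b + 1 * s \<in> {a - pi / h .. a + pi / h}")
      case True
      have "pi / h = b / 2" by (simp add: b_def)
      with True have "a - b / 2 \<le> of_int n * b + s" "of_int n * b + s \<le> a + b / 2" by auto
      with n have "\<bar>s\<bar> \<le> b" by linarith
      from bound[OF this] True show ?thesis by simp
    next
      case False then show ?thesis by simp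
    qed
    then show "ennreal (indicator {a - pi / h .. a + pi / h} (of_int n * b + 1 * s) * per_weight h (of_int n * b + 1 * s))
      \<le> ennreal 4 * ennreal (1 / (1 + (s - (-b))\<^sup>2)) + (ennreal 4 * ennreal (1 / (1 + (s - 0)\<^sup>2)) + ennreal 4 * ennreal (1 / (1 + (s - b)\<^sup>2)))"
      unfolding p by (simp only: ennreal_mult[symmetric] ennreal_plus[symmetric] divide_nonneg_nonneg
          add_nonneg_nonneg zero_le_power2 zero_le_one zero_le_numeral mult_nonneg_nonneg ennreal_leI)
  qed
  also have "\<dots> = ennreal 4 * ennreal pi + (ennreal 4 * ennreal pi + ennreal 4 * ennreal pi)"
    by (subst nn_integral_add, simp, simp, subst nn_integral_add, simp, simp) (simp only: I)
  also have "\<dots> = ennreal (12 * pi)"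
  proof -
    have "ennreal 4 * ennreal pi = ennreal (4 * pi)" by (rule ennreal_mult[symmetric]) auto
    moreover have "ennreal (4 * pi) + (ennreal (4 * pi) + ennreal (4 * pi)) = ennreal (4 * pi + (4 * pi + 4 * pi))"
      using ennreal_plus[of "4*pi" "4*pi"] ennreal_plus[of "4*pi" "4*pi+4*pi"] by (simp only: pi_ge_zero mult_nonneg_nonneg add_nonneg_nonneg zero_le_numeral)
    ultimately show ?thesis by simp
  qed
  finally show ?thesis .
qed

lemma (in bump_rounding) osc_per_weight: "norm (osc \<rho> \<gamma> t) \<le> 2 * K * pi * per_weight h t"
proof -
  let ?N = "norm (osc \<rho> \<gamma> t)"
  have "2 * (1 - cos (t * h)) / h\<^sup>2 * ?N \<le> K * pi"
    using osc_bound2[of t] h by (simp add: pos_divide_le_eq)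
  with osc_bound[of t] have "(1 + 2 * (1 - cos (t * h)) / h\<^sup>2) * ?N \<le> 2 * K * pi"
    by (simp add: distrib_right)
  moreover have "0 < 1 + 2 * (1 - cos (t * h)) / h\<^sup>2" by (intro add_pos_nonneg divide_nonneg_nonneg) auto
  ultimately show ?thesis unfolding per_weight_def by (simp add: pos_le_divide_eq mult_ac)
qed

definition gb :: "real \<Rightarrow> real \<Rightarrow> real \<Rightarrow> real" where "gb l v x = exp (- l * (x - v)\<^sup>2 / 2)"

lemma gb_measurable [measurable]: 
  assumes [measurable]: "f \<in> borel_measurable M" "g \<in> borel_measurable M"
  shows "(\<lambda>x. gb l (f x) (g x)) \<in> borel_measurable M"
  unfolding gb_def by measurable

lemma gb_nonneg: "0 \<le> gb l v x" by (simp add: gb_def)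

lemma norm_exp_neg_ii' [simp]: "norm (exp (- (\<i> * complex_of_real x))) = 1"
  using norm_exp_neg_ii[of x] by simp

definition cw :: "('m::finite \<Rightarrow> real \<Rightarrow> real) \<Rightarrow> real^'m \<Rightarrow> real^'m" where
  "cw r x = (\<chi> j. r j (x $ j))"

lemma cw_measurable: "(\<And>j. r j \<in> borel_measurable borel) \<Longrightarrow> cw r \<in> borel_measurable borel"
  unfolding cw_def[abs_def]
  by (subst borel_measurable_euclidean_space) (auto simp: Basis_vec_def inner_axis)

text \<open>\<open>g\<close> need not factor over the coordinates, but it is an average, with weight
  \<open>g2\<close>, of translates of one product Gaussian. Since \<open>K\<close> serves every
  centre, one-dimensional bounds can be integrated against \<open>g2\<close>.\<close>

locale gauss_mix =
  fixes l K :: real and g2 g :: "real^'m::finite \<Rightarrow> real"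
  assumes bump: "\<And>v. smooth_bump (gb l v) (\<lambda>x. - l * (x - v) * gb l v x) (\<lambda>x. (l\<^sup>2 * (x - v)\<^sup>2 - l) * gb l v x) K v"
    and g2: "\<And>v. 0 \<le> g2 v" "integrable lborel g2"
    and g: "\<And>x. g x = (LINT v|lborel. g2 v * (\<Prod>j\<in>UNIV. gb l (v $ j) (x $ j)))"
begin

definition "A = max 1 (2 * K * pi)"

lemma A: "1 \<le> A" "2 * K * pi \<le> A" by (auto simp: A_def)

lemma g2_measurable [measurable]: "g2 \<in> borel_measurable borel"
  using g2(2) by simp

text \<open>For lattice rounding this is h^m times the sum of g(x) exp (- i <t, x>) over the lattice
  points; for the identity it is the Fourier transform of g.\<close>

definition "\<Theta> r t = (LINT x|lborel. complex_of_real (g (cw r x)) * exp (- \<i> * complex_of_real (t \<bullet> cw r x)))"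

lemma g_nonneg: "0 \<le> g x"
  unfolding g by (intro integral_nonneg_AE AE_I2 mult_nonneg_nonneg g2 prod_nonneg) (auto simp: gb_nonneg)

end

locale gauss_mix_rounding = gauss_mix l K g2 g for l K and g2 g :: "real^'m::finite \<Rightarrow> real" +
  fixes h :: real and r :: "'m \<Rightarrow> real \<Rightarrow> real"
  assumes r: "\<And>j. rounding (r j) h"
begin

lemma br: "bump_rounding (gb l v) (\<lambda>x. - l * (x - v) * gb l v x) (\<lambda>x. (l\<^sup>2 * (x - v)\<^sup>2 - l) * gb l v x) K v (r j) h"
  using bump r by (intro bump_rounding.intro)

lemma K0: "0 \<le> K" using smooth_bump.K_nonneg[OF bump] .

lemma r_measurable [measurable]: "r j \<in> borel_measurable borel"
  using rounding.rmeas[OF r] .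

lemma cwr_measurable [measurable]: "cw r \<in> borel_measurable borel"
  by (rule cw_measurable) simp

lemma h: "0 < h" "h \<le> 1" using rounding.h[OF r] by auto

definition "kern t v x = complex_of_real (g2 v) * (\<Prod>j\<in>UNIV. complex_of_real (gb l (v $ j) (r j (x $ j))) * exp (- \<i> * complex_of_real (t $ j * r j (x $ j))))"

lemma osc_le: "norm (osc (r j) (gb l v) t) \<le> A * per_weight h t"
proof -
  have "norm (osc (r j) (gb l v) t) \<le> 2 * K * pi * per_weight h t"
    by (rule bump_rounding.osc_per_weight[OF br])
  also have "\<dots> \<le> A * per_weight h t" by (intro mult_right_mono A per_weight_bounds)
  finally show ?thesis .
qed

lemma osc_le': "norm (osc (r j) (gb l v) t) \<le> A"
  using osc_le[where j=j and v=v and t=t] mult_left_mono[OF per_weight_bounds(2)[of h t], of A] A(1)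
  by linarith

lemma osc_int: "integrable lborel (\<lambda>x. complex_of_real (gb l v (r j x)) * exp (- \<i> * complex_of_real (t * r j x)))"
  using bump_rounding.integrable_osc'[OF br, where c=0 and t=t] by simp

lemma kern_integral:
  "integrable lborel (kern t v)"
  "(LINT x|lborel. kern t v x) = complex_of_real (g2 v) * (\<Prod>j\<in>UNIV. osc (r j) (gb l (v $ j)) (t $ j))"
  using lint_vec_prod[of "\<lambda>j x. complex_of_real (gb l (v $ j) (r j x)) * exp (- \<i> * complex_of_real (t $ j * r j x))", OF osc_int]
  by (simp_all add: kern_def[abs_def] osc_def)

lemma norm_kern: "complex_of_real (norm (kern t v x)) = kern 0 v x"
  by (simp add: kern_def norm_mult prod_norm[symmetric] g2 gb_nonneg)

lemma kern_measurable [measurable]: "(\<lambda>(v, x). kern t v x) \<in> borel_measurable (lborel \<Otimes>\<^sub>M lborel)"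
  unfolding kern_def by measurable

text \<open>The norm of the kernel is the kernel at frequency 0, so the inner integral of the norm
  is \<open>g2 v\<close> times a product of values of \<open>osc\<close> at 0, each at most
  \<open>A\<close>.\<close>

lemma integrable_pair: "integrable (lborel \<Otimes>\<^sub>M lborel) (\<lambda>(v, x). kern t v x)"
proof (rule lborel_pair.Fubini_integrable)
  show "integrable lborel (\<lambda>v. LINT x|lborel. norm (case (v, x) of (v, x) \<Rightarrow> kern t v x))"
  proof (rule Bochner_Integration.integrable_bound[OF integrable_mult_left[OF g2(2), of "A ^ CARD('m)"]])
    show "AE v in lborel. norm (LINT x|lborel. norm (case (v, x) of (v, x) \<Rightarrow> kern t v x)) \<le> norm (g2 v * A ^ CARD('m))"
    proof (rule AE_I2)
      fix v :: "real^'m"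
      have "complex_of_real (LINT x|lborel. norm (kern t v x)) = (LINT x|lborel. kern 0 v x)"
        by (simp add: integral_complex_of_real[symmetric] norm_kern)
      then have "norm (LINT x|lborel. norm (kern t v x)) = norm (LINT x|lborel. kern 0 v x)"
        by (metis norm_of_real real_norm_def)
      also have "\<dots> = g2 v * (\<Prod>j\<in>UNIV. norm (osc (r j) (gb l (v $ j)) (0 $ j)))"
        by (simp add: kern_integral norm_mult prod_norm g2)
      also have "\<dots> \<le> g2 v * (\<Prod>j\<in>(UNIV::'m set). A)"
        by (intro mult_left_mono prod_mono g2) (auto simp: osc_le')
      finally show "norm (LINT x|lborel. norm (case (v, x) of (v, x) \<Rightarrow> kern t v x)) \<le> norm (g2 v * A ^ CARD('m))"
        using g2(1)[of v] A by (simp add: abs_mult)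
    qed
  qed measurable
qed (use kern_integral(1) in auto)

lemma kern_int_v: "(LINT v|lborel. kern t v x) = complex_of_real (g (cw r x)) * exp (- \<i> * complex_of_real (t \<bullet> cw r x))"
proof -
  have "kern t v x = complex_of_real (g2 v * (\<Prod>j\<in>UNIV. gb l (v $ j) (cw r x $ j))) * exp (- \<i> * complex_of_real (t \<bullet> cw r x))" for v
    unfolding exp_inner_cart by (simp add: kern_def cw_def prod.distrib)
  then show ?thesis
    unfolding g by (simp only: integral_mult_left_zero integral_complex_of_real)
qed

lemma integrable_g: "integrable lborel (\<lambda>x. complex_of_real (g (cw r x)) * exp (- \<i> * complex_of_real (t \<bullet> cw r x)))"
  using lborel_pair.integrable_snd[OF integrable_pair[of t]] by (simp add: kern_int_v)

lemma integrable_g': "integrable lborel (\<lambda>x. g (cw r x))"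
  using integrable_g[of 0] by (simp add: complex_of_real_integrable_eq)

lemma Theta_eq: "\<Theta> r t = (LINT v|lborel. complex_of_real (g2 v) * (\<Prod>j\<in>UNIV. osc (r j) (gb l (v $ j)) (t $ j)))"
  using lborel_pair.Fubini_integral[OF integrable_pair[of t]]
  by (simp add: kern_int_v kern_integral \<Theta>_def)

lemma Theta_integrable: "integrable lborel (\<lambda>v. complex_of_real (g2 v) * (\<Prod>j\<in>UNIV. osc (r j) (gb l (v $ j)) (t $ j)))"
  using lborel_pair.integrable_fst[OF integrable_pair[of t]] by (simp add: kern_integral)

text \<open>The bound is periodic in each coordinate of t. Nothing better can be expected of a
  lattice sum: characters whose frequencies differ by 2\<pi>/h in one coordinate agree on the
  lattice up to a constant of modulus 1.\<close>

lemma Theta_bound: "norm (\<Theta> r t) \<le> (LINT v|lborel. g2 v) * A ^ CARD('m) * (\<Prod>j\<in>UNIV. per_weight h (t $ j))"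
proof -
  have "norm (\<Theta> r t) \<le> (LINT v|lborel. g2 v * (A ^ CARD('m) * (\<Prod>j\<in>UNIV. per_weight h (t $ j))))"
    unfolding Theta_eq
  proof (rule lint_bound)
    fix v :: "real^'m"
    have "(\<Prod>j\<in>UNIV. norm (osc (r j) (gb l (v $ j)) (t $ j))) \<le> (\<Prod>j\<in>UNIV. A * per_weight h (t $ j))"
      by (intro prod_mono) (auto simp: osc_le)
    then have "g2 v * (\<Prod>j\<in>UNIV. norm (osc (r j) (gb l (v $ j)) (t $ j))) \<le> g2 v * (\<Prod>j\<in>UNIV. A * per_weight h (t $ j))"
      by (rule mult_left_mono) (rule g2)
    then show "norm (complex_of_real (g2 v) * (\<Prod>j\<in>UNIV. osc (r j) (gb l (v $ j)) (t $ j))) \<le> g2 v * (A ^ CARD('m) * (\<Prod>j\<in>UNIV. per_weight h (t $ j)))"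
      using g2(1)[of v] by (simp add: norm_mult prod_norm prod.distrib)
  qed (intro integrable_mult_left g2)
  then show ?thesis by (simp add: mult_ac)
qed

lemma g_measurable_cw [measurable]: "(\<lambda>x. g (cw r x)) \<in> borel_measurable borel"
  using integrable_g' by simp

text \<open>Insert the inversion formula for f and exchange the integrals; the kernel is dominated
  by |F t| g (cw r x), a product of two integrable functions.\<close>

lemma fourier_swap:
  fixes F :: "real^'m \<Rightarrow> complex"
  assumes F: "integrable lborel F" and f: "\<And>x. f x = (LINT t|lborel. F t * exp (- \<i> * complex_of_real (t \<bullet> x)))"
  shows "(LINT x|lborel. complex_of_real (g (cw r x)) * f (cw r x)) = (LINT t|lborel. F t * \<Theta> r t)"
    "integrable lborel (\<lambda>t. F t * \<Theta> r t)" 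
    "integrable lborel (\<lambda>x. complex_of_real (g (cw r x)) * f (cw r x))"
proof -
  have [measurable]: "F \<in> borel_measurable borel" using F by simp
  let ?k = "\<lambda>t x. F t * (complex_of_real (g (cw r x)) * exp (- \<i> * complex_of_real (t \<bullet> cw r x)))"
  have int: "integrable (lborel \<Otimes>\<^sub>M lborel) (\<lambda>(t, x). ?k t x)"
  proof (rule lborel_pair.Fubini_integrable)
    have "(LINT x|lborel. norm (case (t, x) of (t, x) \<Rightarrow> ?k t x)) = norm (F t) * (LINT x|lborel. g (cw r x))" for t
      by (simp add: norm_mult g_nonneg)
    then show "integrable lborel (\<lambda>t. LINT x|lborel. norm (case (t, x) of (t, x) \<Rightarrow> ?k t x))"
      using F by simp
  qed (use integrable_g in auto)
  have 1: "(LINT t|lborel. ?k t x) = complex_of_real (g (cw r x)) * f (cw r x)" for x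
    unfolding f by (subst integral_mult_right_zero[symmetric]) (simp add: mult_ac)
  have 2: "(LINT x|lborel. ?k t x) = F t * \<Theta> r t" for t
    by (simp add: \<Theta>_def)
  show "(LINT x|lborel. complex_of_real (g (cw r x)) * f (cw r x)) = (LINT t|lborel. F t * \<Theta> r t)"
    using lborel_pair.Fubini_integral[OF int] unfolding 1 2 .
  show "integrable lborel (\<lambda>t. F t * \<Theta> r t)"
    using lborel_pair.integrable_fst[OF int] by (simp only: 2)
  show "integrable lborel (\<lambda>x. complex_of_real (g (cw r x)) * f (cw r x))"
    using lborel_pair.integrable_snd[OF int] by (simp only: 1)
qed

lemma id: "gauss_mix_rounding l K g2 g h (\<lambda>_ x. x)"
  using h by unfold_locales auto

lemma Theta_approx:
  assumes t: "\<And>j. \<bar>t $ j\<bar> * h \<le> pi"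
  shows "norm (\<Theta> r t - \<Theta> (\<lambda>_ x. x) t) \<le> (LINT v|lborel. g2 v) * (CARD('m) * A ^ CARD('m) * (4 * K * pi)) * h"
proof -
  interpret id: gauss_mix_rounding l K g2 g h "\<lambda>_ x. x" by (rule id)
  let ?c = "real CARD('m) * A ^ CARD('m) * (4 * K * pi * h)"
  have "norm (\<Theta> r t - \<Theta> (\<lambda>_ x. x) t) \<le> (LINT v|lborel. g2 v * ?c)"
    unfolding Theta_eq id.Theta_eq Bochner_Integration.integral_diff[OF Theta_integrable id.Theta_integrable, symmetric]
  proof (rule lint_bound)
    fix v :: "real^'m"
    have "norm ((\<Prod>j\<in>UNIV. osc (r j) (gb l (v $ j)) (t $ j)) - (\<Prod>j\<in>UNIV. osc (\<lambda>x. x) (gb l (v $ j)) (t $ j))) \<le> ?c"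
      by (rule norm_prod_diff_le) (auto simp: osc_le' id.osc_le' A intro: t bump_rounding.osc_approx[OF br])
    from mult_left_mono[OF this g2(1)[of v]]
    show "norm (complex_of_real (g2 v) * (\<Prod>j\<in>UNIV. osc (r j) (gb l (v $ j)) (t $ j))
       - complex_of_real (g2 v) * (\<Prod>j\<in>UNIV. osc (\<lambda>x. x) (gb l (v $ j)) (t $ j))) \<le> g2 v * ?c"
      unfolding right_diff_distrib[symmetric] norm_mult using g2(1)[of v] by simp
  qed (intro integrable_mult_left g2)
  then show ?thesis by (simp add: mult_ac)
qed

text \<open>A single coordinate beyond \<pi>/h suffices: its factor is O(1/|t_i|) = O(h), and every
  other factor is at most \<open>A\<close>.\<close>

lemma Theta_id_decay:
  assumes t: "pi < \<bar>t $ i\<bar> * h"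
  shows "norm (\<Theta> (\<lambda>_ x. x) t) \<le> (LINT v|lborel. g2 v) * (A ^ CARD('m) * (K * pi)) * h"
proof -
  interpret id: gauss_mix_rounding l K g2 g h "\<lambda>_ x. x" by (rule id)
  let ?c = "A ^ CARD('m) * (K * pi * h)"
  have t0: "pi / \<bar>t $ i\<bar> \<le> h" "pi \<le> \<bar>t $ i\<bar>"
  proof -
    have "\<bar>t $ i\<bar> * h \<le> \<bar>t $ i\<bar> * 1" using h by (intro mult_left_mono) auto
    with t show "pi \<le> \<bar>t $ i\<bar>" by simp
    then have "0 < \<bar>t $ i\<bar>" using pi_gt_zero by linarith
    with t show "pi / \<bar>t $ i\<bar> \<le> h" by (simp add: pos_divide_le_eq mult.commute)
  qed
  have "norm (\<Theta> (\<lambda>_ x. x) t) \<le> (LINT v|lborel. g2 v * ?c)"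
    unfolding id.Theta_eq
  proof (rule lint_bound)
    fix v :: "real^'m"
    have 1: "norm (osc (\<lambda>x. x) (gb l (v $ i)) (t $ i)) \<le> K * pi * h"
    proof -
      have "norm (osc (\<lambda>x. x) (gb l (v $ i)) (t $ i)) \<le> K * pi * (pi / \<bar>t $ i\<bar>)"
        using smooth_bump.osc_id_decay[OF bump t0(2)] by simp
      also have "\<dots> \<le> K * pi * h" using K0 t0(1) by (intro mult_left_mono) auto
      finally show ?thesis .
    qed
    have "(\<Prod>j\<in>UNIV. norm (osc (\<lambda>x. x) (gb l (v $ j)) (t $ j))) = norm (osc (\<lambda>x. x) (gb l (v $ i)) (t $ i)) *
       (\<Prod>j\<in>UNIV-{i}. norm (osc (\<lambda>x. x) (gb l (v $ j)) (t $ j)))" by (rule prod.remove) auto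
    also have "\<dots> \<le> (K * pi * h) * (\<Prod>j\<in>UNIV-{i}. A)"
      using 1 id.osc_le' h K0 by (intro mult_mono prod_mono) (auto intro: prod_nonneg)
    also have "\<dots> \<le> (K * pi * h) * A ^ CARD('m)"
      using A h K0 by (intro mult_left_mono) (auto intro!: power_increasing)
    finally have "(\<Prod>j\<in>UNIV. norm (osc (\<lambda>x. x) (gb l (v $ j)) (t $ j))) \<le> ?c" by (simp add: mult_ac)
    from mult_left_mono[OF this g2(1)[of v]]
    show "norm (complex_of_real (g2 v) * (\<Prod>j\<in>UNIV. osc (\<lambda>x. x) (gb l (v $ j)) (t $ j))) \<le> g2 v * ?c"
      using g2(1)[of v] by (simp add: norm_mult prod_norm)
  qed (intro integrable_mult_left g2)
  then show ?thesis by (simp add: mult_ac)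
qed

end

lemma per_weight_integral':
  assumes "0 < h"
  shows "(\<integral>\<^sup>+s. ennreal (if \<bar>s - a\<bar> \<le> pi / h then per_weight h s else 0) \<partial>lborel) \<le> ennreal (12 * pi)"
proof -
  have "(if \<bar>s - a\<bar> \<le> pi / h then per_weight h s else 0) = indicator {a - pi / h .. a + pi / h} s * per_weight h s" for s
    by (auto simp: indicator_def abs_le_iff)
  then show ?thesis using per_weight_integral[OF assms, of a] by simp
qed

lemma prod_mono_ennreal:
  fixes f g :: "'i \<Rightarrow> ennreal"
  assumes "finite I" "\<And>i. i \<in> I \<Longrightarrow> f i \<le> g i"
  shows "prod f I \<le> prod g I"
  using assms by (induction rule: finite_induct) (auto intro!: mult_mono)

lemma outer_weight_measurable:
  fixes G :: "real \<Rightarrow> real"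
  assumes [measurable]: "(\<lambda>t::real^'m::finite. G (norm t)) \<in> borel_measurable borel"
  shows "(\<lambda>t::real^'m. if \<exists>j. pi < \<bar>t $ j\<bar> * h then G (norm t) * (\<Prod>j\<in>UNIV. per_weight h (t $ j)) else 0) \<in> borel_measurable borel"
  by measurable

lemma outer_weight_measurable':
  fixes G :: "real \<Rightarrow> real"
  assumes "integrable lborel (\<lambda>t::real^'m::finite. G (norm t))"
  shows "(\<lambda>t::real^'m. ennreal (if \<exists>j. pi < \<bar>t $ j\<bar> * h then G (norm t) * (\<Prod>j\<in>UNIV. per_weight h (t $ j)) else 0)) \<in> borel_measurable lborel"
  using outer_weight_measurable[of G h] borel_measurable_integrable[OF assms] by simp

text \<open>Each frequency \<open>t\<close> outside the central cell is compared with the points \<open>s\<close> of a cube around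
  \<open>t / 2\<close> whose side is proportional to the period: there \<open>norm s \<le> norm t\<close>, so monotonicity of the
  radial majorant applies, while for fixed \<open>s\<close> the admissible \<open>t\<close> stay within one period.\<close>

lemma radial_tail:
  fixes G :: "real \<Rightarrow> real"
  assumes G: "\<And>r s. 0 < r \<Longrightarrow> r \<le> s \<Longrightarrow> G s \<le> G r" "\<And>r. 0 \<le> G r" "integrable lborel (\<lambda>t::real^'m::finite. G (norm t))"
    and h: "0 < h" "h \<le> 1"
  shows "(\<integral>\<^sup>+t. ennreal (if \<exists>j. pi < \<bar>(t::real^'m) $ j\<bar> * h then G (norm t) * (\<Prod>j\<in>UNIV. per_weight h (t $ j)) else 0) \<partial>lborel)
    \<le> ennreal ((LINT t|lborel. G (norm (t::real^'m))) * (12 * CARD('m)) ^ CARD('m) * h)"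
proof -
  define m where "m = real CARD('m)"
  have m: "1 \<le> m" by (simp add: m_def Suc_le_eq)
  \<comment> \<open>The half-side of the cube. The distance from s to t/2 is then at most m q =
    \<pi>/(2h), which outside the central cell is below |t_i|/2 \<le> |t|/2; hence |s| \<le>
    |t|.\<close>
  define q where "q = pi / (2 * m * h)"
  have q: "0 < q" "2 * q \<le> pi / h" using h m by (auto simp: q_def field_simps)
  have [measurable]: "(\<lambda>t::real^'m. G (norm t)) \<in> borel_measurable borel" using G(3) by simp
  define a where "a t = (if \<exists>j. pi < \<bar>(t::real^'m) $ j\<bar> * h then G (norm t) * (\<Prod>j\<in>UNIV. per_weight h (t $ j)) else 0)" for t
  have [measurable]: "a \<in> borel_measurable borel"
    unfolding a_def[abs_def] by (rule outer_weight_measurable) measurable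
  have a0: "0 \<le> a t" for t by (auto simp: a_def intro!: mult_nonneg_nonneg prod_nonneg G per_weight_bounds)
  define k where "k t s = ennreal (G (norm (s::real^'m))) * (\<Prod>j\<in>UNIV. ennreal (if \<bar>(t::real^'m) $ j - 2 * s $ j\<bar> \<le> pi / h then per_weight h (t $ j) else 0))" for t s
  have [measurable]: "(\<lambda>(t, s). k t s) \<in> borel_measurable (lborel \<Otimes>\<^sub>M lborel)"
    unfolding k_def by measurable
  have cell: "(\<integral>\<^sup>+s. (\<Prod>j\<in>UNIV. (if \<bar>(s::real^'m) $ j - t $ j / 2\<bar> \<le> q then 1 else 0 :: ennreal)) \<partial>lborel) = ennreal ((2 * q) ^ CARD('m))" for t :: "real^'m"
  proof -
    have "(\<integral>\<^sup>+s. (if \<bar>s - c\<bar> \<le> q then 1 else 0 :: ennreal) \<partial>lborel) = ennreal (2 * q)" for c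
    proof -
      have "(\<lambda>s. if \<bar>s - c\<bar> \<le> q then 1 else 0 :: ennreal) = indicator {c - q..c + q}"
        by (auto simp: fun_eq_iff indicator_def abs_le_iff)
      then show ?thesis using q by simp
    qed
    then show ?thesis
      by (subst nn_integral_vec_prod) (auto simp: ennreal_power q less_imp_le)
  qed
  \<comment> \<open>The majorant decreases only on positive arguments, hence
    \<open>s \<noteq> 0\<close>; one point is negligible in the integral over s.\<close>
  have pt: "ennreal (a t) * (\<Prod>j\<in>UNIV. (if \<bar>(s::real^'m) $ j - t $ j / 2\<bar> \<le> q then 1 else 0 :: ennreal)) \<le> k t s"
    if s: "s \<noteq> 0" for t s
  proof (cases "(\<exists>j. pi < \<bar>t $ j\<bar> * h) \<and> (\<forall>j. \<bar>s $ j - t $ j / 2\<bar> \<le> q)")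
    case True
    then obtain i where i: "pi < \<bar>t $ i\<bar> * h" by blast
    have "norm (s - (1/2) *\<^sub>R t) \<le> (\<Sum>j\<in>UNIV. \<bar>(s - (1/2) *\<^sub>R t) $ j\<bar>)" by (rule norm_le_l1_cart)
    also have "\<dots> \<le> (\<Sum>j\<in>(UNIV::'m set). q)" using True by (intro sum_mono) auto
    also have "\<dots> = pi / (2 * h)" using m by (simp add: q_def m_def)
    also have "\<dots> \<le> \<bar>t $ i\<bar> / 2" using i h by (simp add: field_simps)
    also have "\<dots> \<le> norm t / 2" using component_le_norm_cart[of t i] by simp
    finally have "norm s \<le> norm t"
      using norm_triangle_ineq[of "s - (1/2) *\<^sub>R t" "(1/2) *\<^sub>R t"] by simp
    then have Gle: "G (norm t) \<le> G (norm s)" using s by (intro G(1)) auto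
    have "\<bar>t $ j - 2 * s $ j\<bar> \<le> pi / h" for j
    proof -
      have "\<bar>t $ j - 2 * s $ j\<bar> = 2 * \<bar>s $ j - t $ j / 2\<bar>" by (simp add: abs_if) 
      also have "\<dots> \<le> 2 * q" using True by simp
      finally show ?thesis using q(2) by linarith
    qed
    then have "k t s = ennreal (G (norm s) * (\<Prod>j\<in>UNIV. per_weight h (t $ j)))"
      by (simp add: k_def prod_ennreal per_weight_bounds ennreal_mult G prod_nonneg)
    moreover have "ennreal (a t) \<le> ennreal (G (norm s) * (\<Prod>j\<in>UNIV. per_weight h (t $ j)))"
      using True unfolding a_def by (auto intro!: ennreal_leI mult_right_mono Gle prod_nonneg per_weight_bounds)
    ultimately show ?thesis using True by simp
  next
    case False
    then consider "a t = 0" | i where "\<not> \<bar>s $ i - t $ i / 2\<bar> \<le> q" by (auto simp: a_def)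
    then show ?thesis
    proof cases
      case (2 i)
      then have "(\<Prod>j\<in>UNIV. (if \<bar>s $ j - t $ j / 2\<bar> \<le> q then 1 else 0 :: ennreal)) = 0"
        by (intro prod_zero) auto
      then show ?thesis by (simp only: mult_zero_right zero_le)
    qed simp
  qed
  have "(\<integral>\<^sup>+t. ennreal (a t) \<partial>lborel) * ennreal ((2 * q) ^ CARD('m)) =
     (\<integral>\<^sup>+t. ennreal (a t) * ennreal ((2 * q) ^ CARD('m)) \<partial>lborel)"
    by (rule nn_integral_multc[symmetric]) measurable
  also have "\<dots> = (\<integral>\<^sup>+t. \<integral>\<^sup>+s. ennreal (a t) * (\<Prod>j\<in>UNIV. (if \<bar>(s::real^'m) $ j - t $ j / 2\<bar> \<le> q then 1 else 0 :: ennreal)) \<partial>lborel \<partial>lborel)"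
  proof -
    have "(\<integral>\<^sup>+s. ennreal (a t) * (\<Prod>j\<in>UNIV. (if \<bar>(s::real^'m) $ j - t $ j / 2\<bar> \<le> q then 1 else 0 :: ennreal)) \<partial>lborel)
      = ennreal (a t) * ennreal ((2 * q) ^ CARD('m))" for t
      unfolding cell[of t, symmetric] by (rule nn_integral_cmult) measurable
    then show ?thesis by (simp only:)
  qed
  also have "\<dots> \<le> (\<integral>\<^sup>+t. \<integral>\<^sup>+s. k t s \<partial>lborel \<partial>lborel)"
    by (intro nn_integral_mono nn_integral_mono_AE eventually_mono[OF AE_lborel_singleton[of 0]] pt)
  also have "\<dots> = (\<integral>\<^sup>+s. \<integral>\<^sup>+t. k t s \<partial>lborel \<partial>lborel)"
    by (rule lborel_pair.Fubini'[symmetric]) measurable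
  also have "\<dots> \<le> (\<integral>\<^sup>+s. ennreal (G (norm (s::real^'m))) * ennreal ((12 * pi) ^ CARD('m)) \<partial>lborel)"
  proof (rule nn_integral_mono)
    fix s :: "real^'m"
    have "(\<integral>\<^sup>+t. k t s \<partial>lborel) = ennreal (G (norm s)) * (\<Prod>j\<in>UNIV. \<integral>\<^sup>+t. ennreal (if \<bar>t - 2 * s $ j\<bar> \<le> pi / h then per_weight h t else 0) \<partial>lborel)"
      unfolding k_def by (subst nn_integral_cmult, measurable) (subst nn_integral_vec_prod, auto)
    also have "\<dots> \<le> ennreal (G (norm s)) * (\<Prod>j\<in>(UNIV::'m set). ennreal (12 * pi))"
      by (intro mult_left_mono prod_mono_ennreal per_weight_integral' h) auto
    finally show "(\<integral>\<^sup>+t. k t s \<partial>lborel) \<le> ennreal (G (norm s)) * ennreal ((12 * pi) ^ CARD('m))"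
      by (simp add: ennreal_power)
  qed
  also have "\<dots> = (\<integral>\<^sup>+s. ennreal (G (norm (s::real^'m))) \<partial>lborel) * ennreal ((12 * pi) ^ CARD('m))"
    by (rule nn_integral_multc) measurable
  also have "\<dots> = ennreal ((LINT t|lborel. G (norm (t::real^'m))) * (12 * pi) ^ CARD('m))"
    using G by (subst nn_integral_eq_integral) (auto simp: ennreal_mult)
  finally have 1: "(\<integral>\<^sup>+t. ennreal (a t) \<partial>lborel) * ennreal ((2 * q) ^ CARD('m)) \<le> ennreal ((LINT t|lborel. G (norm (t::real^'m))) * (12 * pi) ^ CARD('m))" .
  let ?i = "(1 / (2 * q)) ^ CARD('m)"
  have "ennreal ((2 * q) ^ CARD('m)) * ennreal ?i = ennreal ((2 * q) ^ CARD('m) * ?i)"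
    using q by (intro ennreal_mult[symmetric]) auto
  also have "(2 * q) ^ CARD('m) * ?i = 1" using q by (simp add: power_one_over)
  finally have "(\<integral>\<^sup>+t. ennreal (a t) \<partial>lborel) = (\<integral>\<^sup>+t. ennreal (a t) \<partial>lborel) * ennreal ((2 * q) ^ CARD('m)) * ennreal ?i"
    by (simp only: mult.assoc ennreal_1 mult_1_right)
  also have "\<dots> \<le> ennreal ((LINT t|lborel. G (norm (t::real^'m))) * (12 * pi) ^ CARD('m)) * ennreal ?i"
    using 1 by (rule mult_right_mono) simp
  also have "\<dots> = ennreal ((LINT t|lborel. G (norm (t::real^'m))) * (12 * pi) ^ CARD('m) * ?i)"
    using q G by (intro ennreal_mult[symmetric]) (auto intro!: mult_nonneg_nonneg)
  finally have fin: "(\<integral>\<^sup>+t. ennreal (a t) \<partial>lborel) \<le> ennreal ((LINT t|lborel. G (norm (t::real^'m))) * (12 * pi) ^ CARD('m) * ?i)" .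
  \<comment> \<open>Per coordinate, the integral of the weight over t divided by the side of the
    cube in s; \<pi> cancels and one factor h per coordinate remains.\<close>
  have "12 * pi * (1 / (2 * q)) = 12 * m * h" using h m by (simp add: q_def)
  then have P: "(12 * pi) ^ CARD('m) * ?i = (12 * m) ^ CARD('m) * h ^ CARD('m)"
    by (simp only: power_mult_distrib[symmetric])
  have "h ^ CARD('m) \<le> h" using power_decreasing[of 1 "CARD('m)" h] h by (simp add: Suc_le_eq)
  then have "(LINT t|lborel. G (norm (t::real^'m))) * ((12 * m) ^ CARD('m) * h ^ CARD('m))
      \<le> (LINT t|lborel. G (norm (t::real^'m))) * ((12 * m) ^ CARD('m) * h)"
    using m G(2) by (intro mult_left_mono) auto
  then have "ennreal ((LINT t|lborel. G (norm (t::real^'m))) * (12 * pi) ^ CARD('m) * ?i)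
     \<le> ennreal ((LINT t|lborel. G (norm (t::real^'m))) * (12 * CARD('m)) ^ CARD('m) * h)"
    unfolding mult.assoc P by (intro ennreal_leI) (simp only: m_def mult.assoc of_nat_power of_nat_mult of_nat_numeral)
  with fin show ?thesis unfolding a_def by (rule order_trans)
qed

section \<open>Riemann sums against a Gaussian mixture\<close>

lemma nn_integral_lincomb:
  assumes [measurable]: "u \<in> borel_measurable M" "v \<in> borel_measurable M"
  shows "(\<integral>\<^sup>+t. u t * a + b * v t \<partial>M) = (\<integral>\<^sup>+t. u t \<partial>M) * a + b * (\<integral>\<^sup>+t. v t \<partial>M)"
  by (subst nn_integral_add, measurable) (simp add: nn_integral_multc nn_integral_cmult)

context gauss_mix
begin

text \<open>In the central cell the two transforms differ by O(h), and \<open>F\<close> is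
  integrable. Outside it they are not close, but each is harmless alone: the continuous one is O(h)
  by \<open>Theta_id_decay\<close>, and the lattice one is bounded by the periodic weight, which
  against the radial majorant contributes O(h) by \<open>radial_tail\<close>.\<close>

lemma riemann_sum:
  fixes F :: "real^'m \<Rightarrow> complex"
  assumes F: "integrable lborel F" and f: "\<And>x. f x = (LINT t|lborel. F t * exp (- \<i> * complex_of_real (t \<bullet> x)))"
    and G: "\<And>r s. 0 < r \<Longrightarrow> r \<le> s \<Longrightarrow> G s \<le> G r" "integrable lborel (\<lambda>t::real^'m. G (norm t))"
      "AE t in lborel. norm (F t) \<le> G (norm t)"
  obtains C where "\<And>h r. 0 < h \<Longrightarrow> h \<le> 1 \<Longrightarrow> (\<And>j. rounding (r j) h) \<Longrightarrow>
     norm ((LINT x|lborel. complex_of_real (g (cw r x)) * f (cw r x)) - (LINT x|lborel. complex_of_real (g x) * f x)) \<le> C * h"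
proof -
  \<comment> \<open>\<open>radial_tail\<close> asks for nonnegativity at every argument, 0 and
    negative ones included. The positive part is still nonincreasing on positive arguments,
    integrable and a majorant.\<close>
  define G' where "G' r = max 0 (G r)" for r
  have G': "\<And>r s. 0 < r \<Longrightarrow> r \<le> s \<Longrightarrow> G' s \<le> G' r" "\<And>r. 0 \<le> G' r" "integrable lborel (\<lambda>t::real^'m. G' (norm t))"
      "AE t in lborel. norm (F t) \<le> G' (norm t)"
  proof -
    show "G' s \<le> G' r" if "0 < r" "r \<le> s" for r s using G(1)[OF that] by (auto simp: G'_def)
  qed (use G in \<open>auto simp: G'_def elim!: eventually_mono\<close>)
  have K0: "0 \<le> K" using smooth_bump.K_nonneg[OF bump] .
  define g0 where "g0 = (LINT v|lborel. g2 v)"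
  have g0: "0 \<le> g0" unfolding g0_def using g2 by simp
  define c1 where "c1 = g0 * (CARD('m) * A ^ CARD('m) * (4 * K * pi))"
  define c2 where "c2 = g0 * (A ^ CARD('m) * (K * pi))"
  define c3 where "c3 = g0 * A ^ CARD('m)"
  have c: "0 \<le> c1" "0 \<le> c2" "0 \<le> c3" using g0 A K0 by (auto simp: c1_def c2_def c3_def)
  define I where "I = (LINT t|lborel. G' (norm (t::real^'m))) * (12 * CARD('m)) ^ CARD('m)"
  define N where "N = (LINT t|lborel. norm (F t))"
  have IN: "0 \<le> I" "0 \<le> N" using G' by (auto simp: I_def N_def)
  show thesis
  proof (rule that[of "N * (c1 + c2) + c3 * I"])
    fix h :: real and r :: "'m \<Rightarrow> real \<Rightarrow> real" assume h: "0 < h" "h \<le> 1" and r: "\<And>j. rounding (r j) h"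
    interpret R: gauss_mix_rounding l K g2 g h r by unfold_locales (use r in \<open>auto simp: rounding_def\<close>)
    interpret I: gauss_mix_rounding l K g2 g h "\<lambda>_ x. x" by (rule R.id)
    have [measurable]: "F \<in> borel_measurable borel" using F by simp
    have [measurable]: "(\<lambda>t::real^'m. G' (norm t)) \<in> borel_measurable borel" using G'(3) by simp
    let ?D = "\<lambda>t. F t * (\<Theta> r t - \<Theta> (\<lambda>_ x. x) t)"
    let ?out = "\<lambda>t. (if \<exists>j. pi < \<bar>t $ j\<bar> * h then G' (norm t) * (\<Prod>j\<in>UNIV. per_weight h (t $ j)) else 0)"
    define U where "U t = ?out t" for t :: "real^'m"
    have cwid: "cw (\<lambda>_ x. x) x = x" for x :: "real^'m" by (simp add: cw_def)
    have intD: "integrable lborel ?D"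
      unfolding right_diff_distrib
      by (intro Bochner_Integration.integrable_diff R.fourier_swap(2)[OF F f] I.fourier_swap(2)[OF F f])
    have "(LINT x|lborel. complex_of_real (g (cw r x)) * f (cw r x)) - (LINT x|lborel. complex_of_real (g x) * f x)
       = (LINT t|lborel. ?D t)"
      using R.fourier_swap(1,2)[OF F f] I.fourier_swap(1,2)[OF F f] by (simp add: cwid right_diff_distrib)
    then have s1: "ennreal (norm ((LINT x|lborel. complex_of_real (g (cw r x)) * f (cw r x)) - (LINT x|lborel. complex_of_real (g x) * f x)))
      \<le> (\<integral>\<^sup>+t. ennreal (norm (?D t)) \<partial>lborel)"
      using integral_norm_bound_ennreal[OF intD] by simp
    have s2: "(\<integral>\<^sup>+t. ennreal (norm (?D t)) \<partial>lborel) \<le> (\<integral>\<^sup>+t. ennreal (norm (F t)) * ennreal ((c1 + c2) * h) + ennreal c3 * ennreal (U t) \<partial>lborel)"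
    proof (rule nn_integral_mono_AE, rule eventually_mono[OF G'(4)])
      fix t :: "real^'m" assume Ft: "norm (F t) \<le> G' (norm t)"
      have W0: "0 \<le> (\<Prod>j\<in>UNIV. per_weight h (t $ j))" by (intro prod_nonneg) (auto simp: per_weight_bounds)
      have "norm (?D t) \<le> norm (F t) * ((c1 + c2) * h) + c3 * U t"
      proof (cases "\<exists>j. pi < \<bar>t $ j\<bar> * h")
        case False
        then have "norm (\<Theta> r t - \<Theta> (\<lambda>_ x. x) t) \<le> c1 * h"
          unfolding c1_def g0_def by (intro R.Theta_approx) (auto simp: not_less)
        also have "\<dots> \<le> (c1 + c2) * h" using c h by (intro mult_right_mono) auto
        finally have "norm (F t) * norm (\<Theta> r t - \<Theta> (\<lambda>_ x. x) t) \<le> norm (F t) * ((c1 + c2) * h)" by (rule mult_left_mono) simp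
        then show ?thesis using False by (simp add: norm_mult U_def)
      next
        case True
        then obtain i where i: "pi < \<bar>t $ i\<bar> * h" by blast
        have "norm (\<Theta> r t - \<Theta> (\<lambda>_ x. x) t) \<le> norm (\<Theta> r t) + norm (\<Theta> (\<lambda>_ x. x) t)" by (rule norm_triangle_ineq4)
        also have "\<dots> \<le> c3 * (\<Prod>j\<in>UNIV. per_weight h (t $ j)) + c2 * h"
          unfolding c3_def c2_def g0_def by (intro add_mono R.Theta_bound R.Theta_id_decay[OF i])
        finally have "norm (F t) * norm (\<Theta> r t - \<Theta> (\<lambda>_ x. x) t) \<le> norm (F t) * (c3 * (\<Prod>j\<in>UNIV. per_weight h (t $ j)) + c2 * h)"
          by (rule mult_left_mono) simp
        also have "\<dots> = norm (F t) * (c2 * h) + c3 * (norm (F t) * (\<Prod>j\<in>UNIV. per_weight h (t $ j)))"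
          by (simp add: algebra_simps)
        also have "\<dots> \<le> norm (F t) * ((c1 + c2) * h) + c3 * (G' (norm t) * (\<Prod>j\<in>UNIV. per_weight h (t $ j)))"
          using c h W0 by (intro add_mono mult_left_mono mult_right_mono Ft) auto
        finally show ?thesis using True by (simp add: norm_mult U_def)
      qed
      then have "ennreal (norm (?D t)) \<le> ennreal (norm (F t) * ((c1 + c2) * h) + c3 * U t)" by (rule ennreal_leI)
      also have "\<dots> = ennreal (norm (F t)) * ennreal ((c1 + c2) * h) + ennreal c3 * ennreal (U t)"
        using c h W0 G'(2) by (auto simp: U_def ennreal_plus ennreal_mult)
      finally show "ennreal (norm (?D t)) \<le> ennreal (norm (F t)) * ennreal ((c1 + c2) * h) + ennreal c3 * ennreal (U t)" .
    qed
    have s3: "(\<integral>\<^sup>+t. ennreal (norm (F t)) * ennreal ((c1 + c2) * h) + ennreal c3 * ennreal (U t) \<partial>lborel) = (\<integral>\<^sup>+t. ennreal (norm (F t)) \<partial>lborel) * ennreal ((c1 + c2) * h) + ennreal c3 * (\<integral>\<^sup>+t. ennreal (U t) \<partial>lborel)"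
    proof (rule nn_integral_lincomb)
      show "(\<lambda>t. ennreal (norm (F t))) \<in> borel_measurable lborel"
        using borel_measurable_integrable[OF F] by simp
      show "(\<lambda>t. ennreal (U t)) \<in> borel_measurable lborel"
        unfolding U_def by (rule outer_weight_measurable'[OF G'(3)])
    qed
    have s4: "(\<integral>\<^sup>+t. ennreal (norm (F t)) \<partial>lborel) * ennreal ((c1 + c2) * h) + ennreal c3 * (\<integral>\<^sup>+t. ennreal (U t) \<partial>lborel) \<le> ennreal N * ennreal ((c1 + c2) * h) + ennreal c3 * ennreal (I * h)"
    proof (intro add_mono mult_left_mono mult_right_mono)
      show "(\<integral>\<^sup>+t. ennreal (U t) \<partial>lborel) \<le> ennreal (I * h)"
        unfolding I_def U_def using radial_tail[OF G'(1-3) h] by simp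
      show "(\<integral>\<^sup>+t. ennreal (norm (F t)) \<partial>lborel) \<le> ennreal N"
        unfolding N_def by (subst nn_integral_eq_integral[OF integrable_norm[OF F]]) simp_all
    qed auto
    have s5: "ennreal N * ennreal ((c1 + c2) * h) + ennreal c3 * ennreal (I * h) = ennreal ((N * (c1 + c2) + c3 * I) * h)"
    proof -
      have "ennreal N * ennreal ((c1 + c2) * h) = ennreal (N * ((c1 + c2) * h))" "ennreal c3 * ennreal (I * h) = ennreal (c3 * (I * h))"
        using c h IN by (auto intro!: ennreal_mult[symmetric])
      moreover have "ennreal (N * ((c1 + c2) * h)) + ennreal (c3 * (I * h)) = ennreal (N * ((c1 + c2) * h) + c3 * (I * h))"
        using c h IN by (intro ennreal_plus[symmetric]) auto
      ultimately show ?thesis by (simp only: distrib_right mult.assoc)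
    qed
    have "ennreal (norm ((LINT x|lborel. complex_of_real (g (cw r x)) * f (cw r x)) - (LINT x|lborel. complex_of_real (g x) * f x)))
       \<le> ennreal ((N * (c1 + c2) + c3 * I) * h)"
      using order_trans[OF s1 s2] s4 unfolding s3 s5 by (rule order_trans)
    then show "norm ((LINT x|lborel. complex_of_real (g (cw r x)) * f (cw r x)) - (LINT x|lborel. complex_of_real (g x) * f x)) \<le> (N * (c1 + c2) + c3 * I) * h"
      using c h IN by (subst (asm) ennreal_le_iff) auto
  qed
qed

text \<open>The function 1 is not the transform of an integrable function, so
  \<open>riemann_sum\<close> does not cover it. It is the single frequency t = 0, which lies in the
  central cell.\<close>

lemma riemann_sum_1:
  obtains C where "\<And>h r. 0 < h \<Longrightarrow> h \<le> 1 \<Longrightarrow> (\<And>j. rounding (r j) h) \<Longrightarrow>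
     \<bar>(LINT x|lborel. g (cw r x)) - (LINT x|lborel. g x)\<bar> \<le> C * h"
proof (rule that)
  fix h :: real and r :: "'m \<Rightarrow> real \<Rightarrow> real" assume h: "0 < h" "h \<le> 1" and r: "\<And>j. rounding (r j) h"
  interpret R: gauss_mix_rounding l K g2 g h r by unfold_locales (use r in \<open>auto simp: rounding_def\<close>)
  interpret I: gauss_mix_rounding l K g2 g h "\<lambda>_ x. x" by (rule R.id)
  have "\<Theta> r 0 = complex_of_real (LINT x|lborel. g (cw r x))" "\<Theta> (\<lambda>_ x. x) 0 = complex_of_real (LINT x|lborel. g x)"
    by (simp_all add: \<Theta>_def cw_def integral_complex_of_real)
  then have "\<Theta> r 0 - \<Theta> (\<lambda>_ x. x) 0 = complex_of_real ((LINT x|lborel. g (cw r x)) - (LINT x|lborel. g x))" by simp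
  moreover have "norm (\<Theta> r 0 - \<Theta> (\<lambda>_ x. x) 0) \<le> (LINT v|lborel. g2 v) * (CARD('m) * A ^ CARD('m) * (4 * K * pi)) * h"
    by (rule R.Theta_approx) simp
  ultimately show "\<bar>(LINT x|lborel. g (cw r x)) - (LINT x|lborel. g x)\<bar> \<le> (LINT v|lborel. g2 v) * (CARD('m) * A ^ CARD('m) * (4 * K * pi)) * h"
    by (simp only: norm_of_real)
qed

end

section \<open>Lebesgue measure under linear maps\<close>

text \<open>A well-ordered copy of the index type: the measure of linear images is computed over
  well-ordered indices and then carried back by a bijection.\<close>

typedef ('m::finite) fin = "{..<CARD('m)}"
  by (rule exI[of _ 0]) simp


instance fin :: (finite) finite
proof
  show "finite (UNIV :: 'a fin set)"
    unfolding type_definition.univ[OF type_definition_fin] by simp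
qed

instantiation fin :: (finite) linorder
begin
definition "a \<le> b \<longleftrightarrow> Rep_fin a \<le> Rep_fin b"
definition "a < b \<longleftrightarrow> Rep_fin a < Rep_fin b"
instance
  by standard (auto simp: less_eq_fin_def less_fin_def Rep_fin_inject)
end

instance fin :: (finite) wellorder
proof
  fix P :: "'a fin \<Rightarrow> bool" and a
  assume *: "\<And>x. (\<And>y. y < x \<Longrightarrow> P y) \<Longrightarrow> P x"
  show "P a"
    by (induction a rule: measure_induct_rule[of Rep_fin]) (auto intro: * simp: less_fin_def)
qed

lemma card_fin: "CARD('m::finite fin) = CARD('m)"
  unfolding type_definition.card[OF type_definition_fin] by simp

lemma det_reindex:
  fixes A :: "'a::comm_ring_1^'m::finite^'m" and \<pi> :: "'n::finite \<Rightarrow> 'm"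
  assumes \<pi>: "bij \<pi>"
  shows "det (\<chi> i j. A $ \<pi> i $ \<pi> j) = det A"
proof -
  let ?\<sigma> = "inv \<pi>"
  have \<sigma>: "bij_betw ?\<sigma> UNIV UNIV" "bij_betw \<pi> UNIV UNIV" "inj \<pi>" "inj ?\<sigma>"
    using \<pi> by (auto simp: bij_imp_bij_inv bij_is_inj)
  have [simp]: "?\<sigma> (\<pi> x) = x" "\<pi> (?\<sigma> y) = y" for x y
    using \<pi> by (auto simp: bij_is_inj surj_f_inv_f[OF bij_is_surj])
  show ?thesis
    unfolding det_def
  proof (rule sum.reindex_bij_witness[where i="map_permutation UNIV ?\<sigma>" and j="map_permutation UNIV \<pi>"], goal_cases)
    case (1 p) then show ?case by (intro map_permutation_compose_inv[where B=UNIV]) (use \<sigma> in auto)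
  next
    case (2 p) then show ?case using map_permutation_permutes[OF \<sigma>(2)] by simp
  next
    case (3 p) then show ?case by (intro map_permutation_compose_inv[where B=UNIV]) (use \<sigma> in auto)
  next
    case (4 p) then show ?case using map_permutation_permutes[OF \<sigma>(1)] by simp
  next
    case (5 p)
    have "(\<Prod>i\<in>UNIV. A $ i $ map_permutation UNIV \<pi> p i) = (\<Prod>i\<in>UNIV. A $ \<pi> i $ map_permutation UNIV \<pi> p (\<pi> i))"
      by (rule prod.reindex_bij_betw[OF \<sigma>(2), symmetric])
    then show ?case
      using 5 sign_map_permutation[OF \<sigma>(3), of p] by (simp add: map_permutation_apply[OF \<sigma>(3)])
  qed
qed

text \<open>A linear bijection between the standard bases pulls boxes back to boxes with the same
  sides. It serves to change index types and to pass between \<open>complex^'m\<close> and its real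
  models.\<close>

lemma lborel_distr_basis_iso:
  fixes \<iota> :: "'a::euclidean_space \<Rightarrow> 'b::euclidean_space"
  assumes lin: "linear \<iota>" and bij: "bij_betw \<iota> Basis Basis"
  shows "distr lborel borel \<iota> = lborel"
proof (rule sym, rule lborel_eqI)
  have inner: "\<iota> x \<bullet> \<iota> b = x \<bullet> b" if b: "b \<in> Basis" for x b
  proof -
    have "\<iota> x = (\<Sum>c\<in>Basis. (x \<bullet> c) *\<^sub>R \<iota> c)"
      by (subst euclidean_representation[of x, symmetric]) (simp add: linear_sum[OF lin] linear_scale[OF lin] del: euclidean_representation)
    also have "\<dots> \<bullet> \<iota> b = (\<Sum>c\<in>Basis. (x \<bullet> c) * (\<iota> c \<bullet> \<iota> b))" by (simp add: inner_sum_left)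
    also have "\<dots> = (\<Sum>c\<in>Basis. if c = b then x \<bullet> c else 0)"
    proof (rule sum.cong)
      fix c assume c: "c \<in> (Basis::'a set)"
      have "\<iota> c \<in> Basis" "\<iota> b \<in> Basis" "\<iota> c = \<iota> b \<longleftrightarrow> c = b"
        using bij b c by (auto simp: bij_betw_def inj_on_def)
      then show "(x \<bullet> c) * (\<iota> c \<bullet> \<iota> b) = (if c = b then x \<bullet> c else 0)" by (simp add: inner_Basis)
    qed simp
    also have "\<dots> = x \<bullet> b" using b by simp
    finally show ?thesis .
  qed
  have [measurable]: "\<iota> \<in> borel_measurable borel"
    using lin by (intro borel_measurable_continuous_onI linear_continuous_on linear_conv_bounded_linear[THEN iffD1])
  fix l u :: 'b assume lu: "\<And>b. b \<in> Basis \<Longrightarrow> l \<bullet> b \<le> u \<bullet> b"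
  define p where "p w = (\<Sum>b\<in>Basis. (w \<bullet> \<iota> b) *\<^sub>R b)" for w
  have p: "p w \<bullet> b = w \<bullet> \<iota> b" if "b \<in> Basis" for w b
    using that by (simp add: p_def inner_sum_left inner_Basis if_distrib cong: if_cong)
  have "\<iota> -` box l u = box (p l) (p u)"
  proof (rule set_eqI)
    fix x
    have "x \<in> \<iota> -` box l u \<longleftrightarrow> (\<forall>b\<in>\<iota> ` Basis. l \<bullet> b < \<iota> x \<bullet> b \<and> \<iota> x \<bullet> b < u \<bullet> b)"
      using bij by (simp add: mem_box bij_betw_def)
    also have "\<dots> \<longleftrightarrow> x \<in> box (p l) (p u)" by (simp add: mem_box inner p)
    finally show "x \<in> \<iota> -` box l u \<longleftrightarrow> x \<in> box (p l) (p u)" .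
  qed
  then have "emeasure (distr lborel borel \<iota>) (box l u) = emeasure lborel (box (p l) (p u))"
    by (subst emeasure_distr) auto
  also have "\<dots> = ennreal (\<Prod>b\<in>Basis. (u - l) \<bullet> \<iota> b)"
    using lu bij by (subst emeasure_lborel_box) (auto simp: p inner_diff_left bij_betw_def)
  also have "(\<Prod>b\<in>Basis. (u - l) \<bullet> \<iota> b) = (\<Prod>b\<in>Basis. (u - l) \<bullet> b)"
    by (rule prod.reindex_bij_betw[OF bij])
  finally show "emeasure (distr lborel borel \<iota>) (box l u) = (\<Prod>b\<in>Basis. (u - l) \<bullet> b)" .
qed simp

lemma matrix_mult_measurable [measurable]: "(*v) (A :: real^'m::finite^'n::finite) \<in> borel_measurable borel"
  by (intro borel_measurable_continuous_onI linear_continuous_on) (simp add: matrix_vector_mul_bounded_linear)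

lemma lborel_matrix_wellorder:
  fixes S :: "real^'w::{finite,wellorder}^'w::{finite,wellorder}"
  assumes "det S \<noteq> 0"
  shows "lborel = density (distr lborel borel ((*v) S)) (\<lambda>_. ennreal \<bar>det S\<bar>)"
proof (rule lborel_eqI)
  have inv: "invertible S" using assms by (simp add: invertible_det_nz)
  then obtain T where T: "S ** T = mat 1" "T ** S = mat 1" by (auto simp: invertible_def)
  have dST: "det S * det T = 1" by (metis T(1) det_I det_mul)
  fix l u :: "real^'w::{finite,wellorder}" assume lu: "\<And>b. b \<in> Basis \<Longrightarrow> l \<bullet> b \<le> u \<bullet> b"
  have pre: "(*v) S -` box l u = (*v) T ` box l u"
  proof (auto simp: image_iff)
    fix x assume "S *v x \<in> box l u"
    then show "\<exists>y\<in>box l u. x = T *v y" by (intro bexI[of _ "S *v x"]) (simp_all add: matrix_vector_mul_assoc T)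
  qed (simp add: matrix_vector_mul_assoc T)
  have "measure lebesgue ((*v) T ` box l u) = \<bar>det T\<bar> * measure lebesgue (box l u)"
    using measure_linear_image[of "(*v) T" "box l u"] by simp
  moreover have "(*v) T ` box l u \<in> lmeasurable"
    by (rule measurable_linear_image) auto
  ultimately have "emeasure lebesgue ((*v) T ` box l u) = ennreal (\<bar>det T\<bar> * measure lebesgue (box l u))"
    by (metis emeasure_eq_ennreal_measure fmeasurableD2)
  moreover have "(*v) S -` box l u \<in> sets borel"
    using measurable_sets[OF matrix_mult_measurable[of S], of "box l u"] by simp
  ultimately have "emeasure lborel ((*v) S -` box l u) = ennreal (\<bar>det T\<bar> * measure lebesgue (box l u))"
    unfolding pre by simp
  then have "emeasure (density (distr lborel borel ((*v) S)) (\<lambda>_. ennreal \<bar>det S\<bar>)) (box l u)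
     = ennreal \<bar>det S\<bar> * ennreal (\<bar>det T\<bar> * measure lebesgue (box l u))"
    by (simp add: emeasure_density nn_integral_cmult emeasure_distr)
  also have "\<dots> = ennreal (\<bar>det S * det T\<bar> * measure lebesgue (box l u))"
    by (simp add: ennreal_mult[symmetric] abs_mult mult.assoc)
  also have "\<dots> = ennreal (\<Prod>b\<in>Basis. (u - l) \<bullet> b)"
    using lu by (simp add: dST measure_lborel_box_eq inner_diff_left)
  finally show "emeasure (density (distr lborel borel ((*v) S)) (\<lambda>_. ennreal \<bar>det S\<bar>)) (box l u) = (\<Prod>b\<in>Basis. (u - l) \<bullet> b)" .
qed simp

text \<open>Relabel the coordinates by a bijection with the well-ordered index type. The relabelled
  matrix has the same determinant, and relabelling preserves Lebesgue measure.\<close>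

lemma lborel_matrix:
  fixes S :: "real^'m::finite^'m"
  assumes "det S \<noteq> 0"
  shows "lborel = density (distr lborel borel ((*v) S)) (\<lambda>_. ennreal \<bar>det S\<bar>)"
proof -
  obtain \<pi> :: "'m fin \<Rightarrow> 'm" where \<pi>: "bij \<pi>"
    using finite_same_card_bij[of "UNIV :: 'm fin set" "UNIV :: 'm set"] by (auto simp: card_fin)
  have [simp]: "inv \<pi> (\<pi> x) = x" "\<pi> (inv \<pi> y) = y" for x y
    using \<pi> by (auto simp: bij_is_inj surj_f_inv_f[OF bij_is_surj])
  define \<iota> :: "real^'m fin \<Rightarrow> real^'m" where "\<iota> x = (\<chi> i. x $ inv \<pi> i)" for x
  have lin: "linear \<iota>" by (auto simp: linear_iff \<iota>_def vec_eq_iff)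
  have ax: "\<iota> (axis i 1) = axis (\<pi> i) 1" for i
    by (auto simp: \<iota>_def vec_eq_iff axis_def)
  have rng: "Basis = range (\<lambda>j::'n::finite. axis j (1::real))" by (auto simp: Basis_vec_def)
  have "bij_betw \<iota> Basis Basis"
    unfolding bij_betw_def
  proof
    show "inj_on \<iota> Basis"
    proof (rule inj_onI)
      fix a b assume "a \<in> (Basis::(real^'m fin) set)" "b \<in> (Basis::(real^'m fin) set)" "\<iota> a = \<iota> b"
      moreover from this obtain i j where "a = axis i 1" "b = axis j 1" unfolding rng by blast
      ultimately show "a = b" by (metis ax axis_eq_axis zero_neq_one \<open>\<And>x. inv \<pi> (\<pi> x) = x\<close>)
    qed
    have "range (\<lambda>j. axis (\<pi> j) (1::real)) = (\<lambda>i. axis i 1) ` range \<pi>" by (rule image_image[symmetric])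
    then show "\<iota> ` Basis = Basis" unfolding rng image_image ax bij_is_surj[OF \<pi>] .
  qed
  note iso = lborel_distr_basis_iso[OF lin this]
  have [measurable]: "\<iota> \<in> borel_measurable borel"
    using lin by (intro borel_measurable_continuous_onI linear_continuous_on linear_conv_bounded_linear[THEN iffD1])
  define S' where "S' = (\<chi> i j. S $ \<pi> i $ \<pi> j)"
  have det: "det S' = det S" unfolding S'_def by (rule det_reindex[OF \<pi>])
  have comm: "\<iota> (S' *v x) = S *v \<iota> x" for x
  proof -
    have "(\<Sum>j\<in>UNIV. S $ i $ \<pi> j * x $ j) = (\<Sum>j\<in>UNIV. S $ i $ j * x $ inv \<pi> j)" for i
      using sum.reindex_bij_betw[OF \<pi>, of "\<lambda>j. S $ i $ j * x $ inv \<pi> j"] by simp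
    then show ?thesis by (simp add: vec_eq_iff \<iota>_def S'_def matrix_vector_mult_def)
  qed
  have "lborel = distr lborel borel \<iota>" using iso by simp
  also have "(lborel :: (real^'m fin) measure) = density (distr lborel borel ((*v) S')) (\<lambda>_. ennreal \<bar>det S\<bar>)"
    using lborel_matrix_wellorder[of S'] assms by (simp add: det)
  also have "distr \<dots> borel \<iota> = density (distr (distr lborel borel ((*v) S')) borel \<iota>) (\<lambda>_. ennreal \<bar>det S\<bar>)"
    by (subst density_distr) auto
  also have "distr (distr lborel borel ((*v) S')) borel \<iota> = distr (distr lborel borel \<iota>) borel ((*v) S)"
    by (subst (1 2) distr_distr) (auto simp: o_def comm)
  finally show ?thesis unfolding iso .
qed

section \<open>Positive definite matrices and Gaussian integrals\<close>

definition spd :: "real^'m::finite^'m \<Rightarrow> bool" where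
  "spd H \<longleftrightarrow> transpose H = H \<and> (\<forall>u. u \<noteq> 0 \<longrightarrow> 0 < (H *v u) \<bullet> u)"

lemma inner_matrix_transpose: "(A *v x) \<bullet> y = x \<bullet> (transpose A *v y)"
  for A :: "real^'m::finite^'n::finite"
  by (metis dot_lmul_matrix transpose_matrix_vector inner_commute)

lemma spd_sym: "spd H \<Longrightarrow> (H *v x) \<bullet> y = x \<bullet> (H *v y)"
  by (simp add: spd_def inner_matrix_transpose)

lemma spd_pos: "spd H \<Longrightarrow> u \<noteq> 0 \<Longrightarrow> 0 < (H *v u) \<bullet> u"
  by (simp add: spd_def)

lemma spd_nonneg: "spd H \<Longrightarrow> 0 \<le> (H *v u) \<bullet> u"
  by (cases "u = 0") (auto dest: spd_pos[of H u])

text \<open>Gram-Schmidt for the inner product given by \<open>H\<close>: a vector that is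
  Euclidean-orthogonal to all H b_i is H-orthogonal to all b_i, and a nonzero one exists by
  dimension while n < m.\<close>

lemma spd_orthonormal:
  fixes H :: "real^'m::finite^'m"
  assumes H: "spd H"
  shows "n \<le> CARD('m) \<Longrightarrow> \<exists>b::nat \<Rightarrow> real^'m. \<forall>i<n. \<forall>j<n. (H *v b i) \<bullet> b j = (if i = j then 1 else 0)"
proof (induction n)
  case (Suc n)
  then obtain b :: "nat \<Rightarrow> real^'m" where b: "\<And>i j. i < n \<Longrightarrow> j < n \<Longrightarrow> (H *v b i) \<bullet> b j = (if i = j then 1 else 0)"
    by auto
  have "dim ((\<lambda>i. H *v b i) ` {..<n}) \<le> card ((\<lambda>i. H *v b i) ` {..<n})"
    by (rule dim_le_card) (auto intro: span_base)
  also have "\<dots> \<le> n" using card_image_le[of "{..<n}" "\<lambda>i. H *v b i"] by simp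
  also have "\<dots> < DIM(real^'m)" using Suc.prems by simp
  finally obtain x where x: "x \<noteq> 0" "\<And>y. y \<in> span ((\<lambda>i. H *v b i) ` {..<n}) \<Longrightarrow> orthogonal x y"
    using orthogonal_to_subspace_exists by blast
  define q where "q = sqrt ((H *v x) \<bullet> x)"
  have q: "0 < q" "q * q = (H *v x) \<bullet> x" using spd_pos[OF H x(1)] by (auto simp: q_def)
  define b' where "b' = b(n := (1 / q) *\<^sub>R x)"
  have o: "(H *v b i) \<bullet> x = 0" if "i < n" for i
    using x(2)[of "H *v b i"] that by (auto simp: orthogonal_def inner_commute intro: span_base)
  have "(H *v b' i) \<bullet> b' j = (if i = j then 1 else 0)" if "i < Suc n" "j < Suc n" for i j
  proof -
    have "i < n \<or> i = n" "j < n \<or> j = n" using that by auto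
    then consider "i < n" "j < n" | "i = n" "j < n" | "i < n" "j = n" | "i = n" "j = n" by blast
    then show ?thesis
    proof cases
      case 1 then show ?thesis using b[of i j] by (simp add: b'_def)
    next
      case 2 then show ?thesis using o[of j] spd_sym[OF H, of x "b j"]
        by (simp add: b'_def matrix_vector_mult_scaleR inner_commute)
    next
      case 3 then show ?thesis using o[of i] by (simp add: b'_def)
    next
      case 4 then show ?thesis using q spd_pos[OF H x(1)] by (simp add: b'_def matrix_vector_mult_scaleR field_simps)
    qed
  qed
  then show ?case by blast
qed auto

text \<open>The columns of \<open>S\<close> are an H-orthonormal basis, so the substitution u = S w
  turns the quadratic form of \<open>H\<close> into the standard one.\<close>

lemma spd_basis:
  fixes H :: "real^'m::finite^'m"
  assumes H: "spd H"
  obtains S where "det S \<noteq> 0" "transpose S ** H ** S = mat 1" "(det S)\<^sup>2 * det H = 1"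
proof -
  obtain b :: "nat \<Rightarrow> real^'m" where b: "\<And>i j. i < CARD('m) \<Longrightarrow> j < CARD('m) \<Longrightarrow> (H *v b i) \<bullet> b j = (if i = j then 1 else 0)"
    using spd_orthonormal[OF H, of "CARD('m)"] by auto
  obtain e :: "'m \<Rightarrow> nat" where e: "bij_betw e UNIV {..<CARD('m)}"
    using finite_same_card_bij[of "UNIV :: 'm set" "{..<CARD('m)}"] by auto
  have e1: "e i < CARD('m)" "e i = e j \<longleftrightarrow> i = j" for i j
    using e by (auto simp: bij_betw_def inj_on_def)
  define S :: "real^'m^'m" where "S = (\<chi> i j. b (e j) $ i)"
  have ax: "S *v axis j 1 = b (e j)" for j
    by (simp add: S_def matrix_vector_mult_def vec_eq_iff axis_def if_distrib cong: if_cong)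
  have "(transpose S ** H ** S) $ i $ j = (if i = j then 1 else 0)" for i j
  proof -
    have "(transpose S ** H ** S) $ i $ j = ((transpose S ** H ** S) *v axis j 1) \<bullet> axis i 1"
      by (simp add: inner_axis matrix_vector_mult_basis column_def)
    also have "\<dots> = (H *v (S *v axis j 1)) \<bullet> (S *v axis i 1)"
      by (simp add: matrix_vector_mul_assoc[symmetric] dot_lmul_matrix)
    also have "\<dots> = (if i = j then 1 else 0)" using b[of "e j" "e i"] e1 by (auto simp: ax)
    finally show ?thesis .
  qed
  then have 1: "transpose S ** H ** S = mat 1" by (simp add: vec_eq_iff mat_def)
  from arg_cong[OF this, of det] have "(det S)\<^sup>2 * det H = 1"
    by (simp add: det_mul det_transpose power2_eq_square mult_ac)
  moreover from this have "det S \<noteq> 0" by auto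
  ultimately show thesis using 1 that by blast
qed

lemma spd_det_pos: assumes "spd H" shows "0 < det H"
proof -
  obtain S where "det S \<noteq> 0" "transpose S ** H ** S = mat 1" "(det S)\<^sup>2 * det H = 1" by (rule spd_basis[OF assms])
  then show ?thesis by (metis zero_less_mult_pos zero_less_one zero_less_power2)
qed

lemma spd_invertible: "spd H \<Longrightarrow> invertible H"
  using spd_det_pos[of H] by (simp add: invertible_det_nz)

lemma matrix_inv:
  assumes "invertible A"
  shows "A ** matrix_inv A = mat 1" "matrix_inv A ** A = mat 1"
  using someI_ex[OF assms[unfolded invertible_def]] by (simp_all add: matrix_inv_def)

lemma spd_inv_mult:
  assumes "spd H" shows "H *v (matrix_inv H *v x) = x" "matrix_inv H *v (H *v x) = x"
  using matrix_inv[OF spd_invertible[OF assms]] by (simp_all add: matrix_vector_mul_assoc)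

lemma spd_inv: assumes "spd H" shows "spd (matrix_inv H)"
  unfolding spd_def
proof (intro conjI allI impI)
  have "transpose (matrix_inv H) = matrix_inv H ** (H ** transpose (matrix_inv H))"
    using matrix_inv[OF spd_invertible[OF assms]] by (simp add: matrix_mul_assoc)
  also have "H ** transpose (matrix_inv H) = transpose (matrix_inv H ** H)"
    using assms by (simp add: matrix_transpose_mul spd_def)
  also have "\<dots> = mat 1" using matrix_inv[OF spd_invertible[OF assms]] by (simp add: transpose_mat)
  finally show "transpose (matrix_inv H) = matrix_inv H" by simp
  fix u :: "real^'a" assume "u \<noteq> 0"
  then have "matrix_inv H *v u \<noteq> 0" using spd_inv_mult(1)[OF assms, of u] by auto
  from spd_pos[OF assms this] show "0 < (matrix_inv H *v u) \<bullet> u"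
    by (simp add: spd_inv_mult[OF assms] inner_commute)
qed

lemma spd_inv_inv: assumes "spd H" shows "matrix_inv (matrix_inv H) = H"
proof -
  have "matrix_inv (matrix_inv H) *v x = H *v x" for x
    using spd_inv_mult(2)[OF spd_inv[OF assms], of "H *v x"] by (simp add: spd_inv_mult[OF assms])
  then show ?thesis by (simp add: matrix_eq)
qed

lemma spd_bounds:
  fixes H :: "real^'m::finite^'m"
  assumes "spd H"
  obtains c C where "0 < c" "0 < C" "\<And>u. c * (norm u)\<^sup>2 \<le> (H *v u) \<bullet> u" "\<And>u. (H *v u) \<bullet> u \<le> C * (norm u)\<^sup>2"
proof -
  have cont: "continuous_on (sphere 0 1) (\<lambda>u. (H *v u) \<bullet> u)"
    by (intro continuous_intros)
  have ne: "sphere (0::real^'m) 1 \<noteq> {}" by simp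
  obtain a where a: "a \<in> sphere 0 1" "\<And>u. u \<in> sphere 0 1 \<Longrightarrow> (H *v a) \<bullet> a \<le> (H *v u) \<bullet> u"
    using continuous_attains_inf[OF _ ne cont] by auto
  obtain b where b: "b \<in> sphere 0 1" "\<And>u. u \<in> sphere 0 1 \<Longrightarrow> (H *v u) \<bullet> u \<le> (H *v b) \<bullet> b"
    using continuous_attains_sup[OF _ ne cont] by auto
  have scale: "(H *v u) \<bullet> u = (norm u)\<^sup>2 * ((H *v (u /\<^sub>R norm u)) \<bullet> (u /\<^sub>R norm u))" if "u \<noteq> 0" for u
    using that by (simp add: matrix_vector_mult_scaleR power2_eq_square field_simps)
  have sph: "u /\<^sub>R norm u \<in> sphere 0 1" if "u \<noteq> 0" for u :: "real^'m" using that by simp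
  show thesis
  proof (rule that[of "(H *v a) \<bullet> a" "(H *v b) \<bullet> b"])
    show "0 < (H *v a) \<bullet> a" "0 < (H *v b) \<bullet> b" using a b by (auto intro!: spd_pos[OF assms])
    show "(H *v a) \<bullet> a * (norm u)\<^sup>2 \<le> (H *v u) \<bullet> u" for u
    proof (cases "u = 0")
      case False
      show ?thesis using mult_left_mono[OF a(2)[OF sph[OF False]], of "(norm u)\<^sup>2"] scale[OF False] by (simp add: mult_ac)
    qed simp
    show "(H *v u) \<bullet> u \<le> (H *v b) \<bullet> b * (norm u)\<^sup>2" for u
    proof (cases "u = 0")
      case False
      show ?thesis using mult_left_mono[OF b(2)[OF sph[OF False]], of "(norm u)\<^sup>2"] scale[OF False] by (simp add: mult_ac)
    qed simp
  qed
qed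

lemma nn_integral_gauss_1d: assumes "0 < b" 
  shows "(\<integral>\<^sup>+x. ennreal (exp (- b * x\<^sup>2 / 2)) \<partial>lborel) = ennreal (sqrt (2 * pi / b))"
proof -
  have eq: "exp (- b * x\<^sup>2 / 2) = sqrt (2 * pi / b) * normal_density 0 (1 / sqrt b) x" for x
    using assms by (simp add: normal_density_def real_sqrt_divide power_divide)
  have "has_bochner_integral lborel (\<lambda>x. sqrt (2 * pi / b) * normal_density 0 (1 / sqrt b) x) (sqrt (2 * pi / b) * 1)"
    using assms by (intro has_bochner_integral_mult_right) (auto simp: has_bochner_integral_iff integrable_normal_density integral_normal_density)
  then show ?thesis
    unfolding eq[symmetric] by (subst nn_integral_eq_integral) (auto simp: has_bochner_integral_iff)
qed

lemma nn_integral_gauss_std: assumes "0 < b"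
  shows "(\<integral>\<^sup>+x. ennreal (exp (- b * ((x::real^'m::finite) \<bullet> x) / 2)) \<partial>lborel) = ennreal (sqrt (2 * pi / b) ^ CARD('m))"
proof -
  have "ennreal (exp (- b * ((x::real^'m) \<bullet> x) / 2)) = (\<Prod>j\<in>UNIV. ennreal (exp (- b * (x $ j)\<^sup>2 / 2)))" for x
    by (simp add: prod_ennreal exp_sum[symmetric] inner_vec_def power2_eq_square sum_distrib_left sum_divide_distrib sum_negf)
  then show ?thesis
    using nn_integral_vec_prod[of "\<lambda>_::'m. \<lambda>x. ennreal (exp (- b * x\<^sup>2 / 2))"] assms
    by (simp add: nn_integral_gauss_1d[OF assms, simplified] ennreal_power)
qed

lemma nn_integral_gauss:
  fixes H :: "real^'m::finite^'m"
  assumes H: "spd H" and b: "0 < b"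
  shows "(\<integral>\<^sup>+u. ennreal (exp (- b * ((H *v u) \<bullet> u) / 2)) \<partial>lborel) = ennreal (sqrt (2 * pi / b) ^ CARD('m) / sqrt (det H))"
proof -
  obtain S where S: "det S \<noteq> 0" "transpose S ** H ** S = mat 1" "(det S)\<^sup>2 * det H = 1"
    by (rule spd_basis[OF H])
  have q: "(H *v (S *v w)) \<bullet> (S *v w) = w \<bullet> w" for w
  proof -
    have "(H *v (S *v w)) \<bullet> (S *v w) = ((transpose S ** H ** S) *v w) \<bullet> w"
      by (simp add: matrix_vector_mul_assoc[symmetric] dot_lmul_matrix)
    then show ?thesis by (simp add: S)
  qed
  have d: "\<bar>det S\<bar> = 1 / sqrt (det H)"
  proof -
    have "sqrt ((det S)\<^sup>2) * sqrt (det H) = 1" using S(3) by (metis real_sqrt_mult real_sqrt_one)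
    then show ?thesis by (simp add: divide_simps) (metis mult_zero_right zero_neq_one real_sqrt_zero)
  qed
  have "(\<integral>\<^sup>+u. ennreal (exp (- b * ((H *v u) \<bullet> u) / 2)) \<partial>lborel)
      = (\<integral>\<^sup>+u. ennreal \<bar>det S\<bar> * ennreal (exp (- b * (u \<bullet> u) / 2)) \<partial>(lborel::(real^'m) measure))"
    by (subst lborel_matrix[OF S(1)]) (simp add: nn_integral_density nn_integral_distr q)
  also have "\<dots> = ennreal \<bar>det S\<bar> * ennreal (sqrt (2 * pi / b) ^ CARD('m))"
    by (simp add: nn_integral_cmult nn_integral_gauss_std[OF b, simplified])
  also have "\<dots> = ennreal (sqrt (2 * pi / b) ^ CARD('m) / sqrt (det H))"
    using b by (simp add: d ennreal_mult[symmetric] spd_det_pos[OF H] less_imp_le)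
  finally show ?thesis .
qed

lemma complete_square:
  fixes H :: "real^'m::finite^'m"
  assumes H: "spd H" and b: "b \<noteq> 0"
  shows "y \<bullet> u - b * ((H *v u) \<bullet> u) / 2
    = ((matrix_inv H *v y) \<bullet> y) / (2 * b) - b * ((H *v (u - (1 / b) *\<^sub>R (matrix_inv H *v y))) \<bullet> (u - (1 / b) *\<^sub>R (matrix_inv H *v y))) / 2"
proof -
  let ?w = "matrix_inv H *v y"
  have 1: "(H *v u) \<bullet> ?w = u \<bullet> y" using spd_sym[OF H, of u ?w] by (simp add: spd_inv_mult[OF H])
  have "(H *v (u - (1 / b) *\<^sub>R ?w)) \<bullet> (u - (1 / b) *\<^sub>R ?w)
      = (H *v u) \<bullet> u - (1/b) * (u \<bullet> y) - (1/b) * (y \<bullet> u) + (1/b)*(1/b) * (y \<bullet> ?w)"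
    by (simp add: matrix_vector_mult_diff_distrib matrix_vector_mult_scaleR spd_inv_mult[OF H] inner_diff_left inner_diff_right 1 algebra_simps)
  then show ?thesis using b by (simp add: field_simps inner_commute)
qed

text \<open>The total mass of exp (- b <H u, u> / 2).\<close>

definition gconst :: "real^'m::finite^'m \<Rightarrow> real \<Rightarrow> real" where
  "gconst H b = sqrt (2 * pi / b) ^ CARD('m) / sqrt (det H)"

lemma gconst_pos: "spd H \<Longrightarrow> 0 < b \<Longrightarrow> 0 < gconst H b"
  by (auto simp: gconst_def intro!: divide_pos_pos zero_less_power spd_det_pos)

lemma nn_integral_shift_vec: assumes [measurable]: "f \<in> borel_measurable borel"
  shows "(\<integral>\<^sup>+u. f (u - a) \<partial>(lborel::'a::euclidean_space measure)) = (\<integral>\<^sup>+u. f u \<partial>lborel)"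
proof -
  have "(\<integral>\<^sup>+u. f u \<partial>lborel) = (\<integral>\<^sup>+u. f u \<partial>(distr lborel borel ((+) (-a))))"
    by (simp add: lborel_distr_plus)
  also have "\<dots> = (\<integral>\<^sup>+u. f (u - a) \<partial>lborel)" by (subst nn_integral_distr) auto
  finally show ?thesis by simp
qed

lemma nn_integral_laplace:
  fixes H :: "real^'m::finite^'m"
  assumes H: "spd H" and b: "0 < b"
  shows "(\<integral>\<^sup>+u. ennreal (exp (y \<bullet> u - b * ((H *v u) \<bullet> u) / 2)) \<partial>lborel)
    = ennreal (exp (((matrix_inv H *v y) \<bullet> y) / (2 * b)) * gconst H b)"
proof -
  let ?e = "exp (((matrix_inv H *v y) \<bullet> y) / (2 * b))"
  have "(\<integral>\<^sup>+u. ennreal (exp (y \<bullet> u - b * ((H *v u) \<bullet> u) / 2)) \<partial>lborel)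
     = (\<integral>\<^sup>+u. ennreal ?e * ennreal (exp (- b * ((H *v (u - (1 / b) *\<^sub>R (matrix_inv H *v y))) \<bullet> (u - (1 / b) *\<^sub>R (matrix_inv H *v y))) / 2)) \<partial>lborel)"
    using b by (subst complete_square[OF H, of b]) (auto simp: ennreal_mult[symmetric] exp_add[symmetric] intro!: nn_integral_cong)
  also have "\<dots> = ennreal ?e * ennreal (gconst H b)"
    unfolding gconst_def nn_integral_gauss[OF H b, symmetric]
    by (subst nn_integral_cmult, measurable) (subst nn_integral_shift_vec[of "\<lambda>u. ennreal (exp (- b * ((H *v u) \<bullet> u) / 2))"], simp_all)
  also have "\<dots> = ennreal (?e * gconst H b)"
    using gconst_pos[OF H b] by (simp add: ennreal_mult[symmetric] less_imp_le)
  finally show ?thesis .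
qed

lemma laplace_integral:
  fixes H :: "real^'m::finite^'m"
  assumes H: "spd H" and b: "0 < b"
  shows "has_bochner_integral lborel (\<lambda>u. exp (y \<bullet> u - b * ((H *v u) \<bullet> u) / 2)) (exp (((matrix_inv H *v y) \<bullet> y) / (2 * b)) * gconst H b)"
  using nn_integral_laplace[OF H b, of y] gconst_pos[OF H b]
  by (intro has_bochner_integral_nn_integral) auto

section \<open>Laplace integrals with a nondegenerate minimum\<close>

text \<open>Use 1 + t \<le> exp t, and 2 t \<le> 2/c + c t^2/2, which is (c t - 2)^2 \<ge> 0.
  Factors 1 + t and exp t lost in later estimates thus cost half of the Gaussian decay.\<close>

lemma absorb:
  fixes c t :: real
  assumes "0 < c" "0 \<le> t"
  shows "(1 + t) * exp (t - c * t\<^sup>2) \<le> exp (2 / c) * exp (- (c / 2) * t\<^sup>2)"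
proof -
  have "2 * t \<le> 2 / c + (c / 2) * t\<^sup>2"
  proof -
    have "(2 / c + (c / 2) * t\<^sup>2) * c = 2 + (c * t)\<^sup>2 / 2"
      using assms by (simp add: distrib_right power2_eq_square)
    moreover have "0 \<le> (c * t - 2)\<^sup>2" by simp
    then have "4 * (c * t) \<le> (c * t)\<^sup>2 + 4" by (simp add: power2_diff)
    then have "2 * t * c \<le> 2 + (c * t)\<^sup>2 / 2" by (simp add: mult_ac)
    ultimately have "2 * t * c \<le> (2 / c + (c / 2) * t\<^sup>2) * c" by simp
    then show ?thesis using assms(1) by (rule mult_right_le_imp_le)
  qed
  have "(1 + t) * exp (t - c * t\<^sup>2) \<le> exp t * exp (t - c * t\<^sup>2)"
    by (intro mult_right_mono exp_ge_add_one_self) auto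
  also have "\<dots> = exp (2 * t - c * t\<^sup>2)" by (simp add: exp_add[symmetric])
  also have "\<dots> \<le> exp (2 / c - (c / 2) * t\<^sup>2)"
    using \<open>2 * t \<le> _\<close> by simp
  also have "\<dots> = exp (2 / c) * exp (- (c / 2) * t\<^sup>2)" by (simp add: exp_add[symmetric])
  finally show ?thesis .
qed

lemma poly_exp_bound:
  fixes e :: real
  assumes "0 < e"
  obtains B where "0 < B" "\<And>t. 0 \<le> t \<Longrightarrow> t + t^3 \<le> B * exp (e * t\<^sup>2)"
proof -
  define k where "k = min 1 (e/2)"
  have k: "0 < k" "k \<le> 1" "k \<le> e / 2" using assms by (auto simp: k_def)
  have "t + t^3 \<le> 1 / k\<^sup>2 * exp (e * t\<^sup>2)" if "0 \<le> t" for t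
  proof -
    have "k * (1 + t\<^sup>2) \<le> 1 + (e/2) * t\<^sup>2"
      unfolding distrib_left mult_1_right by (intro add_mono mult_right_mono k) auto
    also have "\<dots> \<le> exp ((e/2) * t\<^sup>2)" by (rule exp_ge_add_one_self)
    finally have "(k * (1 + t\<^sup>2))\<^sup>2 \<le> (exp ((e/2) * t\<^sup>2))\<^sup>2" using k by (intro power_mono) auto
    also have "\<dots> = exp (e * t\<^sup>2)" by (simp add: exp_double[symmetric])
    finally have 1: "(1 + t\<^sup>2)\<^sup>2 \<le> exp (e * t\<^sup>2) / k\<^sup>2"
      using k by (simp add: power_mult_distrib pos_le_divide_eq mult.commute)
    have t: "t \<le> 1 + t\<^sup>2" using zero_le_power2[of "t - 1"] that by (simp add: power2_diff)
    have "t + t^3 = t * (1 + t\<^sup>2)" by (simp add: algebra_simps power3_eq_cube power2_eq_square)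
    also have "\<dots> \<le> (1 + t\<^sup>2) * (1 + t\<^sup>2)" using t by (intro mult_right_mono) auto
    also have "\<dots> \<le> exp (e * t\<^sup>2) / k\<^sup>2" using 1 by (simp add: power2_eq_square)
    finally show ?thesis by simp
  qed
  then show thesis using that[of "1 / k\<^sup>2"] k by simp
qed

lemma exp_diff_bound: "\<bar>exp (- p) - exp (- q)\<bar> \<le> \<bar>p - q\<bar> * exp (- r)" if "r \<le> p" "r \<le> q" for p q r :: real
proof -
  have *: "exp (- p) - exp (- q) \<le> (q - p) * exp (- r)" if "p \<le> q" "r \<le> p" for p q
  proof -
    have "exp (- p) - exp (- q) = exp (- p) * (1 - exp (- (q - p)))"
      by (simp add: right_diff_distrib exp_add[symmetric])
    also have "1 - exp (- (q - p)) \<le> q - p" using exp_ge_add_one_self[of "-(q - p)"] by linarith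
    then have "exp (- p) * (1 - exp (- (q - p))) \<le> exp (- p) * (q - p)" by (intro mult_left_mono) auto
    also have "\<dots> \<le> exp (- r) * (q - p)" using that by (intro mult_right_mono) auto
    finally show ?thesis by (simp add: mult.commute)
  qed
  show ?thesis
  proof (cases "p \<le> q")
    case True with *[OF True that(1)] show ?thesis by (simp add: abs_if)
  next
    case False with *[of q p] that(2) show ?thesis by (simp add: abs_if)
  qed
qed

text \<open>\<open>\<psi>\<close> stands for the potential minus its first order Taylor polynomial,
  \<open>a\<close> for the volume density. The second part of \<open>psi\<close> pinches \<psi>
  between 3/4 and 5/4 of its quadratic part on the whole ball of radius \<delta>, so the exponent
  stays comparable to a Gaussian one even where the rescaled cubic remainder is large.\<close>

locale laplace =
  fixes H :: "real^'m::finite^'m" and \<psi> a :: "real^'m \<Rightarrow> real" and \<delta> a0 Cp Ca :: real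
  assumes H: "spd H" and pos: "0 < \<delta>" "0 < a0" "0 \<le> Cp" "0 \<le> Ca"
    and meas [measurable]: "\<psi> \<in> borel_measurable borel" "a \<in> borel_measurable borel"
    and psi: "\<And>r. norm r < \<delta> \<Longrightarrow> \<bar>\<psi> r - ((H *v r) \<bullet> r) / 2\<bar> \<le> Cp * norm r ^ 3"
      "\<And>r. norm r < \<delta> \<Longrightarrow> \<bar>\<psi> r - ((H *v r) \<bullet> r) / 2\<bar> \<le> ((H *v r) \<bullet> r) / 8"
    and a: "\<And>r. norm r < \<delta> \<Longrightarrow> \<bar>a r - a0\<bar> \<le> Ca * norm r" "\<And>r. norm r < \<delta> \<Longrightarrow> a0 / 2 \<le> a r"
begin

definition "Q u = ((H *v u) \<bullet> u) / 2"
text \<open>The Legendre transform of \<open>Q\<close>, that is the supremum over u of y \<bullet> u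
  - Q u; exp (- E y) is the unnormalised Gaussian of covariance \<open>H\<close>.\<close>

definition "E y = ((matrix_inv H *v y) \<bullet> y) / 2"
text \<open>The Laplace integral over |r| < \<delta> after the substitution r = h u, with the factor
  h^m removed; h plays the part of 1/sqrt k.\<close>

definition "Iin h y = (LINT u|lborel. indicator (ball 0 (\<delta> / h)) u * (exp (y \<bullet> u - \<psi> (h *\<^sub>R u) / h\<^sup>2) * a (h *\<^sub>R u)))"

lemma Q_measurable [measurable]: "Q \<in> borel_measurable borel"
  unfolding Q_def[abs_def] by measurable

lemma Q_nonneg: "0 \<le> Q u" unfolding Q_def using spd_nonneg[OF H] by simp

lemma lap: "0 < b \<Longrightarrow> has_bochner_integral lborel (\<lambda>u. exp (y \<bullet> u - b * Q u)) (exp (E y / b) * gconst H b)"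
  using laplace_integral[OF H, of b y] by (simp add: Q_def E_def mult.commute)

lemma Q_scale: "Q (h *\<^sub>R u) = h\<^sup>2 * Q u"
  by (simp add: Q_def matrix_vector_mult_scaleR power2_eq_square)

lemma psi_scaled:
  assumes h: "0 < h" and u: "u \<in> ball 0 (\<delta> / h)"
  shows "\<bar>\<psi> (h *\<^sub>R u) / h\<^sup>2 - Q u\<bar> \<le> Cp * (h * norm u ^ 3)"
    "(3/4) * Q u \<le> \<psi> (h *\<^sub>R u) / h\<^sup>2" "\<psi> (h *\<^sub>R u) / h\<^sup>2 \<le> (5/4) * Q u" "norm (h *\<^sub>R u) < \<delta>"
proof -
  show n: "norm (h *\<^sub>R u) < \<delta>" using u h by (simp add: field_simps)
  have eq: "\<psi> (h *\<^sub>R u) / h\<^sup>2 - Q u = (\<psi> (h *\<^sub>R u) - Q (h *\<^sub>R u)) / h\<^sup>2"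
    using h by (simp add: Q_scale diff_divide_distrib)
  have "\<bar>\<psi> (h *\<^sub>R u) / h\<^sup>2 - Q u\<bar> = \<bar>\<psi> (h *\<^sub>R u) - Q (h *\<^sub>R u)\<bar> / h\<^sup>2"
    unfolding eq using h by simp
  also have "\<dots> \<le> Cp * norm (h *\<^sub>R u) ^ 3 / h\<^sup>2"
    using psi(1)[OF n] by (intro divide_right_mono) (auto simp: Q_def)
  also have "\<dots> = Cp * (h * norm u ^ 3)"
    using h by (simp add: power_mult_distrib power3_eq_cube power2_eq_square)
  finally show "\<bar>\<psi> (h *\<^sub>R u) / h\<^sup>2 - Q u\<bar> \<le> Cp * (h * norm u ^ 3)" .
  have "\<bar>\<psi> (h *\<^sub>R u) / h\<^sup>2 - Q u\<bar> = \<bar>\<psi> (h *\<^sub>R u) - Q (h *\<^sub>R u)\<bar> / h\<^sup>2"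
    unfolding eq using h by simp
  also have "\<dots> \<le> (Q (h *\<^sub>R u) / 4) / h\<^sup>2"
    using psi(2)[OF n] by (intro divide_right_mono) (auto simp: Q_def)
  also have "\<dots> = Q u / 4" using h by (simp add: Q_scale)
  finally have "\<bar>\<psi> (h *\<^sub>R u) / h\<^sup>2 - Q u\<bar> \<le> Q u / 4" .
  from abs_le_D1[OF this] abs_le_D2[OF this]
  show "(3/4) * Q u \<le> \<psi> (h *\<^sub>R u) / h\<^sup>2" "\<psi> (h *\<^sub>R u) / h\<^sup>2 \<le> (5/4) * Q u" by linarith+
qed

text \<open>Inside the ball the error is of first order in h, with |u| coming from \<open>a\<close>
  and |u|^3 from the cubic remainder of \<psi>. Outside it the integrand is 0, and the missing
  Gaussian is charged to 1 \<le> h |u| / \<delta>, whence the term a0/\<delta>. The exponent 3/4 is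
  the lower pinching constant.\<close>

lemma integrand_bound:
  assumes h: "0 < h" "h \<le> 1"
  shows "\<bar>indicator (ball 0 (\<delta> / h)) u * (exp (y \<bullet> u - \<psi> (h *\<^sub>R u) / h\<^sup>2) * a (h *\<^sub>R u)) - a0 * exp (y \<bullet> u - Q u)\<bar>
    \<le> h * ((Ca + a0 * Cp + a0 / \<delta>) * (norm u + norm u ^ 3)) * exp (y \<bullet> u - (3/4) * Q u)"
proof (cases "u \<in> ball 0 (\<delta> / h)")
  case True
  let ?p = "\<psi> (h *\<^sub>R u) / h\<^sup>2"
  note P = psi_scaled[OF h(1) True]
  have "\<bar>exp (- ?p) * a (h *\<^sub>R u) - a0 * exp (- Q u)\<bar> = \<bar>exp (- ?p) * (a (h *\<^sub>R u) - a0) + a0 * (exp (- ?p) - exp (- Q u))\<bar>"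
    by (simp add: algebra_simps)
  also have "\<dots> \<le> exp (- ?p) * \<bar>a (h *\<^sub>R u) - a0\<bar> + a0 * \<bar>exp (- ?p) - exp (- Q u)\<bar>"
    using pos by (intro order_trans[OF abs_triangle_ineq]) (simp add: abs_mult)
  also have "\<dots> \<le> exp (- (3/4) * Q u) * (Ca * (h * norm u)) + a0 * ((Cp * (h * norm u ^ 3)) * exp (- (3/4) * Q u))"
  proof (intro add_mono mult_mono mult_left_mono)
    show "\<bar>a (h *\<^sub>R u) - a0\<bar> \<le> Ca * (h * norm u)" using a(1)[OF P(4)] h by simp
    have "\<bar>exp (- ?p) - exp (- Q u)\<bar> \<le> \<bar>?p - Q u\<bar> * exp (- ((3/4) * Q u))"
      using P(2) Q_nonneg[of u] by (intro exp_diff_bound) auto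
    also have "\<dots> \<le> (Cp * (h * norm u ^ 3)) * exp (- (3/4) * Q u)" using P(1) by (intro mult_mono) auto
    finally show "\<bar>exp (- ?p) - exp (- Q u)\<bar> \<le> (Cp * (h * norm u ^ 3)) * exp (- (3/4) * Q u)" .
  qed (use P pos in auto)
  also have "\<dots> = h * (Ca * norm u + a0 * Cp * norm u ^ 3) * exp (- (3/4) * Q u)"
    by (simp add: algebra_simps)
  also have "\<dots> \<le> h * ((Ca + a0 * Cp + a0 / \<delta>) * (norm u + norm u ^ 3)) * exp (- (3/4) * Q u)"
  proof (intro mult_right_mono mult_left_mono)
    have "0 \<le> Ca * norm u ^ 3 + a0 * Cp * norm u + a0 / \<delta> * (norm u + norm u ^ 3)" using pos by auto
    then show "Ca * norm u + a0 * Cp * norm u ^ 3 \<le> (Ca + a0 * Cp + a0 / \<delta>) * (norm u + norm u ^ 3)"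
      by (simp add: algebra_simps)
  qed (use h in auto)
  finally have "exp (y \<bullet> u) * \<bar>exp (- ?p) * a (h *\<^sub>R u) - a0 * exp (- Q u)\<bar> \<le> exp (y \<bullet> u) * (h * ((Ca + a0 * Cp + a0 / \<delta>) * (norm u + norm u ^ 3)) * exp (- (3/4) * Q u))"
    by (rule mult_left_mono) simp
  moreover have "indicator (ball 0 (\<delta> / h)) u * (exp (y \<bullet> u - ?p) * a (h *\<^sub>R u)) - a0 * exp (y \<bullet> u - Q u)
      = exp (y \<bullet> u) * (exp (- ?p) * a (h *\<^sub>R u) - a0 * exp (- Q u))"
    using True by (simp add: right_diff_distrib exp_diff exp_minus divide_inverse)
  moreover have "exp (y \<bullet> u) * (h * ((Ca + a0 * Cp + a0 / \<delta>) * (norm u + norm u ^ 3)) * exp (- (3/4) * Q u))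
     = h * ((Ca + a0 * Cp + a0 / \<delta>) * (norm u + norm u ^ 3)) * exp (y \<bullet> u - (3/4) * Q u)"
  proof -
    have "exp (y \<bullet> u - (3/4) * Q u) = exp (y \<bullet> u) * exp (- (3/4) * Q u)" by (simp add: exp_add[symmetric])
    then show ?thesis by (simp only: mult_ac)
  qed
  ultimately show ?thesis by (simp only: abs_mult abs_exp_cancel)
next
  case False
  then have n: "1 \<le> h * norm u / \<delta>" using h pos by (simp add: field_simps not_less)
  have "a0 * exp (y \<bullet> u - Q u) \<le> (h * norm u / \<delta>) * (a0 * exp (y \<bullet> u - (3/4) * Q u))"
    using n pos Q_nonneg[of u] mult_mono[OF n, of "a0 * exp (y \<bullet> u - Q u)" "a0 * exp (y \<bullet> u - (3/4) * Q u)"] by simp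
  also have "\<dots> = h * ((a0 / \<delta>) * norm u) * exp (y \<bullet> u - (3/4) * Q u)" by simp
  also have "\<dots> \<le> h * ((Ca + a0 * Cp + a0 / \<delta>) * (norm u + norm u ^ 3)) * exp (y \<bullet> u - (3/4) * Q u)"
    using h pos by (intro mult_right_mono mult_left_mono mult_mono) auto
  finally show ?thesis using False pos by simp
qed

text \<open>The polynomial |u| + |u|^3 is absorbed by exp (Q u / 12), and 3/4 - 1/12 = 2/3.\<close>

lemma integrand_bound':
  obtains B where "0 \<le> B" "\<And>h u y. 0 < h \<Longrightarrow> h \<le> 1 \<Longrightarrow>
    \<bar>indicator (ball 0 (\<delta> / h)) u * (exp (y \<bullet> u - \<psi> (h *\<^sub>R u) / h\<^sup>2) * a (h *\<^sub>R u)) - a0 * exp (y \<bullet> u - Q u)\<bar>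
    \<le> h * B * exp (y \<bullet> u - (2/3) * Q u)"
proof -
  obtain c where c: "0 < c" "\<And>u. c * (norm u)\<^sup>2 \<le> (H *v u) \<bullet> u" using spd_bounds[OF H] by metis
  obtain B where B: "0 < B" "\<And>t. 0 \<le> t \<Longrightarrow> t + t^3 \<le> B * exp (c / 24 * t\<^sup>2)"
    using poly_exp_bound[of "c / 24"] c(1) by auto
  let ?K = "Ca + a0 * Cp + a0 / \<delta>"
  have K: "0 \<le> ?K" using pos by simp
  show thesis
  proof (rule that[of "?K * B"])
    fix h :: real and u y :: "real^'m" assume h: "0 < h" "h \<le> 1"
    have "norm u + norm u ^ 3 \<le> B * exp (c / 24 * (norm u)\<^sup>2)" by (rule B) simp
    also have "\<dots> \<le> B * exp (Q u / 12)" using c(2)[of u] B(1) by (intro mult_left_mono) (auto simp: Q_def)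
    finally have "h * (?K * (norm u + norm u ^ 3)) * exp (y \<bullet> u - (3/4) * Q u) \<le> h * (?K * (B * exp (Q u / 12))) * exp (y \<bullet> u - (3/4) * Q u)"
      using K h by (intro mult_right_mono mult_left_mono) auto
    also have "\<dots> = h * (?K * B) * (exp (Q u / 12) * exp (y \<bullet> u - (3/4) * Q u))" by simp
    also have "exp (Q u / 12) * exp (y \<bullet> u - (3/4) * Q u) = exp (y \<bullet> u - (2/3) * Q u)"
      unfolding exp_add[symmetric] by simp
    finally show "\<bar>indicator (ball 0 (\<delta> / h)) u * (exp (y \<bullet> u - \<psi> (h *\<^sub>R u) / h\<^sup>2) * a (h *\<^sub>R u)) - a0 * exp (y \<bullet> u - Q u)\<bar>
      \<le> h * (?K * B) * exp (y \<bullet> u - (2/3) * Q u)"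
      using integrand_bound[OF h, of u y] by linarith
  qed (use K B in simp)
qed

lemma Iin_integrable:
  assumes h: "0 < h" "h \<le> 1"
  shows "integrable lborel (\<lambda>u. indicator (ball 0 (\<delta> / h)) u * (exp (y \<bullet> u - \<psi> (h *\<^sub>R u) / h\<^sup>2) * a (h *\<^sub>R u)))"
proof -
  obtain B where B: "0 \<le> B" "\<And>h u y. 0 < h \<Longrightarrow> h \<le> 1 \<Longrightarrow>
    \<bar>indicator (ball 0 (\<delta> / h)) u * (exp (y \<bullet> u - \<psi> (h *\<^sub>R u) / h\<^sup>2) * a (h *\<^sub>R u)) - a0 * exp (y \<bullet> u - Q u)\<bar>
    \<le> h * B * exp (y \<bullet> u - (2/3) * Q u)" using integrand_bound' by metis
  have [measurable]: "ball (0::real^'m) (\<delta> / h) \<in> sets borel" by simp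
  have 1: "integrable lborel (\<lambda>u. h * B * exp (y \<bullet> u - (2/3) * Q u))"
    using lap[of "2/3" y] by (intro integrable_mult_right) (auto simp: has_bochner_integral_iff)
  have 2: "integrable lborel (\<lambda>u. a0 * exp (y \<bullet> u - Q u))"
    using lap[of 1 y] by (intro integrable_mult_right) (auto simp: has_bochner_integral_iff)
  have "integrable lborel (\<lambda>u. indicator (ball 0 (\<delta> / h)) u * (exp (y \<bullet> u - \<psi> (h *\<^sub>R u) / h\<^sup>2) * a (h *\<^sub>R u)) - a0 * exp (y \<bullet> u - Q u))"
  proof (rule Bochner_Integration.integrable_bound[OF 1])
    show "AE u in lborel. norm (indicator (ball 0 (\<delta> / h)) u * (exp (y \<bullet> u - \<psi> (h *\<^sub>R u) / h\<^sup>2) * a (h *\<^sub>R u)) - a0 * exp (y \<bullet> u - Q u)) \<le> norm (h * B * exp (y \<bullet> u - (2/3) * Q u))"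
      using B h by (intro AE_I2) (auto simp: abs_mult)
  qed measurable
  from Bochner_Integration.integrable_add[OF this 2] show ?thesis by simp
qed

text \<open>The Laplace transform of exp (- (2/3) Q) is a multiple of exp ((3/2) E). This error term
  outgrows the main term exp E as y grows, so a reciprocal can be controlled only with the help of a
  separate lower bound.\<close>

lemma Iin_upper:
  obtains C where "0 \<le> C" "\<And>h y. 0 < h \<Longrightarrow> h \<le> 1 \<Longrightarrow> \<bar>Iin h y - a0 * gconst H 1 * exp (E y)\<bar> \<le> C * h * exp ((3/2) * E y)"
proof -
  obtain B where B: "0 \<le> B" "\<And>h u y. 0 < h \<Longrightarrow> h \<le> 1 \<Longrightarrow>
    \<bar>indicator (ball 0 (\<delta> / h)) u * (exp (y \<bullet> u - \<psi> (h *\<^sub>R u) / h\<^sup>2) * a (h *\<^sub>R u)) - a0 * exp (y \<bullet> u - Q u)\<bar>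
    \<le> h * B * exp (y \<bullet> u - (2/3) * Q u)" using integrand_bound' by metis
  show thesis
  proof (rule that[of "B * gconst H (2/3)"])
    show "0 \<le> B * gconst H (2/3)" using B gconst_pos[OF H, of "2/3"] by simp
    fix h :: real and y :: "real^'m" assume h: "0 < h" "h \<le> 1"
    have 1: "has_bochner_integral lborel (\<lambda>u. h * B * exp (y \<bullet> u - (2/3) * Q u)) (h * B * (exp (E y / (2/3)) * gconst H (2/3)))"
      by (intro has_bochner_integral_mult_right lap) simp
    have 2: "has_bochner_integral lborel (\<lambda>u. a0 * exp (y \<bullet> u - 1 * Q u)) (a0 * (exp (E y / 1) * gconst H 1))"
      by (intro has_bochner_integral_mult_right lap) simp
    have eq: "Iin h y - a0 * gconst H 1 * exp (E y) = (LINT u|lborel. indicator (ball 0 (\<delta> / h)) u * (exp (y \<bullet> u - \<psi> (h *\<^sub>R u) / h\<^sup>2) * a (h *\<^sub>R u)) - a0 * exp (y \<bullet> u - Q u))"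
      using 2 Iin_integrable[OF h] by (subst Bochner_Integration.integral_diff) (auto simp: Iin_def has_bochner_integral_iff)
    have le: "\<bar>Iin h y - a0 * gconst H 1 * exp (E y)\<bar> \<le> (LINT u|lborel. h * B * exp (y \<bullet> u - (2/3) * Q u))"
      using 1 2 Iin_integrable[OF h, of y] B(2)[OF h] unfolding eq real_norm_def[symmetric]
      by (intro Bochner_Integration.integral_norm_bound_integral) (auto simp: has_bochner_integral_iff)
    have val: "(LINT u|lborel. h * B * exp (y \<bullet> u - (2/3) * Q u)) = B * gconst H (2/3) * h * exp ((3/2) * E y)"
      unfolding has_bochner_integral_integral_eq[OF 1] by (simp add: mult_ac)
    show "\<bar>Iin h y - a0 * gconst H 1 * exp (E y)\<bar> \<le> B * gconst H (2/3) * h * exp ((3/2) * E y)" 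
      using le unfolding val .
  qed
qed

text \<open>Keep only the unit ball around \<eta> H^-1 y and use \<psi> \<le> (5/4) Q there. For
  \<eta> = 1 the centre would be the maximiser of y \<bullet> u - Q u; in general the exponent at
  the centre is at least (2 \<eta> - (5/4) \<eta>^2) E y, and moving within the ball loses at most
  |y| and a constant. A small \<eta> keeps the ball in the domain even when y has size 1/h.\<close>

lemma Iin_lower:
  obtains c where "0 < c" "\<And>h y \<eta>. 0 < h \<Longrightarrow> h \<le> 1 \<Longrightarrow> 0 \<le> \<eta> \<Longrightarrow> \<eta> \<le> 1 \<Longrightarrow> norm (\<eta> *\<^sub>R (matrix_inv H *v y)) + 1 \<le> \<delta> / h \<Longrightarrow>
    c * exp ((2 * \<eta> - (5/4) * \<eta>\<^sup>2) * E y - norm y) \<le> Iin h y"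
proof -
  obtain C where C: "0 < C" "\<And>u. (H *v u) \<bullet> u \<le> C * (norm u)\<^sup>2" using spd_bounds[OF H] by metis
  define V where "V = measure lborel (ball (0::real^'m) 1)"
  have V: "0 < V" unfolding V_def using content_ball_pos[of 1 "0::real^'m"] by simp
  define c where "c = a0 / 2 * exp (- (5/8) * C)"
  have c: "0 < c" using pos by (simp add: c_def)
  show thesis
  proof (rule that[of "c * V"])
    fix h \<eta> :: real and y :: "real^'m" assume h: "0 < h" "h \<le> 1" and eta: "0 \<le> \<eta>" "\<eta> \<le> 1" and small: "norm (\<eta> *\<^sub>R (matrix_inv H *v y)) + 1 \<le> \<delta> / h"
    let ?u0 = "\<eta> *\<^sub>R (matrix_inv H *v y)"
    let ?v = "c * exp ((2 * \<eta> - (5/4) * \<eta>\<^sup>2) * E y - norm y)"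
    let ?f = "\<lambda>u. indicator (ball 0 (\<delta> / h)) u * (exp (y \<bullet> u - \<psi> (h *\<^sub>R u) / h\<^sup>2) * a (h *\<^sub>R u))"
    have "?v * indicator (ball ?u0 1) u \<le> ?f u" for u
    proof (cases "u \<in> ball ?u0 1")
      case True
      define w where "w = u - ?u0"
      have u: "u = ?u0 + w" by (simp add: w_def)
      have w: "norm w \<le> 1" using True by (simp add: w_def dist_norm norm_minus_commute)
      have "norm u < \<delta> / h" using norm_triangle_ineq[of ?u0 w] True small by (simp add: w_def dist_norm norm_minus_commute)
      then have ub: "u \<in> ball 0 (\<delta> / h)" by simp
      note P = psi_scaled[OF h(1) ub]
      have Hw: "(H *v w) \<bullet> (matrix_inv H *v y) = w \<bullet> y" using spd_sym[OF H, of w "matrix_inv H *v y"] by (simp add: spd_inv_mult[OF H])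
      have Qu: "Q u = \<eta>\<^sup>2 * E y + \<eta> * (y \<bullet> w) + Q w"
        unfolding u Q_def E_def
        by (simp add: matrix_vector_right_distrib matrix_vector_mult_scaleR spd_inv_mult[OF H] inner_add_left inner_add_right Hw inner_commute[of w y] inner_commute[of y "matrix_inv H *v y"] power2_eq_square field_simps)
      have yu: "y \<bullet> u = 2 * \<eta> * E y + y \<bullet> w"
        unfolding u E_def by (simp add: inner_add_right inner_commute)
      have yw: "\<bar>y \<bullet> w\<bar> \<le> norm y" using Cauchy_Schwarz_ineq2[of y w] mult_left_mono[OF w, of "norm y"] by simp
      have "\<bar>(1 - (5/4) * \<eta>) * (y \<bullet> w)\<bar> \<le> 1 * norm y"
        unfolding abs_mult using eta yw by (intro mult_mono) (auto simp: abs_le_iff)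
      then have lin: "- norm y \<le> (1 - (5/4) * \<eta>) * (y \<bullet> w)" by linarith
      have "C * (norm w)\<^sup>2 \<le> C * 1" using w C(1) by (intro mult_left_mono) (auto simp: power_le_one)
      then have Qw: "Q w \<le> C / 2" using C(2)[of w] by (simp add: Q_def)
      have "(2 * \<eta> - (5/4) * \<eta>\<^sup>2) * E y - norm y - (5/8) * C \<le> y \<bullet> u - (5/4) * Q u"
        unfolding Qu yu using lin Qw by (simp add: algebra_simps)
      also have "\<dots> \<le> y \<bullet> u - \<psi> (h *\<^sub>R u) / h\<^sup>2" using P(3) by simp
      finally have 1: "(2 * \<eta> - (5/4) * \<eta>\<^sup>2) * E y - norm y - (5/8) * C \<le> y \<bullet> u - \<psi> (h *\<^sub>R u) / h\<^sup>2" .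
      have "?v = exp ((2 * \<eta> - (5/4) * \<eta>\<^sup>2) * E y - norm y - (5/8) * C) * (a0 / 2)"
      proof -
        have "exp (X - (5/8) * C) = exp X * exp (- (5/8) * C)" for X by (simp add: exp_add[symmetric])
        then show ?thesis by (simp add: c_def)
      qed
      also have "\<dots> \<le> exp (y \<bullet> u - \<psi> (h *\<^sub>R u) / h\<^sup>2) * a (h *\<^sub>R u)"
        using 1 a(2)[OF P(4)] pos by (intro mult_mono) auto
      finally show ?thesis using True ub by simp
    next
      case False
      have "0 \<le> ?f u"
      proof (cases "u \<in> ball 0 (\<delta> / h)")
        case True
        then have "0 \<le> a (h *\<^sub>R u)" using a(2)[OF psi_scaled(4)[OF h(1) True]] pos by linarith
        then show ?thesis by simp
      qed simp
      with False show ?thesis by simp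
    qed
    then have le: "?v * indicator (ball ?u0 1) u \<le> ?f u" for u .
    have "emeasure lborel (ball ?u0 1) < top"
      using emeasure_bounded_finite[OF bounded_ball, of ?u0 1] by simp
    then have i1: "integrable lborel (\<lambda>u. ?v * indicator (ball ?u0 1) u)"
      by (intro integrable_mult_right integrable_real_indicator) simp_all
    have 1: "(LINT u|lborel. ?v * indicator (ball ?u0 1) u) \<le> Iin h y"
      unfolding Iin_def by (rule integral_mono[OF i1 Iin_integrable[OF h] le])
    have 2: "(LINT u|lborel. ?v * indicator (ball ?u0 1) u) = ?v * V"
      using content_ball_conv_unit_ball[of 1 ?u0] by (simp add: V_def)
    show "c * V * exp ((2 * \<eta> - (5/4) * \<eta>\<^sup>2) * E y - norm y) \<le> Iin h y"
      using 1 unfolding 2 by (simp only: mult_ac)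
  qed (use c V in simp)
qed

end

section \<open>Gaussians as mixtures of product Gaussians\<close>

lemma matrix_vector_bound:
  fixes A :: "real^'m::finite^'n::finite"
  obtains L where "0 < L" "\<And>x. norm (A *v x) \<le> L * norm x"
  using bounded_linear.pos_bounded[OF matrix_vector_mul_bounded_linear[of A]] by (metis mult.commute)

lemma prod_gb: "(\<Prod>j\<in>UNIV. gb l (v $ j) (x $ j)) = exp (- l * ((x - v) \<bullet> (x - v)) / 2)"
  for x v :: "real^'m::finite"
  by (simp add: gb_def exp_sum[symmetric] inner_vec_def power2_eq_square sum_distrib_left sum_divide_distrib sum_negf)

text \<open>With \<open>l\<close> larger than the top eigenvalue of \<open>A\<close> and \<open>N = l - A\<close>, one has
  \<open>exp (- A x \<bullet> x / 2) = exp (- l x \<bullet> x / 2) exp (N x \<bullet> x / 2)\<close>, and the second factor is a Laplace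
  transform of a Gaussian.\<close>

lemma gauss_mix_exists:
  fixes A :: "real^'m::finite^'m"
  assumes A: "spd A"
  obtains l K g2 where "gauss_mix l K g2 (\<lambda>x. exp (- ((A *v x) \<bullet> x) / 2))"
proof -
  obtain C where C: "0 < C" "\<And>u. (A *v u) \<bullet> u \<le> C * (norm u)\<^sup>2" using spd_bounds[OF A] by metis
  define l where "l = C + 1"
  have l: "0 < l" using C by (simp add: l_def)
  define N where "N = l *\<^sub>R mat 1 - A"
  have Nv: "N *v u = l *\<^sub>R u - A *v u" for u
    by (simp add: N_def matrix_vector_mult_diff_rdistrib scaleR_matrix_vector_assoc[symmetric])
  have N: "spd N"
    unfolding spd_def
  proof (intro conjI allI impI)
    have "transpose A $ i $ j = A $ i $ j" for i j using A by (simp add: spd_def)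
    then show "transpose N = N" by (auto simp: N_def transpose_def vec_eq_iff mat_def)
    fix u :: "real^'m" assume "u \<noteq> 0"
    then have "0 < (norm u)\<^sup>2" by simp
    moreover have "(N *v u) \<bullet> u = l * (norm u)\<^sup>2 - (A *v u) \<bullet> u"
      by (simp add: Nv inner_diff_left dot_square_norm)
    moreover have "l * (norm u)\<^sup>2 = C * (norm u)\<^sup>2 + (norm u)\<^sup>2" by (simp add: l_def distrib_right)
    ultimately show "0 < (N *v u) \<bullet> u" using C(2)[of u] by linarith
  qed
  let ?N' = "matrix_inv N"
  define c where "c = gconst ?N' (l\<^sup>2)"
  have c: "0 < c" unfolding c_def by (rule gconst_pos[OF spd_inv[OF N]]) (use l in simp)
  \<comment> \<open>The factor exp (l |v|^2 / 2) cancels the same term in the product Gaussian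
    centred at v. What remains is exp (l <x, v>) against the Gaussian with matrix l^2 N^-1, whose
    Laplace transform at l x is c exp (<N x, x> / 2).\<close>
  define g2 where "g2 v = exp (l * (v \<bullet> v) / 2 - l\<^sup>2 * ((?N' *v v) \<bullet> v) / 2) / c" for v
  have [measurable]: "g2 \<in> borel_measurable borel" unfolding g2_def[abs_def] by measurable
  obtain K where "\<And>v. smooth_bump (\<lambda>x. exp (- l * (x - v)\<^sup>2 / 2)) (\<lambda>x. - l * (x - v) * exp (- l * (x - v)\<^sup>2 / 2))
     (\<lambda>x. (l\<^sup>2 * (x - v)\<^sup>2 - l) * exp (- l * (x - v)\<^sup>2 / 2)) K v" by (fact gauss_bump[OF l])
  then have bump: "\<And>v. smooth_bump (gb l v) (\<lambda>x. - l * (x - v) * gb l v x) (\<lambda>x. (l\<^sup>2 * (x - v)\<^sup>2 - l) * gb l v x) K v"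
    by (simp add: gb_def[abs_def])
  have prod: "g2 v * (\<Prod>j\<in>UNIV. gb l (v $ j) (x $ j)) = exp (- l * (x \<bullet> x) / 2) / c * exp ((l *\<^sub>R x) \<bullet> v - l\<^sup>2 * ((?N' *v v) \<bullet> v) / 2)" for v x
    unfolding prod_gb g2_def
    by (simp add: exp_add[symmetric] inner_diff_left inner_diff_right inner_commute field_simps)
  have val: "exp (- l * (x \<bullet> x) / 2) / c * (exp (((matrix_inv ?N' *v (l *\<^sub>R x)) \<bullet> (l *\<^sub>R x)) / (2 * l\<^sup>2)) * c) = exp (- ((A *v x) \<bullet> x) / 2)" for x
  proof -
    have "((matrix_inv ?N' *v (l *\<^sub>R x)) \<bullet> (l *\<^sub>R x)) / (2 * l\<^sup>2) = ((N *v x) \<bullet> x) / 2"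
      using l by (simp add: spd_inv_inv[OF N] matrix_vector_mult_scaleR power2_eq_square)
    also have "\<dots> = l * (x \<bullet> x) / 2 - ((A *v x) \<bullet> x) / 2"
      by (simp add: Nv inner_diff_left diff_divide_distrib)
    finally have e: "((matrix_inv ?N' *v (l *\<^sub>R x)) \<bullet> (l *\<^sub>R x)) / (2 * l\<^sup>2) = l * (x \<bullet> x) / 2 - ((A *v x) \<bullet> x) / 2" .
    have "exp (- l * (x \<bullet> x) / 2) * exp (l * (x \<bullet> x) / 2 - ((A *v x) \<bullet> x) / 2) = exp (- ((A *v x) \<bullet> x) / 2)"
      by (simp add: exp_add[symmetric])
    then show ?thesis unfolding e using c by simp
  qed
  have bi: "has_bochner_integral lborel (\<lambda>v. g2 v * (\<Prod>j\<in>UNIV. gb l (v $ j) (x $ j))) (exp (- ((A *v x) \<bullet> x) / 2))" for x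
    unfolding prod val[symmetric] c_def
    by (intro has_bochner_integral_mult_right laplace_integral spd_inv N) (use l in simp)
  have nn: "0 \<le> g2 v * (\<Prod>j\<in>UNIV. gb l (v $ j) (x $ j))" for v x
    using c by (intro mult_nonneg_nonneg prod_nonneg) (auto simp: g2_def gb_nonneg)
  \<comment> \<open>By Tonelli: the mass of \<open>g2\<close> times the mass of one product Gaussian
    is the mass of exp (- <A x, x> / 2), which is finite.\<close>
  have int: "integrable lborel g2"
  proof (rule integrableI_nonneg)
    show "AE x in lborel. 0 \<le> g2 x" using c by (simp add: g2_def)
    have Z: "(\<integral>\<^sup>+x. ennreal (\<Prod>j\<in>UNIV. gb l (v $ j) (x $ j)) \<partial>lborel) = ennreal (sqrt (2 * pi / l) ^ CARD('m))" for v :: "real^'m"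
      unfolding prod_gb
      by (subst nn_integral_shift_vec[of "\<lambda>x. ennreal (exp (- l * (x \<bullet> x) / 2))"]) (simp_all add: nn_integral_gauss_std[OF l, simplified])
    have "(\<integral>\<^sup>+v. ennreal (g2 v) \<partial>lborel) * ennreal (sqrt (2 * pi / l) ^ CARD('m))
       = (\<integral>\<^sup>+v. ennreal (g2 v) * ennreal (sqrt (2 * pi / l) ^ CARD('m)) \<partial>lborel)"
      by (rule nn_integral_multc[symmetric]) measurable
    also have "\<dots> = (\<integral>\<^sup>+v. \<integral>\<^sup>+x. ennreal (g2 v) * ennreal (\<Prod>j\<in>UNIV. gb l (v $ j) (x $ j)) \<partial>lborel \<partial>lborel)"
    proof (rule nn_integral_cong)
      fix v :: "real^'m"
      show "ennreal (g2 v) * ennreal (sqrt (2 * pi / l) ^ CARD('m)) = (\<integral>\<^sup>+x. ennreal (g2 v) * ennreal (\<Prod>j\<in>UNIV. gb l (v $ j) (x $ j)) \<partial>lborel)"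
        unfolding Z[of v, symmetric] by (rule nn_integral_cmult[symmetric]) measurable
    qed
    also have "\<dots> = (\<integral>\<^sup>+x. \<integral>\<^sup>+v. ennreal (g2 v) * ennreal (\<Prod>j\<in>UNIV. gb l (v $ j) (x $ j)) \<partial>lborel \<partial>lborel)"
      by (rule lborel_pair.Fubini'[symmetric]) measurable
    also have "\<dots> = (\<integral>\<^sup>+x. ennreal (exp (- ((A *v x) \<bullet> x) / 2)) \<partial>lborel)"
    proof (rule nn_integral_cong)
      fix x :: "real^'m"
      have "(\<integral>\<^sup>+v. ennreal (g2 v) * ennreal (\<Prod>j\<in>UNIV. gb l (v $ j) (x $ j)) \<partial>lborel) = (\<integral>\<^sup>+v. ennreal (g2 v * (\<Prod>j\<in>UNIV. gb l (v $ j) (x $ j))) \<partial>lborel)"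
        using c by (intro nn_integral_cong ennreal_mult[symmetric]) (auto simp: g2_def intro!: prod_nonneg gb_nonneg)
      also have "\<dots> = ennreal (exp (- ((A *v x) \<bullet> x) / 2))"
        using bi[of x] by (subst nn_integral_eq_integral) (auto simp only: has_bochner_integral_iff intro!: AE_I2 nn)
      finally show "(\<integral>\<^sup>+v. ennreal (g2 v) * ennreal (\<Prod>j\<in>UNIV. gb l (v $ j) (x $ j)) \<partial>lborel) = ennreal (exp (- ((A *v x) \<bullet> x) / 2))" .
    qed
    also have "\<dots> < \<infinity>" using nn_integral_gauss[OF A, of 1] by simp
    finally show "(\<integral>\<^sup>+v. ennreal (g2 v) \<partial>lborel) < \<infinity>"
      using l by (auto simp: ennreal_mult_less_top)
  qed simp
  have "gauss_mix l K g2 (\<lambda>x. exp (- ((A *v x) \<bullet> x) / 2))"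
  proof (rule gauss_mix.intro)
    show "exp (- ((A *v x) \<bullet> x) / 2) = (LINT v|lborel. g2 v * (\<Prod>j\<in>UNIV. gb l (v $ j) (x $ j)))" for x
      using bi[of x] by (simp add: has_bochner_integral_iff)
    show "0 \<le> g2 v" for v using c by (simp add: g2_def)
  qed (fact bump int)+
  then show thesis by (rule that)
qed

section \<open>Reciprocals of Laplace integrals\<close>

lemma near_rearrange: "(a * h * e1) * (k * e2) * (1 / (c0 * exp z)) = a * k / c0 * h * (e1 * e2 * exp (- z))" for a h :: real
  by (simp add: exp_minus divide_inverse)

lemma abs_recip_diff: "0 < a \<Longrightarrow> 0 < b \<Longrightarrow> \<bar>1 / a - 1 / b\<bar> = \<bar>a - b\<bar> * (1 / b) * (1 / a)" for a b :: real
  by (simp add: diff_frac_eq abs_divide abs_mult abs_minus_commute)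

context laplace
begin

definition "\<kappa> = 1 / (a0 * gconst H 1)"

lemma kappa_pos: "0 < \<kappa>" unfolding \<kappa>_def using pos gconst_pos[OF H] by simp

lemma E_lower: obtains e1 where "0 < e1" "\<And>y. e1 * (norm y)\<^sup>2 \<le> E y"
proof -
  obtain c where c: "0 < c" "\<And>u. c * (norm u)\<^sup>2 \<le> (matrix_inv H *v u) \<bullet> u" using spd_bounds[OF spd_inv[OF H]] by metis
  show thesis
  proof (rule that[of "c / 2"])
    show "c / 2 * (norm y)\<^sup>2 \<le> E y" for y using c(2)[of y] by (simp add: E_def)
  qed (use c in simp)
qed

text \<open>For |y| \<le> \<delta>2/h the lower bound is available with \<eta> = 4/5; dividing the
  error exp ((3/2) E) by the main term exp E and by exp ((4/5) E - |y|) leaves exp (|y| - (3/10) E).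
  For larger |y| nothing is compared: both terms are O(exp (|y| - p |y|^2)), and the factor h comes
  from 1 \<le> h (1 + |y|) / \<delta>2. \<open>R\<close> is the part of a norm from outside the
  ball; being nonnegative, it can only shrink the reciprocal when y is far.\<close>

lemma weight_approx:
  assumes D: "0 < D" and d1: "0 < \<delta>1" and C2: "0 \<le> C2"
  obtains C c h0 where "0 \<le> C" "0 < c" "0 < h0" "h0 \<le> 1"
    "\<And>h R y. 0 < h \<Longrightarrow> h \<le> h0 \<Longrightarrow> 0 \<le> R \<Longrightarrow> norm y \<le> D / h \<Longrightarrow> (norm y \<le> \<delta>1 / h \<Longrightarrow> R \<le> C2 * h) \<Longrightarrow>
      \<bar>1 / (Iin h y + R) - \<kappa> * exp (- E y)\<bar> \<le> C * h * exp (- c * (norm y)\<^sup>2)"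
proof -
  obtain e1 where e1: "0 < e1" "\<And>y. e1 * (norm y)\<^sup>2 \<le> E y" by (fact E_lower)
  obtain L where L: "0 < L" "\<And>y. norm (matrix_inv H *v y) \<le> L * norm y" by (fact matrix_vector_bound)
  obtain C1 where C1: "0 \<le> C1" "\<And>h y. 0 < h \<Longrightarrow> h \<le> 1 \<Longrightarrow> \<bar>Iin h y - a0 * gconst H 1 * exp (E y)\<bar> \<le> C1 * h * exp ((3/2) * E y)"
    by (fact Iin_upper)
  obtain c0 where c0: "0 < c0" "\<And>h y \<eta>. 0 < h \<Longrightarrow> h \<le> 1 \<Longrightarrow> 0 \<le> \<eta> \<Longrightarrow> \<eta> \<le> 1 \<Longrightarrow> norm (\<eta> *\<^sub>R (matrix_inv H *v y)) + 1 \<le> \<delta> / h \<Longrightarrow>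
    c0 * exp ((2 * \<eta> - (5/4) * \<eta>\<^sup>2) * E y - norm y) \<le> Iin h y" by (fact Iin_lower)
  \<comment> \<open>Up to \<delta>2/h the upper bound on \<open>R\<close> applies and |H^-1 y| is at
    most \<delta>/(2h).\<close>
  define \<delta>2 where "\<delta>2 = min \<delta>1 (\<delta> / (2 * L))"
  \<comment> \<open>4/5 is the maximiser of 2 \<eta> - (5/4) \<eta>^2, and every \<eta> in [0, 4/5]
    satisfies 2 \<eta> - (5/4) \<eta>^2 \<ge> \<eta>. The other entry keeps \<eta> H^-1 y within
    \<delta>/(2h) for all |y| \<le> D/h.\<close>
  define \<eta> where "\<eta> = min (4/5) (\<delta> / (2 * L * D))"
  \<comment> \<open>The unit radius of the ball in \<open>Iin_lower\<close> has to fit into the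
    other half: 1 \<le> \<delta>/(2h).\<close>
  define h0 where "h0 = min 1 (\<delta> / 2)"
  have d2: "0 < \<delta>2" "\<delta>2 \<le> \<delta>1" "L * \<delta>2 \<le> \<delta> / 2"
  proof -
    have "L * \<delta>2 \<le> L * (\<delta> / (2 * L))" using L by (intro mult_left_mono) (auto simp: \<delta>2_def)
    then show "L * \<delta>2 \<le> \<delta> / 2" using L by simp
  qed (use d1 pos L in \<open>auto simp: \<delta>2_def\<close>)
  have eta: "0 < \<eta>" "\<eta> \<le> 4/5" "\<eta> * (L * D) \<le> \<delta> / 2"
  proof -
    have "\<eta> * (L * D) \<le> (\<delta> / (2 * L * D)) * (L * D)" using L D by (intro mult_right_mono) (auto simp: \<eta>_def)
    then show "\<eta> * (L * D) \<le> \<delta> / 2" using L D by simp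
  qed (use D pos L in \<open>auto simp: \<eta>_def\<close>)
  have h0: "0 < h0" "h0 \<le> 1" "h0 \<le> \<delta> / 2" using pos by (auto simp: h0_def)
  have E0: "0 \<le> E y" for y using e1(2)[of y] e1(1) by (meson mult_nonneg_nonneg less_imp_le order_trans zero_le_power2)
  define k1 where "k1 = (C1 + C2) * \<kappa> / c0"
  define k2 where "k2 = (1 / c0 + \<kappa>) / \<delta>2"
  have k: "0 \<le> k1" "0 \<le> k2" using C1 C2 kappa_pos c0 d2 by (auto simp: k1_def k2_def)
  define p where "p = min (3/10) \<eta> * e1"
  have p: "0 < p" using eta e1 by (simp add: p_def)
  have small: "norm (t *\<^sub>R (matrix_inv H *v y)) + 1 \<le> \<delta> / h"
    if "0 < h" "h \<le> h0" "0 \<le> t" "t * (L * norm y) \<le> \<delta> / 2 / h" for h t y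
  proof -
    have "norm (t *\<^sub>R (matrix_inv H *v y)) \<le> t * (L * norm y)" using that L(2)[of y] by (simp add: mult_left_mono)
    moreover have "1 \<le> \<delta> / 2 / h" using that h0 by (simp add: field_simps)
    moreover have "\<delta> / h = \<delta> / 2 / h + \<delta> / 2 / h" by simp
    ultimately show ?thesis using that(4) by linarith
  qed
  show thesis
  proof (rule that[of "(k1 + k2) * exp (2 / p)" "p / 2" h0])
    fix h R :: real and y :: "real^'m" assume h: "0 < h" "h \<le> h0" and R: "0 \<le> R" and yD: "norm y \<le> D / h" and RC: "norm y \<le> \<delta>1 / h \<Longrightarrow> R \<le> C2 * h"
    have h1: "h \<le> 1" using h h0 by simp
    let ?I = "Iin h y + R"
    have goal: "\<bar>1 / ?I - \<kappa> * exp (- E y)\<bar> \<le> (k1 + k2) * h * ((1 + norm y) * exp (norm y - p * (norm y)\<^sup>2))"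
    proof (cases "norm y \<le> \<delta>2 / h")
      case True
      then have "R \<le> C2 * h" using d2(2) h by (intro RC order_trans[OF True]) (auto intro: divide_right_mono)
      let ?J = "a0 * gconst H 1 * exp (E y)"
      have J: "0 < ?J" using pos gconst_pos[OF H, of 1] by simp
      have Jk: "1 / ?J = \<kappa> * exp (- E y)" by (simp add: \<kappa>_def exp_minus field_simps)
      have "L * norm y \<le> L * (\<delta>2 / h)" using True L by (intro mult_left_mono) auto
      also have "\<dots> \<le> \<delta> / 2 / h" using divide_right_mono[OF d2(3), of h] h by simp
      finally have "(4/5) * (L * norm y) \<le> \<delta> / 2 / h"
        using mult_nonneg_nonneg[OF less_imp_le[OF L(1)] norm_ge_zero[of y]] by linarith
      from c0(2)[OF h(1) h1 _ _ small[OF h _ this]]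
      have I1: "c0 * exp ((4/5) * E y - norm y) \<le> Iin h y" by (simp add: power2_eq_square)
      then have I2: "c0 * exp ((4/5) * E y - norm y) \<le> ?I" using R by simp
      have cI: "0 < c0 * exp ((4/5) * E y - norm y)" using c0 by simp
      then have I: "0 < ?I" using I2 by linarith
      have "\<bar>?I - ?J\<bar> \<le> C1 * h * exp ((3/2) * E y) + C2 * h * 1"
        using C1(2)[OF h(1) h1, of y] \<open>R \<le> C2 * h\<close> R by (simp add: abs_le_iff)
      also have "\<dots> \<le> C1 * h * exp ((3/2) * E y) + C2 * h * exp ((3/2) * E y)"
        using E0[of y] C2 h by (intro add_left_mono mult_left_mono) auto
      finally have d: "\<bar>?I - ?J\<bar> \<le> (C1 + C2) * h * exp ((3/2) * E y)" by (simp add: distrib_right)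
      have "\<bar>1 / ?I - 1 / ?J\<bar> = \<bar>?I - ?J\<bar> * (1 / ?J) * (1 / ?I)"
        by (rule abs_recip_diff[OF I J])
      also have "\<dots> \<le> ((C1 + C2) * h * exp ((3/2) * E y)) * (\<kappa> * exp (- E y)) * (1 / (c0 * exp ((4/5) * E y - norm y)))"
        unfolding Jk using d I2 cI I kappa_pos C1 C2 h
        by (intro mult_mono frac_le) auto
      also have "\<dots> = k1 * h * (exp ((3/2) * E y) * exp (- E y) * exp (- ((4/5) * E y - norm y)))"
        unfolding k1_def by (rule near_rearrange)
      also have "exp ((3/2) * E y) * exp (- E y) * exp (- ((4/5) * E y - norm y)) = exp (norm y - (3/10) * E y)"
        unfolding exp_add[symmetric] by simp
      also have "k1 * h * exp (norm y - (3/10) * E y) \<le> k1 * h * exp (norm y - p * (norm y)\<^sup>2)"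
      proof -
        have "p * (norm y)\<^sup>2 = min (3/10) \<eta> * (e1 * (norm y)\<^sup>2)" by (simp add: p_def)
        also have "\<dots> \<le> (3/10) * E y" using e1(2)[of y] e1(1) E0[of y] eta by (intro mult_mono) auto
        finally show ?thesis using k h by (intro mult_left_mono) auto
      qed
      also have "\<dots> \<le> (k1 + k2) * h * ((1 + norm y) * exp (norm y - p * (norm y)\<^sup>2))"
        using k h mult_right_mono[of 1 "1 + norm y" "exp (norm y - p * (norm y)\<^sup>2)"] by (intro mult_mono) auto
      finally show ?thesis unfolding Jk .
    next
      case False
      then have far: "1 \<le> h * (1 + norm y) / \<delta>2" using d2 h by (simp add: field_simps)
      have "\<eta> * (L * norm y) \<le> \<eta> * (L * (D / h))" using yD L eta by (intro mult_left_mono) auto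
      also have "\<dots> \<le> \<delta> / 2 / h" using divide_right_mono[OF eta(3), of h] h by simp
      finally have "\<eta> * (L * norm y) \<le> \<delta> / 2 / h" .
      from c0(2)[OF h(1) h1 _ _ small[OF h _ this]] eta
      have f1: "c0 * exp ((2 * \<eta> - (5/4) * \<eta>\<^sup>2) * E y - norm y) \<le> Iin h y" by simp
      have f2: "\<eta> * E y \<le> (2 * \<eta> - (5/4) * \<eta>\<^sup>2) * E y"
      proof (rule mult_right_mono[OF _ E0])
        have "\<eta> * \<eta> \<le> (4/5) * \<eta>" using eta by (intro mult_right_mono) auto
        then show "\<eta> \<le> 2 * \<eta> - (5/4) * \<eta>\<^sup>2" by (simp add: power2_eq_square)
      qed
      have f3: "p * (norm y)\<^sup>2 \<le> \<eta> * E y"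
      proof -
        have "p * (norm y)\<^sup>2 = min (3/10) \<eta> * (e1 * (norm y)\<^sup>2)" by (simp add: p_def)
        also have "\<dots> \<le> \<eta> * E y" using e1(2)[of y] e1(1) E0[of y] eta by (intro mult_mono) auto
        finally show ?thesis .
      qed
      have "exp (p * (norm y)\<^sup>2 - norm y) \<le> exp ((2 * \<eta> - (5/4) * \<eta>\<^sup>2) * E y - norm y)"
        unfolding exp_le_cancel_iff using f2 f3 by linarith
      from order_trans[OF mult_left_mono[OF this less_imp_le[OF c0(1)]] f1]
      have "c0 * exp (p * (norm y)\<^sup>2 - norm y) \<le> Iin h y" .
      then have I2: "c0 * exp (p * (norm y)\<^sup>2 - norm y) \<le> ?I" using R by linarith
      have cI: "0 < c0 * exp (p * (norm y)\<^sup>2 - norm y)" using c0 by simp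
      then have I: "0 < ?I" using I2 by linarith
      have "1 / ?I \<le> 1 / (c0 * exp (p * (norm y)\<^sup>2 - norm y))" using I2 cI by (intro frac_le) auto
      also have "\<dots> = (1 / c0) * exp (norm y - p * (norm y)\<^sup>2)"
        using exp_minus[of "p * (norm y)\<^sup>2 - norm y"] by (simp add: divide_inverse)
      finally have 1: "1 / ?I \<le> (1 / c0) * exp (norm y - p * (norm y)\<^sup>2)" .
      have "p * (norm y)\<^sup>2 = min (3/10) \<eta> * (e1 * (norm y)\<^sup>2)" by (simp add: p_def)
      also have "\<dots> \<le> 1 * E y" using e1(2)[of y] e1(1) E0[of y] eta by (intro mult_mono) auto
      finally have "- E y \<le> norm y - p * (norm y)\<^sup>2" using norm_ge_zero[of y] by linarith
      then have 2: "\<kappa> * exp (- E y) \<le> \<kappa> * exp (norm y - p * (norm y)\<^sup>2)" using kappa_pos by simp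
      have "\<bar>1 / ?I - \<kappa> * exp (- E y)\<bar> \<le> 1 / ?I + \<kappa> * exp (- E y)"
        using I kappa_pos by (intro order_trans[OF abs_triangle_ineq4]) simp
      also have "\<dots> \<le> (1 / c0 + \<kappa>) * exp (norm y - p * (norm y)\<^sup>2) * 1"
        using 1 2 by (simp add: distrib_right)
      also have "\<dots> \<le> (1 / c0 + \<kappa>) * exp (norm y - p * (norm y)\<^sup>2) * (h * (1 + norm y) / \<delta>2)"
        using far c0 kappa_pos by (intro mult_left_mono) auto
      also have "\<dots> = k2 * h * ((1 + norm y) * exp (norm y - p * (norm y)\<^sup>2))" by (simp add: k2_def)
      also have "\<dots> \<le> (k1 + k2) * h * ((1 + norm y) * exp (norm y - p * (norm y)\<^sup>2))"
        using k h by (intro mult_right_mono) auto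
      finally show ?thesis .
    qed
    also have "\<dots> \<le> (k1 + k2) * h * (exp (2 / p) * exp (- (p / 2) * (norm y)\<^sup>2))"
      using absorb[OF p, of "norm y"] k h by (intro mult_left_mono) auto
    finally show "\<bar>1 / ?I - \<kappa> * exp (- E y)\<bar> \<le> (k1 + k2) * exp (2 / p) * h * exp (- (p / 2) * (norm y)\<^sup>2)"
      by (simp add: mult_ac)
  qed (use k p h0 in auto)
qed

end

section \<open>From lattice cells to weighted sums\<close>

text \<open>The index of the half-open cell that contains x; coordinatewise rounding sends x to the
  \<open>cellpt\<close> of this index.\<close>

definition cellidx :: "real \<Rightarrow> real^'m::finite \<Rightarrow> real^'m \<Rightarrow> int^'m" where
  "cellidx h c x = (\<chi> j. \<lfloor>x $ j / h + c $ j\<rfloor>)"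

definition cellpt :: "real \<Rightarrow> real^'m::finite \<Rightarrow> int^'m \<Rightarrow> real^'m" where
  "cellpt h c \<alpha> = (\<chi> j. h * (of_int (\<alpha> $ j) - c $ j))"

lemma cw_rnd: "cw (\<lambda>j. rnd h (c $ j)) x = cellpt h c (cellidx h c x)"
  by (simp add: cw_def rnd_def cellpt_def cellidx_def)

lemma cell_indicator:
  assumes h: "0 < h"
  shows "has_bochner_integral lborel (\<lambda>\<xi>::real. if \<lfloor>\<xi> / h + c\<rfloor> = a then 1 else 0 :: complex) (complex_of_real h)"
proof -
  have "(\<lambda>\<xi>::real. if \<lfloor>\<xi> / h + c\<rfloor> = a then 1 else 0 :: complex) = (\<lambda>\<xi>. indicator {h * (of_int a - c)..<h * (of_int a - c) + h} \<xi> *\<^sub>R 1)"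
  proof
    fix \<xi> :: real
    have "\<lfloor>\<xi> / h + c\<rfloor> = a \<longleftrightarrow> of_int a - c \<le> \<xi> / h \<and> \<xi> / h < of_int a - c + 1"
      unfolding floor_eq_iff by linarith
    also have "\<dots> \<longleftrightarrow> (of_int a - c) * h \<le> \<xi> \<and> \<xi> < (of_int a - c + 1) * h"
      using h by (simp only: pos_le_divide_eq pos_divide_less_eq)
    also have "\<dots> \<longleftrightarrow> \<xi> \<in> {h * (of_int a - c)..<h * (of_int a - c) + h}"
      by (simp add: mult.commute[of h] distrib_right)
    finally show "(if \<lfloor>\<xi> / h + c\<rfloor> = a then 1 else 0 :: complex) = indicator {h * (of_int a - c)..<h * (of_int a - c) + h} \<xi> *\<^sub>R 1"
      by simp
  qed
  moreover have "has_bochner_integral lborel (\<lambda>\<xi>. indicator {h * (of_int a - c)..<h * (of_int a - c) + h} \<xi> *\<^sub>R (1::complex)) (measure lborel {h * (of_int a - c)..<h * (of_int a - c) + h} *\<^sub>R 1)"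
    using h by (intro has_bochner_integral_indicator) auto
  ultimately show ?thesis using h by (simp add: scaleR_conv_of_real)
qed

text \<open>Every cell is a product of half-open intervals of length h, so the passage from a
  lattice sum to an integral loses nothing.\<close>

lemma cell_integral:
  fixes \<phi> :: "int^'m::finite \<Rightarrow> complex"
  assumes h: "0 < h" and fin: "finite \<Lambda>"
  shows "has_bochner_integral lborel (\<lambda>x. if cellidx h c x \<in> \<Lambda> then \<phi> (cellidx h c x) else 0) (of_real (h ^ CARD('m)) * (\<Sum>\<alpha>\<in>\<Lambda>. \<phi> \<alpha>))"
proof -
  let ?F = "\<lambda>\<alpha> (j::'m) \<xi>. if \<lfloor>\<xi> / h + c $ j\<rfloor> = \<alpha> $ j then 1 else 0 :: complex"
  have prod: "(\<Prod>j\<in>UNIV. ?F \<alpha> j (x $ j)) = (if cellidx h c x = \<alpha> then 1 else 0)" for \<alpha> x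
    by (auto simp: cellidx_def vec_eq_iff)
  have one: "has_bochner_integral lborel (\<lambda>x. \<phi> \<alpha> * (if cellidx h c x = \<alpha> then 1 else 0)) (\<phi> \<alpha> * complex_of_real (h ^ CARD('m)))" for \<alpha>
    using lint_vec_prod[of "?F \<alpha>"] cell_indicator[OF h]
    by (intro has_bochner_integral_mult_right) (simp add: prod has_bochner_integral_iff)
  have "has_bochner_integral lborel (\<lambda>x. \<Sum>\<alpha>\<in>\<Lambda>. \<phi> \<alpha> * (if cellidx h c x = \<alpha> then 1 else 0)) (\<Sum>\<alpha>\<in>\<Lambda>. \<phi> \<alpha> * complex_of_real (h ^ CARD('m)))"
    by (intro has_bochner_integral_sum one)
  also have "(\<lambda>x. \<Sum>\<alpha>\<in>\<Lambda>. \<phi> \<alpha> * (if cellidx h c x = \<alpha> then 1 else 0)) = (\<lambda>x. if cellidx h c x \<in> \<Lambda> then \<phi> (cellidx h c x) else 0)"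
    using fin by (auto simp: fun_eq_iff if_distrib cong: if_cong)
  finally show ?thesis by (simp add: sum_distrib_right mult.commute)
qed

text \<open>Transfers Gaussian decay from the rounded point to x itself, at the price of half the
  exponent and a constant factor.\<close>

lemma rnd_norm_bound:
  fixes x c :: "real^'m::finite"
  assumes "0 < h" "h \<le> 1"
  shows "(norm x)\<^sup>2 \<le> 2 * (norm (cw (\<lambda>j. rnd h (c $ j)) x))\<^sup>2 + 2 * (CARD('m))\<^sup>2"
proof -
  let ?y = "cw (\<lambda>j. rnd h (c $ j)) x"
  have "norm (x - ?y) \<le> (\<Sum>j\<in>UNIV. \<bar>(x - ?y) $ j\<bar>)" by (rule norm_le_l1_cart)
  also have "\<dots> \<le> (\<Sum>j\<in>(UNIV::'m set). 1)"
    using rounding.near1[OF rounding_rnd[OF assms]] by (intro sum_mono) (simp add: cw_def abs_minus_commute)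
  finally have "norm (x - ?y) \<le> real CARD('m)" by simp
  then have 1: "(norm (x - ?y))\<^sup>2 \<le> (CARD('m))\<^sup>2" using power_mono[of "norm (x - ?y)" "real CARD('m)" 2] by simp
  have "norm x \<le> norm ?y + norm (x - ?y)" using norm_triangle_ineq[of ?y "x - ?y"] by simp
  then have "(norm x)\<^sup>2 \<le> (norm ?y + norm (x - ?y))\<^sup>2" by (intro power_mono) auto
  also have "\<dots> \<le> 2 * (norm ?y)\<^sup>2 + 2 * (norm (x - ?y))\<^sup>2"
    using sum_squares_bound[of "norm ?y" "norm (x - ?y)"] by (simp add: power2_sum)
  finally show ?thesis using 1 by linarith
qed

context laplace
begin

text \<open>The sum is the integral of a step function, compared pointwise with \<kappa> times the
  rounded Gaussian integrand. On \<Lambda> k this is \<open>near\<close>. Off \<Lambda> k the step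
  function is 0 and the Gaussian tail is charged to 1 \<le> h |y| / d, so the distance in
  \<open>far\<close> is traded for a factor h. The rounded integral is then compared with the true
  one by \<open>rs\<close>.\<close>

lemma weighted_sum:
  fixes f :: "real^'m \<Rightarrow> complex" and \<mu> :: "real^'m" and \<Lambda> :: "nat \<Rightarrow> (int^'m) set" and q :: "nat \<Rightarrow> int^'m \<Rightarrow> real"
  assumes fB: "\<And>x. norm (f x) \<le> B" 
    and rs: "\<And>h r. 0 < h \<Longrightarrow> h \<le> 1 \<Longrightarrow> (\<And>j. rounding (r j) h) \<Longrightarrow>
       norm ((LINT x|lborel. complex_of_real (exp (- E (cw r x))) * f (cw r x)) - (LINT x|lborel. complex_of_real (exp (- E x)) * f x)) \<le> C1 * h"
    and int: "\<And>h r. 0 < h \<Longrightarrow> h \<le> 1 \<Longrightarrow> (\<And>j. rounding (r j) h) \<Longrightarrow> integrable lborel (\<lambda>x. complex_of_real (exp (- E (cw r x))) * f (cw r x))"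
    and fin: "\<And>k. finite (\<Lambda> k)" and C: "0 \<le> C" "0 < c" "0 < d" "1 \<le> k0"
    and near: "\<And>k \<alpha>. k0 \<le> k \<Longrightarrow> \<alpha> \<in> \<Lambda> k \<Longrightarrow>
       \<bar>q k \<alpha> - \<kappa> * exp (- E (cellpt (1 / sqrt k) (real k *\<^sub>R \<mu>) \<alpha>))\<bar> \<le> C * (1 / sqrt k) * exp (- c * (norm (cellpt (1 / sqrt k) (real k *\<^sub>R \<mu>) \<alpha>))\<^sup>2)"
    and far: "\<And>k \<alpha>. k0 \<le> k \<Longrightarrow> \<alpha> \<notin> \<Lambda> k \<Longrightarrow> d * sqrt k \<le> norm (cellpt (1 / sqrt k) (real k *\<^sub>R \<mu>) \<alpha>)"
  obtains K where "0 \<le> K" "\<And>k. k0 \<le> k \<Longrightarrow>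
     norm (of_real ((1 / sqrt k) ^ CARD('m)) * (\<Sum>\<alpha>\<in>\<Lambda> k. of_real (q k \<alpha>) * f (cellpt (1 / sqrt k) (real k *\<^sub>R \<mu>) \<alpha>))
        - of_real \<kappa> * (LINT x|lborel. complex_of_real (exp (- E x)) * f x)) \<le> K * (1 / sqrt k)"
proof -
  obtain e1 where e1: "0 < e1" "\<And>y. e1 * (norm y)\<^sup>2 \<le> E y" by (fact E_lower)
  define c' where "c' = min c (e1 / 2)"
  \<comment> \<open>The second summand pays for the lattice points outside \<Lambda> k; exp (2 / e1)
    comes from \<open>absorb\<close>.\<close>
  define C' where "C' = C + \<kappa> * exp (2 / e1) / d"
  have c': "0 < c'" "c' \<le> c" "c' \<le> e1 / 2" using C e1 by (auto simp: c'_def)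
  have C': "0 \<le> C'" "C \<le> C'" "\<kappa> * exp (2 / e1) / d \<le> C'" using C kappa_pos by (auto simp: C'_def)
  have B: "0 \<le> B" using fB[of 0] norm_ge_zero order_trans by blast
  define Z where "Z = sqrt (2 * pi / c') ^ CARD('m)"
  have hb: "has_bochner_integral lborel (\<lambda>x::real^'m. exp (- c' * (x \<bullet> x) / 2)) Z"
    unfolding Z_def using c' nn_integral_gauss_std[OF c'(1), where 'm='m]
    by (intro has_bochner_integral_nn_integral) auto
  define X where "X = exp (c' * (CARD('m))\<^sup>2)"
  have X: "0 \<le> X" by (simp add: X_def)
  have K0: "0 \<le> B * C' * X * Z" using B C' X c' by (simp add: Z_def)
  show thesis
  proof (rule that[of "B * C' * X * Z + \<kappa> * \<bar>C1\<bar>"])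
    fix k :: nat assume k: "k0 \<le> k"
    define h where "h = 1 / sqrt k"
    have k1: "1 \<le> real k" using k C by simp
    have h: "0 < h" "h \<le> 1" using k1 by (auto simp: h_def)
    define c0 where "c0 = real k *\<^sub>R \<mu>"
    let ?r = "\<lambda>j. rnd h (c0 $ j)"
    have r: "rounding (?r j) h" for j by (rule rounding_rnd[OF h])
    let ?y = "cellpt h c0"
    let ?n = "cellidx h c0"
    let ?W = "\<lambda>x. if ?n x \<in> \<Lambda> k then of_real (q k (?n x)) * f (?y (?n x)) else 0"
    let ?V = "\<lambda>x. complex_of_real (exp (- E (cw ?r x))) * f (cw ?r x)"
    have W: "has_bochner_integral lborel ?W (of_real (h ^ CARD('m)) * (\<Sum>\<alpha>\<in>\<Lambda> k. of_real (q k \<alpha>) * f (?y \<alpha>)))"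
      by (rule cell_integral[OF h(1) fin])
    have main: "norm (?W x - of_real \<kappa> * ?V x) \<le> (B * C' * X * h) * exp (- c' * (x \<bullet> x) / 2)" for x
    proof -
      let ?z = "?y (?n x)"
      have decay: "exp (- p * (norm ?z)\<^sup>2) \<le> exp (- c' * (norm ?z)\<^sup>2)" if "c' \<le> p" for p
        using mult_right_mono[OF that, of "(norm ?z)\<^sup>2"] by simp
      have "norm (?W x - of_real \<kappa> * ?V x) \<le> (C' * h * exp (- c' * (norm ?z)\<^sup>2)) * B"
      proof (cases "?n x \<in> \<Lambda> k")
        case True
        have "?W x - of_real \<kappa> * ?V x = of_real (q k (?n x) - \<kappa> * exp (- E ?z)) * f ?z"
          using True by (simp add: cw_rnd algebra_simps)
        then have "norm (?W x - of_real \<kappa> * ?V x) = \<bar>q k (?n x) - \<kappa> * exp (- E ?z)\<bar> * norm (f ?z)"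
          by (simp only: norm_mult norm_of_real)
        also have "\<dots> \<le> (C' * h * exp (- c' * (norm ?z)\<^sup>2)) * B"
        proof (rule mult_mono[OF _ fB])
          have "\<bar>q k (?n x) - \<kappa> * exp (- E ?z)\<bar> \<le> C * h * exp (- c * (norm ?z)\<^sup>2)"
            using near[OF k True] by (simp add: h_def c0_def)
          also have "\<dots> \<le> C' * h * exp (- c' * (norm ?z)\<^sup>2)"
            using C' h C by (intro mult_mono decay c') auto
          finally show "\<bar>q k (?n x) - \<kappa> * exp (- E ?z)\<bar> \<le> C' * h * exp (- c' * (norm ?z)\<^sup>2)" .
        qed (use C' h in auto)
        finally show ?thesis .
      next
        case False
        have "d * sqrt k \<le> norm ?z" using far[OF k False] by (simp add: h_def c0_def)
        then have f1: "1 \<le> h * norm ?z / d" using C k1 by (simp add: h_def field_simps)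
        have "norm (?W x - of_real \<kappa> * ?V x) = (\<kappa> * exp (- E ?z)) * norm (f ?z)"
          using False kappa_pos by (simp add: cw_rnd norm_mult)
        also have "\<dots> \<le> (C' * h * exp (- c' * (norm ?z)\<^sup>2)) * B"
        proof (rule mult_mono[OF _ fB])
          have "\<kappa> * exp (- E ?z) * 1 \<le> \<kappa> * exp (- e1 * (norm ?z)\<^sup>2) * (h * norm ?z / d)"
            using f1 e1(2)[of ?z] kappa_pos by (intro mult_mono) auto
          also have "\<dots> = (\<kappa> / d * h) * (norm ?z * exp (- e1 * (norm ?z)\<^sup>2))" by simp
          also have "\<dots> \<le> (\<kappa> / d * h) * ((1 + norm ?z) * exp (norm ?z - e1 * (norm ?z)\<^sup>2))"
            using kappa_pos C h by (intro mult_left_mono mult_mono) auto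
          also have "\<dots> \<le> (\<kappa> / d * h) * (exp (2 / e1) * exp (- (e1 / 2) * (norm ?z)\<^sup>2))"
            using kappa_pos C h absorb[OF e1(1), of "norm ?z"] by (intro mult_left_mono) auto
          also have "\<dots> = (\<kappa> * exp (2 / e1) / d) * h * exp (- (e1 / 2) * (norm ?z)\<^sup>2)" by simp
          also have "\<dots> \<le> C' * h * exp (- c' * (norm ?z)\<^sup>2)"
            using C' h C kappa_pos by (intro mult_mono decay c') auto
          finally show "\<kappa> * exp (- E ?z) \<le> C' * h * exp (- c' * (norm ?z)\<^sup>2)" by simp
        qed (use C' h in auto)
        finally show ?thesis .
      qed
      also have "\<dots> \<le> (C' * h * (X * exp (- c' * (x \<bullet> x) / 2))) * B"
      proof (intro mult_right_mono mult_left_mono)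
        have "c' * (norm x)\<^sup>2 \<le> c' * (2 * (norm ?z)\<^sup>2 + 2 * (CARD('m))\<^sup>2)"
          using rnd_norm_bound[OF h, of x c0] c' by (intro mult_left_mono) (auto simp: cw_rnd)
        then have "- c' * (norm ?z)\<^sup>2 \<le> c' * (CARD('m))\<^sup>2 + - c' * (x \<bullet> x) / 2"
          by (simp add: dot_square_norm algebra_simps)
        then show "exp (- c' * (norm ?z)\<^sup>2) \<le> X * exp (- c' * (x \<bullet> x) / 2)"
          unfolding X_def exp_add[symmetric] by simp
      qed (use C' h B in auto)
      finally show ?thesis by (simp add: mult_ac)
    qed
    have intV: "integrable lborel ?V" by (rule int[OF h, of ?r, OF r])
    have bint: "integrable lborel (\<lambda>x::real^'m. (B * C' * X * h) * exp (- c' * (x \<bullet> x) / 2))"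
      using hb by (intro integrable_mult_right) (auto simp: has_bochner_integral_iff)
    have "norm (of_real (h ^ CARD('m)) * (\<Sum>\<alpha>\<in>\<Lambda> k. of_real (q k \<alpha>) * f (?y \<alpha>)) - of_real \<kappa> * (LINT x|lborel. ?V x))
      = norm (LINT x|lborel. ?W x - of_real \<kappa> * ?V x)"
      using W intV by (subst Bochner_Integration.integral_diff) (auto simp: has_bochner_integral_iff)
    also have "\<dots> \<le> (LINT x|lborel. (B * C' * X * h) * exp (- c' * ((x::real^'m) \<bullet> x) / 2))"
      by (rule lint_bound[OF bint main])
    also have "\<dots> = B * C' * X * Z * h" using hb by (simp add: has_bochner_integral_iff)
    finally have 1: "norm (of_real (h ^ CARD('m)) * (\<Sum>\<alpha>\<in>\<Lambda> k. of_real (q k \<alpha>) * f (?y \<alpha>)) - of_real \<kappa> * (LINT x|lborel. ?V x)) \<le> B * C' * X * Z * h" .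
    have "norm ((LINT x|lborel. ?V x) - (LINT x|lborel. complex_of_real (exp (- E x)) * f x)) \<le> \<bar>C1\<bar> * h"
      using rs[OF h, of ?r, OF r] h by (elim order_trans) (auto intro: mult_right_mono)
    then have "\<kappa> * norm ((LINT x|lborel. ?V x) - (LINT x|lborel. complex_of_real (exp (- E x)) * f x)) \<le> \<kappa> * (\<bar>C1\<bar> * h)"
      using kappa_pos by (intro mult_left_mono) auto
    then have 2: "norm (of_real \<kappa> * (LINT x|lborel. ?V x) - of_real \<kappa> * (LINT x|lborel. complex_of_real (exp (- E x)) * f x)) \<le> \<kappa> * (\<bar>C1\<bar> * h)"
      unfolding right_diff_distrib[symmetric] norm_mult using kappa_pos by simp
    have "norm (of_real (h ^ CARD('m)) * (\<Sum>\<alpha>\<in>\<Lambda> k. of_real (q k \<alpha>) * f (?y \<alpha>)) - of_real \<kappa> * (LINT x|lborel. complex_of_real (exp (- E x)) * f x)) \<le> B * C' * X * Z * h + \<kappa> * (\<bar>C1\<bar> * h)"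
      by (rule norm_diff_triangle_le[OF 1 2])
    then show "norm (of_real ((1 / sqrt k) ^ CARD('m)) * (\<Sum>\<alpha>\<in>\<Lambda> k. of_real (q k \<alpha>) * f (cellpt (1 / sqrt k) (real k *\<^sub>R \<mu>) \<alpha>))
        - of_real \<kappa> * (LINT x|lborel. complex_of_real (exp (- E x)) * f x)) \<le> (B * C' * X * Z + \<kappa> * \<bar>C1\<bar>) * (1 / sqrt k)"
      unfolding h_def c0_def by (simp only: distrib_right mult.assoc)
  qed (use K0 kappa_pos in simp)
qed

end

lemma norm_ratio_diff_le:
  fixes S I :: complex and T J :: real
  assumes "norm (S - I) \<le> e" "\<bar>T - J\<bar> \<le> e" "J / 2 \<le> T" "0 < J"
  shows "norm (S / of_real T - I / of_real J) \<le> 2 * e * (1 + norm I / J) / J"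
proof -
  have T: "0 < T" using assms by linarith
  have "S / of_real T - I / of_real J = ((S - I) - I / of_real J * of_real (T - J)) / of_real T"
    using T assms(4) by (simp add: field_simps)
  then have "norm (S / of_real T - I / of_real J) = norm ((S - I) - I / of_real J * of_real (T - J)) / T"
    using T by (simp only: norm_divide norm_of_real abs_of_pos)
  also have "\<dots> \<le> (norm (S - I) + norm I / J * \<bar>T - J\<bar>) / T"
    using T assms(4) norm_triangle_ineq4[of "S - I" "I / of_real J * of_real (T - J)"]
    by (intro divide_right_mono) (auto simp only: norm_mult norm_divide norm_of_real abs_of_pos)
  also have "\<dots> \<le> (e + norm I / J * e) / (J / 2)"
    using assms T order_trans[OF abs_ge_zero assms(2)] by (intro frac_le add_mono mult_left_mono) auto
  also have "\<dots> = 2 * e * (1 + norm I / J) / J" using assms(4) by (simp add: field_simps)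
  finally show ?thesis .
qed

context laplace
begin

text \<open>Numerator and denominator are the weighted sums of f and of the function 1, so
  \<open>weighted_sum\<close> applies to both. The common power of h cancels, and the rescaled
  denominator tends to \<kappa> times the Gaussian mass, hence is eventually at least half of
  it.\<close>

lemma clt_abstract:
  fixes f F :: "real^'m \<Rightarrow> complex" and \<mu> :: "real^'m" and \<Lambda> :: "nat \<Rightarrow> (int^'m) set" and q :: "nat \<Rightarrow> int^'m \<Rightarrow> real"
  assumes F: "integrable lborel F" and f: "\<And>x. f x = (LINT t|lborel. F t * exp (- \<i> * complex_of_real (t \<bullet> x)))"
    and G: "\<And>r s. 0 < r \<Longrightarrow> r \<le> s \<Longrightarrow> G s \<le> G r" "integrable lborel (\<lambda>t::real^'m. G (norm t))"
      "AE t in lborel. norm (F t) \<le> G (norm t)"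
    and fin: "\<And>k. finite (\<Lambda> k)" and C: "0 \<le> C" "0 < c" "0 < d" "1 \<le> k0"
    and near: "\<And>k \<alpha>. k0 \<le> k \<Longrightarrow> \<alpha> \<in> \<Lambda> k \<Longrightarrow>
       \<bar>q k \<alpha> - \<kappa> * exp (- E (cellpt (1 / sqrt k) (real k *\<^sub>R \<mu>) \<alpha>))\<bar> \<le> C * (1 / sqrt k) * exp (- c * (norm (cellpt (1 / sqrt k) (real k *\<^sub>R \<mu>) \<alpha>))\<^sup>2)"
    and far: "\<And>k \<alpha>. k0 \<le> k \<Longrightarrow> \<alpha> \<notin> \<Lambda> k \<Longrightarrow> d * sqrt k \<le> norm (cellpt (1 / sqrt k) (real k *\<^sub>R \<mu>) \<alpha>)"
  obtains K where "eventually (\<lambda>k. norm ((\<Sum>\<alpha>\<in>\<Lambda> k. of_real (q k \<alpha>) * f (cellpt (1 / sqrt k) (real k *\<^sub>R \<mu>) \<alpha>)) / of_real (\<Sum>\<alpha>\<in>\<Lambda> k. q k \<alpha>)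
        - (LINT x|lborel. complex_of_real (exp (- E x)) * f x) / of_real (gconst (matrix_inv H) 1)) \<le> K * (1 / sqrt k)) sequentially"
proof -
  have Eq: "exp (- E x) = exp (- ((matrix_inv H *v x) \<bullet> x) / 2)" for x by (simp add: E_def)
  obtain l K g2 where "gauss_mix l K g2 (\<lambda>x. exp (- ((matrix_inv H *v x) \<bullet> x) / 2))"
    by (fact gauss_mix_exists[OF spd_inv[OF H]])
  then interpret M: gauss_mix l K g2 "\<lambda>x. exp (- E x)" by (simp add: Eq[abs_def])
  have "\<exists>C. \<forall>h r. 0 < h \<and> h \<le> 1 \<and> (\<forall>j. rounding (r j) h) \<longrightarrow>
       norm ((LINT x|lborel. complex_of_real (exp (- E (cw r x))) * f (cw r x)) - (LINT x|lborel. complex_of_real (exp (- E x)) * f x)) \<le> C * h"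
    by (rule M.riemann_sum[OF F f G]) blast+
  then obtain C1 where C1: "norm ((LINT x|lborel. complex_of_real (exp (- E (cw r x))) * f (cw r x)) - (LINT x|lborel. complex_of_real (exp (- E x)) * f x)) \<le> C1 * h"
    if "0 < h" "h \<le> 1" "\<And>j. rounding (r j) h" for h r
    by blast
  have "\<exists>C. \<forall>h r. 0 < h \<and> h \<le> 1 \<and> (\<forall>j. rounding (r j) h) \<longrightarrow>
       \<bar>(LINT x|lborel. exp (- E (cw r x))) - (LINT x|lborel. exp (- E x))\<bar> \<le> C * h"
    by (rule M.riemann_sum_1) blast
  then obtain C2 where C2: "\<bar>(LINT x|lborel. exp (- E (cw r x))) - (LINT x|lborel. exp (- E x))\<bar> \<le> C2 * h"
    if "0 < h" "h \<le> 1" "\<And>j. rounding (r j) h" for h r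
    by blast
  have mr: "gauss_mix_rounding l K g2 (\<lambda>x. exp (- E x)) h r" if "\<And>j. rounding (r j) h" for h r
    using that by (intro gauss_mix_rounding.intro M.gauss_mix_axioms gauss_mix_rounding_axioms.intro)
  define N where "N = (LINT t|lborel. norm (F t))"
  have fN: "norm (f x) \<le> N" for x
    unfolding f N_def by (rule lint_bound[OF integrable_norm[OF F]]) (simp add: norm_mult)
  have J: "(LINT x|lborel. exp (- E x)) = gconst (matrix_inv H) 1" "0 < gconst (matrix_inv H) 1"
    using laplace_integral[OF spd_inv[OF H], of 1 0] gconst_pos[OF spd_inv[OF H], of 1] by (auto simp: Eq has_bochner_integral_iff)
  let ?J = "\<kappa> * gconst (matrix_inv H) 1"
  have J0: "0 < ?J" using J kappa_pos by simp
  let ?I = "of_real \<kappa> * (LINT x|lborel. complex_of_real (exp (- E x)) * f x)"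
  obtain K1 where K1: "0 \<le> K1" "\<And>k. k0 \<le> k \<Longrightarrow>
     norm (of_real ((1 / sqrt k) ^ CARD('m)) * (\<Sum>\<alpha>\<in>\<Lambda> k. of_real (q k \<alpha>) * f (cellpt (1 / sqrt k) (real k *\<^sub>R \<mu>) \<alpha>)) - ?I) \<le> K1 * (1 / sqrt k)"
    by (rule weighted_sum[OF fN C1 gauss_mix_rounding.fourier_swap(3)[OF mr F f] fin C near far]) auto
  have rs1: "norm ((LINT x|lborel. complex_of_real (exp (- E (cw r x))) * 1) - (LINT x|lborel. complex_of_real (exp (- E x)) * 1)) \<le> C2 * h"
    if "0 < h" "h \<le> 1" "\<And>j. rounding (r j) h" for h r
    using C2[OF that] by (simp only: mult_1_right integral_complex_of_real of_real_diff[symmetric] norm_of_real)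
  have int1: "integrable lborel (\<lambda>x. complex_of_real (exp (- E (cw r x))) * 1)" if "0 < h" "h \<le> 1" "\<And>j. rounding (r j) h" for h r
    using gauss_mix_rounding.integrable_g'[OF mr[OF that(3)]] by (simp add: complex_of_real_integrable_eq)
  obtain K2 where K2: "0 \<le> K2" "\<And>k. k0 \<le> k \<Longrightarrow>
     norm (of_real ((1 / sqrt k) ^ CARD('m)) * (\<Sum>\<alpha>\<in>\<Lambda> k. of_real (q k \<alpha>) * 1) - of_real \<kappa> * (LINT x|lborel. complex_of_real (exp (- E x)) * 1)) \<le> K2 * (1 / sqrt k)"
    by (rule weighted_sum[where f="\<lambda>_. 1" and B=1, OF _ rs1 int1 fin C near far]) auto
  define K3 where "K3 = K1 + K2"
  have small: "eventually (\<lambda>k. K3 * (1 / sqrt (real k)) \<le> ?J / 2) sequentially"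
  proof -
    have "((\<lambda>k. K3 * (1 / sqrt (real k))) \<longlongrightarrow> K3 * 0) sequentially"
      by (intro tendsto_mult_left tendsto_divide_0[OF tendsto_const]
          filterlim_at_top_imp_at_infinity filterlim_compose[OF sqrt_at_top filterlim_real_sequentially])
    then have "eventually (\<lambda>k. K3 * (1 / sqrt (real k)) < ?J / 2) sequentially"
      using J0 by (intro order_tendstoD(2)) auto
    then show ?thesis by eventually_elim simp
  qed
  show thesis
  proof (rule that[of "2 * K3 * (1 + norm ?I / ?J) / ?J"], use small eventually_ge_at_top[of k0] in eventually_elim)
    case (elim k)
    let ?h = "(1 / sqrt (real k)) ^ CARD('m)"
    let ?S = "\<Sum>\<alpha>\<in>\<Lambda> k. of_real (q k \<alpha>) * f (cellpt (1 / sqrt k) (real k *\<^sub>R \<mu>) \<alpha>)"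
    let ?T = "\<Sum>\<alpha>\<in>\<Lambda> k. q k \<alpha>"
    have k1: "1 \<le> real k" using elim C by simp
    then have h: "0 < ?h" by simp
    have "0 \<le> 1 / sqrt (real k)" by simp
    then have le: "K1 * (1 / sqrt k) \<le> K3 * (1 / sqrt k)" "K2 * (1 / sqrt k) \<le> K3 * (1 / sqrt k)"
      using K1(1) K2(1) by (intro mult_right_mono; simp add: K3_def)+
    have a: "norm (of_real ?h * ?S - ?I) \<le> K3 * (1 / sqrt k)" using K1(2)[OF elim(2)] le by linarith
    have "of_real ?h * (\<Sum>\<alpha>\<in>\<Lambda> k. of_real (q k \<alpha>) * 1) - of_real \<kappa> * (LINT x|lborel. complex_of_real (exp (- E x)) * 1) = complex_of_real (?h * ?T - ?J)"
      by (simp only: mult_1_right integral_complex_of_real J of_real_sum of_real_mult of_real_diff)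
    then have b: "\<bar>?h * ?T - ?J\<bar> \<le> K3 * (1 / sqrt k)" using K2(2)[OF elim(2)] le by (simp only: norm_of_real; linarith)
    have "norm (of_real ?h * ?S / of_real (?h * ?T) - ?I / of_real ?J) \<le> 2 * (K3 * (1 / sqrt k)) * (1 + norm ?I / ?J) / ?J"
      by (rule norm_ratio_diff_le[OF a b _ J0]) (use elim(1) b in linarith)
    moreover have "of_real ?h * ?S / of_real (?h * ?T) = ?S / of_real ?T"
      unfolding of_real_mult by (rule mult_divide_mult_cancel_left) (use h in \<open>simp only: of_real_eq_0_iff; simp\<close>)
    moreover have "?I / of_real ?J = (LINT x|lborel. complex_of_real (exp (- E x)) * f x) / of_real (gconst (matrix_inv H) 1)"
      using kappa_pos by simp
    ultimately show ?case by (simp only: mult_ac times_divide_eq_right times_divide_eq_left)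
  qed
qed

end

section \<open>Calculus of finitely often differentiable maps\<close>

abbreviation fd :: "('a::real_normed_vector \<Rightarrow> 'b::real_normed_vector) \<Rightarrow> 'a \<Rightarrow> 'a \<Rightarrow> 'b" where
  "fd f x \<equiv> frechet_derivative f (at x)"

lemma fd_eq: "(f has_derivative D) (at x) \<Longrightarrow> fd f x = D"
  by (metis frechet_derivative_at)

lemma fd_works: "f differentiable at x \<Longrightarrow> (f has_derivative fd f x) (at x)"
  by (simp add: frechet_derivative_works)

lemma fd_cong:
  assumes "open S" "x \<in> S" "\<And>y. y \<in> S \<Longrightarrow> f y = g y"
  shows "fd f x = fd g x" "f differentiable at x \<longleftrightarrow> g differentiable at x"
proof -
  have "(f has_derivative D) (at x) \<longleftrightarrow> (g has_derivative D) (at x)" for D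
    using has_derivative_transform_within_open[OF _ assms(1,2), of f D UNIV g]
      has_derivative_transform_within_open[OF _ assms(1,2), of g D UNIV f] assms(3) by auto
  then show "fd f x = fd g x" "f differentiable at x \<longleftrightarrow> g differentiable at x"
    by (simp_all add: frechet_derivative_def differentiable_def)
qed

lemma Ck_subset: "Ck_on n S f \<Longrightarrow> T \<subseteq> S \<Longrightarrow> Ck_on n T f"
  by (induction n arbitrary: f) (auto intro: continuous_on_subset)

lemma Ck_cong:
  assumes "open S" "\<And>x. x \<in> S \<Longrightarrow> f x = g x" "Ck_on n S f"
  shows "Ck_on n S g"
  using assms(2,3)
proof (induction n arbitrary: f g)
  case 0 then show ?case by (simp cong: continuous_on_cong)
next
  case (Suc n)
  have d: "fd f x = fd g x" "f differentiable at x \<longleftrightarrow> g differentiable at x" if "x \<in> S" for x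
    using fd_cong[OF assms(1) that, of f g] Suc.prems(1) by auto
  have "Ck_on n S (\<lambda>x. fd g x v)" for v
    by (rule Suc.IH[of "\<lambda>x. fd f x v"]) (use Suc.prems d in auto)
  then show ?case using Suc.prems d by auto
qed

lemma Ck_SucI:
  assumes S: "open S" and "\<And>x. x \<in> S \<Longrightarrow> (f has_derivative D x) (at x)" "\<And>v. Ck_on n S (\<lambda>x. D x v)"
  shows "Ck_on (Suc n) S f"
proof -
  have "Ck_on n S (\<lambda>x. fd f x v)" for v
    by (rule Ck_cong[OF S _ assms(3)[of v]]) (simp add: fd_eq[OF assms(2)])
  then show ?thesis using assms(2) by (auto simp: differentiable_def)
qed

lemma Ck_diff: "Ck_on (Suc n) S f \<Longrightarrow> x \<in> S \<Longrightarrow> (f has_derivative fd f x) (at x)"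
  by (simp add: frechet_derivative_works)

lemma Ck_Suc_D: "Ck_on (Suc n) S f \<Longrightarrow> Ck_on n S f"
proof (induction n arbitrary: f)
  case 0
  then show ?case by (auto intro!: continuous_at_imp_continuous_on differentiable_imp_continuous_within)
next
  case (Suc n) then show ?case by (metis Ck_on.simps(2))
qed

lemma Ck_le: "Ck_on n S f \<Longrightarrow> m \<le> n \<Longrightarrow> Ck_on m S f"
  by (induction n) (metis le_zero_eq, metis Ck_Suc_D le_Suc_eq)

lemma Ck_continuous: "Ck_on n S f \<Longrightarrow> continuous_on S f"
  using Ck_le[of n S f 0] by simp

lemma Ck_fd: "Ck_on (Suc n) S f \<Longrightarrow> Ck_on n S (\<lambda>x. fd f x v)" by simp

lemma Ck_const: "open S \<Longrightarrow> Ck_on n S (\<lambda>_. c)"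
  by (induction n arbitrary: c) (auto intro!: Ck_SucI[where D="\<lambda>_ _. 0"] simp del: Ck_on.simps(2))

lemma Ck_linear: 
  assumes S: "open S" and f: "bounded_linear f" shows "Ck_on n S f"
proof (cases n)
  case 0 then show ?thesis using linear_continuous_on[OF f] by simp
next
  case (Suc k)
  have "Ck_on (Suc k) S f"
  proof (rule Ck_SucI[OF S])
    show "(f has_derivative f) (at x)" for x
      using bounded_linear.has_derivative[OF f has_derivative_ident] by simp
    show "Ck_on k S (\<lambda>x. f v)" for v by (rule Ck_const[OF S])
  qed
  then show ?thesis by (simp only: Suc)
qed

lemma Ck_linear_compose:
  assumes h: "bounded_linear h"
  shows "open S \<Longrightarrow> Ck_on n S f \<Longrightarrow> Ck_on n S (\<lambda>x. h (f x))"
proof (induction n arbitrary: f)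
  case 0 then show ?case using bounded_linear.continuous_on[OF h] by auto
next
  case (Suc n)
  show ?case
    by (rule Ck_SucI[where D="\<lambda>x v. h (fd f x v)"])
      (use Suc in \<open>auto intro!: bounded_linear.has_derivative[OF h] simp: frechet_derivative_works\<close>)
qed

lemma Ck_add: "open S \<Longrightarrow> Ck_on n S f \<Longrightarrow> Ck_on n S g \<Longrightarrow> Ck_on n S (\<lambda>x. f x + g x)"
proof (induction n arbitrary: f g)
  case 0 then show ?case by (auto intro: continuous_intros)
next
  case (Suc n)
  show ?case
    by (rule Ck_SucI[where D="\<lambda>x v. fd f x v + fd g x v"])
      (use Suc in \<open>auto intro!: has_derivative_add simp: frechet_derivative_works\<close>)
qed

lemma Ck_sum: "open S \<Longrightarrow> (\<And>i. i \<in> I \<Longrightarrow> Ck_on n S (f i)) \<Longrightarrow> Ck_on n S (\<lambda>x. \<Sum>i\<in>I. f i x)"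
  by (induction I rule: infinite_finite_induct) (auto intro: Ck_const Ck_add)

lemma Ck_bilinear:
  assumes h: "bounded_bilinear h"
  shows "open S \<Longrightarrow> Ck_on n S f \<Longrightarrow> Ck_on n S g \<Longrightarrow> Ck_on n S (\<lambda>x. h (f x) (g x))"
proof (induction n arbitrary: f g)
  case 0 then show ?case using bounded_bilinear.continuous_on[OF h] by auto
next
  case (Suc n)
  have "Ck_on n S f" "Ck_on n S g" using Suc.prems Ck_Suc_D by blast+
  then show ?case
    by (intro Ck_SucI[where D="\<lambda>x v. h (f x) (fd g x v) + h (fd f x v) (g x)"])
      (use Suc in \<open>auto intro!: bounded_bilinear.FDERIV[OF h] Ck_add simp: frechet_derivative_works\<close>)
qed

lemmas Ck_mult = Ck_bilinear[OF bounded_bilinear_mult]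
lemmas Ck_scaleR = Ck_bilinear[OF bounded_bilinear_scaleR]

lemma Ck_prod: 
  fixes f :: "'i \<Rightarrow> 'a::real_normed_vector \<Rightarrow> 'b::{real_normed_algebra,comm_ring_1}"
  shows "open S \<Longrightarrow> (\<And>i. i \<in> I \<Longrightarrow> Ck_on n S (f i)) \<Longrightarrow> Ck_on n S (\<lambda>x. \<Prod>i\<in>I. f i x)"
  by (induction I rule: infinite_finite_induct) (auto intro: Ck_const Ck_mult)

lemma fd_expand:
  fixes f :: "'a::euclidean_space \<Rightarrow> 'b::real_normed_vector"
  assumes "f differentiable at x"
  shows "fd f x v = (\<Sum>b\<in>Basis. (v \<bullet> b) *\<^sub>R fd f x b)"
proof -
  have "linear (fd f x)" using fd_works[OF assms] by (rule has_derivative_linear)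
  then have "fd f x (\<Sum>b\<in>Basis. (v \<bullet> b) *\<^sub>R b) = (\<Sum>b\<in>Basis. (v \<bullet> b) *\<^sub>R fd f x b)"
    by (simp add: linear_sum linear_scale)
  then show ?thesis by (simp add: euclidean_representation)
qed

text \<open>The derivative \<open>fd f (g x) (fd g x v)\<close> depends on x in two places.
  Expanding the inner vector in the standard basis turns it into a sum of products, to whose factors
  the induction hypothesis and the product rule apply.\<close>

lemma Ck_compose:
  fixes g :: "'a::real_normed_vector \<Rightarrow> 'b::euclidean_space" and f :: "'b \<Rightarrow> 'c::real_normed_vector"
  shows "open S \<Longrightarrow> open T \<Longrightarrow> g ` S \<subseteq> T \<Longrightarrow> Ck_on n T f \<Longrightarrow> Ck_on n S g \<Longrightarrow> Ck_on n S (\<lambda>x. f (g x))"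
proof (induction n arbitrary: f)
  case 0 then show ?case using continuous_on_compose2[of T f S g] by auto
next
  case (Suc n)
  have gn: "Ck_on n S g" using Suc.prems Ck_Suc_D by blast
  show ?case
  proof (rule Ck_SucI[where D="\<lambda>x v. fd f (g x) (fd g x v)"])
    fix x assume "x \<in> S"
    then show "((\<lambda>x. f (g x)) has_derivative (\<lambda>v. fd f (g x) (fd g x v))) (at x)"
      using Suc.prems by (intro has_derivative_compose[of g _ x UNIV f]) (auto simp: frechet_derivative_works)
  next
    fix v
    have "Ck_on n S (\<lambda>x. \<Sum>b\<in>Basis. (fd g x v \<bullet> b) *\<^sub>R fd f (g x) b)"
    proof (intro Ck_sum Ck_scaleR)
      fix b :: 'b assume "b \<in> Basis"
      show "Ck_on n S (\<lambda>x. fd g x v \<bullet> b)"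
        by (rule Ck_linear_compose[OF bounded_linear_inner_left]) (use Suc.prems in auto)
      show "Ck_on n S (\<lambda>x. fd f (g x) b)"
        by (rule Suc.IH) (use Suc.prems gn in auto)
    qed (use Suc.prems in auto)
    then show "Ck_on n S (\<lambda>x. fd f (g x) (fd g x v))"
    proof (rule Ck_cong[rotated 2])
      fix x assume "x \<in> S"
      then have "f differentiable at (g x)" using Suc.prems by auto
      from fd_expand[OF this, of "fd g x v"]
      show "(\<Sum>b\<in>Basis. (fd g x v \<bullet> b) *\<^sub>R fd f (g x) b) = fd f (g x) (fd g x v)" by simp
    qed (use Suc.prems in auto)
  qed (use Suc.prems in auto)
qed

lemma Ck_inverse: "Ck_on n {0<..} (inverse :: real \<Rightarrow> real)"
proof (induction n)
  case 0 then show ?case by (auto intro!: continuous_intros)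
next
  case (Suc n)
  show ?case
  proof (rule Ck_SucI)
    show "(inverse has_derivative (\<lambda>v. (- v) * (inverse x * inverse x))) (at x)" if "x \<in> {0<..}" for x :: real
      using that by (auto intro!: derivative_eq_intros)
    show "Ck_on n {0<..} (\<lambda>x. (- v) * (inverse x * inverse x))" for v :: real
      by (intro Ck_mult Ck_const Suc) auto
  qed simp
qed

lemma Ck_ln: "Ck_on n {0<..} (ln :: real \<Rightarrow> real)"
proof (cases n)
  case 0 then show ?thesis by (auto intro!: continuous_intros)
next
  case (Suc k)
  show ?thesis unfolding Suc
  proof (rule Ck_SucI)
    show "(ln has_derivative (\<lambda>v. inverse x * v)) (at x)" if "x \<in> {0<..}" for x :: real
      using that by (auto intro!: derivative_eq_intros simp: divide_inverse mult.commute)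
    show "Ck_on k {0<..} (\<lambda>x. inverse x * v)" for v :: real
      by (intro Ck_mult Ck_const Ck_inverse) auto
  qed simp
qed

lemma Ck_local:
  assumes "\<And>x. x \<in> S \<Longrightarrow> \<exists>U. open U \<and> x \<in> U \<and> Ck_on n U f"
  shows "Ck_on n S f"
  using assms
proof (induction n arbitrary: f)
  case 0
  have "continuous (at x) f" if "x \<in> S" for x
    using 0[OF that] continuous_on_eq_continuous_at by auto
  then show ?case by (simp add: continuous_at_imp_continuous_on)
next
  case (Suc n)
  have "Ck_on n S (\<lambda>x. fd f x v)" for v
    by (rule Suc.IH) (use Suc.prems in fastforce)
  moreover have "f differentiable at x" if "x \<in> S" for x using Suc.prems[OF that] by auto
  ultimately show ?case by simp
qed

lemma Ck_vec:
  fixes f :: "'a::real_normed_vector \<Rightarrow> 'b::euclidean_space^'n::finite"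
  assumes "open S" "\<And>i. Ck_on n S (\<lambda>x. f x $ i)"
  shows "Ck_on n S f"
proof -
  have lin: "bounded_linear (\<lambda>c::'b. axis i c :: 'b^'n)" for i
    by (rule linear_conv_bounded_linear[THEN iffD1], rule linearI) (auto simp: axis_def vec_eq_iff)
  have "Ck_on n S (\<lambda>x. \<Sum>i\<in>UNIV. axis i (f x $ i))"
    by (intro Ck_sum Ck_linear_compose[OF lin] assms)
  moreover have "(\<Sum>i\<in>UNIV. axis i (f x $ i)) = f x" for x
    by (auto simp: vec_eq_iff axis_def if_distrib cong: if_cong)
  ultimately show ?thesis by simp
qed

lemma Ck1_lipschitz:
  fixes f :: "'a::euclidean_space \<Rightarrow> 'b::real_normed_vector"
  assumes "open S" "x0 \<in> S" "Ck_on 1 S f"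
  obtains \<epsilon> C where "0 < \<epsilon>" "0 \<le> C" "cball x0 \<epsilon> \<subseteq> S" "\<And>x y. x \<in> cball x0 \<epsilon> \<Longrightarrow> y \<in> cball x0 \<epsilon> \<Longrightarrow> norm (f x - f y) \<le> C * norm (x - y)"
proof -
  obtain \<epsilon> where e: "0 < \<epsilon>" "cball x0 \<epsilon> \<subseteq> S" using assms open_contains_cball by blast
  have "\<exists>K\<ge>0. \<forall>x\<in>cball x0 \<epsilon>. norm (fd f x b) \<le> K" for b
  proof -
    have "continuous_on (cball x0 \<epsilon>) (\<lambda>x. fd f x b)"
      using continuous_on_subset[OF Ck_continuous[OF Ck_fd[of 0 S f b]] e(2)] assms(3) by (simp only: One_nat_def)
    then have "bounded ((\<lambda>x. fd f x b) ` cball x0 \<epsilon>)"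
      by (intro compact_imp_bounded compact_continuous_image) auto
    then show ?thesis unfolding bounded_pos by (metis imageI less_imp_le)
  qed
  then obtain K where K: "\<And>b. 0 \<le> K b" "\<And>b x. x \<in> cball x0 \<epsilon> \<Longrightarrow> norm (fd f x b) \<le> K b" by metis
  have "norm (f x - f y) \<le> (\<Sum>b\<in>Basis. K b) * norm (x - y)" if "x \<in> cball x0 \<epsilon>" "y \<in> cball x0 \<epsilon>" for x y
  proof (rule differentiable_bound[of "cball x0 \<epsilon>" f "fd f"])
    fix x assume x: "x \<in> cball x0 \<epsilon>"
    then have d: "f differentiable at x" using assms e by auto
    show "(f has_derivative fd f x) (at x within cball x0 \<epsilon>)"
      using fd_works[OF d] by (rule has_derivative_at_withinI)
    show "onorm (fd f x) \<le> (\<Sum>b\<in>Basis. K b)"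
    proof (rule onorm_bound)
      show "0 \<le> (\<Sum>b\<in>Basis. K b)" by (intro sum_nonneg K)
      show "norm (fd f x v) \<le> (\<Sum>b\<in>Basis. K b) * norm v" for v
      proof -
        have "norm (fd f x v) \<le> (\<Sum>b\<in>Basis. norm ((v \<bullet> b) *\<^sub>R fd f x b))"
          unfolding fd_expand[OF d, of v] by (rule norm_sum)
        also have "\<dots> \<le> (\<Sum>b\<in>Basis. norm v * K b)"
          using K x Basis_le_norm by (intro sum_mono) (auto intro!: mult_mono)
        finally show ?thesis by (simp add: sum_distrib_left mult.commute)
      qed
    qed
  qed (use that in auto)
  then show thesis using that[of \<epsilon> "\<Sum>b\<in>Basis. K b"] e K by (simp add: sum_nonneg)
qed

section \<open>Holomorphic maps are smooth\<close>

lemma holo_subset: "holo_on S f \<Longrightarrow> T \<subseteq> S \<Longrightarrow> holo_on T f"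
  by (auto simp: holo_on_def)

lemma holo_fd_works: "holo_on S f \<Longrightarrow> x \<in> S \<Longrightarrow> (f has_derivative fd f x) (at x)"
  unfolding holo_on_def by (metis fd_eq)

lemma holo_fd_imult: "holo_on S f \<Longrightarrow> x \<in> S \<Longrightarrow> fd f x (imult v) = imult (fd f x v)"
  unfolding holo_on_def by (metis fd_eq)

lemma holo_compose:
  assumes "holo_on S g" "holo_on T f" "g ` S \<subseteq> T"
  shows "holo_on S (\<lambda>x. f (g x))"
  unfolding holo_on_def
proof
  fix x assume x: "x \<in> S"
  then have gx: "g x \<in> T" using assms by auto
  show "\<exists>D. ((\<lambda>x. f (g x)) has_derivative D) (at x) \<and> (\<forall>v. D (imult v) = imult (D v))"
    by (rule exI[of _ "\<lambda>v. fd f (g x) (fd g x v)"])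
      (auto intro!: has_derivative_compose[of g _ x UNIV f] holo_fd_works[OF assms(1) x] holo_fd_works[OF assms(2) gx]
         simp: holo_fd_imult[OF assms(1) x] holo_fd_imult[OF assms(2) gx])
qed

lemma holo_continuous: "holo_on S f \<Longrightarrow> continuous_on S f"
  using holo_fd_works by (metis continuous_at_imp_continuous_on has_derivative_continuous)

lemma holo_vec_nth:
  fixes f :: "'a::complex_structure \<Rightarrow> complex^'m::finite"
  assumes "holo_on S f" shows "holo_on S (\<lambda>x. f x $ i)"
  unfolding holo_on_def
proof
  fix x assume x: "x \<in> S"
  show "\<exists>D. ((\<lambda>x. f x $ i) has_derivative D) (at x) \<and> (\<forall>v. D (imult v) = imult (D v))"
    by (rule exI[of _ "\<lambda>v. fd f x v $ i"])
      (use bounded_linear.has_derivative[OF bounded_linear_vec_nth[of i] holo_fd_works[OF assms x]] in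
        \<open>auto simp: holo_fd_imult[OF assms x] imult_vec_def\<close>)
qed

lemma bounded_linear_axis: "bounded_linear (\<lambda>c::'b::euclidean_space. axis i c :: 'b^'n::finite)"
  by (rule linear_conv_bounded_linear[THEN iffD1], rule linearI) (auto simp: axis_def vec_eq_iff)

lemma holo_vec:
  fixes f :: "'a::complex_structure \<Rightarrow> complex^'m::finite"
  assumes "\<And>i. holo_on S (\<lambda>x. f x $ i)" shows "holo_on S f"
  unfolding holo_on_def
proof
  fix x assume x: "x \<in> S"
  have eq: "(\<lambda>x. \<Sum>i\<in>UNIV. axis i (f x $ i)) = f"
    by (auto simp: vec_eq_iff axis_def fun_eq_iff if_distrib cong: if_cong)
  have "((\<lambda>x. \<Sum>i\<in>UNIV. axis i (f x $ i)) has_derivative (\<lambda>v. \<Sum>i\<in>UNIV. axis i (fd (\<lambda>x. f x $ i) x v))) (at x)"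
    by (intro has_derivative_sum bounded_linear.has_derivative[OF bounded_linear_axis] holo_fd_works[OF assms x])
  moreover have "(\<Sum>i\<in>UNIV. axis i (fd (\<lambda>x. f x $ i) x (imult v))) = imult (\<Sum>i\<in>UNIV. axis i (fd (\<lambda>x. f x $ i) x v) :: complex^'m)" for v
    by (simp add: holo_fd_imult[OF assms x] imult_vec_def vec_eq_iff axis_def if_distrib cong: if_cong)
  ultimately show "\<exists>D. (f has_derivative D) (at x) \<and> (\<forall>v. D (imult v) = imult (D v))"
    unfolding eq by blast
qed

text \<open>Multiplication by a complex scalar, recovered from \<open>imult\<close>.\<close>

definition cscale :: "complex \<Rightarrow> 'a::complex_structure \<Rightarrow> 'a" where
  "cscale z v = Re z *\<^sub>R v + Im z *\<^sub>R imult v"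

lemma cscale_norm: "norm (cscale z v) \<le> norm z * (norm v + norm (imult v))"
proof -
  have "norm (cscale z v) \<le> \<bar>Re z\<bar> * norm v + \<bar>Im z\<bar> * norm (imult v)"
    unfolding cscale_def by (rule order_trans[OF norm_triangle_ineq]) simp
  also have "\<dots> \<le> norm z * norm v + norm z * norm (imult v)"
    by (intro add_mono mult_right_mono abs_Re_le_cmod abs_Im_le_cmod) auto
  finally show ?thesis by (simp add: distrib_left)
qed

lemma cscale_bounded_linear: "bounded_linear (\<lambda>z. cscale z v)"
proof (rule bounded_linear_intro)
  show "norm (cscale z v) \<le> norm z * (norm v + norm (imult v))" for z by (rule cscale_norm)
qed (auto simp: cscale_def algebra_simps)

lemma cscale_apply:
  fixes D :: "'a::complex_structure \<Rightarrow> complex"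
  assumes "linear D" "\<And>v. D (imult v) = imult (D v)"
  shows "D (cscale w v) = D v * w"
  by (simp add: cscale_def linear_add[OF assms(1)] linear_scale[OF assms(1)] assms(2) imult_complex_def complex_eq_iff algebra_simps)

lemma has_integral_mult_cancel:
  fixes g :: "real \<Rightarrow> complex"
  assumes "((\<lambda>t. c * g t) has_integral c * I) S" "c \<noteq> 0" shows "(g has_integral I) S"
  using has_integral_mult_right[OF assms(1), of "inverse c"] assms(2) by (simp add: mult.assoc[symmetric])

text \<open>\<open>holo_on\<close> provides a complex linear derivative at each point, but no
  continuity of it. On the complex line x + z v the function is holomorphic in the one variable z,
  and Cauchy's formula expresses the derivative through values of f on a circle.\<close>

lemma holo_cauchy_fd:
  fixes f :: "'a::complex_structure \<Rightarrow> complex"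
  assumes f: "holo_on S f" and e: "0 < \<epsilon>" and sub: "\<And>z. norm z \<le> \<epsilon> \<Longrightarrow> x + cscale z v \<in> S"
  shows "fd f x v = integral (cbox 0 1) (\<lambda>t. f (x + cscale (\<epsilon> * exp (2 * of_real pi * \<i> * of_real t)) v) * (exp (- (2 * of_real pi * \<i> * of_real t)) / \<epsilon>))"
proof -
  let ?u = "\<lambda>z. f (x + cscale z v)"
  have der: "(?u has_field_derivative fd f (x + cscale z v) v) (at z)" if z: "norm z \<le> \<epsilon>" for z
  proof -
    have "((\<lambda>z. x + cscale z v) has_derivative (\<lambda>w. cscale w v)) (at z)"
      using has_derivative_add[OF has_derivative_const bounded_linear.has_derivative[OF cscale_bounded_linear has_derivative_ident]] by simp
    from has_derivative_compose[OF this holo_fd_works[OF f sub[OF z]]]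
    have "(?u has_derivative (\<lambda>w. fd f (x + cscale z v) (cscale w v))) (at z)" .
    moreover have "fd f (x + cscale z v) (cscale w v) = fd f (x + cscale z v) v * w" for w
      by (rule cscale_apply[OF has_derivative_linear[OF holo_fd_works[OF f sub[OF z]]] holo_fd_imult[OF f sub[OF z]]])
    ultimately show ?thesis by (simp add: has_field_derivative_def)
  qed
  have hol: "?u holomorphic_on ball 0 \<epsilon>"
  proof (rule holomorphic_onI)
    fix z :: complex assume "z \<in> ball 0 \<epsilon>"
    then have "norm z \<le> \<epsilon>" by simp
    from has_field_derivative_at_within[OF der[OF this]]
    show "?u field_differentiable at z within ball 0 \<epsilon>" by (auto simp: field_differentiable_def)
  qed
  have cont: "continuous_on (cball 0 \<epsilon>) ?u"
    by (intro continuous_at_imp_continuous_on ballI DERIV_isCont[OF der]) auto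
  have "((\<lambda>w. ?u w / (w - 0)^(Suc 1)) has_contour_integral ((2 * pi * \<i>) / (fact 1) * (deriv ^^ 1) ?u 0)) (circlepath 0 \<epsilon>)"
    using e by (intro Cauchy_has_contour_integral_higher_derivative_circlepath[OF cont hol]) auto
  moreover have "deriv ?u 0 = fd f x v" using DERIV_imp_deriv[OF der[of 0]] e by (simp add: cscale_def)
  ultimately have "((\<lambda>t. ?u (circlepath 0 \<epsilon> t) / (circlepath 0 \<epsilon> t)\<^sup>2 * vector_derivative (circlepath 0 \<epsilon>) (at t within {0..1})) has_integral (2 * pi * \<i> * fd f x v)) {0..1}"
    by (simp add: has_contour_integral_def power2_eq_square)
  then have "((\<lambda>t. (2 * pi * \<i>) * (?u (\<epsilon> * exp (2 * of_real pi * \<i> * of_real t)) * (exp (- (2 * of_real pi * \<i> * of_real t)) / \<epsilon>))) has_integral (2 * pi * \<i> * fd f x v)) {0..1}"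
  proof (rule has_integral_eq[rotated])
    fix t :: real assume t: "t \<in> {0..1}"
    have "circlepath 0 \<epsilon> t = \<epsilon> * exp (2 * of_real pi * \<i> * of_real t)" by (simp add: circlepath)
    moreover have "vector_derivative (circlepath 0 \<epsilon>) (at t within {0..1}) = 2 * pi * \<i> * \<epsilon> * exp (2 * of_real pi * \<i> * t)"
      using t by (intro vector_derivative_circlepath01) auto
    ultimately show "?u (circlepath 0 \<epsilon> t) / (circlepath 0 \<epsilon> t)\<^sup>2 * vector_derivative (circlepath 0 \<epsilon>) (at t within {0..1})
       = (2 * pi * \<i>) * (?u (\<epsilon> * exp (2 * of_real pi * \<i> * of_real t)) * (exp (- (2 * of_real pi * \<i> * of_real t)) / \<epsilon>))"
      using e by (simp add: exp_minus field_simps power2_eq_square)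
  qed
  then have "((\<lambda>t. ?u (\<epsilon> * exp (2 * of_real pi * \<i> * of_real t)) * (exp (- (2 * of_real pi * \<i> * of_real t)) / \<epsilon>)) has_integral fd f x v) {0..1}"
    by (rule has_integral_mult_cancel) simp
  then show ?thesis unfolding cbox_interval by (rule integral_unique[symmetric])
qed

lemma small_scale:
  fixes v :: "'a::complex_structure"
  assumes "0 < r" obtains \<epsilon> where "0 < \<epsilon>" "\<And>z. norm z \<le> \<epsilon> \<Longrightarrow> norm (cscale z v) < r"
proof
  let ?k = "norm v + norm (imult v) + 1"
  have k: "0 < ?k" by (intro add_nonneg_pos) auto
  show "0 < r / ?k" using assms k by simp
  fix z :: complex assume z: "norm z \<le> r / ?k"
  have "norm (cscale z v) \<le> norm z * (norm v + norm (imult v))" by (rule cscale_norm)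
  also have "\<dots> \<le> (r / ?k) * (norm v + norm (imult v))" using z by (intro mult_right_mono) auto
  also have "\<dots> < (r / ?k) * ?k" using assms k by (intro mult_strict_left_mono) auto
  also have "\<dots> = r" using k by (simp del: add_nonneg_pos)
  finally show "norm (cscale z v) < r" .
qed

lemma cauchy_kernel_continuous:
  fixes v :: "'a::complex_structure"
  shows "continuous_on X (\<lambda>t. cscale (\<epsilon> * exp (2 * of_real pi * \<i> * of_real t)) v)"
  by (intro bounded_linear.continuous_on[OF cscale_bounded_linear] continuous_intros)

text \<open>One radius serves a whole ball of base points, and over it the circle integral depends
  continuously on x.\<close>

lemma holo_fd_continuous:
  fixes f :: "'a::complex_structure \<Rightarrow> complex"
  assumes S: "open S" and f: "holo_on S f"
  shows "continuous_on S (\<lambda>x. fd f x v)"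
proof (rule continuous_at_imp_continuous_on, rule ballI)
  fix x0 assume "x0 \<in> S"
  then obtain r where r: "0 < r" "ball x0 r \<subseteq> S" using S open_contains_ball by blast
  obtain \<epsilon> where e: "0 < \<epsilon>" "\<And>z. norm z \<le> \<epsilon> \<Longrightarrow> norm (cscale z v) < r / 2" using small_scale[of "r/2" v] r by auto
  let ?U = "ball x0 (r / 2)"
  have sub: "x + cscale z v \<in> S" if "x \<in> ?U" "norm z \<le> \<epsilon>" for x z
  proof -
    have "dist x0 (x + cscale z v) \<le> dist x0 x + norm (cscale z v)"
      by (metis add.commute add_diff_cancel_left' dist_norm dist_triangle norm_minus_commute)
    also have "\<dots> < r" using that e(2)[OF that(2)] by simp
    finally show ?thesis using r by auto
  qed
  have n: "norm (\<epsilon> * exp (2 * of_real pi * \<i> * of_real t)) \<le> \<epsilon>" for t :: real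
    using e by (simp add: norm_mult)
  have "continuous_on ?U (\<lambda>x. integral (cbox 0 1) (\<lambda>t. f (x + cscale (\<epsilon> * exp (2 * of_real pi * \<i> * of_real t)) v) * (exp (- (2 * of_real pi * \<i> * of_real t)) / \<epsilon>)))"
  proof (rule integral_continuous_on_param)
    show "continuous_on (?U \<times> cbox 0 1) (\<lambda>(x, t). f (x + cscale (\<epsilon> * exp (2 * of_real pi * \<i> * of_real t)) v) * (exp (- (2 * of_real pi * \<i> * of_real t)) / \<epsilon>))"
      unfolding split_beta
    proof (intro continuous_on_mult continuous_on_compose2[OF holo_continuous[OF f]])
      show "continuous_on (?U \<times> cbox 0 1) (\<lambda>p. fst p + cscale (\<epsilon> * exp (2 * of_real pi * \<i> * of_real (snd p))) v)"
        by (intro continuous_on_add continuous_on_fst continuous_on_id bounded_linear.continuous_on[OF cscale_bounded_linear] continuous_intros)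
      show "continuous_on (?U \<times> cbox (0::real) 1) (\<lambda>p. exp (- (2 * of_real pi * \<i> * of_real (snd p))) / complex_of_real \<epsilon>)"
        using e by (intro continuous_intros) auto
    qed (use sub n in auto)
  qed
  then have "continuous_on ?U (\<lambda>x. fd f x v)"
  proof (rule continuous_on_eq)
    fix x assume "x \<in> ?U"
    from holo_cauchy_fd[OF f e(1) sub[OF this]]
    show "integral (cbox 0 1) (\<lambda>t. f (x + cscale (\<epsilon> * exp (2 * of_real pi * \<i> * of_real t)) v) * (exp (- (2 * of_real pi * \<i> * of_real t)) / \<epsilon>)) = fd f x v"
      by (rule sym)
  qed
  then show "continuous (at x0) (\<lambda>x. fd f x v)"
    using r by (simp add: continuous_on_eq_continuous_at)
qed

text \<open>Differentiate the circle integral under the integral sign. The derivatives of the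
  integrand form a continuous family of bounded linear maps by \<open>holo_fd_continuous\<close>,
  and complex linearity survives integration.\<close>

lemma holo_fd:
  fixes f :: "'a::{complex_structure,euclidean_space} \<Rightarrow> complex"
  assumes S: "open S" and f: "holo_on S f"
  shows "holo_on S (\<lambda>x. fd f x v)"
  unfolding holo_on_def
proof
  fix x0 assume "x0 \<in> S"
  then obtain r where r: "0 < r" "ball x0 r \<subseteq> S" using S open_contains_ball by blast
  obtain \<epsilon> where e: "0 < \<epsilon>" "\<And>z. norm z \<le> \<epsilon> \<Longrightarrow> norm (cscale z v) < r / 2" using small_scale[of "r/2" v] r by auto
  let ?U = "ball x0 (r / 2)"
  have sub: "x + cscale z v \<in> S" if "x \<in> ?U" "norm z \<le> \<epsilon>" for x z
  proof -
    have "dist x0 (x + cscale z v) \<le> dist x0 x + norm (cscale z v)"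
      by (metis add.commute add_diff_cancel_left' dist_norm dist_triangle norm_minus_commute)
    also have "\<dots> < r" using that e(2)[OF that(2)] by simp
    finally show ?thesis using r by auto
  qed
  have n: "norm (\<epsilon> * exp (2 * of_real pi * \<i> * of_real t)) \<le> \<epsilon>" for t :: real
    using e by (simp add: norm_mult)
  let ?c = "\<lambda>t::real. cscale (\<epsilon> * exp (2 * of_real pi * \<i> * of_real t)) v"
  let ?k = "\<lambda>t::real. exp (- (2 * of_real pi * \<i> * of_real t)) / complex_of_real \<epsilon>"
  have inS: "x + ?c t \<in> S" if "x \<in> ?U" for x t using sub[OF that n] .
  have bl: "bounded_linear (\<lambda>w. fd f (x + ?c t) w * ?k t)" if "x \<in> ?U" for x t
    by (intro bounded_linear_mult_const has_derivative_bounded_linear[OF holo_fd_works[OF f inS[OF that]]])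
  define fx where "fx x t = Blinfun (\<lambda>w. fd f (x + ?c t) w * ?k t)" for x t
  have fx: "blinfun_apply (fx x t) = (\<lambda>w. fd f (x + ?c t) w * ?k t)" if "x \<in> ?U" for x t
    unfolding fx_def by (rule bounded_linear_Blinfun_apply[OF bl[OF that]])
  have x0U: "x0 \<in> ?U" using r by simp
  have pc: "continuous_on (?U \<times> cbox (0::real) 1) (\<lambda>p. fst p + ?c (snd p))"
    by (intro continuous_on_add continuous_on_fst continuous_on_id bounded_linear.continuous_on[OF cscale_bounded_linear] continuous_intros)
  have kc: "continuous_on X (\<lambda>p. ?k (snd p))" for X :: "('a \<times> real) set" using e by (intro continuous_intros) auto
  have cont_fx: "continuous_on (?U \<times> cbox 0 1) (\<lambda>(x, t). fx x t)"
    unfolding split_beta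
  proof (rule continuous_on_blinfun_componentwise)
    fix b :: 'a assume "b \<in> Basis"
    have "continuous_on (?U \<times> cbox (0::real) 1) (\<lambda>p. fd f (fst p + ?c (snd p)) b * ?k (snd p))"
      by (intro continuous_on_mult continuous_on_compose2[OF holo_fd_continuous[OF S f] pc] kc) (use inS in auto)
    then show "continuous_on (?U \<times> cbox 0 1) (\<lambda>p. blinfun_apply (fx (fst p) (snd p)) b)"
      by (rule continuous_on_eq) (auto simp: fx)
  qed
  have "((\<lambda>x. integral (cbox 0 1) (\<lambda>t. f (x + ?c t) * ?k t)) has_derivative integral (cbox 0 1) (fx x0)) (at x0 within ?U)"
  proof (rule leibniz_rule[OF _ _ cont_fx x0U])
    fix x t assume x: "x \<in> ?U" and "t \<in> cbox (0::real) 1"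
    have "((\<lambda>x. x + ?c t) has_derivative (\<lambda>w. w)) (at x within ?U)"
      by (auto intro!: derivative_eq_intros)
    from has_derivative_compose[OF this holo_fd_works[OF f inS[OF x]]]
    have "((\<lambda>x. f (x + ?c t)) has_derivative (\<lambda>w. fd f (x + ?c t) w)) (at x within ?U)" .
    from has_derivative_mult_left[OF this, of "?k t"]
    show "((\<lambda>x. f (x + ?c t) * ?k t) has_derivative blinfun_apply (fx x t)) (at x within ?U)"
      by (simp add: fx[OF x])
  next
    fix x assume x: "x \<in> ?U"
    have "continuous_on (cbox (0::real) 1) (\<lambda>t. f (x + ?c t) * ?k t)"
      using e by (intro continuous_on_mult continuous_on_compose2[OF holo_continuous[OF f]] continuous_on_add continuous_on_const cauchy_kernel_continuous)
        (use inS[OF x] in \<open>auto intro!: continuous_intros\<close>)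
    then show "(\<lambda>t. f (x + ?c t) * ?k t) integrable_on cbox 0 1" by (rule integrable_continuous)
  qed auto
  then have 1: "((\<lambda>x. integral (cbox 0 1) (\<lambda>t. f (x + ?c t) * ?k t)) has_derivative blinfun_apply (integral (cbox 0 1) (fx x0))) (at x0)"
    using x0U by (simp add: at_within_open[of x0 ?U])
  have 2: "((\<lambda>x. fd f x v) has_derivative blinfun_apply (integral (cbox 0 1) (fx x0))) (at x0)"
  proof (rule has_derivative_transform_within_open[OF 1 _ x0U])
    fix x assume "x \<in> ?U"
    from holo_cauchy_fd[OF f e(1) sub[OF this]]
    show "integral (cbox 0 1) (\<lambda>t. f (x + ?c t) * ?k t) = fd f x v" by (rule sym)
  qed simp
  have int: "fx x0 integrable_on cbox 0 1"
  proof (rule integrable_continuous)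
    have "continuous_on (cbox 0 1) (\<lambda>t. (case (x0, t) of (x, t) \<Rightarrow> fx x t))"
      by (rule continuous_on_compose2[OF cont_fx]) (use x0U in \<open>auto intro!: continuous_intros\<close>)
    then show "continuous_on (cbox 0 1) (fx x0)" by simp
  qed
  have "blinfun_apply (integral (cbox 0 1) (fx x0)) (imult w) = imult (blinfun_apply (integral (cbox 0 1) (fx x0)) w)" for w
  proof -
    have "blinfun_apply (integral (cbox 0 1) (fx x0)) (imult w) = integral (cbox 0 1) (\<lambda>t. \<i> * blinfun_apply (fx x0 t) w)"
    proof -
      have "fd f (x0 + ?c t) (imult w) * ?k t = \<i> * (fd f (x0 + ?c t) w * ?k t)" for t
        by (subst holo_fd_imult[OF f inS[OF x0U]]) (simp only: imult_complex_def mult.assoc)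
      then show ?thesis unfolding blinfun_apply_integral[OF int] fx[OF x0U] by (simp only:)
    qed
    also have "\<dots> = imult (blinfun_apply (integral (cbox 0 1) (fx x0)) w)"
      unfolding blinfun_apply_integral[OF int] by (simp add: imult_complex_def)
    finally show ?thesis .
  qed
  with 2 show "\<exists>D. ((\<lambda>x. fd f x v) has_derivative D) (at x0) \<and> (\<forall>v. D (imult v) = imult (D v))" by blast
qed

text \<open>\<open>holo_fd\<close> reproduces the hypothesis for the derivative in any fixed
  direction, so it can be iterated.\<close>

lemma holo_Ck:
  fixes f :: "'a::{complex_structure,euclidean_space} \<Rightarrow> complex"
  shows "open S \<Longrightarrow> holo_on S f \<Longrightarrow> Ck_on n S f"
proof (induction n arbitrary: f)
  case 0 then show ?case by (simp add: holo_continuous)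
next
  case (Suc n)
  then show ?case using holo_fd_works[OF Suc.prems(2)] holo_fd[OF Suc.prems] by (auto simp: differentiable_def)
qed

lemma holo_Ck_vec:
  fixes f :: "'a::{complex_structure,euclidean_space} \<Rightarrow> complex^'m::finite"
  shows "open S \<Longrightarrow> holo_on S f \<Longrightarrow> Ck_on n S f"
  by (intro Ck_vec holo_Ck holo_vec_nth)

lemma fd_vec_nth:
  fixes f :: "'a::real_normed_vector \<Rightarrow> 'b::real_normed_vector^'m::finite"
  assumes "f differentiable at x"
  shows "fd (\<lambda>x. f x $ i) x v = fd f x v $ i"
  using fd_eq[OF bounded_linear.has_derivative[OF bounded_linear_vec_nth[of i] fd_works[OF assms]]] by simp

lemma holo_fd_vec:
  fixes f :: "'a::{complex_structure,euclidean_space} \<Rightarrow> complex^'m::finite"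
  assumes S: "open S" and f: "holo_on S f"
  shows "holo_on S (\<lambda>x. fd f x v)"
proof (rule holo_vec)
  fix i
  have d: "f differentiable at x" if "x \<in> S" for x using holo_fd_works[OF f that] by (auto simp: differentiable_def)
  have "holo_on S (\<lambda>x. fd (\<lambda>x. f x $ i) x v)" by (rule holo_fd[OF S holo_vec_nth[OF f]])
  then show "holo_on S (\<lambda>x. fd f x v $ i)"
    unfolding holo_on_def
    using has_derivative_transform_within_open[OF _ S] fd_vec_nth[OF d] by (metis (no_types, lifting))
qed

section \<open>Logarithmic coordinates on the open orbit\<close>

definition cexp :: "complex^'m::finite \<Rightarrow> complex^'m" where "cexp \<zeta> = (\<chi> a. exp (\<zeta> $ a))"
text \<open>In the convention z = exp (\<rho>/2 + i \<theta>), \<open>rc\<close> embeds \<rho> as a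
  logarithm of the point with angle 0, and \<open>rl\<close> reads \<rho> = log |z|^2 off \<zeta> =
  log z.\<close>

definition rc :: "real^'m::finite \<Rightarrow> complex^'m" where "rc \<rho> = (\<chi> a. complex_of_real (\<rho> $ a / 2))"
definition rl :: "complex^'m::finite \<Rightarrow> real^'m" where "rl \<zeta> = (\<chi> a. 2 * Re (\<zeta> $ a))"

lemma cexp_ctorus: "cexp \<zeta> \<in> ctorus" by (simp add: cexp_def ctorus_def)
lemma cexp_add: "cexp (\<zeta> + \<eta>) = cexp \<zeta> * cexp \<eta>" by (simp add: cexp_def vec_eq_iff exp_add)
lemma cexp_surj: assumes "z \<in> ctorus" shows "cexp (\<chi> a. Ln (z $ a)) = z"
  using assms by (simp add: cexp_def ctorus_def vec_eq_iff)

lemma linear_rc: "bounded_linear rc"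
  by (rule linear_conv_bounded_linear[THEN iffD1], rule linearI)
    (auto simp: rc_def vec_eq_iff complex_eq_iff add_divide_distrib)
lemma linear_rl: "bounded_linear rl"
  by (rule linear_conv_bounded_linear[THEN iffD1], rule linearI) (auto simp: rl_def vec_eq_iff algebra_simps)
lemma rl_rc [simp]: "rl (rc \<rho>) = \<rho>" by (simp add: rl_def rc_def vec_eq_iff)
lemma rl_imult_rc [simp]: "rl (imult (rc \<rho>)) = 0" by (simp add: rl_def rc_def vec_eq_iff imult_vec_def imult_complex_def)

lemma holo_cexp: "holo_on UNIV (cexp :: complex^'m::finite \<Rightarrow> complex^'m)"
proof (rule holo_vec)
  fix i :: 'm
  have "((\<lambda>\<zeta>::complex^'m. exp (\<zeta> $ i)) has_derivative (\<lambda>v. exp (\<zeta> $ i) * v $ i)) (at \<zeta>)" for \<zeta> :: "complex^'m"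
    by (rule has_derivative_compose[OF bounded_linear_imp_has_derivative[OF bounded_linear_vec_nth] DERIV_exp[unfolded has_field_derivative_def]])
  then show "holo_on UNIV (\<lambda>\<zeta>::complex^'m. cexp \<zeta> $ i)"
    unfolding holo_on_def cexp_def by (auto simp: imult_vec_def imult_complex_def algebra_simps intro!: exI)
qed

locale toric =
  fixes M :: "('i, 'a::t2_space, 'm::finite) atlas"
    and act :: "complex^'m \<Rightarrow> 'a \<Rightarrow> 'a"
    and p0 :: 'a
    and L :: "('j, 'a) cocycle"
    and lift :: "complex^'m \<Rightarrow> 'j \<Rightarrow> 'j \<Rightarrow> 'a \<Rightarrow> complex"
    and h :: "'j \<Rightarrow> 'a \<Rightarrow> real"
    and vol :: "'a measure"
    and e :: "'j \<Rightarrow> 'a \<Rightarrow> complex"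
    and P :: "(real^'m) set"
    and s :: "nat \<Rightarrow> int^'m \<Rightarrow> 'j \<Rightarrow> 'a \<Rightarrow> complex"
  assumes ptk: "polarized_toric_kaehler M act p0 L lift h vol"
    and inv_frame: "invariant_frame M act p0 L lift e"
    and delz: "delzant_polytope P"
    and basis: "monomial_basis M act p0 L e P s"
begin

lemma tm: "toric_manifold M act p0" and lb: "line_bundle M L" and amp: "ample M L"
  and lin: "linearization M act L lift" and hm: "hermitian_metric M L h"
  and tim: "torus_invariant_metric act L lift h" and pc: "positively_curved M L h" and kv: "kaehler_volume M L h vol"
  using ptk by (auto simp: polarized_toric_kaehler_def)

lemma cm: "complex_manifold M" and compactM: "compact (UNIV :: 'a set)" and ha: "holo_action M act"
  and orbit_open: "open (open_orbit act p0)" and orbit_dense: "closure (open_orbit act p0) = UNIV"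
  and act_inj: "inj_on (\<lambda>t. act t p0) ctorus"
  using tm by (auto simp: toric_manifold_def)

lemma chart_cover: "\<exists>i. p \<in> chart_dom M i" using cm by (auto simp: complex_manifold_def)
lemma chart_open: "open (chart_dom M i)" "open (chart M i ` chart_dom M i)" using cm by (auto simp: complex_manifold_def)
lemma chart_homeo: "homeomorphism (chart_dom M i) (chart M i ` chart_dom M i) (chart M i) (cinv M i)"
  using cm by (auto simp: complex_manifold_def)
lemma cinv_chart [simp]: "p \<in> chart_dom M i \<Longrightarrow> cinv M i (chart M i p) = p"
  using homeomorphism_apply1[OF chart_homeo] .
lemma chart_cont: "continuous_on (chart_dom M i) (chart M i)" using chart_homeo by (simp add: homeomorphism_def)
lemma chart_inj: "inj_on (chart M i) (chart_dom M i)" by (rule inj_on_inverseI[of _ "cinv M i"]) simp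
lemma chart_image_open: assumes "open V" shows "open (chart M i ` (V \<inter> chart_dom M i))"
proof -
  have "openin (top_of_set (chart_dom M i)) (V \<inter> chart_dom M i)" using assms by (auto simp: openin_open)
  from homeomorphism_imp_open_map[OF chart_homeo this]
  show ?thesis using chart_open(2) openin_open_eq by blast
qed

lemma triv_cover: "\<exists>j. p \<in> triv L j" and triv_open: "open (triv L j)"
  using lb by (auto simp: line_bundle_def)

lemma act_mult: "u \<in> ctorus \<Longrightarrow> t \<in> ctorus \<Longrightarrow> act (u * t) p = act u (act t p)" using ha by (simp add: holo_action_def)
lemma act_cont: "continuous_on (ctorus \<times> UNIV) (\<lambda>(t, p). act t p)" using ha by (simp add: holo_action_def)
lemma act_holo: "holo_on {(t, w). t \<in> ctorus \<and> w \<in> chart M i ` chart_dom M i \<and> act t (cinv M i w) \<in> chart_dom M j}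
   (\<lambda>(t, w). chart M j (act t (cinv M i w)))" using ha by (simp add: holo_action_def)

text \<open>A covering of the open orbit: \<zeta> is a logarithm of the torus element, so the group
  law becomes addition.\<close>

definition "T \<zeta> = act (cexp \<zeta>) p0"
definition "Phi i \<zeta> = chart M i (T \<zeta>)"
definition "V i j = {\<zeta>. T \<zeta> \<in> chart_dom M i \<inter> triv L j}"
definition "Om i j = chart M i ` (open_orbit act p0 \<inter> triv L j \<inter> chart_dom M i)"

lemma T_orbit: "T \<zeta> \<in> open_orbit act p0" by (simp add: T_def open_orbit_def cexp_ctorus)
lemma orbit_T: assumes "p \<in> open_orbit act p0" obtains \<zeta> where "p = T \<zeta>"
proof -
  obtain t where t: "t \<in> ctorus" "p = act t p0" using assms by (auto simp: open_orbit_def)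
  then have "p = T (\<chi> a. Ln (t $ a))" by (simp add: T_def cexp_surj)
  then show thesis by (rule that)
qed
lemma T_add: "T (\<zeta> + \<eta>) = act (cexp \<zeta>) (T \<eta>)" by (simp add: T_def cexp_add act_mult cexp_ctorus)
lemma T_eq: "T \<zeta> = T \<eta> \<longleftrightarrow> cexp \<zeta> = cexp \<eta>"
  using act_inj cexp_ctorus by (auto simp: T_def inj_on_def)

lemma cexp_cont: "continuous_on X cexp" using holo_continuous[OF holo_cexp] continuous_on_subset by blast

lemma T_cont: "continuous_on X T"
proof -
  have "continuous_on X (\<lambda>\<zeta>. (\<lambda>(t, p). act t p) (cexp \<zeta>, p0))"
    by (rule continuous_on_compose2[OF act_cont]) (auto intro!: continuous_intros cexp_cont simp: cexp_ctorus)
  then show ?thesis by (simp add: T_def[abs_def])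
qed

lemma T_vimage_open: "open X \<Longrightarrow> open {\<zeta>. T \<zeta> \<in> X}"
  using continuous_open_vimage[OF _ T_cont[of UNIV, unfolded continuous_on_eq_continuous_at[OF open_UNIV], rule_format]]
  by (simp add: vimage_def)

lemma V_open: "open (V i j)" unfolding V_def by (rule T_vimage_open) (auto intro: chart_open triv_open)
lemma V_cover: "\<exists>i j. \<zeta> \<in> V i j" using chart_cover triv_cover by (auto simp: V_def)
lemma Om_open: "open (Om i j)" unfolding Om_def by (intro chart_image_open open_Int orbit_open triv_open)
lemma Phi_Om: "\<zeta> \<in> V i j \<Longrightarrow> Phi i \<zeta> \<in> Om i j" using T_orbit by (auto simp: V_def Om_def Phi_def)
lemma cinv_Phi: "T \<zeta> \<in> chart_dom M i \<Longrightarrow> cinv M i (Phi i \<zeta>) = T \<zeta>" by (simp add: Phi_def)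

text \<open>The action is holomorphic jointly in the group element and the chart coordinate; here
  the latter is frozen at that of \<open>p0\<close>.\<close>

lemma Phi_holo: "holo_on {\<zeta>. T \<zeta> \<in> chart_dom M i} (Phi i)"
proof -
  obtain i0 where i0: "p0 \<in> chart_dom M i0" using chart_cover by blast
  let ?g = "\<lambda>\<zeta>::complex^'m. (cexp \<zeta>, chart M i0 p0)"
  have g: "holo_on {\<zeta>. T \<zeta> \<in> chart_dom M i} ?g"
    unfolding holo_on_def
  proof
    fix \<zeta> :: "complex^'m"
    show "\<exists>D. (?g has_derivative D) (at \<zeta>) \<and> (\<forall>v. D (imult v) = imult (D v))"
      by (rule exI[of _ "\<lambda>v. (fd cexp \<zeta> v, 0)"])
        (use holo_fd_works[OF holo_cexp] holo_fd_imult[OF holo_cexp] in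
          \<open>auto intro!: has_derivative_Pair simp: imult_prod_def imult_vec_def imult_complex_def vec_eq_iff\<close>)
  qed
  have "holo_on {\<zeta>. T \<zeta> \<in> chart_dom M i} (\<lambda>\<zeta>. (\<lambda>(t, w). chart M i (act t (cinv M i0 w))) (?g \<zeta>))"
    by (rule holo_compose[OF g act_holo[of i0 i]]) (use i0 in \<open>auto simp: cexp_ctorus T_def\<close>)
  then show ?thesis using i0 by (simp add: Phi_def[abs_def] T_def)
qed

lemma Phi_holo_V: "holo_on (V i j) (Phi i)"
  by (rule holo_subset[OF Phi_holo]) (auto simp: V_def)

lemma hs_e: "holo_section M L 1 (open_orbit act p0) e" and e_nz: "p \<in> open_orbit act p0 \<Longrightarrow> p \<in> triv L j \<Longrightarrow> e j p \<noteq> 0"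
  and e_equiv: "t \<in> ctorus \<Longrightarrow> p \<in> open_orbit act p0 \<Longrightarrow> p \<in> triv L i' \<Longrightarrow> act t p \<in> triv L j \<Longrightarrow> e j (act t p) = lift t i' j p * e i' p"
  using inv_frame by (auto simp: invariant_frame_def)

lemma e_holo: "holo_on (Om i j) (e j \<circ> cinv M i)"
  using hs_e by (auto simp: holo_section_def holo_fun_on_def Om_def)

lemma h_pos: "p \<in> triv L j \<Longrightarrow> 0 < h j p" and h_smooth: "smooth_on (chart M i ` (chart_dom M i \<inter> triv L j)) (h j \<circ> cinv M i)"
  and h_trans: "p \<in> triv L i' \<Longrightarrow> p \<in> triv L j \<Longrightarrow> h j p = (cmod (transit L i' j p))\<^sup>2 * h i' p"
  using hm unfolding hermitian_metric_def by blast+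

lemma norm2_at_eq:
  assumes "p \<in> triv L j" and "\<And>i. p \<in> triv L i \<Longrightarrow> \<sigma> i p = transit L i j p ^ k * \<sigma> j p"
  shows "norm2_at L h k \<sigma> p = h j p ^ k * (cmod (\<sigma> j p))\<^sup>2"
proof -
  let ?i = "SOME j. p \<in> triv L j"
  have i: "p \<in> triv L ?i" using assms(1) by (rule someI)
  have "h j p ^ k * (cmod (\<sigma> j p))\<^sup>2 = h ?i p ^ k * (cmod (transit L ?i j p ^ k * \<sigma> j p))\<^sup>2"
    unfolding h_trans[OF i assms(1)] by (simp add: power_mult_distrib norm_mult norm_power power_mult[symmetric] mult.commute[of 2])
  then show ?thesis by (simp add: norm2_at_def Let_def assms(2)[OF i])
qed

lemma norm2_e: assumes "p \<in> open_orbit act p0" "p \<in> triv L j" shows "norm2_at L h 1 e p = h j p * (cmod (e j p))\<^sup>2"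
proof -
  have "norm2_at L h 1 e p = h j p ^ 1 * (cmod (e j p))\<^sup>2"
  proof (rule norm2_at_eq[OF assms(2)])
    fix i assume "p \<in> triv L i"
    then show "e i p = transit L i j p ^ 1 * e j p" using assms hs_e unfolding holo_section_def by blast
  qed
  then show ?thesis by simp
qed

definition "Npot \<zeta> = - ln (norm2_at L h 1 e (T \<zeta>))"
text \<open>The potential in a chart. The second summand is pluriharmonic, because the frame is
  holomorphic and without zeros on the orbit, so the curvature comes from the metric part
  alone.\<close>

definition "psi i j w = - ln (h j (cinv M i w)) - ln ((cmod (e j (cinv M i w)))\<^sup>2)"

lemma Npot_psi: assumes "\<zeta> \<in> V i j" shows "Npot \<zeta> = psi i j (Phi i \<zeta>)"
proof -
  have t: "T \<zeta> \<in> triv L j" "T \<zeta> \<in> chart_dom M i" using assms by (auto simp: V_def)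
  have "0 < h j (T \<zeta>)" "0 < (cmod (e j (T \<zeta>)))\<^sup>2" using h_pos[OF t(1)] e_nz[OF T_orbit t(1)] by auto
  then show ?thesis unfolding Npot_def psi_def norm2_e[OF T_orbit t(1)] cinv_Phi[OF t(2)] by (simp add: ln_mult)
qed

lemma hW_Ck: "Ck_on n (chart M i ` (chart_dom M i \<inter> triv L j)) (\<lambda>w. - ln (h j (cinv M i w)))"
proof -
  let ?S = "chart M i ` (chart_dom M i \<inter> triv L j)"
  have S: "open ?S" using chart_image_open[OF triv_open, of i j] by (simp add: Int_commute)
  have "Ck_on n ?S (\<lambda>w. ln (h j (cinv M i w)))"
  proof (rule Ck_compose[where T="{0<..}" and f=ln and g="\<lambda>w. h j (cinv M i w)"])
    show "Ck_on n ?S (\<lambda>w. h j (cinv M i w))" using h_smooth by (auto simp: smooth_on_def o_def)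
  qed (use S Ck_ln h_pos in auto)
  from Ck_linear_compose[OF bounded_linear_minus[OF bounded_linear_ident] S this] show ?thesis .
qed

lemma eW_Ck: "Ck_on n (Om i j) (\<lambda>w. ln ((cmod (e j (cinv M i w)))\<^sup>2))"
proof (rule Ck_compose[where T="{0<..}" and f=ln and g="\<lambda>w. (cmod (e j (cinv M i w)))\<^sup>2"])
  have "Ck_on n (Om i j) (\<lambda>w. (e j \<circ> cinv M i) w \<bullet> (e j \<circ> cinv M i) w)"
    by (intro Ck_bilinear[OF bounded_bilinear_inner] holo_Ck Om_open e_holo)
  then show "Ck_on n (Om i j) (\<lambda>w. (cmod (e j (cinv M i w)))\<^sup>2)" by (simp add: dot_square_norm)
  show "(\<lambda>w. (cmod (e j (cinv M i w)))\<^sup>2) ` Om i j \<subseteq> {0<..}"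
    using e_nz by (auto simp: Om_def)
qed (use Om_open Ck_ln in auto)

lemma psi_Ck: "Ck_on n (Om i j) (psi i j)"
proof -
  have "Ck_on n (Om i j) (\<lambda>w. - ln (h j (cinv M i w)) + - ln ((cmod (e j (cinv M i w)))\<^sup>2))"
    by (intro Ck_add Om_open Ck_subset[OF hW_Ck] Ck_linear_compose[OF bounded_linear_minus[OF bounded_linear_ident] Om_open eW_Ck])
      (auto simp: Om_def)
  then show ?thesis by (simp add: psi_def[abs_def])
qed

lemma Npot_Ck_V: "Ck_on n (V i j) Npot"
proof (rule Ck_cong[OF V_open])
  show "Ck_on n (V i j) (\<lambda>\<zeta>. psi i j (Phi i \<zeta>))"
    by (rule Ck_compose[where f="psi i j" and g="Phi i", OF V_open Om_open _ psi_Ck holo_Ck_vec[OF V_open Phi_holo_V]]) (use Phi_Om in auto)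
qed (use Npot_psi in auto)

lemma Npot_Ck: "Ck_on n UNIV Npot"
proof (rule Ck_local)
  fix \<zeta> :: "complex^'m"
  obtain i j where "\<zeta> \<in> V i j" using V_cover by blast
  then show "\<exists>U. open U \<and> \<zeta> \<in> U \<and> Ck_on n U Npot"
    by (intro exI[of _ "V i j"] conjI V_open Npot_Ck_V)
qed

text \<open>\<open>rl \<eta>\<close> = 0 means that \<open>cexp \<eta>\<close> lies in the real
  torus. The frame is multiplied by the lift, the metric is divided by its squared modulus, and the
  two cancel.\<close>

lemma Npot_invariant:
  assumes "rl \<eta> = 0" shows "Npot (\<eta> + \<zeta>) = Npot \<zeta>"
proof -
  have t: "cexp \<eta> \<in> rtorus" using assms by (auto simp: rtorus_def cexp_def rl_def vec_eq_iff)
  obtain i where i: "T \<zeta> \<in> triv L i" using triv_cover by blast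
  obtain j where j: "T (\<eta> + \<zeta>) \<in> triv L j" using triv_cover by blast
  have a: "T (\<eta> + \<zeta>) = act (cexp \<eta>) (T \<zeta>)" by (rule T_add)
  have "norm2_at L h 1 e (T (\<eta> + \<zeta>)) = h j (T (\<eta> + \<zeta>)) * (cmod (e j (T (\<eta> + \<zeta>))))\<^sup>2"
    by (rule norm2_e[OF T_orbit j])
  also have "e j (T (\<eta> + \<zeta>)) = lift (cexp \<eta>) i j (T \<zeta>) * e i (T \<zeta>)"
    unfolding a by (rule e_equiv[OF cexp_ctorus T_orbit i]) (use j a in simp)
  also have "h j (T (\<eta> + \<zeta>)) * (cmod (lift (cexp \<eta>) i j (T \<zeta>) * e i (T \<zeta>)))\<^sup>2
     = (h j (act (cexp \<eta>) (T \<zeta>)) * (cmod (lift (cexp \<eta>) i j (T \<zeta>)))\<^sup>2) * (cmod (e i (T \<zeta>)))\<^sup>2"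
    by (simp add: a norm_mult power_mult_distrib)
  also have "h j (act (cexp \<eta>) (T \<zeta>)) * (cmod (lift (cexp \<eta>) i j (T \<zeta>)))\<^sup>2 = h i (T \<zeta>)"
    using tim t i j a by (auto simp: torus_invariant_metric_def)
  also have "h i (T \<zeta>) * (cmod (e i (T \<zeta>)))\<^sup>2 = norm2_at L h 1 e (T \<zeta>)"
    by (rule norm2_e[OF T_orbit i, symmetric])
  finally show ?thesis by (simp add: Npot_def)
qed

definition "phi = kaehler_potential act p0 L h e"

lemma phi_Npot: "phi \<rho> = Npot (rc \<rho>)"
proof -
  have "(\<chi> a. complex_of_real (exp (\<rho> $ a / 2))) = cexp (rc \<rho>)"
    by (simp only: cexp_def rc_def vec_lambda_beta exp_of_real)
  then show ?thesis by (simp add: phi_def kaehler_potential_def Npot_def T_def)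
qed

lemma Npot_phi: "Npot \<zeta> = phi (rl \<zeta>)"
proof -
  have "rl (\<zeta> - rc (rl \<zeta>)) = 0" by (simp add: rl_def rc_def vec_eq_iff)
  from Npot_invariant[OF this, of "rc (rl \<zeta>)"] show ?thesis by (simp add: phi_Npot)
qed

lemma phi_Ck: "Ck_on n UNIV phi"
proof -
  have "Ck_on n UNIV (\<lambda>\<rho>. Npot (rc \<rho>))"
    by (rule Ck_compose[where f=Npot and g=rc, OF _ _ _ Npot_Ck Ck_linear[OF _ linear_rc]]) auto
  then show ?thesis by (simp add: phi_Npot[symmetric])
qed

end

section \<open>Second derivatives, the Levi form and Taylor expansions\<close>

abbreviation fd2 :: "('a::real_normed_vector \<Rightarrow> 'b::real_normed_vector) \<Rightarrow> 'a \<Rightarrow> 'a \<Rightarrow> 'a \<Rightarrow> 'b" where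
  "fd2 f x v u \<equiv> fd (\<lambda>y. fd f y v) x u"

lemma Ck2_diff: "Ck_on (Suc (Suc 0)) S f \<Longrightarrow> x \<in> S \<Longrightarrow> ((\<lambda>y. fd f y v) has_derivative fd2 f x v) (at x)"
  by (rule Ck_diff[OF Ck_fd])

lemma fd2_expand:
  fixes f :: "'a::euclidean_space \<Rightarrow> 'b::real_normed_vector"
  assumes S: "open S" "x \<in> S" and f: "Ck_on (Suc (Suc 0)) S f"
  shows "fd2 f x v u = (\<Sum>b\<in>Basis. (v \<bullet> b) *\<^sub>R fd2 f x b u)"
proof -
  have "((\<lambda>y. \<Sum>b\<in>Basis. (v \<bullet> b) *\<^sub>R fd f y b) has_derivative (\<lambda>u. \<Sum>b\<in>Basis. (v \<bullet> b) *\<^sub>R fd2 f x b u)) (at x)"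
    by (intro has_derivative_sum has_derivative_scaleR_right Ck2_diff[OF f S(2)])
  from has_derivative_transform_within_open[OF this S]
  have "((\<lambda>y. fd f y v) has_derivative (\<lambda>u. \<Sum>b\<in>Basis. (v \<bullet> b) *\<^sub>R fd2 f x b u)) (at x)"
    using fd_expand[OF differentiableI[OF Ck_diff[OF f]], of _ v] by simp
  from fd_eq[OF this] show ?thesis by simp
qed

lemma fd2_compose:
  fixes \<Phi> :: "'a::euclidean_space \<Rightarrow> 'b::euclidean_space" and f :: "'b \<Rightarrow> 'c::real_normed_vector"
  assumes S: "open S" "x \<in> S" and \<Phi>: "Ck_on (Suc (Suc 0)) S \<Phi>" and T: "open T" "\<Phi> ` S \<subseteq> T" and f: "Ck_on (Suc (Suc 0)) T f"
  shows "fd2 (\<lambda>y. f (\<Phi> y)) x v u = fd f (\<Phi> x) (fd2 \<Phi> x v u) + fd2 f (\<Phi> x) (fd \<Phi> x v) (fd \<Phi> x u)"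
proof -
  have Tx: "\<Phi> y \<in> T" if "y \<in> S" for y using T that by auto
  have 1: "fd (\<lambda>y. f (\<Phi> y)) y v = (\<Sum>b\<in>Basis. (fd \<Phi> y v \<bullet> b) *\<^sub>R fd f (\<Phi> y) b)" if y: "y \<in> S" for y
  proof -
    from has_derivative_compose[OF Ck_diff[OF \<Phi> y] Ck_diff[OF f Tx[OF y]]]
    have "fd (\<lambda>y. f (\<Phi> y)) y v = fd f (\<Phi> y) (fd \<Phi> y v)" by (simp add: fd_eq)
    also have "\<dots> = (\<Sum>b\<in>Basis. (fd \<Phi> y v \<bullet> b) *\<^sub>R fd f (\<Phi> y) b)"
      by (rule fd_expand[OF differentiableI[OF Ck_diff[OF f Tx[OF y]]]])
    finally show ?thesis .
  qed
  have 2: "((\<lambda>y. \<Sum>b\<in>Basis. (fd \<Phi> y v \<bullet> b) *\<^sub>R fd f (\<Phi> y) b) has_derivative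
     (\<lambda>u. \<Sum>b\<in>Basis. (fd \<Phi> x v \<bullet> b) *\<^sub>R fd2 f (\<Phi> x) b (fd \<Phi> x u) + (fd2 \<Phi> x v u \<bullet> b) *\<^sub>R fd f (\<Phi> x) b)) (at x)"
    by (intro has_derivative_sum has_derivative_scaleR has_derivative_inner_left Ck2_diff[OF \<Phi> S(2)]
        has_derivative_compose[OF Ck_diff[OF \<Phi> S(2)] Ck2_diff[OF f Tx[OF S(2)]]])
  have "((\<lambda>y. fd (\<lambda>y. f (\<Phi> y)) y v) has_derivative
     (\<lambda>u. \<Sum>b\<in>Basis. (fd \<Phi> x v \<bullet> b) *\<^sub>R fd2 f (\<Phi> x) b (fd \<Phi> x u) + (fd2 \<Phi> x v u \<bullet> b) *\<^sub>R fd f (\<Phi> x) b)) (at x)"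
    by (rule has_derivative_transform_within_open[OF 2 S]) (use 1 in auto)
  from fd_eq[OF this] have "fd2 (\<lambda>y. f (\<Phi> y)) x v u =
     (\<Sum>b\<in>Basis. (fd \<Phi> x v \<bullet> b) *\<^sub>R fd2 f (\<Phi> x) b (fd \<Phi> x u)) + (\<Sum>b\<in>Basis. (fd2 \<Phi> x v u \<bullet> b) *\<^sub>R fd f (\<Phi> x) b)"
    by (simp add: sum.distrib)
  then show ?thesis
    using fd2_expand[OF T(1) Tx[OF S(2)] f, of "fd \<Phi> x v" "fd \<Phi> x u"]
      fd_expand[OF differentiableI[OF Ck_diff[OF f Tx[OF S(2)]]], of "fd2 \<Phi> x v u"] by simp
qed

text \<open>The Laplacian of f along the complex line spanned by v, that is four times the Levi
  form. Unlike the full second derivative it is compatible with holomorphic maps.\<close>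

definition lev :: "('a::complex_structure \<Rightarrow> real) \<Rightarrow> 'a \<Rightarrow> 'a \<Rightarrow> real" where
  "lev f x v = fd2 f x v v + fd2 f x (imult v) (imult v)"

lemma linear_imult: "linear imult" by (rule linearI) (simp_all add: imult_add imult_scaleR)

text \<open>The chain rule produces an extra term with the second derivative of \<Phi>. Complex
  linearity in both slots gives D^2 \<Phi> (iv, iv) = - D^2 \<Phi> (v, v), so the two contributions
  cancel.\<close>

lemma lev_compose:
  fixes \<Phi> :: "'a::{complex_structure,euclidean_space} \<Rightarrow> 'b::{complex_structure,euclidean_space}"
  assumes S: "open S" "x \<in> S" and \<Phi>: "Ck_on (Suc (Suc 0)) S \<Phi>" "holo_on S \<Phi>" "\<And>v. holo_on S (\<lambda>y. fd \<Phi> y v)"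
    and T: "open T" "\<Phi> ` S \<subseteq> T" and f: "Ck_on (Suc (Suc 0)) T f"
  shows "lev (\<lambda>y. f (\<Phi> y)) x v = lev f (\<Phi> x) (fd \<Phi> x v)"
proof -
  have "((\<lambda>y. imult (fd \<Phi> y v)) has_derivative (\<lambda>u. imult (fd2 \<Phi> x v u))) (at x)"
    by (rule bounded_linear.has_derivative[OF linear_conv_bounded_linear[THEN iffD1, OF linear_imult] Ck2_diff[OF \<Phi>(1) S(2)]])
  then have "((\<lambda>y. fd \<Phi> y (imult v)) has_derivative (\<lambda>u. imult (fd2 \<Phi> x v u))) (at x)"
    by (rule has_derivative_transform_within_open[OF _ S]) (simp add: holo_fd_imult[OF \<Phi>(2)])
  from fd_eq[OF this] have "fd2 \<Phi> x (imult v) (imult v) = - fd2 \<Phi> x v v"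
    by (simp add: holo_fd_imult[OF \<Phi>(3) S(2)] imult_imult)
  moreover have "fd f (\<Phi> x) (- w) = - fd f (\<Phi> x) w" for w
    using T S by (intro linear_neg has_derivative_linear[OF Ck_diff[OF f]]) auto
  ultimately show ?thesis
    by (simp add: lev_def fd2_compose[OF S \<Phi>(1) T f] holo_fd_imult[OF \<Phi>(2) S(2)])
qed

text \<open>log |z|^2 is harmonic away from 0. The identity \<open>b\<close> is Pythagoras for the
  orthogonal directions w and i w.\<close>

lemma lev_ln_norm:
  assumes z: "z \<noteq> (0::complex)" shows "lev (\<lambda>z. ln ((cmod z)\<^sup>2)) z w = 0"
proof -
  have 1: "((\<lambda>z::complex. ln ((cmod z)\<^sup>2)) has_derivative (\<lambda>w. 2 * (z \<bullet> w) / (z \<bullet> z))) (at z)" if "z \<noteq> 0" for z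
  proof -
    have "((\<lambda>z::complex. ln (z \<bullet> z)) has_derivative (\<lambda>w. 2 * (z \<bullet> w) / (z \<bullet> z))) (at z)"
      using that by (auto intro!: derivative_eq_intros simp: inner_commute field_simps)
    then show ?thesis by (simp add: dot_square_norm)
  qed
  have 2: "((\<lambda>z. fd (\<lambda>z. ln ((cmod z)\<^sup>2)) z w) has_derivative
      (\<lambda>u. (2 * (u \<bullet> w) * (z \<bullet> z) - 2 * (z \<bullet> w) * (2 * (z \<bullet> u))) / ((z \<bullet> z) * (z \<bullet> z)))) (at z)" for w
  proof (rule has_derivative_transform_within_open[of "\<lambda>z. 2 * (z \<bullet> w) / (z \<bullet> z)" _ _ _ "-{0}"])
    show "((\<lambda>z. 2 * (z \<bullet> w) / (z \<bullet> z)) has_derivative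
      (\<lambda>u. (2 * (u \<bullet> w) * (z \<bullet> z) - 2 * (z \<bullet> w) * (2 * (z \<bullet> u))) / ((z \<bullet> z) * (z \<bullet> z)))) (at z)"
      using z by (auto intro!: derivative_eq_intros simp: inner_commute fun_eq_iff)
  qed (use z fd_eq[OF 1] in auto)
  have n: "z \<bullet> z \<noteq> 0" using z by simp
  have a: "imult w \<bullet> imult w = w \<bullet> w" by (simp add: imult_complex_def inner_complex_def)
  have b: "(z \<bullet> w) * (z \<bullet> w) + (z \<bullet> imult w) * (z \<bullet> imult w) = (z \<bullet> z) * (w \<bullet> w)"
    by (simp add: imult_complex_def inner_complex_def algebra_simps)
  have "lev (\<lambda>z. ln ((cmod z)\<^sup>2)) z w = (2 * (w \<bullet> w) * (z \<bullet> z) - 2 * (z \<bullet> w) * (2 * (z \<bullet> w))) / ((z \<bullet> z) * (z \<bullet> z))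
     + (2 * (imult w \<bullet> imult w) * (z \<bullet> z) - 2 * (z \<bullet> imult w) * (2 * (z \<bullet> imult w))) / ((z \<bullet> z) * (z \<bullet> z))"
    unfolding lev_def fd_eq[OF 2] by simp
  also have "\<dots> = (4 * (w \<bullet> w) * (z \<bullet> z) - 4 * ((z \<bullet> w) * (z \<bullet> w) + (z \<bullet> imult w) * (z \<bullet> imult w))) / ((z \<bullet> z) * (z \<bullet> z))"
    unfolding a add_divide_distrib[symmetric] by (simp add: algebra_simps)
  also have "\<dots> = 0" unfolding b by simp
  finally show ?thesis .
qed

lemma sum_Basis_cvec:
  fixes g :: "complex^'m::finite \<Rightarrow> 'b::comm_monoid_add"
  shows "(\<Sum>b\<in>Basis. g b) = (\<Sum>a\<in>UNIV. g (axis a 1) + g (axis a \<i>))"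
proof -
  have "(\<Sum>b\<in>Basis. g b) = (\<Sum>a\<in>UNIV. \<Sum>b\<in>{axis a 1, axis a \<i>}. g b)"
    unfolding Basis_vec_def
    by (subst sum.UNION_disjoint) (auto simp: Basis_complex_def axis_eq_axis insert_commute)
  also have "\<dots> = (\<Sum>a\<in>UNIV. g (axis a 1) + g (axis a \<i>))" by (simp add: axis_eq_axis complex_eq_iff)
  finally show ?thesis .
qed

text \<open>Links the Wirtinger matrix, through which the curvature is defined, with
  \<open>lev\<close>, which transforms well under holomorphic maps.\<close>

lemma lev_hessian:
  fixes f :: "complex^'m::finite \<Rightarrow> real"
  assumes S: "open S" "w \<in> S" and f: "Ck_on (Suc (Suc 0)) S f"
  shows "Re (\<Sum>a\<in>UNIV. \<Sum>b\<in>UNIV. complex_hessian f w $ a $ b * v $ a * cnj (v $ b)) = lev f w v / 4"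
proof -
  define H where "H x y = fd2 f w x y" for x y
  have 1: "((\<lambda>u. complex_of_real (f u)) has_derivative (\<lambda>x. complex_of_real (fd f u x))) (at u)" if "u \<in> S" for u
    by (rule bounded_linear.has_derivative[OF bounded_linear_of_real Ck_diff[OF f that]])
  have 2: "wirtinger_bar b (\<lambda>u. complex_of_real (f u)) u
     = (complex_of_real (fd f u (axis b 1)) + \<i> * complex_of_real (fd f u (axis b \<i>))) / 2" if "u \<in> S" for b u
    unfolding wirtinger_bar_def fd_eq[OF 1[OF that]] ..
  have 3: "((\<lambda>u. (complex_of_real (fd f u (axis b 1)) + \<i> * complex_of_real (fd f u (axis b \<i>))) / 2)
     has_derivative (\<lambda>x. (complex_of_real (H (axis b 1) x) + \<i> * complex_of_real (H (axis b \<i>) x)) / 2)) (at w)" for b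
    unfolding H_def divide_inverse
    by (intro has_derivative_mult_left has_derivative_add has_derivative_mult_right
        bounded_linear.has_derivative[OF bounded_linear_of_real Ck2_diff[OF f S(2)]])
  have 4: "fd (wirtinger_bar b (\<lambda>u. complex_of_real (f u))) w
     = (\<lambda>x. (complex_of_real (H (axis b 1) x) + \<i> * complex_of_real (H (axis b \<i>) x)) / 2)" for b
    by (rule fd_eq, rule has_derivative_transform_within_open[OF 3 S]) (simp add: 2)
  define p q where "p a = Re (v $ a)" and "q a = Im (v $ a)" for a
  define H11 Hi1 H1i Hii where "H11 b a = H (axis b 1) (axis a 1)" and "Hi1 b a = H (axis b \<i>) (axis a 1)"
    and "H1i b a = H (axis b 1) (axis a \<i>)" and "Hii b a = H (axis b \<i>) (axis a \<i>)" for b a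
  have C0: "Re (complex_hessian f w $ a $ b * v $ a * cnj (v $ b)) =
     ((H11 b a + Hii b a) * (p a * p b + q a * q b) - (Hi1 b a - H1i b a) * (q a * p b - p a * q b)) / 4" for a b
    unfolding complex_hessian_def wirtinger_def 4 H11_def Hi1_def H1i_def Hii_def p_def q_def by (simp add: field_simps)
  have C: "4 * Re (complex_hessian f w $ a $ b * v $ a * cnj (v $ b)) =
     (H11 b a + Hii b a) * (p a * p b + q a * q b) - (Hi1 b a - H1i b a) * (q a * p b - p a * q b)" for a b
    by (subst C0) simp
  have ex: "H x x = (\<Sum>b\<in>UNIV. \<Sum>a\<in>UNIV. Re (x $ b) * (Re (x $ a) * H11 b a + Im (x $ a) * H1i b a)
     + Im (x $ b) * (Re (x $ a) * Hi1 b a + Im (x $ a) * Hii b a))" for x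
  proof -
    have h: "H y x = (\<Sum>a\<in>UNIV. Re (x $ a) * H y (axis a 1) + Im (x $ a) * H y (axis a \<i>))" for y
      unfolding H_def using fd_expand[OF differentiableI[OF Ck2_diff[OF f S(2)]], of y x]
      by (simp add: sum_Basis_cvec inner_axis)
    have "H x x = (\<Sum>b\<in>UNIV. Re (x $ b) * H (axis b 1) x + Im (x $ b) * H (axis b \<i>) x)"
      unfolding H_def using fd2_expand[OF S f, of x x] by (simp add: sum_Basis_cvec inner_axis)
    moreover have "Re (x $ b) * H (axis b 1) x + Im (x $ b) * H (axis b \<i>) x =
        (\<Sum>a\<in>UNIV. Re (x $ b) * (Re (x $ a) * H11 b a + Im (x $ a) * H1i b a)
     + Im (x $ b) * (Re (x $ a) * Hi1 b a + Im (x $ a) * Hii b a))" for b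
      unfolding h[of "axis b 1"] h[of "axis b \<i>"] H11_def Hi1_def H1i_def Hii_def
      by (simp only: sum_distrib_left sum.distrib[symmetric])
    ultimately show ?thesis by (simp only:)
  qed
  have "lev f w v = H v v + H (imult v) (imult v)" by (simp add: lev_def H_def)
  also have "\<dots> = (\<Sum>b\<in>UNIV. \<Sum>a\<in>UNIV.
      (H11 b a + Hii b a) * (p a * p b + q a * q b) - (Hi1 b a - H1i b a) * (q a * p b - p a * q b))"
    unfolding ex[of v] ex[of "imult v"] sum.distrib[symmetric] p_def q_def
    by (intro sum.cong refl) (simp add: imult_vec_def imult_complex_def algebra_simps)
  also have "\<dots> = (\<Sum>a\<in>UNIV. \<Sum>b\<in>UNIV. 4 * Re (complex_hessian f w $ a $ b * v $ a * cnj (v $ b)))"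
    unfolding C by (rule sum.swap)
  also have "\<dots> = 4 * Re (\<Sum>a\<in>UNIV. \<Sum>b\<in>UNIV. complex_hessian f w $ a $ b * v $ a * cnj (v $ b))"
    by (simp only: sum_distrib_left Re_sum)
  finally show ?thesis by linarith
qed

lemma line_deriv:
  fixes F :: "'a::real_normed_vector \<Rightarrow> real"
  assumes "(F has_derivative fd F (x + s *\<^sub>R u)) (at (x + s *\<^sub>R u))"
  shows "((\<lambda>s. F (x + s *\<^sub>R u)) has_real_derivative fd F (x + s *\<^sub>R u) u) (at s)"
proof -
  have "((\<lambda>s. x + s *\<^sub>R u) has_derivative (\<lambda>t. t *\<^sub>R u)) (at s)" by (auto intro!: derivative_eq_intros)
  from has_derivative_compose[OF this assms]
  have "((\<lambda>s. F (x + s *\<^sub>R u)) has_derivative (\<lambda>t. fd F (x + s *\<^sub>R u) (t *\<^sub>R u))) (at s)" .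
  then show ?thesis
    by (simp add: has_field_derivative_def linear_scale[OF has_derivative_linear[OF assms]] mult.commute[of _ "fd F (x + s *\<^sub>R u) u"])
qed

text \<open>The mean value theorem twice, first in the direction u and then in the direction
  w.\<close>

lemma second_difference:
  fixes F :: "'a::euclidean_space \<Rightarrow> real"
  assumes F: "Ck_on (Suc (Suc 0)) UNIV F" and s: "0 < s"
  shows "\<exists>p. norm (p - x) \<le> s * (norm u + norm w) \<and>
    F (x + s *\<^sub>R w + s *\<^sub>R u) - F (x + s *\<^sub>R u) - F (x + s *\<^sub>R w) + F x = s * s * fd2 F p u w"
proof -
  note D = line_deriv[OF Ck_diff[OF F UNIV_I]] and D2 = line_deriv[OF Ck2_diff[OF F UNIV_I]]
  have "\<exists>\<tau>>0. \<tau> < s \<and> (F (x + s *\<^sub>R w + s *\<^sub>R u) - F (x + s *\<^sub>R u)) - (F (x + s *\<^sub>R w + 0 *\<^sub>R u) - F (x + 0 *\<^sub>R u)) =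
     (s - 0) * (fd F (x + s *\<^sub>R w + \<tau> *\<^sub>R u) u - fd F (x + \<tau> *\<^sub>R u) u)"
    by (rule MVT2[OF s, where f="\<lambda>\<tau>. F (x + s *\<^sub>R w + \<tau> *\<^sub>R u) - F (x + \<tau> *\<^sub>R u)"]) (intro DERIV_diff D)
  then obtain \<tau> where t: "0 < \<tau>" "\<tau> < s" "F (x + s *\<^sub>R w + s *\<^sub>R u) - F (x + s *\<^sub>R u) - F (x + s *\<^sub>R w) + F x =
     s * (fd F (x + s *\<^sub>R w + \<tau> *\<^sub>R u) u - fd F (x + \<tau> *\<^sub>R u) u)" by auto
  have "\<exists>\<sigma>>0. \<sigma> < s \<and> fd F (x + \<tau> *\<^sub>R u + s *\<^sub>R w) u - fd F (x + \<tau> *\<^sub>R u + 0 *\<^sub>R w) u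
     = (s - 0) * fd2 F (x + \<tau> *\<^sub>R u + \<sigma> *\<^sub>R w) u w"
    by (rule MVT2[OF s, where f="\<lambda>\<sigma>. fd F (x + \<tau> *\<^sub>R u + \<sigma> *\<^sub>R w) u"]) (intro D2)
  then obtain \<sigma> where s': "0 < \<sigma>" "\<sigma> < s" "fd F (x + s *\<^sub>R w + \<tau> *\<^sub>R u) u - fd F (x + \<tau> *\<^sub>R u) u
     = s * fd2 F (x + \<tau> *\<^sub>R u + \<sigma> *\<^sub>R w) u w" by (auto simp: add_ac)
  have "norm (\<tau> *\<^sub>R u + \<sigma> *\<^sub>R w) \<le> \<tau> * norm u + \<sigma> * norm w"
    by (rule order_trans[OF norm_triangle_ineq]) (use t s' in simp)
  also have "\<dots> \<le> s * norm u + s * norm w" using t s' by (intro add_mono mult_right_mono) auto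
  finally show ?thesis using t(3) s'(3)
    by (intro exI[of _ "x + \<tau> *\<^sub>R u + \<sigma> *\<^sub>R w"]) (simp add: distrib_left add.assoc)
qed

text \<open>The second difference is symmetric in u and w, so the two mixed derivatives agree at
  points p and q arbitrarily close to x; continuity then excludes a gap at x.\<close>

lemma fd2_sym:
  fixes F :: "'a::euclidean_space \<Rightarrow> real"
  assumes F: "Ck_on (Suc (Suc 0)) UNIV F"
  shows "fd2 F x u w = fd2 F x w u"
proof (rule ccontr)
  assume ne: "fd2 F x u w \<noteq> fd2 F x w u"
  define \<epsilon> where "\<epsilon> = \<bar>fd2 F x u w - fd2 F x w u\<bar> / 2"
  have e: "0 < \<epsilon>" using ne by (simp add: \<epsilon>_def)
  have c: "\<exists>d>0. \<forall>p. norm (p - x) < d \<longrightarrow> \<bar>fd2 F p u w - fd2 F x u w\<bar> < \<epsilon>" for u w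
    using Ck_continuous[OF Ck_fd[OF Ck_fd[OF F]], of u w] e
    by (simp add: continuous_on_iff dist_norm)
  obtain d1 where d1: "0 < d1" "\<And>p. norm (p - x) < d1 \<Longrightarrow> \<bar>fd2 F p u w - fd2 F x u w\<bar> < \<epsilon>" using c by blast
  obtain d2 where d2: "0 < d2" "\<And>p. norm (p - x) < d2 \<Longrightarrow> \<bar>fd2 F p w u - fd2 F x w u\<bar> < \<epsilon>" using c by blast
  define N where "N = norm u + norm w + 1"
  define s where "s = min d1 d2 / (2 * N)"
  have N: "0 < N" by (simp add: N_def add_nonneg_pos)
  have s: "0 < s" using d1 d2 N by (simp add: s_def)
  have "s * (norm u + norm w) \<le> s * N" using s by (intro mult_left_mono) (auto simp: N_def)
  moreover have "s * N = min d1 d2 / 2" using N by (simp add: s_def)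
  ultimately have sm: "s * (norm u + norm w) < d1" "s * (norm u + norm w) < d2" using d1(1) d2(1) by linarith+
  obtain p where p: "norm (p - x) \<le> s * (norm u + norm w)"
    "F (x + s *\<^sub>R w + s *\<^sub>R u) - F (x + s *\<^sub>R u) - F (x + s *\<^sub>R w) + F x = s * s * fd2 F p u w"
    using second_difference[OF F s] by blast
  obtain q where q: "norm (q - x) \<le> s * (norm w + norm u)"
    "F (x + s *\<^sub>R u + s *\<^sub>R w) - F (x + s *\<^sub>R w) - F (x + s *\<^sub>R u) + F x = s * s * fd2 F q w u"
    using second_difference[OF F s] by blast
  have eq: "x + s *\<^sub>R w + s *\<^sub>R u = x + s *\<^sub>R u + s *\<^sub>R w" by simp
  have "s * s * fd2 F p u w = s * s * fd2 F q w u" unfolding p(2)[symmetric] q(2)[symmetric] eq by simp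
  then have "fd2 F p u w = fd2 F q w u" using s by simp
  moreover have "\<bar>fd2 F p u w - fd2 F x u w\<bar> < \<epsilon>" using p(1) sm(1) by (intro d1(2)) linarith
  moreover have "\<bar>fd2 F q w u - fd2 F x w u\<bar> < \<epsilon>" using q(1) sm(2) by (intro d2(2)) (simp add: add.commute)
  ultimately have "\<bar>fd2 F x u w - fd2 F x w u\<bar> < 2 * \<epsilon>" unfolding abs_less_iff by linarith
  then show False by (simp add: \<epsilon>_def)
qed

lemma vec_axis_sum: "(\<Sum>a\<in>UNIV. (r $ a) *\<^sub>R axis a (1::real)) = r"
  using basis_expansion[of r] by (simp add: scalar_mult_eq_scaleR)

lemma gradient_fd:
  assumes "(F has_derivative fd F x) (at x)"
  shows "gradient F x \<bullet> r = fd F x r"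
proof -
  have "fd F x r = (\<Sum>a\<in>UNIV. (r $ a) *\<^sub>R fd F x (axis a 1))"
    by (subst vec_axis_sum[symmetric]) (simp add: linear_sum[OF has_derivative_linear[OF assms]] linear_scale[OF has_derivative_linear[OF assms]])
  then show ?thesis by (simp add: gradient_def inner_vec_def mult.commute)
qed

lemma hessian_fd:
  fixes F :: "real^'m::finite \<Rightarrow> real"
  assumes F: "Ck_on (Suc (Suc 0)) UNIV F"
  shows "(hessian F x *v r) \<bullet> u = fd2 F x r u"
proof -
  have l: "fd2 F x r u = (\<Sum>a\<in>UNIV. u $ a * fd2 F x r (axis a 1))" for r u
    by (subst vec_axis_sum[symmetric, of u])
      (simp add: linear_sum[OF has_derivative_linear[OF Ck2_diff[OF F UNIV_I]]] linear_scale[OF has_derivative_linear[OF Ck2_diff[OF F UNIV_I]]])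
  have s: "fd2 F x r (axis a 1) = (\<Sum>b\<in>UNIV. r $ b * fd2 F x (axis b 1) (axis a 1))" for a
    by (rule trans[OF fd2_sym[OF F, of r x "axis a 1"]], rule trans[OF l])
      (intro sum.cong refl arg_cong2[where f="(*)"] fd2_sym[OF F])
  show ?thesis
    unfolding l[of r u] s inner_vec_def matrix_vector_mult_def hessian_def by (simp add: mult.commute)
qed

lemma hessian_Ck:
  fixes F :: "real^'m::finite \<Rightarrow> real"
  assumes F: "Ck_on (Suc (Suc n)) UNIV F" shows "Ck_on n UNIV (hessian F)"
proof (rule Ck_vec[OF open_UNIV], rule Ck_vec[OF open_UNIV])
  fix a b :: 'm
  show "Ck_on n UNIV (\<lambda>x. hessian F x $ a $ b)"
    using Ck_fd[OF Ck_fd[OF F]] by (simp add: hessian_def)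
qed

lemma taylor2:
  fixes F :: "'a::euclidean_space \<Rightarrow> real"
  assumes F: "Ck_on (Suc (Suc 0)) UNIV F"
  shows "\<exists>t. 0 \<le> t \<and> t \<le> 1 \<and> F (x + r) = F x + fd F x r + fd2 F (x + t *\<^sub>R r) r r / 2"
proof -
  note D = line_deriv[OF Ck_diff[OF F UNIV_I]] and D2 = line_deriv[OF Ck2_diff[OF F UNIV_I]]
  define df where "df m s = (if m = 0 then F (x + s *\<^sub>R r) else if m = 1 then fd F (x + s *\<^sub>R r) r else fd2 F (x + s *\<^sub>R r) r r)" for m :: nat and s
  have "\<exists>t>0. t \<le> 1 \<and> df 0 1 = (\<Sum>m<2. df m 0 / fact m * 1 ^ m) + df 2 t / fact 2 * 1 ^ 2"
  proof (rule Maclaurin2, simp, simp, intro allI impI)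
    fix m :: nat and t :: real assume "m < 2 \<and> 0 \<le> t \<and> t \<le> 1"
    then consider "m = 0" | "m = 1" by linarith
    then show "(df m has_real_derivative df (Suc m) t) (at t)"
      by cases (auto simp: df_def[abs_def] intro: D D2)
  qed
  then obtain t where "0 < t" "t \<le> 1" "df 0 1 = (\<Sum>m<2. df m 0 / fact m * 1 ^ m) + df 2 t / fact 2 * 1 ^ 2" by blast
  then show ?thesis by (intro exI[of _ t]) (simp add: df_def numeral_2_eq_2)
qed

lemma matrix_form_bound: "\<bar>(D *v r) \<bullet> r\<bar> \<le> real CARD('m)^2 * norm D * (norm r)\<^sup>2" for D :: "real^'m::finite^'m"
proof -
  have "\<bar>(D *v r) \<bullet> r\<bar> \<le> (\<Sum>a\<in>UNIV. \<Sum>b\<in>UNIV. \<bar>D $ a $ b * r $ b * r $ a\<bar>)"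
    unfolding inner_vec_def matrix_vector_mult_def
    by (simp add: sum_distrib_right) (rule order_trans[OF sum_abs sum_mono[OF sum_abs]])
  also have "\<dots> \<le> (\<Sum>a\<in>(UNIV::'m set). \<Sum>b\<in>(UNIV::'m set). norm D * (norm r)\<^sup>2)"
  proof (intro sum_mono)
    fix a b :: 'm
    have "\<bar>D $ a $ b\<bar> \<le> norm D" using component_le_norm_cart[of "D $ a" b] Finite_Cartesian_Product.norm_nth_le[of D a] by linarith
    then show "\<bar>D $ a $ b * r $ b * r $ a\<bar> \<le> norm D * (norm r)\<^sup>2"
      unfolding abs_mult power2_eq_square mult.assoc by (intro mult_mono component_le_norm_cart) auto
  qed
  finally show ?thesis by (simp add: power2_eq_square mult_ac)
qed

text \<open>The mean value form of the second order remainder evaluates the Hessian at an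
  intermediate point, and a Lipschitz Hessian changes there by O(|r|) only.\<close>

lemma taylor3:
  fixes F :: "real^'m::finite \<Rightarrow> real"
  assumes F: "Ck_on (Suc (Suc (Suc 0))) UNIV F"
  obtains \<epsilon> C where "0 < \<epsilon>" "0 \<le> C"
    "\<And>r. norm r \<le> \<epsilon> \<Longrightarrow> \<bar>F (x + r) - F x - fd F x r - ((hessian F x *v r) \<bullet> r) / 2\<bar> \<le> C * norm r ^ 3"
proof -
  note F2 = Ck_Suc_D[OF F]
  obtain \<epsilon> C where e: "0 < \<epsilon>" "0 \<le> C"
    and L: "\<And>p q. p \<in> cball x \<epsilon> \<Longrightarrow> q \<in> cball x \<epsilon> \<Longrightarrow> norm (hessian F p - hessian F q) \<le> C * norm (p - q)"
    by (rule Ck1_lipschitz[OF open_UNIV UNIV_I, of "hessian F" x]) (use hessian_Ck[OF F] in auto)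
  show thesis
  proof (rule that[OF e(1)])
    show "0 \<le> real CARD('m)^2 * C / 2" using e by simp
    fix r :: "real^'m" assume r: "norm r \<le> \<epsilon>"
    obtain t where t: "0 \<le> t" "t \<le> 1" "F (x + r) = F x + fd F x r + fd2 F (x + t *\<^sub>R r) r r / 2"
      using taylor2[OF F2] by blast
    have tr: "norm (t *\<^sub>R r) \<le> norm r" using t by (simp add: mult_left_le_one_le)
    have "F (x + r) - F x - fd F x r - ((hessian F x *v r) \<bullet> r) / 2 = (((hessian F (x + t *\<^sub>R r) - hessian F x) *v r) \<bullet> r) / 2"
      unfolding t(3) hessian_fd[OF F2, symmetric] by (simp add: matrix_vector_mult_diff_rdistrib inner_diff_left diff_divide_distrib)
    also have "\<bar>\<dots>\<bar> \<le> real CARD('m)^2 * norm (hessian F (x + t *\<^sub>R r) - hessian F x) * (norm r)\<^sup>2 / 2"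
      using matrix_form_bound[of "hessian F (x + t *\<^sub>R r) - hessian F x" r] by simp
    also have "\<dots> \<le> real CARD('m)^2 * (C * norm r) * (norm r)\<^sup>2 / 2"
    proof -
      have "norm (hessian F (x + t *\<^sub>R r) - hessian F x) \<le> C * norm (t *\<^sub>R r)"
        using L[of "x + t *\<^sub>R r" x] r tr e by (simp add: dist_norm)
      also have "\<dots> \<le> C * norm r" using tr e by (intro mult_left_mono)
      finally show ?thesis by (intro divide_right_mono mult_right_mono mult_left_mono) auto
    qed
    also have "\<dots> = real CARD('m)^2 * C / 2 * norm r ^ 3" by (simp add: power3_eq_cube power2_eq_square)
    finally show "\<bar>F (x + r) - F x - fd F x r - ((hessian F x *v r) \<bullet> r) / 2\<bar> \<le> real CARD('m)^2 * C / 2 * norm r ^ 3" .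
  qed
qed


lemma lev_cong:
  assumes "open S" "x \<in> S" "\<And>y. y \<in> S \<Longrightarrow> f y = g y"
  shows "lev f x v = lev g x v"
proof -
  have "fd f y = fd g y" if "y \<in> S" for y by (rule fd_cong(1)[OF assms(1) that]) (rule assms(3))
  then have "fd2 f x u = fd2 g x u" for u by (intro fd_cong(1)[OF assms(1,2)]) simp
  then show ?thesis by (simp add: lev_def)
qed

lemma lev_diff:
  fixes f :: "'a::{complex_structure,euclidean_space} \<Rightarrow> real"
  assumes S: "open S" "x \<in> S" and f: "Ck_on (Suc (Suc 0)) S f" and g: "Ck_on (Suc (Suc 0)) S g"
  shows "lev (\<lambda>y. f y - g y) x v = lev f x v - lev g x v"
proof -
  have 1: "fd (\<lambda>y. f y - g y) y = (\<lambda>v. fd f y v - fd g y v)" if "y \<in> S" for y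
    by (rule fd_eq) (intro has_derivative_diff Ck_diff[OF f that] Ck_diff[OF g that])
  have 2: "((\<lambda>y. fd f y u - fd g y u) has_derivative (\<lambda>w. fd2 f x u w - fd2 g x u w)) (at x)" for u
    by (intro has_derivative_diff Ck2_diff[OF f S(2)] Ck2_diff[OF g S(2)])
  have "((\<lambda>y. fd (\<lambda>y. f y - g y) y u) has_derivative (\<lambda>w. fd2 f x u w - fd2 g x u w)) (at x)" for u
    by (rule has_derivative_transform_within_open[OF 2 S]) (simp add: 1)
  from fd_eq[OF this] show ?thesis by (simp add: lev_def)
qed

lemma fd2_linear_composite:
  fixes f :: "'b::euclidean_space \<Rightarrow> 'c::real_normed_vector" and l :: "'a::euclidean_space \<Rightarrow> 'b"
  assumes l: "bounded_linear l" and f: "Ck_on (Suc (Suc 0)) UNIV f"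
  shows "fd2 (\<lambda>y. f (l y)) x v u = fd2 f (l x) (l v) (l u)"
proof -
  have 1: "fd l y = l" for y by (rule fd_eq[OF bounded_linear_imp_has_derivative[OF l]])
  have "fd2 l x v u = 0" unfolding 1 by (simp add: fd_eq[OF has_derivative_const])
  moreover have "fd f (l x) 0 = 0" by (rule linear_0[OF has_derivative_linear[OF Ck_diff[OF f UNIV_I]]])
  ultimately show ?thesis
    using fd2_compose[OF open_UNIV UNIV_I Ck_linear[OF open_UNIV l] open_UNIV _ f, of v x u] by (simp add: 1)
qed

text \<open>The pinching bound follows from the cubic one on the radius c / (8 (C + 1)), with c the
  lower bound of the Hessian; C + 1 keeps the denominator positive when C is 0.\<close>

lemma taylor_lower:
  fixes F :: "real^'m::finite \<Rightarrow> real"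
  assumes F: "Ck_on (Suc (Suc (Suc 0))) UNIV F" and H: "spd (hessian F x)"
  obtains \<delta> C where "0 < \<delta>" "0 \<le> C"
    "\<And>r. norm r < \<delta> \<Longrightarrow> \<bar>F (x + r) - F x - fd F x r - ((hessian F x *v r) \<bullet> r) / 2\<bar> \<le> C * norm r ^ 3"
    "\<And>r. norm r < \<delta> \<Longrightarrow> \<bar>F (x + r) - F x - fd F x r - ((hessian F x *v r) \<bullet> r) / 2\<bar> \<le> ((hessian F x *v r) \<bullet> r) / 8"
proof -
  obtain \<epsilon> C where e: "0 < \<epsilon>" "0 \<le> C"
    and L: "\<And>r. norm r \<le> \<epsilon> \<Longrightarrow> \<bar>F (x + r) - F x - fd F x r - ((hessian F x *v r) \<bullet> r) / 2\<bar> \<le> C * norm r ^ 3"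
    by (fact taylor3[OF F])
  obtain c C' where c: "0 < c" "0 < C'" "\<And>u. c * (norm u)\<^sup>2 \<le> (hessian F x *v u) \<bullet> u" "\<And>u. (hessian F x *v u) \<bullet> u \<le> C' * (norm u)\<^sup>2"
    by (fact spd_bounds[OF H])
  show thesis
  proof (rule that[of "min \<epsilon> (c / (8 * (C + 1)))" C])
    show "0 < min \<epsilon> (c / (8 * (C + 1)))" using e c by simp
    show "0 \<le> C" by (rule e)
    fix r :: "real^'m" assume r: "norm r < min \<epsilon> (c / (8 * (C + 1)))"
    then show A: "\<bar>F (x + r) - F x - fd F x r - ((hessian F x *v r) \<bullet> r) / 2\<bar> \<le> C * norm r ^ 3"
      by (intro L) simp
    have "C * norm r \<le> (C + 1) * (c / (8 * (C + 1)))" using r e by (intro mult_mono) auto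
    moreover have "(C + 1) * (c / (8 * (C + 1))) = c / 8" using e add_nonneg_pos[of C 1] by (simp del: distrib_left_numeral distrib_right_numeral)
    ultimately have "C * norm r \<le> c / 8" by (rule ord_le_eq_trans)
    then have "C * norm r * (norm r)\<^sup>2 \<le> c / 8 * (norm r)\<^sup>2" by (intro mult_right_mono) auto
    also have "\<dots> \<le> ((hessian F x *v r) \<bullet> r) / 8" using c(3)[of r] by simp
    finally have B: "C * norm r ^ 3 \<le> ((hessian F x *v r) \<bullet> r) / 8" by (simp add: power3_eq_cube power2_eq_square)
    with A show "\<bar>F (x + r) - F x - fd F x r - ((hessian F x *v r) \<bullet> r) / 2\<bar> \<le> ((hessian F x *v r) \<bullet> r) / 8" by linarith
  qed
qed

text \<open>Along rays F is convex, so its excess over the tangent plane grows at least linearly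
  beyond the sphere of radius \<delta>, starting from a minimum on the sphere that is positive by
  strict convexity.\<close>

lemma convex_growth:
  fixes F :: "real^'m::finite \<Rightarrow> real"
  assumes F: "Ck_on (Suc (Suc 0)) UNIV F" and H: "\<And>x. spd (hessian F x)" and d: "0 < \<delta>"
  obtains c where "0 < c" "\<And>r. \<delta> \<le> norm r \<Longrightarrow> c * norm r \<le> F (x + r) - F x - fd F x r"
proof -
  define \<psi> where "\<psi> r = F (x + r) - F x - fd F x r" for r
  note lin = has_derivative_linear[OF Ck_diff[OF F UNIV_I]]
  have pos: "0 < \<psi> u" if "u \<noteq> 0" for u
  proof -
    obtain t where t: "F (x + u) = F x + fd F x u + fd2 F (x + t *\<^sub>R u) u u / 2" using taylor2[OF F] by blast
    then show ?thesis using spd_pos[OF H that, of "x + t *\<^sub>R u"] by (simp add: \<psi>_def hessian_fd[OF F])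
  qed
  have "continuous_on (sphere 0 \<delta>) \<psi>" unfolding \<psi>_def
    by (intro continuous_intros continuous_on_compose2[OF Ck_continuous[OF F]] linear_continuous_on linear_conv_bounded_linear[THEN iffD1] lin) auto
  moreover have "sphere (0::real^'m) \<delta> \<noteq> {}" using d by (simp add: sphere_eq_empty)
  ultimately obtain u0 where u0: "u0 \<in> sphere 0 \<delta>" "\<And>u. u \<in> sphere 0 \<delta> \<Longrightarrow> \<psi> u0 \<le> \<psi> u"
    using continuous_attains_inf[OF compact_sphere] by metis
  have m: "0 < \<psi> u0" using u0(1) d by (intro pos) auto
  show thesis
  proof (rule that[of "\<psi> u0 / \<delta>"])
    show "0 < \<psi> u0 / \<delta>" using m d by simp
    fix r :: "real^'m" assume r: "\<delta> \<le> norm r"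
    then have r0: "0 < norm r" using d by linarith
    have "convex_on UNIV (\<lambda>s. F (x + s *\<^sub>R r))"
      by (rule f''_ge0_imp_convex[OF convex_UNIV line_deriv[OF Ck_diff[OF F UNIV_I]] line_deriv[OF Ck2_diff[OF F UNIV_I]]])
        (simp add: hessian_fd[OF F, symmetric] spd_nonneg[OF H])
    from convex_onD[OF this, of "\<delta> / norm r" 0 1] have "F (x + (\<delta> / norm r) *\<^sub>R r) \<le> (1 - \<delta> / norm r) * F x + \<delta> / norm r * F (x + r)"
      using d r r0 by (simp add: divide_le_eq_1)
    then have "\<psi> ((\<delta> / norm r) *\<^sub>R r) \<le> \<delta> / norm r * \<psi> r"
      by (simp add: \<psi>_def linear_scale[OF lin] algebra_simps)
    moreover have "\<psi> u0 \<le> \<psi> ((\<delta> / norm r) *\<^sub>R r)" by (rule u0(2)) (use d r0 in simp)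
    ultimately have "\<psi> u0 \<le> \<delta> / norm r * \<psi> r" by linarith
    then have "\<psi> u0 / \<delta> * norm r \<le> \<psi> r" using d r0 by (simp add: field_simps)
    then show "\<psi> u0 / \<delta> * norm r \<le> F (x + r) - F x - fd F x r" by (simp only: \<psi>_def)
  qed
qed

section \<open>Positivity of the Hessian of the potential\<close>

context toric
begin

text \<open>T (\<eta> + \<zeta>) is the image of T \<zeta> under one fixed group element, so the
  derivative at \<eta> + \<zeta> factors through the derivative at \<zeta>.\<close>

lemma chart_translate:
  assumes "T \<zeta> \<in> chart_dom M i" "T (\<eta> + \<zeta>) \<in> chart_dom M i"
  shows "\<exists>A. linear A \<and> (\<forall>v. fd (Phi i) (\<eta> + \<zeta>) v = A (fd (Phi i) \<zeta> v))"
proof -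
  let ?S = "{\<zeta>. T \<zeta> \<in> chart_dom M i}"
  let ?A = "\<lambda>w. chart M i (act (cexp \<eta>) (cinv M i w))"
  let ?g = "\<lambda>(t, w). chart M i (act t (cinv M i w))"
  have oS: "open ?S" by (rule T_vimage_open[OF chart_open(1)])
  have mem: "(cexp \<eta>, Phi i \<zeta>) \<in> {(t, w). t \<in> ctorus \<and> w \<in> chart M i ` chart_dom M i \<and> act t (cinv M i w) \<in> chart_dom M i}"
    using assms by (auto simp: cexp_ctorus Phi_def T_add)
  have "((\<lambda>w. (cexp \<eta>, w)) has_derivative (\<lambda>w. (0, w))) (at (Phi i \<zeta>))"
    by (intro has_derivative_Pair has_derivative_const has_derivative_ident)
  from has_derivative_compose[OF this holo_fd_works[OF act_holo mem]]
  have A: "(?A has_derivative (\<lambda>w. fd ?g (cexp \<eta>, Phi i \<zeta>) (0, w))) (at (Phi i \<zeta>))" by simp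
  have PH: "(Phi i has_derivative fd (Phi i) \<zeta>) (at \<zeta>)" by (rule holo_fd_works[OF Phi_holo]) (use assms in simp)
  have eq: "?A (Phi i \<xi>) = Phi i (\<eta> + \<xi>)" if "\<xi> \<in> ?S" for \<xi>
    using that by (simp add: Phi_def T_add)
  have 1: "((\<lambda>\<xi>. Phi i (\<eta> + \<xi>)) has_derivative (\<lambda>v. fd ?g (cexp \<eta>, Phi i \<zeta>) (0, fd (Phi i) \<zeta> v))) (at \<zeta>)"
    by (rule has_derivative_transform_within_open[OF has_derivative_compose[OF PH A] oS _ eq]) (use assms in simp)
  have "((\<lambda>\<xi>. \<eta> + \<xi>) has_derivative (\<lambda>v. v)) (at \<zeta>)" by (auto intro!: derivative_eq_intros)
  from has_derivative_compose[OF this holo_fd_works[OF Phi_holo[of i]]]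
  have 2: "((\<lambda>\<xi>. Phi i (\<eta> + \<xi>)) has_derivative (\<lambda>v. fd (Phi i) (\<eta> + \<zeta>) v)) (at \<zeta>)" using assms by simp
  have "fd (Phi i) (\<eta> + \<zeta>) v = fd ?g (cexp \<eta>, Phi i \<zeta>) (0, fd (Phi i) \<zeta> v)" for v
    using has_derivative_unique[OF 2 1] by (rule fun_cong)
  then show ?thesis using has_derivative_linear[OF A] by blast
qed

lemma cexp_inj:
  assumes "cexp \<zeta> = cexp \<eta>" "\<And>a. \<bar>Im (\<zeta> $ a) - Im (\<eta> $ a)\<bar> < 2 * pi"
  shows "\<zeta> = \<eta>"
  unfolding vec_eq_iff
proof
  fix a
  have "exp (\<zeta> $ a) = exp (\<eta> $ a)" using arg_cong[OF assms(1), of "\<lambda>v. v $ a"] by (simp add: cexp_def)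
  then show "\<zeta> $ a = \<eta> $ a" using exp_complex_eqI[OF assms(2)] by blast
qed

text \<open>By translation a kernel vector at \<zeta> is a kernel vector all along the line \<zeta>
  + s v, so \<open>Phi i\<close> is constant on a segment, and so is \<open>T\<close>. The orbit map
  is injective on the torus and the exponential is injective on small sets, which forces v =
  0.\<close>

lemma Phi_fd_inj:
  assumes z: "T \<zeta> \<in> chart_dom M i" and v: "fd (Phi i) \<zeta> v = 0"
  shows "v = 0"
proof -
  have "open {\<zeta>. T \<zeta> \<in> chart_dom M i}" by (rule T_vimage_open[OF chart_open(1)])
  then obtain \<epsilon> where e: "0 < \<epsilon>" "ball \<zeta> \<epsilon> \<subseteq> {\<zeta>. T \<zeta> \<in> chart_dom M i}"
    using z by (auto simp: open_contains_ball)
  define d where "d = \<epsilon> / (norm v + 1)"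
  have n1: "0 < norm v + 1" by (simp add: add_nonneg_pos)
  have d: "0 < d" using e n1 by (simp add: d_def)
  have mem: "T (s *\<^sub>R v + \<zeta>) \<in> chart_dom M i" if "\<bar>s\<bar> < d" for s
  proof -
    have "\<bar>s\<bar> * norm v \<le> \<bar>s\<bar> * (norm v + 1)" by (intro mult_left_mono) auto
    also have "\<dots> < d * (norm v + 1)" using that n1 by (intro mult_strict_right_mono)
    also have "\<dots> = \<epsilon>" using n1 by (simp add: d_def)
    finally have "s *\<^sub>R v + \<zeta> \<in> ball \<zeta> \<epsilon>" by (simp add: dist_norm)
    then show ?thesis using e(2) by blast
  qed
  have der: "((\<lambda>s. Phi i (\<zeta> + s *\<^sub>R v)) has_derivative (\<lambda>h. 0)) (at s)" if s: "\<bar>s\<bar> < d" for s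
  proof -
    obtain A where A: "linear A" "\<And>u. fd (Phi i) (s *\<^sub>R v + \<zeta>) u = A (fd (Phi i) \<zeta> u)"
      using chart_translate[OF z mem[OF s]] by blast
    have D: "(Phi i has_derivative fd (Phi i) (\<zeta> + s *\<^sub>R v)) (at (\<zeta> + s *\<^sub>R v))"
      by (rule holo_fd_works[OF Phi_holo]) (use mem[OF s] in \<open>simp add: add.commute\<close>)
    have "((\<lambda>s. \<zeta> + s *\<^sub>R v) has_derivative (\<lambda>t. t *\<^sub>R v)) (at s)" by (auto intro!: derivative_eq_intros)
    from has_derivative_compose[OF this D]
    have "((\<lambda>s. Phi i (\<zeta> + s *\<^sub>R v)) has_derivative (\<lambda>t. fd (Phi i) (\<zeta> + s *\<^sub>R v) (t *\<^sub>R v))) (at s)" .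
    moreover have "fd (Phi i) (\<zeta> + s *\<^sub>R v) (t *\<^sub>R v) = 0" for t
      using A(2)[of v] linear_scale[OF has_derivative_linear[OF D], of t v] v linear_0[OF A(1)] by (simp add: add.commute)
    ultimately show ?thesis by (simp only:)
  qed
  have "\<exists>c. \<forall>s\<in>{-d<..<d}. Phi i (\<zeta> + s *\<^sub>R v) = c"
  proof (rule has_derivative_zero_constant)
    fix s assume "s \<in> {-d<..<d}"
    then have "\<bar>s\<bar> < d" by auto
    from der[OF this] show "((\<lambda>s. Phi i (\<zeta> + s *\<^sub>R v)) has_derivative (\<lambda>h. 0)) (at s within {-d<..<d})"
      by (rule has_derivative_at_withinI)
  qed simp
  then obtain c where c: "\<And>s. s \<in> {-d<..<d} \<Longrightarrow> Phi i (\<zeta> + s *\<^sub>R v) = c" by blast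
  \<comment> \<open>Short enough for the segment to stay in the chart and for the imaginary parts to
    move by less than 2\<pi>.\<close>
  define s where "s = min (d / 2) (1 / (norm v + 1))"
  have s: "0 < s" "s < d" "s * norm v < 1"
  proof -
    show "0 < s" "s < d" using d n1 by (auto simp: s_def min_def)
    have "s * norm v < s * (norm v + 1)" using \<open>0 < s\<close> by simp
    also have "\<dots> \<le> 1 / (norm v + 1) * (norm v + 1)" using n1 by (intro mult_right_mono) (auto simp: s_def)
    finally show "s * norm v < 1" using n1 by simp
  qed
  have "Phi i (\<zeta> + s *\<^sub>R v) = Phi i \<zeta>" using c[of s] c[of 0] s d by simp
  then have "T (\<zeta> + s *\<^sub>R v) = T \<zeta>"
    using inj_onD[OF chart_inj[of i]] z mem[of s] s by (auto simp: Phi_def add.commute)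
  then have eq: "cexp (\<zeta> + s *\<^sub>R v) = cexp \<zeta>" by (simp only: T_eq)
  have "\<zeta> + s *\<^sub>R v = \<zeta>"
  proof (rule cexp_inj[OF eq])
    fix a
    have "\<bar>Im (v $ a)\<bar> \<le> norm v" using abs_Im_le_cmod[of "v $ a"] Finite_Cartesian_Product.norm_nth_le[of v a] by linarith
    then have "s * \<bar>Im (v $ a)\<bar> \<le> s * norm v" using s by (intro mult_left_mono) auto
    then have "s * \<bar>Im (v $ a)\<bar> < 2 * pi" using s(3) pi_gt3 by linarith
    then show "\<bar>Im ((\<zeta> + s *\<^sub>R v) $ a) - Im (\<zeta> $ a)\<bar> < 2 * pi" using s by (simp add: abs_mult)
  qed
  then show ?thesis using s by simp
qed

definition "gform i j p v = Re (\<Sum>a\<in>UNIV. \<Sum>b\<in>UNIV. curvature_matrix M h i j p $ a $ b * v $ a * cnj (v $ b))"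

lemma gform_pos: "p \<in> chart_dom M i \<Longrightarrow> p \<in> triv L j \<Longrightarrow> v \<noteq> 0 \<Longrightarrow> 0 < gform i j p v"
  using pc unfolding positively_curved_def gform_def by blast

lemma lev_lnh:
  assumes p: "p \<in> chart_dom M i" "p \<in> triv L j"
  shows "lev (\<lambda>w. - ln (h j (cinv M i w))) (chart M i p) v = 4 * gform i j p v"
proof -
  have S: "open (chart M i ` (chart_dom M i \<inter> triv L j))" using chart_image_open[OF triv_open, of i j] by (simp add: Int_commute)
  have m: "chart M i p \<in> chart M i ` (chart_dom M i \<inter> triv L j)" using p by blast
  show ?thesis
    using lev_hessian[OF S m hW_Ck, of v] by (simp add: gform_def curvature_matrix_def)
qed

lemma lev_lne:
  assumes w: "w \<in> Om i j"
  shows "lev (\<lambda>w. ln ((cmod (e j (cinv M i w)))\<^sup>2)) w v = 0"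
proof -
  have ck: "Ck_on n (-{0}) (\<lambda>z::complex. ln ((cmod z)\<^sup>2))" for n
  proof (rule Ck_compose[where T="{0<..}" and f=ln and g="\<lambda>z. (cmod z)\<^sup>2"])
    have "Ck_on n (-{0}) (\<lambda>z::complex. z \<bullet> z)"
      by (intro Ck_bilinear[OF bounded_bilinear_inner] Ck_linear bounded_linear_ident) auto
    then show "Ck_on n (-{0}) (\<lambda>z::complex. (cmod z)\<^sup>2)" by (simp add: dot_square_norm)
  qed (use Ck_ln in auto)
  have "lev (\<lambda>w. (\<lambda>z. ln ((cmod z)\<^sup>2)) ((e j \<circ> cinv M i) w)) w v = lev (\<lambda>z. ln ((cmod z)\<^sup>2)) ((e j \<circ> cinv M i) w) (fd (e j \<circ> cinv M i) w v)"
    by (rule lev_compose[OF Om_open w holo_Ck[OF Om_open e_holo] e_holo holo_fd[OF Om_open e_holo] _ _ ck])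
      (use e_nz in \<open>auto simp: Om_def\<close>)
  also have "\<dots> = 0" by (rule lev_ln_norm) (use w e_nz in \<open>auto simp: Om_def\<close>)
  finally show ?thesis by simp
qed

lemma lev_Npot:
  assumes z: "\<zeta> \<in> V i j"
  shows "lev Npot \<zeta> v = 4 * gform i j (T \<zeta>) (fd (Phi i) \<zeta> v)"
proof -
  have t: "T \<zeta> \<in> chart_dom M i" "T \<zeta> \<in> triv L j" using z by (auto simp: V_def)
  have "lev Npot \<zeta> v = lev (\<lambda>\<zeta>. psi i j (Phi i \<zeta>)) \<zeta> v"
    by (rule lev_cong[OF V_open z]) (rule Npot_psi)
  also have "\<dots> = lev (psi i j) (Phi i \<zeta>) (fd (Phi i) \<zeta> v)"
    by (rule lev_compose[OF V_open z holo_Ck_vec[OF V_open Phi_holo_V] Phi_holo_V holo_fd_vec[OF V_open Phi_holo_V] Om_open _ psi_Ck])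
      (use Phi_Om in auto)
  also have "\<dots> = lev (\<lambda>w. - ln (h j (cinv M i w))) (Phi i \<zeta>) (fd (Phi i) \<zeta> v)"
  proof -
    have "Ck_on n (Om i j) (\<lambda>w. - ln (h j (cinv M i w)))" for n by (rule Ck_subset[OF hW_Ck]) (auto simp: Om_def)
    from lev_diff[OF Om_open Phi_Om[OF z] this eW_Ck, of "fd (Phi i) \<zeta> v"]
    show ?thesis by (simp add: psi_def[abs_def] lev_lne[OF Phi_Om[OF z]])
  qed
  also have "\<dots> = 4 * gform i j (T \<zeta>) (fd (Phi i) \<zeta> v)" unfolding Phi_def[of i \<zeta>] by (rule lev_lnh[OF t])
  finally show ?thesis .
qed

text \<open>\<open>Npot\<close> depends on \<open>rl \<zeta>\<close> only, and \<open>rl\<close>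
  kills i times a real direction, so one of the two terms of \<open>lev\<close> vanishes.\<close>

lemma lev_Npot_rc: "lev Npot (rc \<rho>) (rc x) = fd2 phi \<rho> x x"
proof -
  have N: "Npot = (\<lambda>\<zeta>. phi (rl \<zeta>))" by (simp add: Npot_phi fun_eq_iff)
  have "fd2 phi \<rho> 0 0 = 0" by (rule linear_0[OF has_derivative_linear[OF Ck2_diff[OF phi_Ck UNIV_I]]])
  then show ?thesis unfolding lev_def N fd2_linear_composite[OF linear_rl phi_Ck] by simp
qed

text \<open>The Hessian in the direction u is four times the curvature form at the image of
  \<open>rc u\<close> under the derivative of \<open>Phi i\<close>, and this image is nonzero by
  \<open>Phi_fd_inj\<close>.\<close>

lemma spd_phi: "spd (hessian phi \<rho>)"
  unfolding spd_def
proof (intro conjI allI impI)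
  show "transpose (hessian phi \<rho>) = hessian phi \<rho>"
    by (simp add: transpose_def hessian_def vec_eq_iff fd2_sym[OF phi_Ck])
  fix u :: "real^'m" assume u: "u \<noteq> 0"
  obtain i j where z: "rc \<rho> \<in> V i j" using V_cover by blast
  then have t: "T (rc \<rho>) \<in> chart_dom M i" "T (rc \<rho>) \<in> triv L j" by (auto simp: V_def)
  have "rc u \<noteq> 0" using u rl_rc[of u] linear_0[OF bounded_linear.linear[OF linear_rl]] by metis
  then have "fd (Phi i) (rc \<rho>) (rc u) \<noteq> 0" using Phi_fd_inj[OF t(1)] by blast
  from gform_pos[OF t this] show "0 < (hessian phi \<rho> *v u) \<bullet> u"
    using lev_Npot[OF z, of "rc u"] by (simp add: hessian_fd[OF phi_Ck] lev_Npot_rc)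
qed

end

section \<open>The real determinant of a complex linear map\<close>

text \<open>In the Leibniz expansion a permutation other than the identity moves at least two
  indices, so its product vanishes to second order at s = 0.\<close>

lemma det_deriv_mat1:
  fixes B :: "'a::real_normed_field^'n::finite^'n"
  shows "((\<lambda>s::real. det (mat 1 + s *\<^sub>R B)) has_vector_derivative (\<Sum>i\<in>UNIV. B $ i $ i)) (at 0)"
proof -
  let ?S = "{p. p permutes (UNIV::'n set)}"
  have fin: "finite ?S" by (rule finite_permutations) simp
  have D: "((\<lambda>s::real. of_int (sign p) * (\<Prod>i\<in>UNIV. (mat 1 + s *\<^sub>R B) $ i $ p i)) has_derivative
      (\<lambda>t. of_int (sign p) * (\<Sum>i\<in>UNIV. (t *\<^sub>R B $ i $ p i) * (\<Prod>j\<in>UNIV-{i}. (mat 1 :: 'a^'n^'n) $ j $ p j)))) (at 0)" for p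
  proof -
    have "((\<lambda>s::real. (mat 1 + s *\<^sub>R B) $ i $ p i) has_derivative (\<lambda>t. t *\<^sub>R B $ i $ p i)) (at 0)" for i
      by (auto intro!: derivative_eq_intros)
    have "((\<lambda>s::real. \<Prod>i\<in>UNIV. (mat 1 + s *\<^sub>R B) $ i $ p i) has_derivative
      (\<lambda>t. \<Sum>i\<in>UNIV. (t *\<^sub>R B $ i $ p i) * (\<Prod>j\<in>UNIV-{i}. (mat 1 + 0 *\<^sub>R B) $ j $ p j))) (at 0)"
      by (rule has_derivative_prod) (rule \<open>\<And>i. (_ has_derivative _) _\<close>)
    then show ?thesis by (intro has_derivative_mult_right) simp
  qed
  have Z: "(\<Sum>i\<in>UNIV. (t *\<^sub>R B $ i $ p i) * (\<Prod>j\<in>UNIV-{i}. (mat 1 :: 'a^'n^'n) $ j $ p j)) = 0" if p: "p permutes UNIV" "p \<noteq> id" for p t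
  proof (rule sum.neutral, rule ballI)
    fix i :: 'n
    obtain k where k: "p k \<noteq> k" using p(2) by (auto simp: fun_eq_iff)
    have "p (p k) \<noteq> p k" using k permutes_inj[OF p(1)] by (auto simp: inj_def)
    then obtain j where "j \<noteq> i" "p j \<noteq> j" using k by metis
    then have "(\<Prod>j\<in>UNIV-{i}. (mat 1 :: 'a^'n^'n) $ j $ p j) = 0"
      by (intro prod_zero) (auto simp: mat_def intro!: bexI[of _ j])
    then show "(t *\<^sub>R B $ i $ p i) * (\<Prod>j\<in>UNIV-{i}. (mat 1 :: 'a^'n^'n) $ j $ p j) = 0" by simp
  qed
  have "((\<lambda>s::real. det (mat 1 + s *\<^sub>R B)) has_derivative
      (\<lambda>t. \<Sum>p\<in>?S. of_int (sign p) * (\<Sum>i\<in>UNIV. (t *\<^sub>R B $ i $ p i) * (\<Prod>j\<in>UNIV-{i}. (mat 1 :: 'a^'n^'n) $ j $ p j)))) (at 0)"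
    unfolding det_def by (intro has_derivative_sum D)
  moreover have "(\<Sum>p\<in>?S. of_int (sign p) * (\<Sum>i\<in>UNIV. (t *\<^sub>R B $ i $ p i) * (\<Prod>j\<in>UNIV-{i}. (mat 1 :: 'a^'n^'n) $ j $ p j)))
     = t *\<^sub>R (\<Sum>i\<in>UNIV. B $ i $ i)" for t
  proof -
    have "(\<Sum>p\<in>?S. of_int (sign p) * (\<Sum>i\<in>UNIV. (t *\<^sub>R B $ i $ p i) * (\<Prod>j\<in>UNIV-{i}. (mat 1 :: 'a^'n^'n) $ j $ p j)))
      = (\<Sum>p\<in>{id}. of_int (sign p) * (\<Sum>i\<in>UNIV. (t *\<^sub>R B $ i $ p i) * (\<Prod>j\<in>UNIV-{i}. (mat 1 :: 'a^'n^'n) $ j $ p j)))"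
    proof (rule sum.mono_neutral_right[OF fin])
      show "{id} \<subseteq> ?S" by (simp add: permutes_id)
      show "\<forall>p\<in>?S - {id}. of_int (sign p) * (\<Sum>i\<in>UNIV. (t *\<^sub>R B $ i $ p i) * (\<Prod>j\<in>UNIV-{i}. (mat 1 :: 'a^'n^'n) $ j $ p j)) = 0"
      proof
        fix p assume "p \<in> ?S - {id}"
        then have "p permutes UNIV" "p \<noteq> id" by auto
        from Z[OF this] show "of_int (sign p) * (\<Sum>i\<in>UNIV. (t *\<^sub>R B $ i $ p i) * (\<Prod>j\<in>UNIV-{i}. (mat 1 :: 'a^'n^'n) $ j $ p j)) = 0"
          by (simp only: mult_zero_right)
      qed
    qed
    also have "\<dots> = t *\<^sub>R (\<Sum>i\<in>UNIV. B $ i $ i)" by (simp add: mat_def scaleR_sum_right)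
    finally show ?thesis .
  qed
  ultimately show ?thesis by (simp add: has_vector_derivative_def)
qed

text \<open>The real change of variables formula needs a well-ordered index type, hence these coordinates.\<close>

definition cbas :: "'m::finite bit0 \<Rightarrow> complex^'m" where "cbas = (SOME \<beta>. bij_betw \<beta> UNIV Basis)"
definition crep :: "real^('m::finite bit0) \<Rightarrow> complex^'m" where "crep x = (\<Sum>w\<in>UNIV. x $ w *\<^sub>R cbas w)"
definition cabs :: "complex^'m::finite \<Rightarrow> real^('m bit0)" where "cabs v = (\<chi> w. v \<bullet> cbas w)"
definition rdet :: "(complex^'m::finite \<Rightarrow> complex^'m) \<Rightarrow> real" where "rdet f = det (matrix (\<lambda>x. cabs (f (crep x))))"

lemma cbas: "bij_betw (cbas :: 'm::finite bit0 \<Rightarrow> complex^'m) UNIV Basis"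
proof -
  have "card (UNIV :: 'm bit0 set) = card (Basis :: (complex^'m) set)" by simp
  then have "\<exists>\<beta> :: 'm bit0 \<Rightarrow> complex^'m. bij_betw \<beta> UNIV Basis" by (intro finite_same_card_bij) auto
  then show ?thesis unfolding cbas_def by (rule someI_ex)
qed

lemma cbas_inner: "cbas w \<bullet> cbas w' = (if w = w' then 1 else 0)"
proof -
  have "cbas w \<in> Basis" "cbas w' \<in> Basis" using bij_betwE[OF cbas] by auto
  from inner_Basis[OF this] show ?thesis using inj_eq[OF bij_betw_imp_inj_on[OF cbas], of w w'] by simp
qed

lemma linear_crep: "linear crep"
  by (rule linearI) (simp_all add: crep_def scaleR_left_distrib sum.distrib scaleR_sum_right)
lemma linear_cabs: "linear cabs"
  by (rule linearI) (simp_all add: cabs_def vec_eq_iff inner_add_left)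
lemma crep_axis: "crep (axis w 1) = cbas w"
  by (simp add: crep_def axis_def if_distrib[of "\<lambda>c. c *\<^sub>R _"] cong: if_cong)
lemma cabs_crep [simp]: "cabs (crep x) = x"
  by (simp add: cabs_def crep_def vec_eq_iff inner_sum_left cbas_inner if_distrib cong: if_cong)
lemma crep_cabs [simp]: "crep (cabs v) = v"
proof -
  have "crep (cabs v) = (\<Sum>b\<in>Basis. (v \<bullet> b) *\<^sub>R b)"
    unfolding crep_def cabs_def vec_lambda_beta by (rule sum.reindex_bij_betw[OF cbas])
  then show ?thesis by (simp add: euclidean_representation)
qed

lemma rdet_compose:
  assumes "linear f" "linear g" shows "rdet (\<lambda>x. f (g x)) = rdet f * rdet g"
proof -
  have l: "linear (\<lambda>x. cabs (f (crep x)))" "linear (\<lambda>x. cabs (g (crep x)))"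
    using assms linear_compose[OF linear_crep, unfolded o_def] linear_compose[OF _ linear_cabs, unfolded o_def] by blast+
  have "matrix (\<lambda>x. cabs (f (g (crep x)))) = matrix (\<lambda>x. cabs (f (crep x))) ** matrix (\<lambda>x. cabs (g (crep x)))"
    using matrix_compose[OF l(2,1)] by (simp add: o_def)
  then show ?thesis by (simp add: rdet_def det_mul)
qed

lemma matrix_entry: "matrix (\<lambda>x. cabs (f (crep x))) $ i $ j = f (cbas j) \<bullet> cbas i"
  by (simp add: matrix_def crep_axis) (simp add: cabs_def)

lemma rdet_deriv:
  assumes f: "linear f"
  shows "((\<lambda>s::real. rdet (\<lambda>x. x + s *\<^sub>R f x)) has_real_derivative (\<Sum>b\<in>Basis. f b \<bullet> b)) (at 0)"
proof -
  have "rdet (\<lambda>x. x + s *\<^sub>R f x) = det (mat 1 + s *\<^sub>R matrix (\<lambda>x. cabs (f (crep x))))" for s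
    unfolding rdet_def by (rule arg_cong[of _ _ det]) (simp add: vec_eq_iff matrix_entry matrix_entry[of "\<lambda>x. x + s *\<^sub>R f x"] inner_add_left cbas_inner mat_def)
  moreover have "(\<Sum>b\<in>Basis. f b \<bullet> b) = (\<Sum>i\<in>UNIV. matrix (\<lambda>x. cabs (f (crep x))) $ i $ i)"
    unfolding matrix_entry by (rule sum.reindex_bij_betw[OF cbas, symmetric])
  ultimately show ?thesis using det_deriv_mat1[of "matrix (\<lambda>x. cabs (f (crep x)))"]
    by (simp add: has_real_derivative_iff_has_vector_derivative)
qed

lemma rdet_adjoint:
  assumes "\<And>x y. f x \<bullet> y = x \<bullet> g y" shows "rdet f = rdet g"
proof -
  have "matrix (\<lambda>x. cabs (f (crep x))) = transpose (matrix (\<lambda>x. cabs (g (crep x))))"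
    unfolding vec_eq_iff transpose_def vec_lambda_beta matrix_entry assms by (simp add: inner_commute)
  then show ?thesis by (simp add: rdet_def det_transpose)
qed

definition ctrans :: "complex^'m^'n \<Rightarrow> complex^'n^'m" where "ctrans A = (\<chi> i j. cnj (A $ j $ i))"

lemma inner_cvec: "x \<bullet> y = Re (\<Sum>i\<in>UNIV. x $ i * cnj (y $ i))" for x y :: "complex^'m::finite"
  by (simp add: inner_vec_def inner_complex_def)

lemma ctrans_inner: "(A *v x) \<bullet> y = x \<bullet> (ctrans A *v y)" for A :: "complex^'m::finite^'n::finite"
proof -
  have "(\<Sum>i\<in>UNIV. (\<Sum>j\<in>UNIV. A $ i $ j * x $ j) * cnj (y $ i)) = (\<Sum>j\<in>UNIV. x $ j * cnj (\<Sum>i\<in>UNIV. cnj (A $ i $ j) * y $ i))"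
    unfolding sum_distrib_left sum_distrib_right cnj_sum by (subst sum.swap) (simp add: mult_ac)
  then show ?thesis unfolding inner_cvec matrix_vector_mult_def ctrans_def by (simp only: vec_lambda_beta)
qed

lemma linear_mv: "linear ((*v) (A :: complex^'m::finite^'n::finite))"
  by (rule linearI) (rule matrix_vector_right_distrib, simp add: vec_eq_iff matrix_vector_mult_def scaleR_sum_right)

lemma det_cnj: "det (\<chi> i j. cnj (A $ i $ j)) = cnj (det A)"
  by (simp add: det_def)

lemma det_ctrans: "det (ctrans A) = cnj (det A)"
proof -
  have "ctrans A = transpose (\<chi> i j. cnj (A $ i $ j))" by (simp add: ctrans_def transpose_def)
  then show ?thesis by (simp add: det_transpose det_cnj)
qed

lemma real_trace_complex: "(\<Sum>b\<in>Basis. (B *v b) \<bullet> b) = 2 * Re (\<Sum>i\<in>UNIV. B $ i $ i)" for B :: "complex^'m::finite^'m"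
proof -
  have "(B *v axis a c) $ a = B $ a $ a * c" for a c
    by (simp add: matrix_vector_mult_def axis_def if_distrib[of "\<lambda>c. _ * c"] cong: if_cong)
  then show ?thesis by (simp add: sum_Basis_cvec inner_axis inner_complex_def sum_distrib_left)
qed

text \<open>\<open>rdet\<close> and |det|^2 are multiplicative, and both have derivative 2 Re tr at
  the identity. Their quotient is therefore constant on the segment from 1 to N, the product of the
  adjoint of A with A, and it is 1 at the start. The adjoint has the same \<open>rdet\<close> as A,
  so the identity at N is the square of the claim.\<close>

lemma abs_rdet:
  fixes A :: "complex^'m::finite^'m"
  assumes A: "det A \<noteq> 0"
  shows "\<bar>rdet ((*v) A)\<bar> = (cmod (det A))\<^sup>2"
proof -
  define N where "N = ctrans A ** A"
  define G where "G t = mat 1 + t *\<^sub>R (N - mat 1)" for t :: real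
  define f where "f t = rdet ((*v) (G t)) / (cmod (det (G t)))\<^sup>2" for t
  have inj: "x = 0" if "A *v x = 0" for x
    using A that invertible_det_nz[of A] invertible_left_inverse[of A] matrix_left_invertible_ker[of A] by blast
  \<comment> \<open>A kernel vector x would give 0 = <G t x, x> = (1 - t) |x|^2 + t |A x|^2, which
    is positive.\<close>
  have nz: "det (G t) \<noteq> 0" if t: "0 \<le> t" "t \<le> 1" for t
  proof
    assume "det (G t) = 0"
    then obtain x where x: "x \<noteq> 0" "G t *v x = 0"
      using invertible_det_nz[of "G t"] invertible_left_inverse[of "G t"] matrix_left_invertible_ker[of "G t"] by blast
    have sc: "(t *\<^sub>R M) *v x = t *\<^sub>R (M *v x)" for M :: "complex^'m^'m"
      by (simp add: vec_eq_iff matrix_vector_mult_def scaleR_sum_right)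
    have "G t *v x = (1 - t) *\<^sub>R x + t *\<^sub>R (ctrans A *v (A *v x))"
      by (simp add: G_def N_def matrix_vector_mult_add_rdistrib matrix_vector_mult_diff_rdistrib sc matrix_vector_mul_assoc[symmetric] algebra_simps)
    then have "0 = (1 - t) * (x \<bullet> x) + t * ((A *v x) \<bullet> (A *v x))"
      using x(2) by (simp add: ctrans_inner flip: inner_add_right inner_scaleR_right)
    moreover have "0 < x \<bullet> x" "0 < (A *v x) \<bullet> (A *v x)" using x(1) inj[of x] by auto
    ultimately have p: "0 = (1 - t) * (x \<bullet> x) + t * ((A *v x) \<bullet> (A *v x))" "0 < x \<bullet> x" "0 < (A *v x) \<bullet> (A *v x)" by blast+
    show False
    proof (cases "t = 1")
      case False
      then have "0 < (1 - t) * (x \<bullet> x)" using t p by (intro mult_pos_pos) auto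
      moreover have "0 \<le> t * ((A *v x) \<bullet> (A *v x))" using t by simp
      ultimately show False using p(1) by linarith
    qed (use p in simp)
  qed
  have der: "(f has_real_derivative 0) (at t)" if t: "0 \<le> t" "t \<le> 1" for t
  proof -
    obtain C where C: "G t ** C = mat 1" using nz[OF t] invertible_det_nz[of "G t"] by (auto simp: invertible_def)
    define B where "B = C ** (N - mat 1)"
    \<comment> \<open>Multiplicativity moves the derivative at t to a derivative at the identity
      matrix.\<close>
    have Gs: "G (t + s) = G t ** (mat 1 + s *\<^sub>R B)" for s
    proof -
      have sc: "M ** (s *\<^sub>R K) = s *\<^sub>R (M ** K)" for M K :: "complex^'m^'m"
        by (simp add: vec_eq_iff matrix_matrix_mult_def scaleR_sum_right)
      have "G t ** (mat 1 + s *\<^sub>R B) = G t + s *\<^sub>R ((G t ** C) ** (N - mat 1))"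
        unfolding matrix_add_ldistrib sc B_def by (simp add: matrix_mul_assoc)
      then show ?thesis unfolding C by (simp add: G_def scaleR_left_distrib add.assoc)
    qed
    define k where "k s = rdet (\<lambda>x. x + s *\<^sub>R (B *v x)) / (cmod (det (mat 1 + s *\<^sub>R B)))\<^sup>2" for s
    have sc: "(s *\<^sub>R B) *v x = s *\<^sub>R (B *v x)" for s x
      by (simp add: vec_eq_iff matrix_vector_mult_def scaleR_sum_right)
    have fk: "f (t + s) = f t * k s" for s
    proof -
      have "(*v) (G (t + s)) = (\<lambda>x. G t *v (x + s *\<^sub>R (B *v x)))"
        by (simp add: Gs fun_eq_iff matrix_vector_mul_assoc[symmetric] matrix_vector_mult_add_rdistrib sc)
      moreover have "rdet (\<lambda>x. G t *v (x + s *\<^sub>R (B *v x))) = rdet ((*v) (G t)) * rdet (\<lambda>x. x + s *\<^sub>R (B *v x))"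
        by (rule rdet_compose[OF linear_mv]) (intro linear_compose_add linear_ident linear_compose_scale_right linear_mv)
      ultimately show ?thesis by (simp add: f_def k_def Gs det_mul norm_mult power_mult_distrib)
    qed
    let ?tr = "\<Sum>i\<in>UNIV. B $ i $ i"
    have d1: "((\<lambda>s. rdet (\<lambda>x. x + s *\<^sub>R (B *v x))) has_real_derivative 2 * Re ?tr) (at 0)"
      using rdet_deriv[OF linear_mv[of B]] by (simp only: real_trace_complex)
    have "((\<lambda>s. det (mat 1 + s *\<^sub>R B) \<bullet> det (mat 1 + s *\<^sub>R B)) has_derivative
       (\<lambda>s. det (mat 1 + 0 *\<^sub>R B) \<bullet> (s *\<^sub>R ?tr) + (s *\<^sub>R ?tr) \<bullet> det (mat 1 + 0 *\<^sub>R B))) (at 0)"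
      by (intro has_derivative_inner det_deriv_mat1[unfolded has_vector_derivative_def])
    then have d2: "((\<lambda>s. (cmod (det (mat 1 + s *\<^sub>R B)))\<^sup>2) has_real_derivative 2 * Re ?tr) (at 0)"
      by (simp add: has_field_derivative_def dot_square_norm inner_complex_def algebra_simps mult_commute_abs)
    have r1: "rdet (\<lambda>x::complex^'m. x) = 1"
    proof -
      have "matrix (\<lambda>x::real^('m bit0). x) = mat 1" by (simp add: matrix_def mat_def axis_def vec_eq_iff)
      then show ?thesis by (simp add: rdet_def)
    qed
    have "(k has_real_derivative 0) (at 0)"
      unfolding k_def[abs_def] using DERIV_divide[OF d1 d2] by (simp add: r1)
    from DERIV_cmult[OF this, of "f t"] have "((\<lambda>s. f (t + s)) has_real_derivative 0) (at 0)" by (simp add: fk)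
    then show ?thesis by (simp add: DERIV_shift[of f 0 0 t, symmetric] add.commute)
  qed
  have "f 1 = f 0" by (rule DERIV_isconst_end[of 0 1]) (auto intro!: der DERIV_isCont continuous_at_imp_continuous_on)
  moreover have "f 0 = 1"
  proof -
    have "(*v) (mat 1 :: complex^'m^'m) = (\<lambda>x. x)" by (simp add: fun_eq_iff)
    moreover have "matrix (\<lambda>x::real^('m bit0). x) = mat 1" by (simp add: matrix_def mat_def axis_def vec_eq_iff)
    ultimately show ?thesis by (simp add: f_def G_def rdet_def)
  qed
  moreover have "cmod (det N) = (cmod (det A))\<^sup>2"
    by (simp add: N_def det_mul det_ctrans norm_mult power2_eq_square)
  moreover have "G 1 = N" by (simp add: G_def)
  ultimately have "rdet ((*v) N) / ((cmod (det A))\<^sup>2)\<^sup>2 = 1" unfolding f_def by metis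
  then have "rdet ((*v) N) = ((cmod (det A))\<^sup>2)\<^sup>2" by (simp only: divide_eq_1_iff)
  moreover have "rdet ((*v) N) = rdet ((*v) (ctrans A)) * rdet ((*v) A)"
    using rdet_compose[OF linear_mv[of "ctrans A"] linear_mv[of A]] by (simp add: N_def matrix_vector_mul_assoc)
  moreover have "rdet ((*v) A) = rdet ((*v) (ctrans A))" by (rule rdet_adjoint) (rule ctrans_inner)
  ultimately have "(rdet ((*v) A))\<^sup>2 = ((cmod (det A))\<^sup>2)\<^sup>2" by (simp add: power2_eq_square)
  then show ?thesis by (metis abs_of_nonneg power2_eq_iff abs_minus_cancel zero_le_power2)
qed

section \<open>Change of variables in complex coordinates\<close>

lemma crep_lborel: "distr lborel borel (crep :: real^('m::finite bit0) \<Rightarrow> complex^'m) = lborel"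
proof (rule lborel_distr_basis_iso[OF linear_crep])
  have "Basis = range (\<lambda>w. axis w 1 :: real^('m bit0))" by (auto simp: Basis_vec_def)
  moreover have "inj (\<lambda>w. axis w 1 :: real^('m bit0))" by (auto simp: inj_def axis_eq_axis)
  ultimately have "bij_betw (\<lambda>w. axis w 1 :: real^('m bit0)) UNIV Basis" by (simp add: bij_betw_def)
  moreover have "bij_betw (\<lambda>w. crep (axis w 1) :: complex^'m) UNIV Basis" unfolding crep_axis by (rule cbas)
  ultimately show "bij_betw (crep :: real^('m bit0) \<Rightarrow> complex^'m) Basis Basis"
    using bij_betw_comp_iff[of "\<lambda>w. axis w 1 :: real^('m bit0)" UNIV Basis crep Basis] by (simp add: o_def)
qed

lemma crep_measurable [measurable]: "crep \<in> borel_measurable borel"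
  by (intro borel_measurable_continuous_onI linear_continuous_on linear_conv_bounded_linear[THEN iffD1] linear_crep)

text \<open>Finiteness lets the nonnegative integral be read as a gauge integral, the form in which
  the measure of a differentiable image is given; \<open>crep\<close> and \<open>cabs\<close> carry
  it to real coordinates and back.\<close>

lemma emeasure_diff_image:
  fixes g :: "complex^'m::finite \<Rightarrow> complex^'m"
  assumes S: "S \<in> sets borel" and gS: "g ` S \<in> sets borel" and g: "\<And>x. x \<in> S \<Longrightarrow> (g has_derivative g' x) (at x)"
    and inj: "inj_on g S" and m: "(\<lambda>x. indicator S x * \<bar>rdet (g' x)\<bar>) \<in> borel_measurable borel"
    and fin: "(\<integral>\<^sup>+x. ennreal (indicator S x * \<bar>rdet (g' x)\<bar>) \<partial>lborel) < \<infinity>"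
  shows "emeasure lborel (g ` S) = (\<integral>\<^sup>+x. ennreal (indicator S x * \<bar>rdet (g' x)\<bar>) \<partial>lborel)"
proof -
  let ?I = "\<integral>\<^sup>+x. ennreal (indicator S x * \<bar>rdet (g' x)\<bar>) \<partial>lborel"
  define X where "X = crep -` S"
  define k where "k x = cabs (g (crep x))" for x
  define k' where "k' x u = cabs (g' (crep x) (crep u))" for x u
  note bl = linear_conv_bounded_linear[THEN iffD1]
  have X: "X \<in> sets borel" using measurable_sets[OF crep_measurable S] by (simp add: X_def)
  have kd: "(k has_derivative k' x) (at x within X)" if "x \<in> X" for x
  proof -
    have "crep x \<in> S" using that by (simp add: X_def)
    from has_derivative_compose[OF bounded_linear_imp_has_derivative[OF bl[OF linear_crep]] g[OF this]]
    have "((\<lambda>x. g (crep x)) has_derivative (\<lambda>u. g' (crep x) (crep u))) (at x within X)" .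
    from bounded_linear.has_derivative[OF bl[OF linear_cabs] this] show ?thesis by (simp add: k_def[abs_def] k'_def[abs_def])
  qed
  have kinj: "inj_on k X"
  proof (rule inj_onI)
    fix x y assume "x \<in> X" "y \<in> X" "k x = k y"
    then have "crep (k x) = crep (k y)" "crep x \<in> S" "crep y \<in> S" by (auto simp: X_def)
    then have "crep x = crep y" using inj by (auto simp: k_def inj_on_def)
    then have "cabs (crep x) = cabs (crep y)" by simp
    then show "x = y" by simp
  qed
  have "?I = (\<integral>\<^sup>+x. ennreal (indicator S x * \<bar>rdet (g' x)\<bar>) \<partial>distr lborel borel crep)" by (simp add: crep_lborel)
  also have "\<dots> = (\<integral>\<^sup>+x. ennreal (indicator S (crep x) * \<bar>rdet (g' (crep x))\<bar>) \<partial>lborel)"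
    using m by (intro nn_integral_distr) auto
  finally have I: "?I = (\<integral>\<^sup>+x. ennreal (indicator S (crep x) * \<bar>rdet (g' (crep x))\<bar>) \<partial>lborel)" .
  have m': "(\<lambda>x. indicator S (crep x) * \<bar>rdet (g' (crep x))\<bar>) \<in> borel_measurable borel"
    using measurable_compose[OF crep_measurable m] .
  have eI: "?I = ennreal (enn2real ?I)" using fin by (simp add: less_top)
  have "((\<lambda>x. indicator S (crep x) * \<bar>rdet (g' (crep x))\<bar>) has_integral enn2real ?I) UNIV"
    by (rule nn_integral_has_integral[OF m']) (use I eI in auto)
  moreover have "(\<lambda>x. indicator S (crep x) * \<bar>rdet (g' (crep x))\<bar>) = (\<lambda>x. if x \<in> X then \<bar>det (matrix (k' x))\<bar> else 0)"
    by (auto simp: X_def k'_def[abs_def] rdet_def indicator_def)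
  ultimately have "((\<lambda>x. \<bar>det (matrix (k' x))\<bar>) has_integral enn2real ?I) X"
    by (simp add: has_integral_restrict_UNIV)
  then have lm: "k ` X \<in> lmeasurable" "measure lebesgue (k ` X) = enn2real ?I"
    using has_measure_differentiable_image[OF _ kd kinj, of "enn2real ?I"] X by auto
  have kX: "crep -` (g ` S) = k ` X"
  proof (intro set_eqI iffI)
    fix x assume "x \<in> crep -` (g ` S)"
    then obtain y where y: "y \<in> S" "crep x = g y" by auto
    then have "x = k (cabs y)" by (simp add: k_def y(2)[symmetric])
    moreover have "cabs y \<in> X" using y by (simp add: X_def)
    ultimately show "x \<in> k ` X" by blast
  qed (auto simp: X_def k_def)
  have "emeasure lborel (g ` S) = emeasure (distr lborel borel crep) (g ` S)" by (simp add: crep_lborel)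
  also have "\<dots> = emeasure lborel (k ` X)" using gS by (subst emeasure_distr) (auto simp: kX)
  also have "\<dots> = emeasure lebesgue (k ` X)"
    using measurable_sets[OF crep_measurable gS] by (simp add: kX)
  also have "\<dots> = ennreal (measure lebesgue (k ` X))" by (rule emeasure_eq_measure2[OF lm(1)])
  also have "\<dots> = ?I" using lm(2) eI by simp
  finally show ?thesis .
qed

text \<open>Invariance of domain makes the image of \<open>U\<close> open and the inverse continuous
  on it, so images of Borel sets are preimages under a Borel map.\<close>

lemma inj_image_borel:
  fixes g :: "'a::euclidean_space \<Rightarrow> 'a"
  assumes U: "open U" "continuous_on U g" "inj_on g U" and B: "B \<in> sets borel" "B \<subseteq> U"
  shows "g ` B \<in> sets borel" and "(\<lambda>w. if w \<in> g ` U then inv_into U g w else 0) \<in> borel_measurable borel"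
proof -
  have og: "open (g ` U)" by (rule invariance_of_domain[OF U(2,1,3)])
  have "continuous_on (g ` U) (inv_into U g)" by (rule continuous_on_inverse_open) (use U in auto)
  then have c: "inv_into U g \<in> borel_measurable (restrict_space borel (g ` U))" by (rule borel_measurable_continuous_on_restrict)
  have "inv_into U g -` B \<inter> g ` U \<in> sets (restrict_space borel (g ` U))"
    using measurable_sets[OF c B(1)] by (simp add: space_restrict_space)
  then have "inv_into U g -` B \<inter> g ` U \<in> sets borel" using og by (subst (asm) sets_restrict_space_iff) auto
  moreover have "inv_into U g -` B \<inter> g ` U = g ` B" using B(2) U(3) by (auto simp: inv_into_f_f image_iff)
  ultimately show "g ` B \<in> sets borel" by simp
  show "(\<lambda>w. if w \<in> g ` U then inv_into U g w else 0) \<in> borel_measurable borel"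
    using og c by (intro measurable_restrict_space_iff[THEN iffD1]) auto
qed

lemma nn_integral_cov:
  fixes g :: "complex^'m::finite \<Rightarrow> complex^'m"
  assumes U: "open U" "bounded U" and g: "\<And>x. x \<in> U \<Longrightarrow> (g has_derivative g' x) (at x)" and inj: "inj_on g U"
    and c: "continuous_on U (\<lambda>x. rdet (g' x))" and bd: "\<And>x. x \<in> U \<Longrightarrow> \<bar>rdet (g' x)\<bar> \<le> C"
    and B: "B \<in> sets borel" "B \<subseteq> U" and F: "F \<in> borel_measurable borel"
  shows "(\<integral>\<^sup>+w. indicator (g ` B) w * F (inv_into U g w) \<partial>lborel) = (\<integral>\<^sup>+x. indicator B x * (F x * ennreal \<bar>rdet (g' x)\<bar>) \<partial>lborel)"
proof -
  have cg: "continuous_on U g" using g by (intro continuous_at_imp_continuous_on ballI has_derivative_continuous)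
  define Psi where "Psi w = (if w \<in> g ` U then inv_into U g w else 0)" for w
  have Psi [measurable]: "Psi \<in> borel_measurable borel" unfolding Psi_def[abs_def] using inj_image_borel(2)[OF U(1) cg inj B] .
  have gU [measurable]: "g ` U \<in> sets borel" using invariance_of_domain[OF cg U(1) inj] by simp
  define J where "J x = indicator U x * \<bar>rdet (g' x)\<bar>" for x
  have J [measurable]: "J \<in> borel_measurable borel"
    using borel_measurable_continuous_on_indicator[OF _ continuous_on_rabs[OF c]] U(1) by (simp add: J_def[abs_def])
  define N1 where "N1 = distr (density lborel (indicator (g ` U))) borel Psi"
  have N1: "N1 = density lborel (\<lambda>x. ennreal (J x))"
  proof (rule measure_eqI)
    fix X assume "X \<in> sets N1"
    then have X [measurable]: "X \<in> sets borel" by (simp add: N1_def)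
    have UX: "U \<inter> X \<in> sets borel" using U(1) X by auto
    have J2: "indicator (U \<inter> X) x * \<bar>rdet (g' x)\<bar> = indicator X x * J x" for x by (auto simp: J_def indicator_def)
    have "emeasure N1 X = (\<integral>\<^sup>+w. indicator (g ` U) w * indicator (Psi -` X) w \<partial>lborel)"
      unfolding N1_def by (subst emeasure_distr) (auto simp: emeasure_density measurable_sets_borel[OF Psi X])
    also have "\<dots> = (\<integral>\<^sup>+w. indicator (g ` (U \<inter> X)) w \<partial>lborel)"
    proof (rule nn_integral_cong)
      fix w
      show "indicator (g ` U) w * indicator (Psi -` X) w = (indicator (g ` (U \<inter> X)) w :: ennreal)"
      proof (cases "w \<in> g ` U")
        case True
        then obtain x where x: "x \<in> U" "w = g x" by blast
        then have "Psi w = x" by (simp add: Psi_def inv_into_f_f[OF inj])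
        moreover have "w \<in> g ` (U \<inter> X) \<longleftrightarrow> x \<in> X"
          using inj_on_image_mem_iff[OF inj x(1), of "U \<inter> X"] x by auto
        ultimately show ?thesis using True by (simp add: indicator_def)
      next
        case False
        then have "w \<notin> g ` (U \<inter> X)" by blast
        then show ?thesis using False by (simp add: indicator_def)
      qed
    qed
    also have "\<dots> = emeasure lborel (g ` (U \<inter> X))"
      using inj_image_borel(1)[OF U(1) cg inj UX] by (simp add: nn_integral_indicator)
    also have "\<dots> = (\<integral>\<^sup>+x. ennreal (indicator (U \<inter> X) x * \<bar>rdet (g' x)\<bar>) \<partial>lborel)"
    proof (rule emeasure_diff_image[OF UX inj_image_borel(1)[OF U(1) cg inj UX]])
      show "(\<lambda>x. indicator (U \<inter> X) x * \<bar>rdet (g' x)\<bar>) \<in> borel_measurable borel" unfolding J2 by measurable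
      have "(\<integral>\<^sup>+x. ennreal (indicator (U \<inter> X) x * \<bar>rdet (g' x)\<bar>) \<partial>lborel) \<le> (\<integral>\<^sup>+x. ennreal C * indicator U x \<partial>lborel)"
        using bd by (intro nn_integral_mono) (auto simp: indicator_def intro!: ennreal_leI)
      also have "\<dots> = ennreal C * emeasure lborel U" using U(1) by (simp add: nn_integral_cmult_indicator)
      also have "\<dots> < \<infinity>" using emeasure_bounded_finite[OF U(2)] by (simp add: ennreal_mult_less_top)
      finally show "(\<integral>\<^sup>+x. ennreal (indicator (U \<inter> X) x * \<bar>rdet (g' x)\<bar>) \<partial>lborel) < \<infinity>" .
    qed (use g inj in \<open>auto intro: inj_on_subset\<close>)
    also have "\<dots> = emeasure (density lborel (\<lambda>x. ennreal (J x))) X"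
      unfolding J2 by (subst emeasure_density) (auto intro!: nn_integral_cong simp: indicator_def)
    finally show "emeasure N1 X = emeasure (density lborel (\<lambda>x. ennreal (J x))) X" .
  qed (simp add: N1_def)
  note F[measurable] note B(1)[measurable]
  have "(\<integral>\<^sup>+w. indicator (g ` B) w * F (inv_into U g w) \<partial>lborel) = (\<integral>\<^sup>+w. indicator (g ` U) w * (indicator B (Psi w) * F (Psi w)) \<partial>lborel)"
  proof (rule nn_integral_cong)
    fix w
    show "indicator (g ` B) w * F (inv_into U g w) = indicator (g ` U) w * (indicator B (Psi w) * F (Psi w))"
    proof (cases "w \<in> g ` U")
      case True
      then obtain x where x: "x \<in> U" "w = g x" by blast
      then have "Psi w = x" "inv_into U g w = x" by (simp_all add: Psi_def inv_into_f_f[OF inj])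
      moreover have "w \<in> g ` B \<longleftrightarrow> x \<in> B"
        using inj_on_image_mem_iff[OF inj x(1) B(2)] x by simp
      ultimately show ?thesis using True by (simp add: indicator_def)
    next
      case False
      then have "w \<notin> g ` B" using B(2) by blast
      then show ?thesis using False by (simp add: indicator_def)
    qed
  qed
  also have "\<dots> = (\<integral>\<^sup>+x. indicator B x * F x \<partial>N1)"
    unfolding N1_def by (subst nn_integral_distr) (auto simp: nn_integral_density)
  also have "\<dots> = (\<integral>\<^sup>+x. ennreal (J x) * (indicator B x * F x) \<partial>lborel)"
    unfolding N1 by (rule nn_integral_density) measurable
  also have "\<dots> = (\<integral>\<^sup>+x. indicator B x * (F x * ennreal \<bar>rdet (g' x)\<bar>) \<partial>lborel)"
    by (intro nn_integral_cong) (use B(2) in \<open>auto simp: J_def indicator_def mult.commute\<close>)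
  finally show ?thesis .
qed

lemma rdet_continuous:
  assumes "\<And>b. continuous_on S (\<lambda>x. g x b)"
  shows "continuous_on S (\<lambda>x. rdet (g x))"
  unfolding rdet_def det_def matrix_entry
  by (intro continuous_intros assms)

section \<open>Hermitian forms and a fundamental domain of the exponential\<close>

definition cnjv :: "complex^'m \<Rightarrow> complex^'m" where "cnjv v = (\<chi> a. cnj (v $ a))"
definition sesq :: "complex^'m::finite^'m \<Rightarrow> complex^'m \<Rightarrow> complex^'m \<Rightarrow> complex" where
  "sesq M u v = (\<Sum>a\<in>UNIV. u $ a * (M *v cnjv v) $ a)"

lemma sesq_sum: "(\<Sum>a\<in>UNIV. \<Sum>b\<in>UNIV. M $ a $ b * v $ a * cnj (v $ b)) = sesq M v v"
  unfolding sesq_def cnjv_def matrix_vector_mult_def by (simp add: sum_distrib_left mult_ac)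

lemma sesq_add: "sesq M (u + u') v = sesq M u v + sesq M u' v" "sesq M u (v + v') = sesq M u v + sesq M u v'"
proof -
  have "cnjv (v + v') = cnjv v + cnjv v'" by (simp add: cnjv_def vec_eq_iff)
  then show "sesq M u (v + v') = sesq M u v + sesq M u v'"
    by (simp add: sesq_def matrix_vector_right_distrib distrib_left sum.distrib)
qed (simp add: sesq_def distrib_right sum.distrib)

lemma sesq_axis: "sesq M (axis c x) (axis d y) = x * M $ c $ d * cnj y"
proof -
  have "(M *v cnjv (axis d y)) $ a = M $ a $ d * cnj y" for a
    by (simp add: matrix_vector_mult_def cnjv_def axis_def if_distrib[of cnj] if_distrib[of "\<lambda>t. _ * t"] cong: if_cong)
  then show ?thesis by (simp add: sesq_def axis_def if_distrib[of "\<lambda>t. t * _"] cong: if_cong)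
qed

text \<open>Polarisation: the vectors e_c + e_d and e_c + i e_d give the sum and the difference of
  the two off-diagonal entries.\<close>

lemma sesq_diag_zero:
  assumes "\<And>v. sesq M v v = 0" shows "M = 0"
proof -
  have d: "M $ c $ c = 0" for c using assms[of "axis c 1"] by (simp add: sesq_axis)
  have "M $ c $ d = 0" for c d
  proof -
    have "M $ c $ d + M $ d $ c = 0"
      using assms[of "axis c 1 + axis d 1"] by (simp add: sesq_add sesq_axis d add.commute)
    moreover have "- (\<i> * M $ c $ d) + \<i> * M $ d $ c = 0"
      using assms[of "axis c 1 + axis d \<i>"] by (simp add: sesq_add sesq_axis d algebra_simps)
    then have "\<i> * (M $ d $ c - M $ c $ d) = 0" by (simp add: algebra_simps)
    then have "M $ d $ c = M $ c $ d" by simp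
    ultimately show ?thesis by simp
  qed
  then show ?thesis by (simp add: vec_eq_iff)
qed

text \<open>The rule by which the matrix of such a form changes under the linear substitution
  \<open>A\<close>, as a curvature matrix does under a holomorphic change of coordinates.\<close>

lemma sesq_congruence:
  "sesq (transpose A ** G ** (\<chi> i j. cnj (A $ i $ j))) v v = sesq G (A *v v) (A *v v)"
proof -
  have dotT: "(\<Sum>a\<in>UNIV. v $ a * (transpose A *v w) $ a) = (\<Sum>a\<in>UNIV. (A *v v) $ a * w $ a)" for w
    unfolding matrix_vector_mult_def transpose_def vec_lambda_beta sum_distrib_left sum_distrib_right
    by (subst sum.swap) (simp add: mult_ac)
  have "(\<chi> i j. cnj (A $ i $ j)) *v cnjv v = cnjv (A *v v)"
    by (simp add: cnjv_def matrix_vector_mult_def vec_eq_iff)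
  then have "sesq (transpose A ** G ** (\<chi> i j. cnj (A $ i $ j))) v v = (\<Sum>a\<in>UNIV. v $ a * (transpose A *v (G *v cnjv (A *v v))) $ a)"
    by (simp add: sesq_def matrix_vector_mul_assoc[symmetric])
  also have "\<dots> = (\<Sum>a\<in>UNIV. (A *v v) $ a * (G *v cnjv (A *v v)) $ a)"
    by (rule dotT)
  finally show ?thesis by (simp add: sesq_def)
qed

definition rmat :: "real^'m^'n \<Rightarrow> complex^'m^'n" where "rmat H = (\<chi> a b. complex_of_real (H $ a $ b))"

lemma det_rmat: "det (rmat H) = complex_of_real (det H)"
  by (simp add: det_def rmat_def)

lemma sesq_rmat:
  assumes "transpose H = H"
  shows "sesq (rmat H) v v = complex_of_real ((H *v (\<chi> a. Re (v $ a))) \<bullet> (\<chi> a. Re (v $ a)) + (H *v (\<chi> a. Im (v $ a))) \<bullet> (\<chi> a. Im (v $ a)))"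
proof -
  have s: "H $ a $ b = H $ b $ a" for a b using assms by (metis transpose_def vec_lambda_beta)
  have "(\<Sum>a\<in>UNIV. \<Sum>b\<in>UNIV. H $ a $ b * (Im (v $ a) * Re (v $ b))) = (\<Sum>a\<in>UNIV. \<Sum>b\<in>UNIV. H $ a $ b * (Re (v $ a) * Im (v $ b)))"
    by (subst sum.swap) (simp add: s[of _ _] mult_ac)
  then have im: "Im (sesq (rmat H) v v) = 0"
    unfolding sesq_sum[symmetric] rmat_def by (simp add: algebra_simps sum_subtractf)
  have "Re (sesq (rmat H) v v) = (H *v (\<chi> a. Re (v $ a))) \<bullet> (\<chi> a. Re (v $ a)) + (H *v (\<chi> a. Im (v $ a))) \<bullet> (\<chi> a. Im (v $ a))"
    unfolding sesq_sum[symmetric] rmat_def inner_vec_def matrix_vector_mult_def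
    by (simp add: sum_distrib_left sum_distrib_right sum.distrib algebra_simps)
  with im show ?thesis by (simp add: complex_eq_iff)
qed

lemma period_shift:
  fixes x :: real obtains n :: int where "0 \<le> x - 2 * pi * n" "x - 2 * pi * n < 2 * pi"
proof -
  have "2 * pi * \<lfloor>x / (2 * pi)\<rfloor> \<le> x" using floor_divide_lower[of "2 * pi" x] by (simp add: mult_ac)
  moreover have "x < 2 * pi * (\<lfloor>x / (2 * pi)\<rfloor> + 1)" using floor_divide_upper[of "2 * pi" x] by (simp add: mult_ac)
  ultimately show thesis by (intro that[of "\<lfloor>x / (2 * pi)\<rfloor>"]) (simp_all add: algebra_simps)
qed

text \<open>A fundamental domain of \<open>cexp\<close>: it contains exactly one logarithm of each
  torus element.\<close>

definition strip :: "(complex^'m::finite) set" where "strip = {\<zeta>. \<forall>a. 0 \<le> Im (\<zeta> $ a) \<and> Im (\<zeta> $ a) < 2 * pi}"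

lemma strip_borel [measurable]: "strip \<in> sets borel"
proof -
  have eq: "strip = (\<Inter>a. {\<zeta>::complex^'m. 0 \<le> Im (\<zeta> $ a)} \<inter> {\<zeta>. Im (\<zeta> $ a) < 2 * pi})" by (auto simp: strip_def)
  have m: "{\<zeta>::complex^'m. 0 \<le> Im (\<zeta> $ a)} \<inter> {\<zeta>. Im (\<zeta> $ a) < 2 * pi} \<in> sets borel" for a
    by (intro sets.Int borel_closed borel_open closed_Collect_le open_Collect_less continuous_intros)
  show ?thesis unfolding eq by (rule sets.finite_INT[OF finite UNIV_not_empty m])
qed

lemma rl_measurable [measurable]: "rl \<in> borel_measurable borel"
  by (intro borel_measurable_continuous_onI linear_continuous_on linear_rl)

text \<open>The angles integrate out. The constant is \<pi>^m: the angles contribute (2 \<pi>)^m,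
  and \<rho> = 2 Re \<zeta> contributes 2^(-m).\<close>

lemma strip_integral:
  obtains K :: real where "0 < K"
    "\<And>g :: real^'m::finite \<Rightarrow> ennreal. g \<in> borel_measurable borel \<Longrightarrow>
      (\<integral>\<^sup>+\<zeta>. indicator strip \<zeta> * g (rl \<zeta>) \<partial>lborel) = ennreal K * (\<integral>\<^sup>+\<rho>. g \<rho> \<partial>lborel)"
proof -
  define \<kappa> :: "(real^'m) \<times> (real^'m) \<Rightarrow> complex^'m" where "\<kappa> p = (\<chi> a. Complex (fst p $ a) (snd p $ a))" for p
  have lin: "linear \<kappa>" by (rule linearI) (simp_all add: \<kappa>_def vec_eq_iff complex_eq_iff)
  have bb: "bij_betw \<kappa> Basis Basis"
    unfolding bij_betw_def
  proof
    have "inj \<kappa>" by (auto simp: inj_def \<kappa>_def vec_eq_iff prod_eq_iff)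
    then show "inj_on \<kappa> Basis" by (rule inj_on_subset) simp
    have 1: "\<kappa> (axis a 1, 0) = axis a 1" "\<kappa> (0, axis a 1) = axis a \<i>" for a
      by (auto simp: \<kappa>_def vec_eq_iff axis_def complex_eq_iff)
    have b1: "Basis = range (\<lambda>a. (axis a 1, 0::real^'m)) \<union> range (\<lambda>a. (0::real^'m, axis a 1::real^'m))"
      by (auto simp: Basis_prod_def Basis_vec_def)
    have b2: "Basis = range (\<lambda>a. axis a 1 :: complex^'m) \<union> range (\<lambda>a. axis a \<i>)"
      by (auto simp: Basis_vec_def Basis_complex_def)
    show "\<kappa> ` Basis = Basis" unfolding b1 b2 image_Un image_image 1 ..
  qed
  have \<kappa>m [measurable]: "\<kappa> \<in> borel_measurable borel"
    by (intro borel_measurable_continuous_onI linear_continuous_on linear_conv_bounded_linear[THEN iffD1] lin)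
  define X :: "(real^'m) set" where "X = {y. \<forall>a. 0 \<le> y $ a \<and> y $ a < 2 * pi}"
  have X [measurable]: "X \<in> sets borel"
  proof -
    have eq: "X = (\<Inter>a. {y::real^'m. 0 \<le> y $ a} \<inter> {y. y $ a < 2 * pi})" by (auto simp: X_def)
    have m: "{y::real^'m. 0 \<le> y $ a} \<inter> {y. y $ a < 2 * pi} \<in> sets borel" for a
      by (intro sets.Int borel_closed borel_open closed_Collect_le open_Collect_less continuous_intros)
    show ?thesis unfolding eq by (rule sets.finite_INT[OF finite UNIV_not_empty m])
  qed
  define v where "v = measure lborel X"
  have Xs: "X \<subseteq> cbox 0 (\<chi> a. 2 * pi)" "box 0 (\<chi> a. 2 * pi) \<subseteq> X"
    by (auto simp: X_def mem_box_cart less_imp_le)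
  have Xf: "emeasure lborel X < \<infinity>"
    using emeasure_mono[OF Xs(1), of lborel] emeasure_lborel_cbox_finite[of 0 "(\<chi> a. 2 * pi) :: real^'m"] by (auto simp: less_top[symmetric] top_unique)
  have ev: "emeasure lborel X = ennreal v" unfolding v_def using Xf by (intro emeasure_eq_ennreal_measure) auto
  have "0 < emeasure lborel (box 0 ((\<chi> a. 2 * pi) :: real^'m))"
  proof -
    have "box 0 (\<chi> a. 2 * pi) \<noteq> ({} :: (real^'m) set)" by (auto simp: box_ne_empty Basis_vec_def inner_axis)
    then have "\<not> negligible (box 0 (\<chi> a. 2 * pi) :: (real^'m) set)" by (intro open_not_negligible) auto
    then show ?thesis by (auto simp: negligible_iff_null_sets null_sets_def zero_less_iff_neq_zero)
  qed
  also have "\<dots> \<le> emeasure lborel X" by (rule emeasure_mono[OF Xs(2)]) simp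
  finally have v: "0 < v" by (simp add: ev)
  show thesis
  proof (rule that[of "v / 2 ^ CARD('m)"])
    show "0 < v / 2 ^ CARD('m)" using v by simp
    fix g :: "real^'m \<Rightarrow> ennreal" assume g [measurable]: "g \<in> borel_measurable borel"
    have rk: "rl (\<kappa> (x, y)) = 2 *\<^sub>R x" "\<kappa> (x, y) \<in> strip \<longleftrightarrow> y \<in> X" for x y
      by (auto simp: rl_def \<kappa>_def vec_eq_iff strip_def X_def)
    have "(\<integral>\<^sup>+\<zeta>. indicator strip \<zeta> * g (rl \<zeta>) \<partial>lborel) = (\<integral>\<^sup>+\<zeta>. indicator strip \<zeta> * g (rl \<zeta>) \<partial>distr lborel borel \<kappa>)"
      by (simp add: lborel_distr_basis_iso[OF lin bb])
    also have "\<dots> = (\<integral>\<^sup>+p. indicator strip (\<kappa> p) * g (rl (\<kappa> p)) \<partial>(lborel \<Otimes>\<^sub>M lborel))"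
      by (subst nn_integral_distr) (auto simp: lborel_prod)
    also have "\<dots> = (\<integral>\<^sup>+p. (\<lambda>(x, y). g (2 *\<^sub>R x) * indicator X y) p \<partial>(lborel \<Otimes>\<^sub>M lborel))"
      by (intro nn_integral_cong) (auto simp: rk indicator_def)
    also have "\<dots> = (\<integral>\<^sup>+x. \<integral>\<^sup>+y. g (2 *\<^sub>R x) * indicator X y \<partial>lborel \<partial>lborel)"
      by (subst lborel.nn_integral_fst[symmetric]) (auto simp: case_prod_beta)
    also have "\<dots> = (\<integral>\<^sup>+x. g (2 *\<^sub>R x) \<partial>lborel) * ennreal v"
      by (simp add: nn_integral_cmult_indicator nn_integral_multc ev)
    also have "(\<integral>\<^sup>+x. g (2 *\<^sub>R x) \<partial>lborel) = ennreal (1 / 2 ^ CARD('m)) * (\<integral>\<^sup>+x. g x \<partial>lborel)"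
    proof -
      have "(\<integral>\<^sup>+x. g x \<partial>lborel) = (\<integral>\<^sup>+x. g x \<partial>density (distr lborel borel (\<lambda>x. 0 + 2 *\<^sub>R x)) (\<lambda>_. ennreal (\<bar>2\<bar>^DIM(real^'m))))"
        by (subst lborel_affine[of 2 0]) auto
      also have "\<dots> = ennreal (2 ^ CARD('m)) * (\<integral>\<^sup>+x. g (2 *\<^sub>R x) \<partial>lborel)"
        by (simp add: nn_integral_density nn_integral_distr nn_integral_cmult)
      finally show ?thesis by (simp add: mult.assoc[symmetric] ennreal_mult[symmetric])
    qed
    finally have fin: "(\<integral>\<^sup>+\<zeta>. indicator strip \<zeta> * g (rl \<zeta>) \<partial>lborel) = ennreal (1 / 2 ^ CARD('m)) * (\<integral>\<^sup>+x. g x \<partial>lborel) * ennreal v" .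
    show "(\<integral>\<^sup>+\<zeta>. indicator strip \<zeta> * g (rl \<zeta>) \<partial>lborel) = ennreal (v / 2 ^ CARD('m)) * (\<integral>\<^sup>+\<rho>. g \<rho> \<partial>lborel)"
    proof -
      have "ennreal (v / 2 ^ CARD('m)) = ennreal (1 / 2 ^ CARD('m)) * ennreal v"
        using v by (subst ennreal_mult[symmetric]) auto
      then show ?thesis unfolding fin by (simp only: mult_ac)
    qed
  qed
qed

section \<open>The volume form on the open orbit\<close>

context toric
begin

definition "Amat i \<zeta> = (\<chi> a b. fd (Phi i) \<zeta> (axis b 1) $ a)"

lemma fd_Phi_mat:
  assumes z: "T \<zeta> \<in> chart_dom M i"
  shows "fd (Phi i) \<zeta> v = Amat i \<zeta> *v v"
proof -
  have z': "\<zeta> \<in> {\<zeta>. T \<zeta> \<in> chart_dom M i}" using z by simp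
  note lin = has_derivative_linear[OF holo_fd_works[OF Phi_holo z']]
  have ax: "fd (Phi i) \<zeta> (axis b c) $ a = fd (Phi i) \<zeta> (axis b 1) $ a * c" for a b c
  proof -
    have "axis b c = Re c *\<^sub>R axis b 1 + Im c *\<^sub>R imult (axis b (1::complex))"
      by (simp add: vec_eq_iff axis_def imult_vec_def imult_complex_def complex_eq_iff)
    then have "fd (Phi i) \<zeta> (axis b c) = Re c *\<^sub>R fd (Phi i) \<zeta> (axis b 1) + Im c *\<^sub>R imult (fd (Phi i) \<zeta> (axis b 1))"
      by (simp only: linear_add[OF lin] linear_scale[OF lin] holo_fd_imult[OF Phi_holo z'])
    then show ?thesis by (simp add: imult_vec_def imult_complex_def complex_eq_iff algebra_simps)
  qed
  have "v = (\<Sum>b\<in>UNIV. axis b (v $ b))" by (simp add: vec_eq_iff axis_def if_distrib cong: if_cong)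
  then have eq: "fd (Phi i) \<zeta> v = (\<Sum>b\<in>UNIV. fd (Phi i) \<zeta> (axis b (v $ b)))" using linear_sum[OF lin] by metis
  have "fd (Phi i) \<zeta> v $ a = (Amat i \<zeta> *v v) $ a" for a
  proof -
    have "fd (Phi i) \<zeta> v $ a = (\<Sum>b\<in>UNIV. fd (Phi i) \<zeta> (axis b (v $ b)) $ a)" unfolding eq by (rule sum_component)
    also have "\<dots> = (\<Sum>b\<in>UNIV. fd (Phi i) \<zeta> (axis b 1) $ a * v $ b)" by (rule sum.cong[OF refl]) (rule ax)
    also have "\<dots> = (Amat i \<zeta> *v v) $ a" by (simp only: Amat_def matrix_vector_mult_def vec_lambda_beta)
    finally show ?thesis .
  qed
  then show ?thesis unfolding vec_eq_iff by blast
qed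

text \<open>The curvature form pulled back by \<open>Phi i\<close> and the complexified Hessian of
  \<phi> agree on the diagonal, hence as matrices by polarisation: with A the Jacobian and G the
  curvature matrix, transpose A G conj A is the Hessian. Take determinants and use that the real
  Jacobian is |det A|^2. In the coordinate \<zeta> the volume density is thus a function of \<rho>
  alone.\<close>

lemma density_identity:
  assumes z: "\<zeta> \<in> V i j"
  shows "Re (det (curvature_matrix M h i j (T \<zeta>))) * \<bar>rdet (fd (Phi i) \<zeta>)\<bar> = det (hessian phi (rl \<zeta>))"
    and "rdet (fd (Phi i) \<zeta>) \<noteq> 0"
proof -
  let ?A = "Amat i \<zeta>" and ?G = "curvature_matrix M h i j (T \<zeta>)" and ?H = "hessian phi (rl \<zeta>)"
  have t: "T \<zeta> \<in> chart_dom M i" "T \<zeta> \<in> triv L j" using z by (auto simp: V_def)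
  have sym: "transpose ?H = ?H" using spd_phi by (simp add: spd_def)
  have q: "sesq ?G (?A *v v) (?A *v v) = sesq (rmat ?H) v v" for v
  proof -
    have N: "Npot = (\<lambda>\<zeta>. phi (rl \<zeta>))" by (simp add: Npot_phi fun_eq_iff)
    have r: "rl v = 2 *\<^sub>R (\<chi> a. Re (v $ a))" "rl (imult v) = (-2) *\<^sub>R (\<chi> a. Im (v $ a))"
      by (simp_all add: rl_def vec_eq_iff imult_vec_def imult_complex_def)
    have sc: "(?H *v (c *\<^sub>R x)) \<bullet> (c *\<^sub>R x) = c\<^sup>2 * ((?H *v x) \<bullet> x)" for c x
      by (simp add: matrix_vector_mult_scaleR power2_eq_square)
    have "4 * gform i j (T \<zeta>) (?A *v v) = lev Npot \<zeta> v" using lev_Npot[OF z, of v] fd_Phi_mat[OF t(1)] by simp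
    also have "\<dots> = 4 * ((?H *v (\<chi> a. Re (v $ a))) \<bullet> (\<chi> a. Re (v $ a)) + (?H *v (\<chi> a. Im (v $ a))) \<bullet> (\<chi> a. Im (v $ a)))"
      unfolding lev_def N fd2_linear_composite[OF linear_rl phi_Ck] hessian_fd[OF phi_Ck, symmetric] r sc by simp
    finally have "Re (sesq ?G (?A *v v) (?A *v v)) = (?H *v (\<chi> a. Re (v $ a))) \<bullet> (\<chi> a. Re (v $ a)) + (?H *v (\<chi> a. Im (v $ a))) \<bullet> (\<chi> a. Im (v $ a))"
      by (simp add: gform_def sesq_sum)
    moreover have "Im (sesq ?G (?A *v v) (?A *v v)) = 0"
    proof (cases "?A *v v = 0")
      case False
      then have "sesq ?G (?A *v v) (?A *v v) \<in> \<real>" using pc t unfolding positively_curved_def sesq_sum by blast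
      then show ?thesis by (simp add: complex_is_Real_iff)
    qed (simp add: sesq_def)
    ultimately show ?thesis unfolding sesq_rmat[OF sym] by (simp add: complex_eq_iff)
  qed
  let ?K = "transpose ?A ** ?G ** (\<chi> a b. cnj (?A $ a $ b))"
  have "sesq (?K - rmat ?H) v v = sesq ?K v v - sesq (rmat ?H) v v" for v
    by (simp add: sesq_def matrix_vector_mult_diff_rdistrib right_diff_distrib sum_subtractf)
  then have "?K - rmat ?H = 0" by (intro sesq_diag_zero) (simp add: sesq_congruence q)
  then have "det ?K = det (rmat ?H)" by simp
  then have d: "det ?A * det ?G * cnj (det ?A) = complex_of_real (det ?H)"
    by (simp add: det_mul det_transpose det_cnj det_rmat)
  have "det ?H > 0" by (rule spd_det_pos[OF spd_phi])
  then have nz: "det ?A \<noteq> 0" using d by auto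
  have rd: "\<bar>rdet (fd (Phi i) \<zeta>)\<bar> = (cmod (det ?A))\<^sup>2"
  proof -
    have "fd (Phi i) \<zeta> = (*v) ?A" by (rule ext) (rule fd_Phi_mat[OF t(1)])
    then show ?thesis using abs_rdet[OF nz] by simp
  qed
  then show "rdet (fd (Phi i) \<zeta>) \<noteq> 0" using nz by auto
  have "det ?G * complex_of_real ((cmod (det ?A))\<^sup>2) = complex_of_real (det ?H)"
    using d unfolding complex_norm_square by (simp add: mult_ac)
  from arg_cong[OF this, of Re] show "Re (det ?G) * \<bar>rdet (fd (Phi i) \<zeta>)\<bar> = det ?H"
    unfolding rd by simp
qed

text \<open>The density of the volume in the coordinate \<zeta>; the power of 2 is the one in
  \<open>kaehler_volume\<close>.\<close>

definition "Hd \<rho> = 2 ^ CARD('m) * det (hessian phi \<rho>)"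

lemma Hd_pos: "0 < Hd \<rho>" by (simp add: Hd_def spd_det_pos[OF spd_phi])

lemma Hd_Ck: "Ck_on n UNIV Hd"
proof -
  have "Ck_on n UNIV (\<lambda>x. hessian phi x $ a $ b)" for a b
    using Ck_linear_compose[OF bounded_linear_vec_nth open_UNIV Ck_linear_compose[OF bounded_linear_vec_nth open_UNIV hessian_Ck[OF phi_Ck]]] .
  then show ?thesis unfolding Hd_def[abs_def] det_def
    by (intro Ck_mult Ck_sum Ck_prod Ck_const open_UNIV)
qed

lemma Hd_measurable [measurable]: "Hd \<in> borel_measurable borel"
  by (rule borel_measurable_continuous_onI[OF Ck_continuous[OF Hd_Ck]])

lemma vol_sets [measurable_cong]: "sets vol = sets borel" using kv by (simp add: kaehler_volume_def)

text \<open>On a ball of radius at most 1 imaginary parts differ by less than 2\<pi>, so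
  \<open>Phi i\<close> is injective there; the closed ball inside \<open>V i j\<close> bounds the
  Jacobian. The density G of the chart cancels against the Jacobian by
  \<open>density_identity\<close>.\<close>

lemma vol_local:
  assumes e: "0 < \<epsilon>" "\<epsilon> \<le> 1" "cball \<zeta>0 \<epsilon> \<subseteq> V i j" and B: "B \<in> sets borel" "B \<subseteq> ball \<zeta>0 \<epsilon>"
  shows "T ` B \<in> sets borel" and "emeasure vol (T ` B) = (\<integral>\<^sup>+\<zeta>. indicator B \<zeta> * ennreal (Hd (rl \<zeta>)) \<partial>lborel)"
proof -
  let ?U = "ball \<zeta>0 \<epsilon>"
  have UV: "?U \<subseteq> V i j" using e(3) by auto
  have tV: "T \<zeta> \<in> chart_dom M i" "T \<zeta> \<in> triv L j" if "\<zeta> \<in> V i j" for \<zeta> using that by (auto simp: V_def)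
  have der: "(Phi i has_derivative fd (Phi i) \<zeta>) (at \<zeta>)" if "\<zeta> \<in> ?U" for \<zeta>
    by (rule holo_fd_works[OF Phi_holo_V]) (use that UV in blast)
  have inj: "inj_on (Phi i) ?U"
  proof (rule inj_onI)
    fix x y assume xy: "x \<in> ?U" "y \<in> ?U" "Phi i x = Phi i y"
    then have "T x = T y" using inj_onD[OF chart_inj[of i]] tV UV unfolding Phi_def by blast
    then have eq: "cexp x = cexp y" by (simp only: T_eq)
    have "dist x y < 2 * \<epsilon>" using xy(1,2) dist_triangle2[of x y \<zeta>0] by (simp add: dist_commute)
    then have nd: "norm (x - y) < 2 * pi" using e(2) pi_gt3 by (simp add: dist_norm)
    show "x = y"
    proof (rule cexp_inj[OF eq])
      fix a
      have "\<bar>Im (x $ a) - Im (y $ a)\<bar> \<le> cmod ((x - y) $ a)" using abs_Im_le_cmod[of "(x - y) $ a"] by simp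
      also have "\<dots> \<le> norm (x - y)" by (rule Finite_Cartesian_Product.norm_nth_le)
      finally show "\<bar>Im (x $ a) - Im (y $ a)\<bar> < 2 * pi" using nd by linarith
    qed
  qed
  have contV: "continuous_on (V i j) (\<lambda>\<zeta>. rdet (fd (Phi i) \<zeta>))"
    by (intro rdet_continuous Ck_continuous[OF Ck_fd[OF holo_Ck_vec[OF V_open Phi_holo_V]]])
  have "compact ((\<lambda>\<zeta>. rdet (fd (Phi i) \<zeta>)) ` cball \<zeta>0 \<epsilon>)"
    by (intro compact_continuous_image continuous_on_subset[OF contV e(3)] compact_cball)
  from compact_imp_bounded[OF this] have "\<exists>C. \<forall>\<zeta>\<in>cball \<zeta>0 \<epsilon>. \<bar>rdet (fd (Phi i) \<zeta>)\<bar> \<le> C"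
    by (simp add: bounded_iff)
  then obtain C where C: "\<And>\<zeta>. \<zeta> \<in> cball \<zeta>0 \<epsilon> \<Longrightarrow> \<bar>rdet (fd (Phi i) \<zeta>)\<bar> \<le> C" by blast
  define F where "F \<zeta> = ennreal (indicator ?U \<zeta> *\<^sub>R (Hd (rl \<zeta>) / \<bar>rdet (fd (Phi i) \<zeta>)\<bar>))" for \<zeta>
  have F: "F \<in> borel_measurable borel"
    unfolding F_def[abs_def]
  proof (intro measurable_compose[OF _ measurable_ennreal] borel_measurable_continuous_on_indicator)
    show "continuous_on ?U (\<lambda>\<zeta>. Hd (rl \<zeta>) / \<bar>rdet (fd (Phi i) \<zeta>)\<bar>)"
      by (intro continuous_on_divide continuous_on_rabs continuous_on_subset[OF contV UV]
          continuous_on_compose2[OF Ck_continuous[OF Hd_Ck]] linear_continuous_on linear_rl)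
        (use density_identity(2) UV in auto)
  qed simp
  have cont: "continuous_on ?U (Phi i)" using der by (intro continuous_at_imp_continuous_on ballI has_derivative_continuous)
  have PB: "Phi i ` B \<in> sets borel" by (rule inj_image_borel(1)[OF open_ball cont inj B])
  have TB: "T ` B = chart M i -` (Phi i ` B) \<inter> chart_dom M i"
  proof (intro set_eqI iffI)
    fix p assume "p \<in> chart M i -` (Phi i ` B) \<inter> chart_dom M i"
    then obtain \<zeta> where "\<zeta> \<in> B" "chart M i p = chart M i (T \<zeta>)" "p \<in> chart_dom M i" by (auto simp: Phi_def)
    moreover from this have "T \<zeta> \<in> chart_dom M i" using tV B(2) UV by blast
    ultimately show "p \<in> T ` B" using inj_onD[OF chart_inj[of i]] by blast
  next
    fix p assume "p \<in> T ` B"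
    then show "p \<in> chart M i -` (Phi i ` B) \<inter> chart_dom M i" using tV B(2) UV by (auto simp: Phi_def)
  qed
  have "chart M i -` (Phi i ` B) \<inter> chart_dom M i \<in> sets (restrict_space borel (chart_dom M i))"
    using measurable_sets[OF borel_measurable_continuous_on_restrict[OF chart_cont] PB] by (simp add: space_restrict_space)
  then show TBs: "T ` B \<in> sets borel" unfolding TB using chart_open(1)[of i] by (subst (asm) sets_restrict_space_iff) auto
  have cT: "chart M i ` T ` B = Phi i ` B" by (auto simp: Phi_def)
  have "T ` B \<subseteq> chart_dom M i \<inter> triv L j" using tV B(2) UV by blast
  then have "emeasure vol (T ` B) = (\<integral>\<^sup>+w. ennreal (2 ^ CARD('m) * Re (det (curvature_matrix M h i j (cinv M i w)))) * indicator (Phi i ` B) w \<partial>lborel)"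
    using kv TBs unfolding kaehler_volume_def cT[symmetric] by blast
  also have "\<dots> = (\<integral>\<^sup>+w. indicator (Phi i ` B) w * F (inv_into ?U (Phi i) w) \<partial>lborel)"
  proof (rule nn_integral_cong)
    fix w
    show "ennreal (2 ^ CARD('m) * Re (det (curvature_matrix M h i j (cinv M i w)))) * indicator (Phi i ` B) w = indicator (Phi i ` B) w * F (inv_into ?U (Phi i) w)"
    proof (cases "w \<in> Phi i ` B")
      case True
      then obtain \<zeta> where z: "\<zeta> \<in> B" "w = Phi i \<zeta>" by blast
      then have zU: "\<zeta> \<in> ?U" "\<zeta> \<in> V i j" using B(2) UV by auto
      have "inv_into ?U (Phi i) w = \<zeta>" unfolding z(2) by (rule inv_into_f_f[OF inj zU(1)])
      moreover have "cinv M i w = T \<zeta>" unfolding z(2) by (rule cinv_Phi[OF tV(1)[OF zU(2)]])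
      moreover have "2 ^ CARD('m) * Re (det (curvature_matrix M h i j (T \<zeta>))) = Hd (rl \<zeta>) / \<bar>rdet (fd (Phi i) \<zeta>)\<bar>"
        unfolding Hd_def density_identity(1)[OF zU(2), symmetric] using density_identity(2)[OF zU(2)] by simp
      ultimately show ?thesis using True zU(1) by (simp add: F_def)
    qed simp
  qed
  also have "\<dots> = (\<integral>\<^sup>+\<zeta>. indicator B \<zeta> * (F \<zeta> * ennreal \<bar>rdet (fd (Phi i) \<zeta>)\<bar>) \<partial>lborel)"
    by (rule nn_integral_cov[OF open_ball bounded_ball der inj continuous_on_subset[OF contV UV] _ B F, where C=C]) (use C in auto)
  also have "\<dots> = (\<integral>\<^sup>+\<zeta>. indicator B \<zeta> * ennreal (Hd (rl \<zeta>)) \<partial>lborel)"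
  proof (rule nn_integral_cong)
    fix \<zeta>
    show "indicator B \<zeta> * (F \<zeta> * ennreal \<bar>rdet (fd (Phi i) \<zeta>)\<bar>) = indicator B \<zeta> * ennreal (Hd (rl \<zeta>))"
    proof (cases "\<zeta> \<in> B")
      case True
      then have zU: "\<zeta> \<in> ?U" "\<zeta> \<in> V i j" using B(2) UV by auto
      have "F \<zeta> * ennreal \<bar>rdet (fd (Phi i) \<zeta>)\<bar> = ennreal (Hd (rl \<zeta>) / \<bar>rdet (fd (Phi i) \<zeta>)\<bar> * \<bar>rdet (fd (Phi i) \<zeta>)\<bar>)"
        unfolding F_def using zU(1) Hd_pos[of "rl \<zeta>"] by (subst ennreal_mult) auto
      then show ?thesis using density_identity(2)[OF zU(2)] by simp
    qed simp
  qed
  finally show "emeasure vol (T ` B) = (\<integral>\<^sup>+\<zeta>. indicator B \<zeta> * ennreal (Hd (rl \<zeta>)) \<partial>lborel)" .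
qed

lemma T_inj_strip: "inj_on T strip"
proof (rule inj_onI)
  fix x y assume xy: "x \<in> strip" "y \<in> strip" "T x = T y"
  then have eq: "cexp x = cexp y" by (simp only: T_eq)
  show "x = y"
  proof (rule cexp_inj[OF eq])
    fix a
    have "0 \<le> Im (x $ a)" "Im (x $ a) < 2 * pi" "0 \<le> Im (y $ a)" "Im (y $ a) < 2 * pi" using xy(1,2) by (auto simp: strip_def)
    then show "\<bar>Im (x $ a) - Im (y $ a)\<bar> < 2 * pi" by linarith
  qed
qed

text \<open>By Lindelof countably many of the balls of \<open>vol_local\<close> cover everything. B
  is cut along them into disjoint pieces, and the images of the pieces stay disjoint because
  \<open>T\<close> is injective on the strip.\<close>

lemma vol_strip:
  assumes B: "B \<in> sets borel" "B \<subseteq> strip"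
  shows "T ` B \<in> sets borel" and "emeasure vol (T ` B) = (\<integral>\<^sup>+\<zeta>. indicator B \<zeta> * ennreal (Hd (rl \<zeta>)) \<partial>lborel)"
proof -
  define \<F> where "\<F> = {ball \<zeta>0 \<epsilon> | \<zeta>0 \<epsilon>. 0 < \<epsilon> \<and> \<epsilon> \<le> 1 \<and> (\<exists>i j. cball \<zeta>0 \<epsilon> \<subseteq> V i j)}"
  have cov: "\<Union>\<F> = UNIV"
  proof -
    have "\<exists>X\<in>\<F>. \<zeta> \<in> X" for \<zeta>
    proof -
      obtain i j where "\<zeta> \<in> V i j" using V_cover by blast
      then obtain \<epsilon> where e: "0 < \<epsilon>" "cball \<zeta> \<epsilon> \<subseteq> V i j" using V_open open_contains_cball by blast
      have "cball \<zeta> (min \<epsilon> 1) \<subseteq> V i j" using e(2) by auto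
      then have "ball \<zeta> (min \<epsilon> 1) \<in> \<F>" unfolding \<F>_def using e(1) by (intro CollectI exI[of _ \<zeta>] exI[of _ "min \<epsilon> 1"]) auto
      then show ?thesis using e(1) by (intro bexI[of _ "ball \<zeta> (min \<epsilon> 1)"]) auto
    qed
    then show ?thesis by blast
  qed
  have "\<And>S. S \<in> \<F> \<Longrightarrow> open S" by (auto simp: \<F>_def)
  then obtain \<F>' where F': "\<F>' \<subseteq> \<F>" "countable \<F>'" "\<Union>\<F>' = \<Union>\<F>" by (rule Lindelof)
  have ne: "\<F>' \<noteq> {}" using F'(3) cov by auto
  define U where "U n = from_nat_into \<F>' n" for n
  have Un: "U n \<in> \<F>" for n using from_nat_into[OF ne] F'(1) by (auto simp: U_def)
  have UU: "(\<Union>n. U n) = UNIV"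
    unfolding U_def using range_from_nat_into[OF ne F'(2)] F'(3) cov by simp
  define C where "C n = B \<inter> disjointed U n" for n
  have Ub: "U n \<in> sets borel" for n using Un[of n] by (auto simp: \<F>_def)
  have Cb: "C n \<in> sets borel" for n
    unfolding C_def using sets.range_disjointed_sets[of U borel] Ub B(1) by blast
  have CU: "C n \<subseteq> U n" for n using disjointed_subset[of U n] by (auto simp: C_def)
  have CB: "(\<Union>n. C n) = B" using UN_disjointed_eq[of U] UU by (auto simp: C_def)
  have Cd: "disjoint_family C" using disjoint_family_disjointed[of U] by (auto simp: C_def disjoint_family_on_def)
  have loc: "T ` C n \<in> sets borel \<and> emeasure vol (T ` C n) = (\<integral>\<^sup>+\<zeta>. indicator (C n) \<zeta> * ennreal (Hd (rl \<zeta>)) \<partial>lborel)" for n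
  proof -
    obtain \<zeta>0 \<epsilon> i j where e: "0 < \<epsilon>" "\<epsilon> \<le> 1" "cball \<zeta>0 \<epsilon> \<subseteq> V i j" "U n = ball \<zeta>0 \<epsilon>" using Un[of n] by (auto simp: \<F>_def)
    show ?thesis using vol_local[OF e(1-3) Cb[of n]] CU[of n] e(4) by auto
  qed
  have TB: "T ` B = (\<Union>n. T ` C n)" unfolding CB[symmetric] by blast
  show "T ` B \<in> sets borel" unfolding TB using loc by auto
  have "disjoint_family (\<lambda>n. T ` C n)"
    unfolding disjoint_family_on_def
  proof (intro ballI impI)
    fix m n :: nat assume "m \<noteq> n"
    then have "C m \<inter> C n = {}" using Cd by (auto simp: disjoint_family_on_def)
    moreover have "C m \<subseteq> strip" "C n \<subseteq> strip" using B(2) by (auto simp: C_def)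
    ultimately show "T ` C m \<inter> T ` C n = {}" using inj_on_image_Int[OF T_inj_strip, of "C m" "C n"] by simp
  qed
  then have "emeasure vol (T ` B) = (\<Sum>n. emeasure vol (T ` C n))"
    unfolding TB by (intro suminf_emeasure[symmetric]) (use loc vol_sets in auto)
  also have "\<dots> = (\<Sum>n. emeasure (density lborel (\<lambda>\<zeta>. ennreal (Hd (rl \<zeta>)))) (C n))"
    using loc Cb by (simp add: emeasure_density mult.commute)
  also have "\<dots> = emeasure (density lborel (\<lambda>\<zeta>. ennreal (Hd (rl \<zeta>)))) B"
    unfolding CB[symmetric] by (intro suminf_emeasure Cd) (use Cb in auto)
  also have "\<dots> = (\<integral>\<^sup>+\<zeta>. indicator B \<zeta> * ennreal (Hd (rl \<zeta>)) \<partial>lborel)"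
    using B(1) by (simp add: emeasure_density mult.commute)
  finally show "emeasure vol (T ` B) = (\<integral>\<^sup>+\<zeta>. indicator B \<zeta> * ennreal (Hd (rl \<zeta>)) \<partial>lborel)" .
qed

lemma vol_orbit:
  assumes X: "X \<in> sets borel" and F: "F \<in> borel_measurable borel"
  shows "T ` {\<zeta> \<in> strip. rl \<zeta> \<in> X} \<in> sets borel"
    and "(\<integral>\<^sup>+p. indicator (T ` {\<zeta> \<in> strip. rl \<zeta> \<in> X}) p * F p \<partial>vol)
      = (\<integral>\<^sup>+\<zeta>. indicator strip \<zeta> * (indicator X (rl \<zeta>) * F (T \<zeta>) * ennreal (Hd (rl \<zeta>))) \<partial>lborel)"
proof -
  note X [measurable] F [measurable]
  let ?Z = "{\<zeta> \<in> strip. rl \<zeta> \<in> X}"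
  have Z [measurable]: "?Z \<in> sets borel"
  proof -
    have "?Z = strip \<inter> rl -` X" by auto
    then show ?thesis using measurable_sets_borel[OF rl_measurable X] strip_borel by simp
  qed
  have Tm [measurable]: "T \<in> borel_measurable borel" by (rule borel_measurable_continuous_onI[OF T_cont])
  show W [measurable]: "T ` ?Z \<in> sets borel" by (rule vol_strip(1)[OF Z]) auto
  have eq: "density vol (indicator (T ` ?Z)) = distr (density lborel (\<lambda>\<zeta>. indicator ?Z \<zeta> * ennreal (Hd (rl \<zeta>)))) borel T"
  proof (rule measure_eqI)
    fix Y assume "Y \<in> sets (density vol (indicator (T ` ?Z)))"
    then have Y [measurable]: "Y \<in> sets borel" by (simp add: vol_sets)
    have ZY: "?Z \<inter> T -` Y \<in> sets borel" using measurable_sets_borel[OF Tm Y] Z by auto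
    have "emeasure (density vol (indicator (T ` ?Z))) Y = (\<integral>\<^sup>+p. indicator (T ` (?Z \<inter> T -` Y)) p \<partial>vol)"
      by (subst emeasure_density) (auto simp: vol_sets indicator_def intro!: nn_integral_cong)
    also have "\<dots> = emeasure vol (T ` (?Z \<inter> T -` Y))"
    proof -
      have "T ` (?Z \<inter> T -` Y) \<in> sets vol" unfolding vol_sets by (rule vol_strip(1)[OF ZY]) auto
      then show ?thesis by (rule nn_integral_indicator)
    qed
    also have "\<dots> = (\<integral>\<^sup>+\<zeta>. indicator (?Z \<inter> T -` Y) \<zeta> * ennreal (Hd (rl \<zeta>)) \<partial>lborel)"
      by (rule vol_strip(2)[OF ZY]) auto
    also have "\<dots> = emeasure (distr (density lborel (\<lambda>\<zeta>. indicator ?Z \<zeta> * ennreal (Hd (rl \<zeta>)))) borel T) Y"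
      using measurable_sets_borel[OF Tm Y]
      by (subst emeasure_distr) (auto simp: emeasure_density indicator_def intro!: nn_integral_cong)
    finally show "emeasure (density vol (indicator (T ` ?Z))) Y = \<dots>" .
  qed (simp add: vol_sets)
  have "(\<integral>\<^sup>+p. indicator (T ` ?Z) p * F p \<partial>vol) = (\<integral>\<^sup>+p. F p \<partial>density vol (indicator (T ` ?Z)))"
    by (subst nn_integral_density) (auto simp: vol_sets cong: measurable_cong_sets)
  also have "\<dots> = (\<integral>\<^sup>+\<zeta>. indicator ?Z \<zeta> * ennreal (Hd (rl \<zeta>)) * F (T \<zeta>) \<partial>lborel)"
    unfolding eq by (simp add: nn_integral_distr nn_integral_density)
  also have "\<dots> = (\<integral>\<^sup>+\<zeta>. indicator strip \<zeta> * (indicator X (rl \<zeta>) * F (T \<zeta>) * ennreal (Hd (rl \<zeta>))) \<partial>lborel)"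
    by (intro nn_integral_cong) (auto simp: indicator_def mult.commute)
  finally show "(\<integral>\<^sup>+p. indicator (T ` ?Z) p * F p \<partial>vol) = \<dots>" .
qed

end

section \<open>Finite volume, pointwise norms and lattice points\<close>

text \<open>Makes the continuity of the curvature determinant visible; it is bounded on compact sets
  of a chart, as \<open>vol_finite\<close> requires.\<close>

lemma complex_hessian_fd2:
  fixes f :: "complex^'m::finite \<Rightarrow> real"
  assumes S: "open S" "w \<in> S" and f: "Ck_on (Suc (Suc 0)) S f"
  shows "complex_hessian f w $ a $ b = (complex_of_real (fd2 f w (axis b 1) (axis a 1)) + \<i> * complex_of_real (fd2 f w (axis b \<i>) (axis a 1))
     - \<i> * (complex_of_real (fd2 f w (axis b 1) (axis a \<i>)) + \<i> * complex_of_real (fd2 f w (axis b \<i>) (axis a \<i>)))) / 4"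
proof -
  have 1: "((\<lambda>u. complex_of_real (f u)) has_derivative (\<lambda>x. complex_of_real (fd f u x))) (at u)" if "u \<in> S" for u
    by (rule bounded_linear.has_derivative[OF bounded_linear_of_real Ck_diff[OF f that]])
  have 2: "wirtinger_bar b (\<lambda>u. complex_of_real (f u)) u
     = (complex_of_real (fd f u (axis b 1)) + \<i> * complex_of_real (fd f u (axis b \<i>))) / 2" if "u \<in> S" for b u
    unfolding wirtinger_bar_def fd_eq[OF 1[OF that]] ..
  have 3: "((\<lambda>u. (complex_of_real (fd f u (axis b 1)) + \<i> * complex_of_real (fd f u (axis b \<i>))) / 2)
     has_derivative (\<lambda>x. (complex_of_real (fd2 f w (axis b 1) x) + \<i> * complex_of_real (fd2 f w (axis b \<i>) x)) / 2)) (at w)" for b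
    unfolding divide_inverse
    by (intro has_derivative_mult_left has_derivative_add has_derivative_mult_right
        bounded_linear.has_derivative[OF bounded_linear_of_real Ck2_diff[OF f S(2)]])
  have 4: "fd (wirtinger_bar b (\<lambda>u. complex_of_real (f u))) w
     = (\<lambda>x. (complex_of_real (fd2 f w (axis b 1) x) + \<i> * complex_of_real (fd2 f w (axis b \<i>) x)) / 2)" for b
    by (rule fd_eq, rule has_derivative_transform_within_open[OF 3 S]) (simp add: 2)
  show ?thesis unfolding complex_hessian_def wirtinger_def vec_lambda_beta 4 by (simp add: diff_divide_distrib add_divide_distrib)
qed

lemma complex_hessian_continuous:
  fixes f :: "complex^'m::finite \<Rightarrow> real"
  assumes S: "open S" and f: "Ck_on (Suc (Suc 0)) S f"
  shows "continuous_on S (\<lambda>w. Re (det (complex_hessian f w)))"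
proof -
  have c: "continuous_on S (\<lambda>w. complex_hessian f w $ a $ b)" for a b
    by (subst continuous_on_cong[OF refl complex_hessian_fd2[OF S _ f]], assumption)
      (intro continuous_intros Ck_continuous[OF Ck_fd[OF Ck_fd[OF f]]], simp)
  show ?thesis unfolding det_def
    by (intro continuous_on_Re continuous_on_sum continuous_on_mult continuous_on_const continuous_on_prod c)
qed

text \<open>From (1 + x/n)^n \<le> exp x with x = \<beta>/h^2, which even gives h^(2n); half of that
  is kept.\<close>

lemma exp_power_bound:
  fixes \<beta> h :: real
  assumes "0 < \<beta>" "0 < h" "h \<le> 1" "0 < n"
  shows "exp (- \<beta> / h\<^sup>2) \<le> (real n / \<beta>) ^ n * h ^ n"
proof -
  have "(\<beta> / h\<^sup>2 / n) ^ n \<le> (1 + \<beta> / h\<^sup>2 / n) ^ n" using assms by (intro power_mono) auto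
  also have "\<dots> \<le> exp (\<beta> / h\<^sup>2)" using assms by (intro exp_ge_one_plus_x_over_n_power_n) (auto intro: order_trans[of _ 0])
  finally have 1: "(\<beta> / h\<^sup>2 / n) ^ n \<le> exp (\<beta> / h\<^sup>2)" .
  have p: "0 < (\<beta> / h\<^sup>2 / n) ^ n" using assms by simp
  have "exp (- \<beta> / h\<^sup>2) = 1 / exp (\<beta> / h\<^sup>2)" by (simp add: exp_minus divide_inverse)
  also have "\<dots> \<le> 1 / (\<beta> / h\<^sup>2 / n) ^ n" using 1 p by (intro divide_left_mono) auto
  also have "\<dots> = (real n / \<beta>) ^ n * (h ^ n * h ^ n)"
    using assms by (simp add: power_divide power_mult_distrib power2_eq_square field_simps)
  also have "\<dots> \<le> (real n / \<beta>) ^ n * (h ^ n * 1)"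
    using assms by (intro mult_left_mono power_le_one) auto
  finally show ?thesis by simp
qed

lemma finite_int_box: "finite {\<alpha>::int^'m::finite. \<forall>a. \<bar>\<alpha> $ a\<bar> \<le> N}"
proof -
  have "finite (vec_nth ` {\<alpha>::int^'m. \<forall>a. \<bar>\<alpha> $ a\<bar> \<le> N})"
  proof (rule finite_subset)
    show "vec_nth ` {\<alpha>::int^'m. \<forall>a. \<bar>\<alpha> $ a\<bar> \<le> N} \<subseteq> Pi\<^sub>E UNIV (\<lambda>_. {-N..N})"
      by (auto simp: PiE_def abs_le_iff) (metis minus_le_iff)
    show "finite (Pi\<^sub>E (UNIV::'m set) (\<lambda>_. {-N..N}))" by (rule finite_PiE) auto
  qed
  then show ?thesis by (rule finite_imageD) (auto simp: inj_on_def vec_nth_inject)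
qed

context toric
begin

text \<open>Each point has a neighbourhood on which the density is bounded in a chart, and finitely
  many of these cover the compact M.\<close>

lemma vol_finite: "emeasure vol UNIV < \<infinity>"
proof -
  have loc: "\<exists>W. open W \<and> p \<in> W \<and> emeasure vol W < \<infinity>" for p
  proof -
    obtain i where i: "p \<in> chart_dom M i" using chart_cover by blast
    obtain j where j: "p \<in> triv L j" using triv_cover by blast
    let ?S = "chart M i ` (chart_dom M i \<inter> triv L j)"
    let ?f = "\<lambda>w. - ln (h j (cinv M i w))"
    have S: "open ?S" using chart_image_open[OF triv_open, of i j] by (simp add: Int_commute)
    have pS: "chart M i p \<in> ?S" using i j by blast
    obtain \<epsilon> where e: "0 < \<epsilon>" "cball (chart M i p) \<epsilon> \<subseteq> ?S" using S pS open_contains_cball by blast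
    have "compact ((\<lambda>w. Re (det (complex_hessian ?f w))) ` cball (chart M i p) \<epsilon>)"
      by (intro compact_continuous_image continuous_on_subset[OF complex_hessian_continuous[OF S hW_Ck] e(2)] compact_cball)
    from compact_imp_bounded[OF this] have "\<exists>C. \<forall>w\<in>cball (chart M i p) \<epsilon>. \<bar>Re (det (complex_hessian ?f w))\<bar> \<le> C"
      by (simp add: bounded_iff)
    then obtain C where C: "\<And>w. w \<in> cball (chart M i p) \<epsilon> \<Longrightarrow> \<bar>Re (det (complex_hessian ?f w))\<bar> \<le> C" by blast
    define W where "W = chart_dom M i \<inter> chart M i -` ball (chart M i p) \<epsilon>"
    have Wo: "open W" unfolding W_def by (rule continuous_open_preimage[OF chart_cont chart_open(1) open_ball])
    have Wt: "W \<subseteq> chart_dom M i \<inter> triv L j"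
    proof
      fix q assume q: "q \<in> W"
      then have "chart M i q \<in> ?S" using e(2) by (auto simp: W_def)
      then obtain q' where "q' \<in> chart_dom M i" "q' \<in> triv L j" "chart M i q = chart M i q'" by blast
      then show "q \<in> chart_dom M i \<inter> triv L j" using inj_onD[OF chart_inj[of i]] q by (auto simp: W_def)
    qed
    have "emeasure vol W = (\<integral>\<^sup>+w. ennreal (2 ^ CARD('m) * Re (det (curvature_matrix M h i j (cinv M i w)))) * indicator (chart M i ` W) w \<partial>lborel)"
      using kv Wt Wo unfolding kaehler_volume_def by (meson borel_open)
    also have "\<dots> \<le> (\<integral>\<^sup>+w. ennreal (2 ^ CARD('m) * C) * indicator (ball (chart M i p) \<epsilon>) w \<partial>lborel)"
    proof (rule nn_integral_mono)
      fix w
      show "ennreal (2 ^ CARD('m) * Re (det (curvature_matrix M h i j (cinv M i w)))) * indicator (chart M i ` W) w \<le> ennreal (2 ^ CARD('m) * C) * indicator (ball (chart M i p) \<epsilon>) w"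
      proof (cases "w \<in> chart M i ` W")
        case True
        then obtain q where q: "q \<in> W" "w = chart M i q" by blast
        then have wb: "w \<in> ball (chart M i p) \<epsilon>" and cq: "cinv M i w = q" by (auto simp: W_def)
        have "Re (det (curvature_matrix M h i j (cinv M i w))) \<le> C"
          unfolding curvature_matrix_def cq q(2)[symmetric] using C[of w] wb by auto
        then show ?thesis using wb by (auto simp: indicator_def intro!: ennreal_leI)
      qed simp
    qed
    also have "\<dots> = ennreal (2 ^ CARD('m) * C) * emeasure lborel (ball (chart M i p) \<epsilon>)"
      by (simp add: nn_integral_cmult_indicator)
    also have "\<dots> < \<infinity>" using emeasure_bounded_finite[OF bounded_ball[of "chart M i p" \<epsilon>]] by (simp add: ennreal_mult_less_top)
    finally have "emeasure vol W < \<infinity>" .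
    moreover have "p \<in> W" using i e(1) by (simp add: W_def)
    ultimately show ?thesis using Wo by blast
  qed
  then obtain W where W: "\<And>p. open (W p)" "\<And>p. p \<in> W p" "\<And>p. emeasure vol (W p) < \<infinity>" by metis
  have cov: "(UNIV :: 'a set) \<subseteq> (\<Union>p\<in>UNIV. W p)" using W(2) by blast
  obtain I where I: "I \<subseteq> UNIV" "finite I" "UNIV \<subseteq> (\<Union>p\<in>I. W p)"
    by (rule compactE_image[OF compactM W(1) cov])
  have "emeasure vol UNIV \<le> emeasure vol (\<Union>p\<in>I. W p)" using I by (intro emeasure_mono) (auto simp: vol_sets intro!: borel_open open_UN W(1))
  also have "\<dots> \<le> (\<Sum>p\<in>I. emeasure vol (W p))" using I(2) by (intro emeasure_subadditive_finite) (auto simp: vol_sets intro!: borel_open W(1))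
  also have "\<dots> < \<infinity>" using W(3) by (simp add: I(2))
  finally show ?thesis .
qed

lemma norm2_at_nonneg: "0 \<le> norm2_at L h k \<sigma> p"
proof -
  have "p \<in> triv L (SOME j. p \<in> triv L j)" using triv_cover by (rule someI_ex)
  then have "0 < h (SOME j. p \<in> triv L j) p" by (rule h_pos)
  then show ?thesis by (simp add: norm2_at_def Let_def)
qed

lemma norm2_at_H0:
  assumes "\<sigma> \<in> H0 M L k" "p \<in> triv L j"
  shows "norm2_at L h k \<sigma> p = h j p ^ k * (cmod (\<sigma> j p))\<^sup>2"
proof (rule norm2_at_eq[OF assms(2)])
  fix i assume "p \<in> triv L i"
  then show "\<sigma> i p = transit L i j p ^ k * \<sigma> j p" using assms unfolding H0_def holo_section_def by blast
qed

lemma norm2_at_cont: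
  assumes \<sigma>: "\<sigma> \<in> H0 M L k" shows "continuous_on UNIV (norm2_at L h k \<sigma>)"
proof (rule continuous_at_imp_continuous_on, rule ballI)
  fix p
  obtain i where i: "p \<in> chart_dom M i" using chart_cover by blast
  obtain j where j: "p \<in> triv L j" using triv_cover by blast
  let ?W = "chart_dom M i \<inter> triv L j"
  have W: "open ?W" by (intro open_Int chart_open triv_open)
  have cc: "continuous_on ?W (chart M i)" by (rule continuous_on_subset[OF chart_cont]) auto
  have h1: "continuous_on (chart M i ` ?W) (h j \<circ> cinv M i)"
    using h_smooth[of i j] unfolding smooth_on_def by (blast intro: Ck_continuous)
  have "continuous_on ?W (\<lambda>q. (h j \<circ> cinv M i) (chart M i q))"
    by (rule continuous_on_compose2[OF h1 cc]) auto
  then have 1: "continuous_on ?W (h j)" by (rule continuous_on_eq) auto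
  have "holo_on (chart M i ` (UNIV \<inter> triv L j \<inter> chart_dom M i)) (\<sigma> j \<circ> cinv M i)"
    using \<sigma> unfolding H0_def holo_section_def holo_fun_on_def by blast
  then have s1: "continuous_on (chart M i ` ?W) (\<sigma> j \<circ> cinv M i)" by (intro holo_continuous) (simp add: Int_commute)
  have "continuous_on ?W (\<lambda>q. (\<sigma> j \<circ> cinv M i) (chart M i q))"
    by (rule continuous_on_compose2[OF s1 cc]) auto
  then have 2: "continuous_on ?W (\<sigma> j)" by (rule continuous_on_eq) auto
  have "continuous_on ?W (\<lambda>q. h j q ^ k * (cmod (\<sigma> j q))\<^sup>2)" by (intro continuous_intros 1 2)
  then have "continuous_on ?W (norm2_at L h k \<sigma>)" by (rule continuous_on_eq) (auto simp: norm2_at_H0[OF \<sigma>])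
  then show "isCont (norm2_at L h k \<sigma>) p" using W i j by (simp add: continuous_on_eq_continuous_at)
qed

lemma basis_H0: "1 \<le> k \<Longrightarrow> \<alpha> \<in> lattice_points P k \<Longrightarrow> s k \<alpha> \<in> H0 M L k"
  using basis unfolding monomial_basis_def by blast

text \<open>On the orbit |z^\<alpha>|^2 = exp <\<alpha>, \<rho>> and the squared norm of the frame
  is exp (- \<phi>).\<close>

lemma norm2_basis:
  assumes k: "1 \<le> k" and al: "\<alpha> \<in> lattice_points P k"
  shows "norm2_at L h k (s k \<alpha>) (T \<zeta>) = exp (rvec \<alpha> \<bullet> rl \<zeta> - real k * phi (rl \<zeta>))"
proof -
  obtain j where j: "T \<zeta> \<in> triv L j" using triv_cover by blast
  have sk: "s k \<alpha> j (T \<zeta>) = monomial \<alpha> (cexp \<zeta>) * e j (T \<zeta>) ^ k"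
    using basis k al j cexp_ctorus unfolding monomial_basis_def T_def by blast
  have m: "(cmod (monomial \<alpha> (cexp \<zeta>)))\<^sup>2 = exp (rvec \<alpha> \<bullet> rl \<zeta>)"
  proof -
    have "(cmod (exp (\<zeta> $ a) powi (\<alpha> $ a)))\<^sup>2 = exp (rvec \<alpha> $ a * rl \<zeta> $ a)" for a
      by (simp add: norm_power_int rvec_def rl_def power_int_def exp_of_nat_mult[symmetric] exp_minus[symmetric] power2_eq_square exp_add[symmetric])
    then show ?thesis
      by (simp add: monomial_def cexp_def prod_norm[symmetric] prod_power_distrib inner_vec_def exp_sum)
  qed
  have n: "h j (T \<zeta>) * (cmod (e j (T \<zeta>)))\<^sup>2 = exp (- phi (rl \<zeta>))"
  proof -
    have "0 < h j (T \<zeta>) * (cmod (e j (T \<zeta>)))\<^sup>2" using h_pos[OF j] e_nz[OF T_orbit j] by simp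
    then show ?thesis unfolding Npot_phi[symmetric] Npot_def norm2_e[OF T_orbit j] by simp
  qed
  have "norm2_at L h k (s k \<alpha>) (T \<zeta>) = h j (T \<zeta>) ^ k * (cmod (monomial \<alpha> (cexp \<zeta>) * e j (T \<zeta>) ^ k))\<^sup>2"
    unfolding norm2_at_H0[OF basis_H0[OF k al] j] sk ..
  also have "\<dots> = (cmod (monomial \<alpha> (cexp \<zeta>)))\<^sup>2 * (h j (T \<zeta>) * (cmod (e j (T \<zeta>)))\<^sup>2) ^ k"
    by (simp add: norm_mult norm_power power_mult_distrib power_mult[symmetric] mult_ac)
  also have "\<dots> = exp (rvec \<alpha> \<bullet> rl \<zeta> - real k * phi (rl \<zeta>))"
    unfolding m n exp_of_nat_mult[symmetric] exp_add[symmetric] by simp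
  finally show ?thesis .
qed

lemma P_bounded: obtains B where "0 < B" "\<And>x. x \<in> P \<Longrightarrow> norm x \<le> B"
  using delz polytope_imp_bounded bounded_pos by (metis delzant_polytope_def)

lemma finite_lattice: "finite (lattice_points P k)"
proof -
  obtain B where B: "0 < B" "\<And>x. x \<in> P \<Longrightarrow> norm x \<le> B" by (fact P_bounded)
  have "lattice_points P k \<subseteq> {\<alpha>. \<forall>a. \<bar>\<alpha> $ a\<bar> \<le> \<lceil>real k * B\<rceil>}"
  proof
    fix \<alpha> assume "\<alpha> \<in> lattice_points P k"
    then obtain x where x: "x \<in> P" "rvec \<alpha> = real k *\<^sub>R x" by (auto simp: lattice_points_def)
    have "\<bar>real_of_int (\<alpha> $ a)\<bar> \<le> real k * B" for a
    proof -
      have "\<bar>rvec \<alpha> $ a\<bar> \<le> norm (rvec \<alpha>)" by (rule component_le_norm_cart)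
      also have "\<dots> \<le> real k * B" unfolding x(2) using B(2)[OF x(1)] by (simp add: mult_left_mono)
      finally show ?thesis by (simp add: rvec_def)
    qed
    then have "real_of_int \<bar>\<alpha> $ a\<bar> \<le> real_of_int \<lceil>real k * B\<rceil>" for a
      using order_trans[OF _ le_of_int_ceiling[of "real k * B"]] by simp
    then have "\<bar>\<alpha> $ a\<bar> \<le> \<lceil>real k * B\<rceil>" for a by (simp only: of_int_le_iff)
    then show "\<alpha> \<in> {\<alpha>. \<forall>a. \<bar>\<alpha> $ a\<bar> \<le> \<lceil>real k * B\<rceil>}" by blast
  qed
  then show ?thesis by (rule finite_subset) (rule finite_int_box)
qed

section \<open>The moment map stays away from the boundary of the polytope\<close>

text \<open>Ampleness enters here: some power of L has no base points, so by compactness the sum of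
  the |s_\<alpha>|^2 for this power has a positive minimum. Along the ray \<rho>0 + t v this sum is
  at most a constant times exp (k (t b - \<phi>)), so \<phi> grows at most like t b. Strict
  convexity makes it grow at least like t (<\<mu>, v> + c). Comparing for large t gives the claim,
  with the same c for all v.\<close>

lemma support_bound:
  obtains c where "0 < c" "\<And>v b. norm v = 1 \<Longrightarrow> (\<And>x. x \<in> P \<Longrightarrow> x \<bullet> v \<le> b) \<Longrightarrow> fd phi \<rho>0 v + c \<le> b"
proof -
  obtain c where c: "0 < c" "\<And>r. 1 \<le> norm r \<Longrightarrow> c * norm r \<le> phi (\<rho>0 + r) - phi \<rho>0 - fd phi \<rho>0 r"
    by (rule convex_growth[OF phi_Ck spd_phi zero_less_one]) blast
  obtain B where B: "0 < B" "\<And>x. x \<in> P \<Longrightarrow> norm x \<le> B" by (fact P_bounded)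
  obtain k where k: "1 \<le> k" "very_ample_power M L k" using amp by (auto simp: ample_def)
  let ?\<Lambda> = "lattice_points P k"
  define N where "N p = (\<Sum>\<alpha>\<in>?\<Lambda>. norm2_at L h k (s k \<alpha>) p)" for p
  have Npos: "0 < N p" for p
  proof -
    obtain \<sigma> where sg: "\<sigma> \<in> H0 M L k" "\<not> vanishes_at L \<sigma> p" using k(2) unfolding very_ample_power_def by blast
    then obtain j where j: "p \<in> triv L j" "\<sigma> j p \<noteq> 0" by (auto simp: vanishes_at_def)
    obtain co where "\<sigma> = (\<lambda>j p. \<Sum>\<alpha>\<in>?\<Lambda>. co \<alpha> * s k \<alpha> j p)" using basis k(1) sg(1) unfolding monomial_basis_def by blast
    then have "(\<Sum>\<alpha>\<in>?\<Lambda>. co \<alpha> * s k \<alpha> j p) \<noteq> 0" using j(2) by simp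
    then obtain \<alpha> where al: "\<alpha> \<in> ?\<Lambda>" "s k \<alpha> j p \<noteq> 0" by (metis (no_types, lifting) sum.neutral mult_zero_right)
    have "0 < norm2_at L h k (s k \<alpha>) p"
      unfolding norm2_at_H0[OF basis_H0[OF k(1) al(1)] j(1)] using h_pos[OF j(1)] al(2) by simp
    then show ?thesis unfolding N_def
      by (intro sum_pos2[OF finite_lattice al(1)]) (auto intro: norm2_at_nonneg)
  qed
  have "continuous_on UNIV N" unfolding N_def[abs_def]
    by (intro continuous_on_sum norm2_at_cont basis_H0 k(1))
  then obtain p1 where p1: "\<And>p. N p1 \<le> N p" using continuous_attains_inf[OF compactM] by (metis UNIV_I UNIV_not_empty)
  define \<eta> where "\<eta> = N p1"
  have eta: "0 < \<eta>" by (simp add: \<eta>_def Npos)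
  have card: "0 < card ?\<Lambda>"
  proof (rule ccontr)
    assume "\<not> 0 < card ?\<Lambda>"
    then have "?\<Lambda> = {}" using finite_lattice by auto
    then show False using Npos[of p0] by (simp add: N_def)
  qed
  show thesis
  proof (rule that[OF c(1)])
    fix v :: "real^'m" and b assume v: "norm v = 1" and b: "\<And>x. x \<in> P \<Longrightarrow> x \<bullet> v \<le> b"
    let ?\<mu> = "fd phi \<rho>0 v"
    have lin: "fd phi \<rho>0 (t *\<^sub>R v) = t * ?\<mu>" for t
      using linear_scale[OF has_derivative_linear[OF Ck_diff[OF phi_Ck UNIV_I]]] by simp
    define C where "C = ln (\<eta> / card ?\<Lambda>) / real k - B * norm \<rho>0 + phi \<rho>0"
    have main: "C \<le> t * (b - ?\<mu> - c)" if t: "1 \<le> t" for t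
    proof -
      define \<rho> where "\<rho> = \<rho>0 + t *\<^sub>R v"
      have ex: "norm2_at L h k (s k \<alpha>) (T (rc \<rho>)) \<le> exp (real k * (B * norm \<rho>0 + t * b - phi \<rho>))" if al: "\<alpha> \<in> ?\<Lambda>" for \<alpha>
      proof -
        obtain x where x: "x \<in> P" "rvec \<alpha> = real k *\<^sub>R x" using al by (auto simp: lattice_points_def)
        have "x \<bullet> \<rho>0 \<le> norm x * norm \<rho>0" by (rule norm_cauchy_schwarz)
        also have "\<dots> \<le> B * norm \<rho>0" using B(2)[OF x(1)] by (intro mult_right_mono) auto
        finally have "x \<bullet> \<rho> \<le> B * norm \<rho>0 + t * b" using b[OF x(1)] t by (simp add: \<rho>_def inner_add_right add_mono)
        then have "real k * (x \<bullet> \<rho>) \<le> real k * (B * norm \<rho>0 + t * b)" by (intro mult_left_mono) auto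
        then show ?thesis unfolding norm2_basis[OF k(1) al] rl_rc x(2) by (simp add: right_diff_distrib)
      qed
      have "\<eta> \<le> N (T (rc \<rho>))" unfolding \<eta>_def by (rule p1)
      also have "\<dots> \<le> real (card ?\<Lambda>) * exp (real k * (B * norm \<rho>0 + t * b - phi \<rho>))"
        unfolding N_def by (rule sum_bounded_above) (rule ex)
      finally have "\<eta> / card ?\<Lambda> \<le> exp (real k * (B * norm \<rho>0 + t * b - phi \<rho>))" using card by (simp add: pos_divide_le_eq mult.commute)
      then have "ln (\<eta> / card ?\<Lambda>) \<le> ln (exp (real k * (B * norm \<rho>0 + t * b - phi \<rho>)))"
        using eta card by (subst ln_le_cancel_iff) auto
      then have "ln (\<eta> / card ?\<Lambda>) \<le> real k * (B * norm \<rho>0 + t * b - phi \<rho>)" by (simp only: ln_exp)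
      then have "ln (\<eta> / card ?\<Lambda>) / real k \<le> B * norm \<rho>0 + t * b - phi \<rho>" using k(1) by (simp add: pos_divide_le_eq mult.commute)
      moreover have "c * t \<le> phi \<rho> - phi \<rho>0 - t * ?\<mu>" using c(2)[of "t *\<^sub>R v"] v t by (simp add: \<rho>_def lin)
      ultimately show ?thesis by (simp add: C_def algebra_simps)
    qed
    show "?\<mu> + c \<le> b"
    proof (rule ccontr)
      assume "\<not> ?\<mu> + c \<le> b"
      then have d: "0 < ?\<mu> + c - b" by simp
      \<comment> \<open>From (|C| + 1)/(gap) on, the lower bound \<open>C\<close> is violated; the
        maximum with 1 keeps t in the range of \<open>main\<close>.\<close>
      define t where "t = max 1 ((\<bar>C\<bar> + 1) / (?\<mu> + c - b))"
      have "(\<bar>C\<bar> + 1) / (?\<mu> + c - b) * (?\<mu> + c - b) \<le> t * (?\<mu> + c - b)" using d by (intro mult_right_mono) (auto simp: t_def)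
      then have "\<bar>C\<bar> + 1 \<le> t * (?\<mu> + c - b)" using d by simp
      moreover have "C \<le> t * (b - ?\<mu> - c)" by (rule main) (simp add: t_def)
      moreover have "t * (b - ?\<mu> - c) = - (t * (?\<mu> + c - b))" by (simp add: algebra_simps)
      ultimately show False by linarith
    qed
  qed
qed

text \<open>Apply \<open>support_bound\<close> to the unit normal, pointing away from P, of a
  hyperplane that separates x from P.\<close>

lemma moment_interior:
  obtains d where "0 < d" "\<And>x. x \<notin> P \<Longrightarrow> d \<le> norm (x - gradient phi \<rho>0)"
proof -
  obtain c where c: "0 < c" "\<And>v b. norm v = 1 \<Longrightarrow> (\<And>x. x \<in> P \<Longrightarrow> x \<bullet> v \<le> b) \<Longrightarrow> fd phi \<rho>0 v + c \<le> b"
    by (rule support_bound[of \<rho>0]) blast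
  have P: "convex P" "closed P" "P \<noteq> {}"
    using delz polytope_imp_convex polytope_imp_closed by (auto simp: delzant_polytope_def)
  show thesis
  proof (rule that[OF c(1)])
    fix x assume "x \<notin> P"
    then obtain a b where ab: "a \<bullet> x < b" "\<And>y. y \<in> P \<Longrightarrow> b < a \<bullet> y"
      using separating_hyperplane_closed_point[OF P(1,2)] by blast
    have a: "a \<noteq> 0" using ab P(3) by fastforce
    define v where "v = (- 1 / norm a) *\<^sub>R a"
    have v: "norm v = 1" using a by (simp add: v_def)
    have iv: "y \<bullet> v = - (a \<bullet> y) / norm a" for y by (simp add: v_def inner_commute)
    have "fd phi \<rho>0 v + c \<le> - b / norm a"
    proof (rule c(2)[OF v])
      fix y assume "y \<in> P"
      then have "b \<le> a \<bullet> y" using ab(2) less_imp_le by blast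
      then have "- (a \<bullet> y) / norm a \<le> - b / norm a" by (intro divide_right_mono) auto
      then show "y \<bullet> v \<le> - b / norm a" by (simp only: iv)
    qed
    also have "\<dots> \<le> x \<bullet> v" unfolding iv using ab(1) by (intro divide_right_mono) auto
    finally have "c \<le> (x - gradient phi \<rho>0) \<bullet> v"
      by (simp add: inner_diff_left gradient_fd[OF Ck_diff[OF phi_Ck UNIV_I]])
    also have "\<dots> \<le> norm (x - gradient phi \<rho>0) * norm v" by (rule norm_cauchy_schwarz)
    finally show "c \<le> norm (x - gradient phi \<rho>0)" by (simp add: v)
  qed
qed

text \<open>Shift the imaginary parts by multiples of 2\<pi>, which neither \<open>T\<close> nor
  \<open>rl\<close> notices.\<close>

lemma T_strip: obtains \<xi> where "\<xi> \<in> strip" "T \<xi> = T \<zeta>" "rl \<xi> = rl \<zeta>"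
proof -
  have "\<forall>a. \<exists>n::int. 0 \<le> Im (\<zeta> $ a) - 2 * pi * n \<and> Im (\<zeta> $ a) - 2 * pi * n < 2 * pi" using period_shift by metis
  then obtain n :: "'m \<Rightarrow> int" where n: "\<And>a. 0 \<le> Im (\<zeta> $ a) - 2 * pi * n a \<and> Im (\<zeta> $ a) - 2 * pi * n a < 2 * pi" by metis
  define \<xi> where "\<xi> = (\<chi> a. \<zeta> $ a - 2 * of_int (n a) * pi * \<i>)"
  have "\<xi> \<in> strip" using n by (auto simp: strip_def \<xi>_def mult_ac)
  moreover have "cexp \<xi> = cexp \<zeta>"
  proof -
    have "exp (2 * complex_of_int (n a) * pi * \<i>) = 1" for a using exp_integer_2pi[of "of_int (n a)"] by simp
    then show ?thesis by (simp add: cexp_def \<xi>_def vec_eq_iff exp_diff)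
  qed
  moreover have "rl \<xi> = rl \<zeta>" by (simp add: rl_def \<xi>_def vec_eq_iff)
  ultimately show thesis using that by (simp add: T_eq)
qed

text \<open>On the orbit, relative to the centre, the exponent is k (<\<alpha>/k - \<mu>, r> -
  \<psi> r), at most - k c |r| / 2 when |\<alpha>/k - \<mu>| \<le> c/2. Points off the orbit have no
  coordinate \<zeta> and are reached by closure: the set Y where the bound holds is closed, the
  points with |r| \<le> \<delta> form a compact subset Q of the orbit, and Y together with Q
  contains the dense orbit.\<close>

lemma norm2_far:
  assumes d: "0 < \<delta>" and c: "0 < c" "\<And>r. \<delta> \<le> norm r \<Longrightarrow> c * norm r \<le> phi (\<rho>0 + r) - phi \<rho>0 - fd phi \<rho>0 r"
    and k: "1 \<le> k" and al: "\<alpha> \<in> lattice_points P k" and close: "norm ((1 / real k) *\<^sub>R rvec \<alpha> - gradient phi \<rho>0) \<le> c / 2"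
    and p: "p \<notin> T ` {\<zeta> \<in> strip. rl \<zeta> \<in> ball \<rho>0 \<delta>}"
  shows "norm2_at L h k (s k \<alpha>) p \<le> exp (rvec \<alpha> \<bullet> \<rho>0 - real k * phi \<rho>0) * exp (- (real k * (c * \<delta> / 2)))"
proof -
  let ?N = "norm2_at L h k (s k \<alpha>)" and ?\<mu> = "gradient phi \<rho>0"
  define Y where "Y = {p. ?N p \<le> exp (rvec \<alpha> \<bullet> \<rho>0 - real k * phi \<rho>0) * exp (- (real k * (c * \<delta> / 2)))}"
  have Yc: "closed Y" unfolding Y_def by (intro closed_Collect_le norm2_at_cont basis_H0[OF k al] continuous_on_const)
  have TY: "T \<zeta> \<in> Y" if z: "\<delta> \<le> norm (rl \<zeta> - \<rho>0)" for \<zeta>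
  proof -
    define r where "r = rl \<zeta> - \<rho>0"
    have r: "rl \<zeta> = \<rho>0 + r" by (simp add: r_def)
    have g: "?\<mu> \<bullet> r = fd phi \<rho>0 r" by (rule gradient_fd[OF Ck_diff[OF phi_Ck UNIV_I]])
    have "((1 / real k) *\<^sub>R rvec \<alpha> - ?\<mu>) \<bullet> r \<le> norm ((1 / real k) *\<^sub>R rvec \<alpha> - ?\<mu>) * norm r" by (rule norm_cauchy_schwarz)
    also have "\<dots> \<le> c / 2 * norm r" using close by (intro mult_right_mono) auto
    finally have "((1 / real k) *\<^sub>R rvec \<alpha> - ?\<mu>) \<bullet> r - (phi (\<rho>0 + r) - phi \<rho>0 - ?\<mu> \<bullet> r) \<le> c / 2 * norm r - c * norm r"
      using c(2)[of r] z unfolding g by (simp add: r_def)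
    also have "\<dots> \<le> - (c * \<delta> / 2)"
      using mult_left_mono[OF z, of c] c(1) by (simp add: r_def)
    finally have "real k * (((1 / real k) *\<^sub>R rvec \<alpha> - ?\<mu>) \<bullet> r - (phi (\<rho>0 + r) - phi \<rho>0 - ?\<mu> \<bullet> r)) \<le> real k * (- (c * \<delta> / 2))"
      by (intro mult_left_mono) auto
    moreover have "real k * (((1 / real k) *\<^sub>R rvec \<alpha> - ?\<mu>) \<bullet> r - (phi (\<rho>0 + r) - phi \<rho>0 - ?\<mu> \<bullet> r)) = rvec \<alpha> \<bullet> r - real k * (phi (\<rho>0 + r) - phi \<rho>0)"
      using k by (simp add: inner_diff_left field_simps)
    ultimately have "rvec \<alpha> \<bullet> (\<rho>0 + r) - real k * phi (\<rho>0 + r) \<le> (rvec \<alpha> \<bullet> \<rho>0 - real k * phi \<rho>0) + - (real k * (c * \<delta> / 2))"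
      by (simp add: inner_add_right right_diff_distrib)
    then show ?thesis unfolding Y_def mem_Collect_eq norm2_basis[OF k al] r exp_add[symmetric] by simp
  qed
  \<comment> \<open>The factor 2 undoes the half in \<open>rc\<close>, so the second component is
    the angle itself; it ranges over a closed box to make Q compact.\<close>
  define Q where "Q = (\<lambda>p. T (rc (fst p) + imult (rc (2 *\<^sub>R snd p)))) ` (cball \<rho>0 \<delta> \<times> cbox 0 (\<chi> a. 2 * pi))"
  have "compact Q" unfolding Q_def
  proof (rule compact_continuous_image)
    have "linear (\<lambda>p::(real^'m) \<times> (real^'m). rc (fst p) + imult (rc (2 *\<^sub>R snd p)))"
      by (intro linearI) (simp_all add: rc_def imult_vec_def imult_complex_def vec_eq_iff complex_eq_iff field_simps)
    then have "continuous_on X (\<lambda>p::(real^'m) \<times> (real^'m). rc (fst p) + imult (rc (2 *\<^sub>R snd p)))" for X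
      by (intro linear_continuous_on linear_conv_bounded_linear[THEN iffD1])
    then show "continuous_on (cball \<rho>0 \<delta> \<times> cbox 0 (\<chi> a. 2 * pi)) (\<lambda>p. T (rc (fst p) + imult (rc (2 *\<^sub>R snd p))))"
      by (rule continuous_on_compose2[OF T_cont[of UNIV]]) auto
  qed (intro compact_Times compact_cball compact_cbox)
  then have Qc: "closed Q" by (rule compact_imp_closed)
  have QE: "\<exists>\<zeta>. q = T \<zeta>" if "q \<in> Q" for q using that by (auto simp: Q_def)
  have "open_orbit act p0 \<subseteq> Y \<union> Q"
  proof
    fix q assume "q \<in> open_orbit act p0"
    then obtain \<zeta>' where "q = T \<zeta>'" by (rule orbit_T)
    moreover obtain \<zeta> where z: "\<zeta> \<in> strip" "T \<zeta> = T \<zeta>'" by (rule T_strip)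
    ultimately have q: "q = T \<zeta>" by simp
    show "q \<in> Y \<union> Q"
    proof (cases "\<delta> \<le> norm (rl \<zeta> - \<rho>0)")
      case False
      have "\<zeta> = rc (rl \<zeta>) + imult (rc (2 *\<^sub>R (\<chi> a. Im (\<zeta> $ a))))"
        by (simp add: rc_def rl_def imult_vec_def imult_complex_def vec_eq_iff complex_eq_iff)
      moreover have "rl \<zeta> \<in> cball \<rho>0 \<delta>" using False by (simp add: dist_norm norm_minus_commute)
      moreover have "(\<chi> a. Im (\<zeta> $ a)) \<in> cbox 0 (\<chi> a. 2 * pi)" using z(1) by (auto simp: mem_box_cart strip_def less_imp_le)
      ultimately have "q \<in> Q" unfolding q Q_def by (intro image_eqI[of _ _ "(rl \<zeta>, \<chi> a. Im (\<zeta> $ a))"]) auto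
      then show ?thesis by blast
    qed (use TY q in blast)
  qed
  then have "closure (open_orbit act p0) \<subseteq> Y \<union> Q" by (rule closure_minimal) (intro closed_Un Yc Qc)
  then consider "p \<in> Y" | "p \<in> Q" using orbit_dense by blast
  then have "p \<in> Y"
  proof cases
    case 2
    then obtain \<zeta>' where "p = T \<zeta>'" using QE by blast
    moreover obtain \<zeta> where z: "\<zeta> \<in> strip" "T \<zeta> = T \<zeta>'" by (rule T_strip)
    ultimately have q: "p = T \<zeta>" by simp
    then have "rl \<zeta> \<notin> ball \<rho>0 \<delta>" using p z(1) by blast
    then have "\<delta> \<le> norm (rl \<zeta> - \<rho>0)" by (simp add: dist_norm norm_minus_commute)
    then show ?thesis unfolding q by (rule TY)
  qed
  then show ?thesis by (simp add: Y_def)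
qed

end

section \<open>Gaussian normalisation and the norms of the monomial sections\<close>

text \<open>(2 \<pi>)^(-m/2) (det H)^(-1/2) is the reciprocal of the total mass of exp (- <H^-1 x,
  x> / 2), because det (H^-1) = 1 / det H.\<close>

lemma gaussian_integral:
  fixes H :: "real^'m::finite^'m" and f :: "real^'m \<Rightarrow> complex"
  assumes H: "spd H" and f: "f \<in> borel_measurable borel"
  shows "(LINT x|gaussian_measure 0 H. f x)
    = (LINT x|lborel. complex_of_real (exp (- (((matrix_inv H *v x) \<bullet> x) / 2))) * f x) / of_real (gconst (matrix_inv H) 1)"
proof -
  define c where "c = (2 * pi) powr (- real CARD('m) / 2) * (det H) powr (- 1 / 2)"
  have dH: "0 < det H" by (rule spd_det_pos[OF H])
  have "det H * det (matrix_inv H) = 1"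
    using matrix_inv[OF spd_invertible[OF H]] det_mul[of H "matrix_inv H"] by simp
  then have di: "det (matrix_inv H) = 1 / det H" using dH by (simp add: field_simps)
  have p1: "(2 * pi) powr (- real CARD('m) / 2) = 1 / sqrt (2 * pi) ^ CARD('m)"
  proof -
    have "(2 * pi) powr (real CARD('m) / 2) = ((2 * pi) powr (1 / 2)) powr real CARD('m)" by (simp add: powr_powr)
    also have "\<dots> = sqrt (2 * pi) ^ CARD('m)" by (simp add: powr_half_sqrt powr_realpow)
    finally show ?thesis using powr_minus_divide[of "2 * pi" "real CARD('m) / 2"] by simp
  qed
  have p2: "(det H) powr (- 1 / 2) = 1 / sqrt (det H)"
    using powr_minus_divide[of "det H" "1 / 2"] dH by (simp add: powr_half_sqrt)
  have c: "c = 1 / gconst (matrix_inv H) 1"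
    unfolding c_def p1 p2 gconst_def di by (simp add: real_sqrt_divide)
  have c0: "0 \<le> c" by (simp add: c_def)
  have me: "(\<lambda>x. exp (- (((matrix_inv H *v x) \<bullet> x) / 2))) \<in> borel_measurable borel"
    by (intro borel_measurable_continuous_onI continuous_intros linear_continuous_on linear_conv_bounded_linear[THEN iffD1] matrix_vector_mul_linear) auto
  have gm: "gaussian_measure 0 H = density lborel (\<lambda>x. ennreal (c * exp (- (((matrix_inv H *v x) \<bullet> x) / 2))))"
    by (simp add: gaussian_measure_def c_def)
  have "(LINT x|gaussian_measure 0 H. f x) = (LINT x|lborel. (c * exp (- (((matrix_inv H *v x) \<bullet> x) / 2))) *\<^sub>R f x)"
    unfolding gm
  proof (rule integral_density)
    show "f \<in> borel_measurable lborel" using f by simp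
    show "(\<lambda>x. c * exp (- (((matrix_inv H *v x) \<bullet> x) / 2))) \<in> borel_measurable lborel"
      using borel_measurable_times[OF borel_measurable_const me] by simp
    show "AE x in lborel. 0 \<le> c * exp (- (((matrix_inv H *v x) \<bullet> x) / 2))" using c0 by simp
  qed
  also have "\<dots> = (LINT x|lborel. complex_of_real c * (complex_of_real (exp (- (((matrix_inv H *v x) \<bullet> x) / 2))) * f x))"
    by (intro Bochner_Integration.integral_cong) (auto simp: scaleR_conv_of_real mult.assoc)
  also have "\<dots> = complex_of_real c * (LINT x|lborel. complex_of_real (exp (- (((matrix_inv H *v x) \<bullet> x) / 2))) * f x)"
    by (rule integral_mult_right_zero)
  finally show ?thesis by (simp add: c)
qed

lemma nn_integral_affine:
  fixes g :: "real^'m::finite \<Rightarrow> ennreal"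
  assumes c: "0 < c" and g: "g \<in> borel_measurable borel"
  shows "(\<integral>\<^sup>+x. g x \<partial>lborel) = ennreal (c ^ CARD('m)) * (\<integral>\<^sup>+u. g (t + c *\<^sub>R u) \<partial>lborel)"
proof -
  note g [measurable]
  have "(\<integral>\<^sup>+x. g x \<partial>lborel) = (\<integral>\<^sup>+x. g x \<partial>density (distr lborel borel (\<lambda>x. t + c *\<^sub>R x)) (\<lambda>_. ennreal (\<bar>c\<bar>^DIM(real^'m))))"
    using c by (subst lborel_affine[of c t]) auto
  also have "\<dots> = ennreal (c ^ CARD('m)) * (\<integral>\<^sup>+x. g (t + c *\<^sub>R x) \<partial>lborel)"
    using c by (simp add: nn_integral_density nn_integral_distr nn_integral_cmult)
  finally show ?thesis .
qed

lemma cellpt_eq: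
  assumes "0 < k"
  shows "cellpt (1 / sqrt k) (real k *\<^sub>R \<mu>) \<alpha> = sqrt k *\<^sub>R ((1 / real k) *\<^sub>R rvec \<alpha> - \<mu>)"
proof -
  have s: "sqrt (real k) * sqrt (real k) = real k" "sqrt (real k) > 0" using assms by auto
  have "1 / sqrt k * (x - real k * m) = sqrt k * (1 / real k * x - m)" for x m :: real
    using s assms by (simp add: field_simps)
  then show ?thesis by (simp add: cellpt_def rvec_def vec_eq_iff)
qed

context toric
begin

lemma laplace_setup:
  assumes K: "0 < K"
  obtains \<delta> Cp Ca where
    "laplace (hessian phi \<rho>0) (\<lambda>r. phi (\<rho>0 + r) - phi \<rho>0 - fd phi \<rho>0 r) (\<lambda>r. K * Hd (\<rho>0 + r)) \<delta> (K * Hd \<rho>0) Cp Ca"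
proof -
  obtain \<delta>1 C where d1: "0 < \<delta>1" "0 \<le> C"
    "\<And>r. norm r < \<delta>1 \<Longrightarrow> \<bar>phi (\<rho>0 + r) - phi \<rho>0 - fd phi \<rho>0 r - ((hessian phi \<rho>0 *v r) \<bullet> r) / 2\<bar> \<le> C * norm r ^ 3"
    "\<And>r. norm r < \<delta>1 \<Longrightarrow> \<bar>phi (\<rho>0 + r) - phi \<rho>0 - fd phi \<rho>0 r - ((hessian phi \<rho>0 *v r) \<bullet> r) / 2\<bar> \<le> ((hessian phi \<rho>0 *v r) \<bullet> r) / 8"
    by (fact taylor_lower[OF phi_Ck spd_phi])
  obtain \<epsilon> C' where e: "0 < \<epsilon>" "0 \<le> C'"
    and L: "\<And>x y. x \<in> cball \<rho>0 \<epsilon> \<Longrightarrow> y \<in> cball \<rho>0 \<epsilon> \<Longrightarrow> norm (Hd x - Hd y) \<le> C' * norm (x - y)"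
    using Ck1_lipschitz[OF open_UNIV UNIV_I Hd_Ck, of \<rho>0] by metis
  define Ca where "Ca = K * C'"
  define a0 where "a0 = K * Hd \<rho>0"
  have Ca: "0 \<le> Ca" and a0: "0 < a0" using K e Hd_pos by (auto simp: Ca_def a0_def)
  \<comment> \<open>Radii for the Taylor bounds, for the Lipschitz bound of the density, and for the
    density to stay above half its value at the centre.\<close>
  define \<delta> where "\<delta> = min \<delta>1 (min \<epsilon> (a0 / (2 * (Ca + 1))))"
  have dpos: "0 < \<delta>" using d1 e a0 Ca by (simp add: \<delta>_def)
  have A: "\<bar>K * Hd (\<rho>0 + r) - a0\<bar> \<le> Ca * norm r" if r: "norm r < \<delta>" for r
  proof -
    have "\<bar>Hd (\<rho>0 + r) - Hd \<rho>0\<bar> \<le> C' * norm r"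
      using L[of "\<rho>0 + r" \<rho>0] r e by (simp add: \<delta>_def dist_norm)
    then have "K * \<bar>Hd (\<rho>0 + r) - Hd \<rho>0\<bar> \<le> K * (C' * norm r)" using K by (intro mult_left_mono) auto
    then show ?thesis using K by (simp add: a0_def Ca_def right_diff_distrib[symmetric] abs_mult mult.assoc)
  qed
  have B: "a0 / 2 \<le> K * Hd (\<rho>0 + r)" if r: "norm r < \<delta>" for r
  proof -
    have "Ca * norm r \<le> (Ca + 1) * (a0 / (2 * (Ca + 1)))"
      using r Ca by (intro mult_mono) (auto simp: \<delta>_def)
    moreover have "(Ca + 1) * (a0 / (2 * (Ca + 1))) = a0 / 2"
      using Ca add_nonneg_pos[of Ca 1] by (simp del: distrib_left_numeral distrib_right_numeral)
    ultimately have "Ca * norm r \<le> a0 / 2" by (rule ord_le_eq_trans)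
    with A[OF r] show ?thesis unfolding abs_le_iff by linarith
  qed
  have "laplace (hessian phi \<rho>0) (\<lambda>r. phi (\<rho>0 + r) - phi \<rho>0 - fd phi \<rho>0 r) (\<lambda>r. K * Hd (\<rho>0 + r)) \<delta> (K * Hd \<rho>0) C Ca"
  proof
    show "spd (hessian phi \<rho>0)" by (rule spd_phi)
    show "0 < \<delta>" "0 \<le> C" "0 \<le> Ca" "0 < K * Hd \<rho>0" using dpos d1 Ca a0 by (auto simp: a0_def)
    show "(\<lambda>r. phi (\<rho>0 + r) - phi \<rho>0 - fd phi \<rho>0 r) \<in> borel_measurable borel"
      by (intro borel_measurable_continuous_onI continuous_intros continuous_on_compose2[OF Ck_continuous[OF phi_Ck]]
          linear_continuous_on linear_conv_bounded_linear[THEN iffD1] has_derivative_linear[OF Ck_diff[OF phi_Ck UNIV_I]]) auto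
    show "(\<lambda>r. K * Hd (\<rho>0 + r)) \<in> borel_measurable borel"
      by (intro borel_measurable_continuous_onI continuous_intros continuous_on_compose2[OF Ck_continuous[OF Hd_Ck]]) auto
    fix r :: "real^'m" assume r: "norm r < \<delta>"
    then have "norm r < \<delta>1" by (simp add: \<delta>_def)
    from d1(3,4)[OF this]
    show "\<bar>phi (\<rho>0 + r) - phi \<rho>0 - fd phi \<rho>0 r - ((hessian phi \<rho>0 *v r) \<bullet> r) / 2\<bar> \<le> C * norm r ^ 3"
      "\<bar>phi (\<rho>0 + r) - phi \<rho>0 - fd phi \<rho>0 r - ((hessian phi \<rho>0 *v r) \<bullet> r) / 2\<bar> \<le> ((hessian phi \<rho>0 *v r) \<bullet> r) / 8" .
    show "\<bar>K * Hd (\<rho>0 + r) - K * Hd \<rho>0\<bar> \<le> Ca * norm r" using A[OF r] by (simp only: a0_def)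
    show "K * Hd \<rho>0 / 2 \<le> K * Hd (\<rho>0 + r)" using B[OF r] by (simp only: a0_def)
  qed
  then show thesis by (rule that)
qed

text \<open>With r = \<rho> - \<rho>0 the exponent <\<alpha>, \<rho>> - k \<phi> is its value at
  \<rho>0 plus <\<alpha> - k \<mu>, r> - k \<psi> r. The substitution r = h u turns the linear term
  into y \<bullet> u and k into 1/h^2, which is the integrand of \<open>Iin\<close>; the angles have
  contributed the constant \<open>K\<close>.\<close>

lemma inner_integral:
  assumes K: "\<And>g :: real^'m \<Rightarrow> ennreal. g \<in> borel_measurable borel \<Longrightarrow>
      (\<integral>\<^sup>+\<zeta>. indicator strip \<zeta> * g (rl \<zeta>) \<partial>lborel) = ennreal K * (\<integral>\<^sup>+\<rho>. g \<rho> \<partial>lborel)" and K0: "0 < K"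
    and lap: "laplace (hessian phi \<rho>0) (\<lambda>r. phi (\<rho>0 + r) - phi \<rho>0 - fd phi \<rho>0 r) (\<lambda>r. K * Hd (\<rho>0 + r)) \<delta> (K * Hd \<rho>0) Cp Ca"
    and k: "1 \<le> k" and al: "\<alpha> \<in> lattice_points P k" and hh: "hh = 1 / sqrt k" and y: "y = hh *\<^sub>R (rvec \<alpha> - real k *\<^sub>R gradient phi \<rho>0)"
  shows "(\<integral>\<^sup>+p. indicator (T ` {\<zeta> \<in> strip. rl \<zeta> \<in> ball \<rho>0 \<delta>}) p * ennreal (norm2_at L h k (s k \<alpha>) p) \<partial>vol)
    = ennreal (exp (rvec \<alpha> \<bullet> \<rho>0 - real k * phi \<rho>0) * hh ^ CARD('m) * laplace.Iin (\<lambda>r. phi (\<rho>0 + r) - phi \<rho>0 - fd phi \<rho>0 r) (\<lambda>r. K * Hd (\<rho>0 + r)) \<delta> hh y)"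
proof -
  interpret Lp: laplace "hessian phi \<rho>0" "\<lambda>r. phi (\<rho>0 + r) - phi \<rho>0 - fd phi \<rho>0 r" "\<lambda>r. K * Hd (\<rho>0 + r)" \<delta> "K * Hd \<rho>0" Cp Ca by (rule lap)
  let ?N0 = "exp (rvec \<alpha> \<bullet> \<rho>0 - real k * phi \<rho>0)"
  have h0: "0 < hh" "hh \<le> 1" "1 / hh\<^sup>2 = real k" "hh * hh * real k = 1" using k by (auto simp: hh power_divide field_simps)
  define g where "g \<rho> = ennreal (indicator (ball \<rho>0 \<delta>) \<rho> * (exp (rvec \<alpha> \<bullet> \<rho> - real k * phi \<rho>) * Hd \<rho>))" for \<rho>
  have c1: "(\<lambda>\<rho>. exp (rvec \<alpha> \<bullet> \<rho> - real k * phi \<rho>) * Hd \<rho>) \<in> borel_measurable borel"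
    by (intro borel_measurable_continuous_onI continuous_intros Ck_continuous[OF phi_Ck] Ck_continuous[OF Hd_Ck])
  have g: "g \<in> borel_measurable borel" unfolding g_def[abs_def]
    by (intro measurable_compose[OF _ measurable_ennreal] borel_measurable_times borel_measurable_indicator c1) simp
  define I where "I u = indicator (ball 0 (\<delta> / hh)) u * (exp (y \<bullet> u - (phi (\<rho>0 + hh *\<^sub>R u) - phi \<rho>0 - fd phi \<rho>0 (hh *\<^sub>R u)) / hh\<^sup>2) * (K * Hd (\<rho>0 + hh *\<^sub>R u)))" for u
  have Iint: "integrable lborel I" unfolding I_def[abs_def] by (rule Lp.Iin_integrable[OF h0(1,2)])
  have I0: "0 \<le> I u" for u using K0 Hd_pos[of "\<rho>0 + hh *\<^sub>R u"] by (simp add: I_def)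
  have gI: "ennreal K * g (\<rho>0 + hh *\<^sub>R u) = ennreal ?N0 * ennreal (I u)" for u
  proof -
    have ib: "\<rho>0 + hh *\<^sub>R u \<in> ball \<rho>0 \<delta> \<longleftrightarrow> u \<in> ball 0 (\<delta> / hh)" using h0(1) by (simp add: dist_norm pos_less_divide_eq mult.commute)
    have gr: "gradient phi \<rho>0 \<bullet> r = fd phi \<rho>0 r" for r by (rule gradient_fd[OF Ck_diff[OF phi_Ck UNIV_I]])
    have "y \<bullet> u - (phi (\<rho>0 + hh *\<^sub>R u) - phi \<rho>0 - fd phi \<rho>0 (hh *\<^sub>R u)) / hh\<^sup>2
      = hh * (rvec \<alpha> \<bullet> u - real k * (gradient phi \<rho>0 \<bullet> u)) - real k * (phi (\<rho>0 + hh *\<^sub>R u) - phi \<rho>0 - hh * (gradient phi \<rho>0 \<bullet> u))"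
      unfolding h0(3)[symmetric] gr[symmetric] by (simp add: y inner_diff_left h0(3)[symmetric])
    then have ee: "?N0 * exp (y \<bullet> u - (phi (\<rho>0 + hh *\<^sub>R u) - phi \<rho>0 - fd phi \<rho>0 (hh *\<^sub>R u)) / hh\<^sup>2)
      = exp (rvec \<alpha> \<bullet> (\<rho>0 + hh *\<^sub>R u) - real k * phi (\<rho>0 + hh *\<^sub>R u))"
      by (simp add: exp_add[symmetric] inner_add_right algebra_simps)
    have "K * (indicator (ball \<rho>0 \<delta>) (\<rho>0 + hh *\<^sub>R u) * (exp (rvec \<alpha> \<bullet> (\<rho>0 + hh *\<^sub>R u) - real k * phi (\<rho>0 + hh *\<^sub>R u)) * Hd (\<rho>0 + hh *\<^sub>R u))) = ?N0 * I u"
      unfolding ee[symmetric] I_def using ib by (simp add: indicator_def mult_ac)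
    then show ?thesis unfolding g_def using K0 I0 Hd_pos by (simp add: ennreal_mult[symmetric] less_imp_le)
  qed
  have Nm: "norm2_at L h k (s k \<alpha>) \<in> borel_measurable borel"
    by (rule borel_measurable_continuous_onI[OF norm2_at_cont[OF basis_H0[OF k al]]])
  have b: "ball \<rho>0 \<delta> \<in> sets borel" by simp
  have "(\<integral>\<^sup>+p. indicator (T ` {\<zeta> \<in> strip. rl \<zeta> \<in> ball \<rho>0 \<delta>}) p * ennreal (norm2_at L h k (s k \<alpha>) p) \<partial>vol)
    = (\<integral>\<^sup>+\<zeta>. indicator strip \<zeta> * (indicator (ball \<rho>0 \<delta>) (rl \<zeta>) * ennreal (norm2_at L h k (s k \<alpha>) (T \<zeta>)) * ennreal (Hd (rl \<zeta>))) \<partial>lborel)"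
    by (rule vol_orbit(2)[OF b]) (use Nm in measurable)
  also have "\<dots> = (\<integral>\<^sup>+\<zeta>. indicator strip \<zeta> * g (rl \<zeta>) \<partial>lborel)"
    unfolding norm2_basis[OF k al] g_def
    by (intro nn_integral_cong) (auto simp: indicator_def ennreal_mult[symmetric] less_imp_le[OF Hd_pos])
  also have "\<dots> = ennreal K * (\<integral>\<^sup>+\<rho>. g \<rho> \<partial>lborel)" by (rule K[OF g])
  also have "\<dots> = ennreal (hh ^ CARD('m)) * (\<integral>\<^sup>+u. ennreal K * g (\<rho>0 + hh *\<^sub>R u) \<partial>lborel)"
  proof -
    have "(\<lambda>u. g (\<rho>0 + hh *\<^sub>R u)) \<in> borel_measurable borel" using g by measurable
    then show ?thesis unfolding nn_integral_affine[OF h0(1) g, of \<rho>0] by (subst nn_integral_cmult) (auto simp: mult.left_commute)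
  qed
  also have "\<dots> = ennreal (hh ^ CARD('m)) * (ennreal ?N0 * (\<integral>\<^sup>+u. ennreal (I u) \<partial>lborel))"
    unfolding gI using Iint by (subst nn_integral_cmult) auto
  also have "(\<integral>\<^sup>+u. ennreal (I u) \<partial>lborel) = ennreal (Lp.Iin hh y)"
    unfolding Lp.Iin_def I_def[symmetric] using Iint I0 by (intro nn_integral_eq_integral) auto
  also have "ennreal (hh ^ CARD('m)) * (ennreal ?N0 * ennreal (Lp.Iin hh y)) = ennreal (?N0 * hh ^ CARD('m) * Lp.Iin hh y)"
  proof -
    have "0 \<le> Lp.Iin hh y" unfolding Lp.Iin_def I_def[symmetric] by (rule Bochner_Integration.integral_nonneg) (rule I0)
    then show ?thesis using h0(1) by (simp add: ennreal_mult[symmetric] mult_ac)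
  qed
  finally show ?thesis .
qed

text \<open>\<open>R\<close> is the contribution of the complement of the image of |r| < \<delta>,
  measured in units of |s_\<alpha>(z)|^2 h^m. It is finite because M has finite volume and norms of
  sections are bounded. When \<alpha>/k is close to \<mu>, \<open>norm2_far\<close> makes it
  exponentially small; m + 1 powers of h are extracted, m for the unit and one for the claimed
  bound.\<close>

lemma section_norm_split:
  assumes K: "\<And>g :: real^'m \<Rightarrow> ennreal. g \<in> borel_measurable borel \<Longrightarrow>
      (\<integral>\<^sup>+\<zeta>. indicator strip \<zeta> * g (rl \<zeta>) \<partial>lborel) = ennreal K * (\<integral>\<^sup>+\<rho>. g \<rho> \<partial>lborel)" and K0: "0 < K"
    and lap: "laplace (hessian phi \<rho>0) (\<lambda>r. phi (\<rho>0 + r) - phi \<rho>0 - fd phi \<rho>0 r) (\<lambda>r. K * Hd (\<rho>0 + r)) \<delta> (K * Hd \<rho>0) Cp Ca"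
    and c: "0 < c" "\<And>r. \<delta> \<le> norm r \<Longrightarrow> c * norm r \<le> phi (\<rho>0 + r) - phi \<rho>0 - fd phi \<rho>0 r"
    and k: "1 \<le> k" and al: "\<alpha> \<in> lattice_points P k" and hh: "hh = 1 / sqrt k" and y: "y = hh *\<^sub>R (rvec \<alpha> - real k *\<^sub>R gradient phi \<rho>0)"
  shows "\<exists>R\<ge>0. section_norm2 L h vol k (s k \<alpha>) = exp (rvec \<alpha> \<bullet> \<rho>0 - real k * phi \<rho>0) * hh ^ CARD('m)
      * (laplace.Iin (\<lambda>r. phi (\<rho>0 + r) - phi \<rho>0 - fd phi \<rho>0 r) (\<lambda>r. K * Hd (\<rho>0 + r)) \<delta> hh y + R)
    \<and> (norm y \<le> (c / 2) / hh \<longrightarrow> R \<le> ((real (Suc CARD('m)) / (c * \<delta> / 2)) ^ Suc CARD('m) * measure vol UNIV) * hh)"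
proof -
  interpret Lp: laplace "hessian phi \<rho>0" "\<lambda>r. phi (\<rho>0 + r) - phi \<rho>0 - fd phi \<rho>0 r" "\<lambda>r. K * Hd (\<rho>0 + r)" \<delta> "K * Hd \<rho>0" Cp Ca by (rule lap)
  let ?N0 = "exp (rvec \<alpha> \<bullet> \<rho>0 - real k * phi \<rho>0)" and ?sec = "norm2_at L h k (s k \<alpha>)"
  let ?W = "T ` {\<zeta> \<in> strip. rl \<zeta> \<in> ball \<rho>0 \<delta>}" and ?m = "CARD('m)"
  have d: "0 < \<delta>" by (rule Lp.pos)
  have h0: "0 < hh" "hh \<le> 1" "1 / hh\<^sup>2 = real k" using k by (auto simp: hh power_divide field_simps)
  have Nc: "continuous_on UNIV ?sec" by (rule norm2_at_cont[OF basis_H0[OF k al]])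
  then have Nm [measurable]: "?sec \<in> borel_measurable borel" by (rule borel_measurable_continuous_onI)
  have b: "ball \<rho>0 \<delta> \<in> sets borel" by simp
  have W [measurable]: "?W \<in> sets borel" by (rule vol_orbit(1)[OF b, of "\<lambda>_. 0"]) simp
  obtain p1 where p1: "\<And>p. ?sec p \<le> ?sec p1" using continuous_attains_sup[OF compactM _ Nc] by (metis UNIV_I UNIV_not_empty)
  have fin: "emeasure vol X < \<infinity>" for X using emeasure_mono[of X UNIV vol] vol_finite
    by (cases "X \<in> sets vol") (auto simp: vol_sets emeasure_notin_sets intro: le_less_trans)
  let ?J = "\<integral>\<^sup>+p. indicator (- ?W) p * ennreal (?sec p) \<partial>vol"
  have bound: "?J \<le> ennreal (B * measure vol UNIV)" if B: "\<And>p. p \<notin> ?W \<Longrightarrow> ?sec p \<le> B" and "0 \<le> B" for B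
  proof -
    have "?J \<le> (\<integral>\<^sup>+p. ennreal B \<partial>vol)" using B by (intro nn_integral_mono) (auto simp: indicator_def intro!: ennreal_leI)
    also have "\<dots> = ennreal B * emeasure vol (space vol)" by simp
    also have "space vol = UNIV" using sets_eq_imp_space_eq[OF vol_sets] by simp
    also have "emeasure vol UNIV = ennreal (measure vol UNIV)" using fin[of UNIV] by (intro emeasure_eq_ennreal_measure) auto
    finally show ?thesis using \<open>0 \<le> B\<close> by (simp add: ennreal_mult[symmetric])
  qed
  have Jf: "?J < \<infinity>" using bound[of "?sec p1"] p1 norm2_at_nonneg by (auto intro: le_less_trans)
  define J where "J = enn2real ?J"
  have J: "?J = ennreal J" "0 \<le> J" using Jf by (auto simp: J_def less_top)
  define R where "R = J / (?N0 * hh ^ ?m)"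
  have pos: "0 < ?N0 * hh ^ ?m" using h0 by simp
  have R0: "0 \<le> R" using J pos by (simp add: R_def)
  have RJ: "J = ?N0 * hh ^ ?m * R" using h0(1) by (simp add: R_def)
  have I0: "0 \<le> Lp.Iin hh y"
    unfolding Lp.Iin_def 
    by (intro Bochner_Integration.integral_nonneg mult_nonneg_nonneg indicator_pos_le exp_ge_zero less_imp_le[OF K0] less_imp_le[OF Hd_pos])
  have ii: "(\<integral>\<^sup>+p. indicator ?W p * ennreal (?sec p) \<partial>vol) = ennreal (?N0 * hh ^ ?m * Lp.Iin hh y)"
    by (rule inner_integral[OF _ K0 lap k al hh y]) (rule K)
  have mW: "(\<lambda>p. indicator ?W p * ennreal (?sec p)) \<in> borel_measurable vol" "(\<lambda>p. indicator (- ?W) p * ennreal (?sec p)) \<in> borel_measurable vol"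
    unfolding measurable_cong_sets[OF vol_sets refl]
    by (intro borel_measurable_times_ennreal borel_measurable_indicator measurable_compose[OF Nm measurable_ennreal] W borel_comp)+
  have "(\<integral>\<^sup>+p. ennreal (?sec p) \<partial>vol) = (\<integral>\<^sup>+p. indicator ?W p * ennreal (?sec p) + indicator (- ?W) p * ennreal (?sec p) \<partial>vol)"
    by (intro nn_integral_cong) (auto simp: indicator_def)
  also have "\<dots> = (\<integral>\<^sup>+p. indicator ?W p * ennreal (?sec p) \<partial>vol) + ?J"
    by (rule nn_integral_add[OF mW])
  also have "\<dots> = ennreal (?N0 * hh ^ ?m * Lp.Iin hh y) + ennreal J"
    unfolding ii J(1) ..
  also have "\<dots> = ennreal (?N0 * hh ^ ?m * (Lp.Iin hh y + R))"
    using pos I0 J(2) by (simp add: RJ distrib_left flip: ennreal_plus)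
  finally have "(LINT p|vol. ?sec p) = ?N0 * hh ^ ?m * (Lp.Iin hh y + R)"
    using pos I0 R0 by (subst integral_eq_nn_integral) (auto simp: norm2_at_nonneg measurable_cong_sets[OF vol_sets refl])
  then have S: "section_norm2 L h vol k (s k \<alpha>) = ?N0 * hh ^ ?m * (Lp.Iin hh y + R)" by (simp add: section_norm2_def)
  have Rb: "R \<le> ((real (Suc ?m) / (c * \<delta> / 2)) ^ Suc ?m * measure vol UNIV) * hh" if ny: "norm y \<le> (c / 2) / hh"
  proof -
    have yk: "(1 / real k) *\<^sub>R rvec \<alpha> - gradient phi \<rho>0 = hh *\<^sub>R y"
      using k by (simp add: y hh scaleR_diff_right)
    have "norm ((1 / real k) *\<^sub>R rvec \<alpha> - gradient phi \<rho>0) = hh * norm y" unfolding yk using h0 by simp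
    also have "\<dots> \<le> hh * ((c / 2) / hh)" using ny h0 by (intro mult_left_mono) auto
    finally have cl: "norm ((1 / real k) *\<^sub>R rvec \<alpha> - gradient phi \<rho>0) \<le> c / 2" using h0 by simp
    have "?J \<le> ennreal (?N0 * exp (- (real k * (c * \<delta> / 2))) * measure vol UNIV)"
    proof (rule bound)
      fix p assume p: "p \<notin> ?W"
      show "?sec p \<le> ?N0 * exp (- (real k * (c * \<delta> / 2)))"
        by (rule norm2_far[OF d c(1) c(2) k al cl], assumption, rule p)
    qed simp
    then have "J \<le> ?N0 * exp (- (real k * (c * \<delta> / 2))) * measure vol UNIV" unfolding J(1) by (subst (asm) ennreal_le_iff) auto
    also have "real k * (c * \<delta> / 2) = (c * \<delta> / 2) / hh\<^sup>2" unfolding h0(3)[symmetric] by simp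
    also have "?N0 * exp (- ((c * \<delta> / 2) / hh\<^sup>2)) * measure vol UNIV \<le> ?N0 * ((real (Suc ?m) / (c * \<delta> / 2)) ^ Suc ?m * hh ^ Suc ?m) * measure vol UNIV"
      using exp_power_bound[of "c * \<delta> / 2" hh "Suc ?m"] c(1) d h0 by (intro mult_right_mono mult_left_mono) auto
    finally have "J \<le> ?N0 * ((real (Suc ?m) / (c * \<delta> / 2)) ^ Suc ?m * hh ^ Suc ?m) * measure vol UNIV" .
    also have "\<dots> = (((real (Suc ?m) / (c * \<delta> / 2)) ^ Suc ?m * measure vol UNIV) * hh) * (?N0 * hh ^ ?m)"
      by (simp only: power_Suc mult_ac)
    finally show ?thesis unfolding R_def pos_divide_le_eq[OF pos] .
  qed
  show ?thesis using S R0 Rb by blast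
qed

section \<open>Assembly: Gaussian limit of the rescaled measures at rate 1/sqrt k\<close>

lemma clt:
  assumes z: "z \<in> ctorus" and f: "C0 f" "fourier_transform_L1 f fhat" "radially_dominated fhat"
  shows "(\<lambda>k. norm ((LINT x|rescaled_measure act p0 L h vol e P s z k. f x)
                   - (LINT x|gaussian_measure 0 (potential_hessian act p0 L h e z). f x)))
         \<in> O(\<lambda>k. 1 / sqrt (real k))"
proof -
  define \<zeta>0 where "\<zeta>0 = (\<chi> a. Ln (z $ a))"
  define \<rho>0 where "\<rho>0 = log_coords z"
  have T0: "T \<zeta>0 = act z p0" unfolding T_def \<zeta>0_def cexp_surj[OF z] ..
  have r0: "rl \<zeta>0 = \<rho>0"
    using z by (auto simp: rl_def \<zeta>0_def \<rho>0_def log_coords_def vec_eq_iff ctorus_def ln_realpow)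
  define \<mu> where "\<mu> = gradient phi \<rho>0"
  have mu: "moment_map act p0 L h e z = \<mu>" by (simp add: moment_map_def \<mu>_def phi_def \<rho>0_def)
  define H where "H = hessian phi \<rho>0"
  have ph: "potential_hessian act p0 L h e z = H" by (simp add: potential_hessian_def H_def phi_def \<rho>0_def)
  obtain K where K0: "0 < K" and K: "\<And>g :: real^'m \<Rightarrow> ennreal. g \<in> borel_measurable borel \<Longrightarrow>
      (\<integral>\<^sup>+\<zeta>. indicator strip \<zeta> * g (rl \<zeta>) \<partial>lborel) = ennreal K * (\<integral>\<^sup>+\<rho>. g \<rho> \<partial>lborel)" by (fact strip_integral)
  obtain \<delta> Cp Ca where lap: "laplace (hessian phi \<rho>0) (\<lambda>r. phi (\<rho>0 + r) - phi \<rho>0 - fd phi \<rho>0 r) (\<lambda>r. K * Hd (\<rho>0 + r)) \<delta> (K * Hd \<rho>0) Cp Ca"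
    by (fact laplace_setup[OF K0])
  interpret Lp: laplace "hessian phi \<rho>0" "\<lambda>r. phi (\<rho>0 + r) - phi \<rho>0 - fd phi \<rho>0 r" "\<lambda>r. K * Hd (\<rho>0 + r)" \<delta> "K * Hd \<rho>0" Cp Ca by (rule lap)
  obtain c where c: "0 < c" "\<And>r. \<delta> \<le> norm r \<Longrightarrow> c * norm r \<le> phi (\<rho>0 + r) - phi \<rho>0 - fd phi \<rho>0 r"
    by (fact convex_growth[OF phi_Ck spd_phi Lp.pos(1)])
  obtain d where d: "0 < d" "\<And>x. x \<notin> P \<Longrightarrow> d \<le> norm (x - gradient phi \<rho>0)" by (fact moment_interior)
  obtain B where B: "0 < B" "\<And>x. x \<in> P \<Longrightarrow> norm x \<le> B" by (fact P_bounded)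
  \<comment> \<open>Bounds |\<alpha>/k - \<mu>| over all lattice points of kP, so that |y| \<le> D/h
    for every term of the sum.\<close>
  define D where "D = B + norm \<mu>"
  have D: "0 < D" using B by (simp add: D_def add_pos_nonneg)
  define C2 where "C2 = (real (Suc CARD('m)) / (c * \<delta> / 2)) ^ Suc CARD('m) * measure vol UNIV"
  have C2: "0 \<le> C2" unfolding C2_def using c(1) Lp.pos(1) by (intro mult_nonneg_nonneg zero_le_power divide_nonneg_nonneg) auto
  have c2: "0 < c / 2" using c by simp
  obtain C c' h0 where w: "0 \<le> C" "0 < c'" "0 < h0" "h0 \<le> 1"
    "\<And>h R y. 0 < h \<Longrightarrow> h \<le> h0 \<Longrightarrow> 0 \<le> R \<Longrightarrow> norm y \<le> D / h \<Longrightarrow> (norm y \<le> (c / 2) / h \<Longrightarrow> R \<le> C2 * h) \<Longrightarrow>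
      \<bar>1 / (Lp.Iin h y + R) - Lp.\<kappa> * exp (- Lp.E y)\<bar> \<le> C * h * exp (- c' * (norm y)\<^sup>2)"
    by (fact Lp.weight_approx[OF D c2 C2])
  \<comment> \<open>From this k on, h = 1/sqrt k is at most h0; the maximum with 1 excludes k =
    0.\<close>
  define k0 where "k0 = max 1 (nat \<lceil>1 / h0\<^sup>2\<rceil>)"
  \<comment> \<open>The power of h offsets the one in the norm of the section, so that q equals 1 /
    (Iin + R) exactly; it cancels when the sums are divided.\<close>
  define q where "q k \<alpha> = (1 / sqrt (real k)) ^ CARD('m) * szego_weight L h vol s k \<alpha> (act z p0)" for k \<alpha>
  obtain G where G: "\<And>r s. 0 < r \<Longrightarrow> r \<le> s \<Longrightarrow> G s \<le> G r" "integrable lborel (\<lambda>t::real^'m. G (norm t))"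
      "AE t in lborel. norm (fhat t) \<le> G (norm t)"
    using f(3) unfolding radially_dominated_def by blast
  have F: "integrable lborel fhat" "\<And>x. f x = (LINT t|lborel. fhat t * exp (- \<i> * complex_of_real (t \<bullet> x)))"
    using f(2) unfolding fourier_transform_L1_def by blast+
  have near: "\<bar>q k \<alpha> - Lp.\<kappa> * exp (- Lp.E (cellpt (1 / sqrt k) (real k *\<^sub>R \<mu>) \<alpha>))\<bar>
      \<le> C * (1 / sqrt k) * exp (- c' * (norm (cellpt (1 / sqrt k) (real k *\<^sub>R \<mu>) \<alpha>))\<^sup>2)"
    if k: "k0 \<le> k" and al: "\<alpha> \<in> lattice_points P k" for k \<alpha>
  proof -
    have k1: "1 \<le> k" using k by (simp add: k0_def)
    define hh where "hh = 1 / sqrt (real k)"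
    define y where "y = hh *\<^sub>R (rvec \<alpha> - real k *\<^sub>R gradient phi \<rho>0)"
    have hp: "0 < hh" using k1 by (simp add: hh_def)
    have hle: "hh \<le> h0"
    proof -
      have "1 / h0\<^sup>2 \<le> real k" using k by (simp add: k0_def)
      then have "sqrt (1 / h0\<^sup>2) \<le> sqrt (real k)" by (rule real_sqrt_le_mono)
      then have "1 / h0 \<le> sqrt (real k)" using w(3) by (simp add: real_sqrt_divide)
      then show ?thesis using w(3) k1 by (simp add: hh_def field_simps)
    qed
    have ye: "cellpt (1 / sqrt k) (real k *\<^sub>R \<mu>) \<alpha> = y"
      by (simp add: cellpt_def y_def hh_def \<mu>_def rvec_def vec_eq_iff)
    have yn: "norm y \<le> D / hh"
    proof -
      obtain x where x: "x \<in> P" "rvec \<alpha> = real k *\<^sub>R x" using al by (auto simp: lattice_points_def)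
      have "norm (x - \<mu>) \<le> D" unfolding D_def using norm_triangle_ineq4[of x \<mu>] B(2)[OF x(1)] by linarith
      moreover have "y = (1 / hh) *\<^sub>R (x - \<mu>)"
        using k1 by (simp add: y_def x(2) \<mu>_def scaleR_diff_right[symmetric] hh_def real_div_sqrt)
      ultimately show ?thesis using hp by (simp add: divide_right_mono)
    qed
    obtain R where R: "0 \<le> R" "section_norm2 L h vol k (s k \<alpha>) = exp (rvec \<alpha> \<bullet> \<rho>0 - real k * phi \<rho>0) * hh ^ CARD('m) * (Lp.Iin hh y + R)"
      "norm y \<le> (c / 2) / hh \<Longrightarrow> R \<le> C2 * hh"
      using section_norm_split[OF K K0 lap c k1 al hh_def y_def] unfolding C2_def by blast
    have "norm2_at L h k (s k \<alpha>) (act z p0) = exp (rvec \<alpha> \<bullet> \<rho>0 - real k * phi \<rho>0)"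
      unfolding T0[symmetric] norm2_basis[OF k1 al] r0 ..
    then have "q k \<alpha> = 1 / (Lp.Iin hh y + R)"
      using hp by (simp add: q_def szego_weight_def R(2) hh_def[symmetric])
    then show ?thesis using w(5)[OF hp hle R(1) yn R(3)] unfolding ye hh_def by simp
  qed
  have far: "d * sqrt k \<le> norm (cellpt (1 / sqrt k) (real k *\<^sub>R \<mu>) \<alpha>)"
    if k: "k0 \<le> k" and al: "\<alpha> \<notin> lattice_points P k" for k \<alpha>
  proof -
    have k1: "0 < k" using k by (simp add: k0_def)
    have "(1 / real k) *\<^sub>R rvec \<alpha> \<notin> P"
    proof
      assume "(1 / real k) *\<^sub>R rvec \<alpha> \<in> P"
      then have "rvec \<alpha> \<in> (\<lambda>x. real k *\<^sub>R x) ` P" using k1 by (intro image_eqI[of _ _ "(1 / real k) *\<^sub>R rvec \<alpha>"]) auto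
      then show False using al by (simp add: lattice_points_def)
    qed
    from mult_left_mono[OF d(2)[OF this], of "sqrt (real k)"]
    show ?thesis unfolding cellpt_eq[OF k1] \<mu>_def by (simp add: mult.commute)
  qed
  have k01: "1 \<le> k0" by (simp add: k0_def)
  have "\<exists>Kc. eventually (\<lambda>k. norm ((\<Sum>\<alpha>\<in>lattice_points P k. of_real (q k \<alpha>) * f (cellpt (1 / sqrt k) (real k *\<^sub>R \<mu>) \<alpha>)) / of_real (\<Sum>\<alpha>\<in>lattice_points P k. q k \<alpha>)
        - (LINT x|lborel. complex_of_real (exp (- Lp.E x)) * f x) / of_real (gconst (matrix_inv (hessian phi \<rho>0)) 1)) \<le> Kc * (1 / sqrt k)) sequentially"
    by (rule Lp.clt_abstract[where f=f and F=fhat and G=G and \<Lambda>="lattice_points P" and q=q and \<mu>=\<mu> and C=C and c=c' and d=d, OF F])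
      (assumption | rule exI G finite_lattice w(1,2) d(1) k01 near far)+
  then obtain Kc where ev: "eventually (\<lambda>k. norm ((\<Sum>\<alpha>\<in>lattice_points P k. of_real (q k \<alpha>) * f (cellpt (1 / sqrt k) (real k *\<^sub>R \<mu>) \<alpha>)) / of_real (\<Sum>\<alpha>\<in>lattice_points P k. q k \<alpha>)
        - (LINT x|lborel. complex_of_real (exp (- Lp.E x)) * f x) / of_real (gconst (matrix_inv (hessian phi \<rho>0)) 1)) \<le> Kc * (1 / sqrt k)) sequentially" by blast
  have fm: "f \<in> borel_measurable borel" using f(1) by (intro borel_measurable_continuous_onI) (simp add: C0_def)
  have gauss: "(LINT x|gaussian_measure 0 H. f x) = (LINT x|lborel. complex_of_real (exp (- Lp.E x)) * f x) / of_real (gconst (matrix_inv (hessian phi \<rho>0)) 1)"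
    unfolding Lp.E_def H_def by (rule gaussian_integral[OF spd_phi fm])
  have resc: "(LINT x|rescaled_measure act p0 L h vol e P s z k. f x)
     = (\<Sum>\<alpha>\<in>lattice_points P k. of_real (q k \<alpha>) * f (cellpt (1 / sqrt k) (real k *\<^sub>R \<mu>) \<alpha>)) / of_real (\<Sum>\<alpha>\<in>lattice_points P k. q k \<alpha>)"
    if k: "k0 \<le> k" for k
  proof -
    have k1: "0 < k" using k by (simp add: k0_def)
    let ?\<Lambda> = "lattice_points P k" and ?w = "\<lambda>\<alpha>. szego_weight L h vol s k \<alpha> (act z p0)"
    let ?S = "szego_density L h vol s P k (act z p0)" and ?x = "\<lambda>\<alpha>. sqrt (real k) *\<^sub>R ((1 / real k) *\<^sub>R rvec \<alpha> - \<mu>)"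
    define t where "t = (1 / sqrt (real k)) ^ CARD('m)"
    have t: "t \<noteq> 0" using k1 by (simp add: t_def)
    have w0: "0 \<le> ?w \<alpha>" for \<alpha>
      unfolding szego_weight_def section_norm2_def by (intro divide_nonneg_nonneg Bochner_Integration.integral_nonneg norm2_at_nonneg)
    have S0: "0 \<le> ?S" unfolding szego_density_def by (intro sum_nonneg w0)
    have "(LINT x|rescaled_measure act p0 L h vol e P s z k. f x) = (LINT \<alpha>|point_measure ?\<Lambda> (\<lambda>\<alpha>. ennreal (?w \<alpha> / ?S)). f (?x \<alpha>))"
      unfolding rescaled_measure_def mu by (rule integral_distr) (use fm in \<open>auto simp: measurable_point_measure_eq1\<close>)
    also have "\<dots> = (\<Sum>\<alpha>\<in>?\<Lambda>. (?w \<alpha> / ?S) *\<^sub>R f (?x \<alpha>))"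
      using w0 S0 by (intro lebesgue_integral_point_measure_finite finite_lattice) auto
    also have "\<dots> = (\<Sum>\<alpha>\<in>?\<Lambda>. of_real (?w \<alpha>) * f (?x \<alpha>)) / of_real ?S"
      by (simp add: scaleR_conv_of_real sum_divide_distrib)
    also have "\<dots> = (of_real t * (\<Sum>\<alpha>\<in>?\<Lambda>. of_real (?w \<alpha>) * f (?x \<alpha>))) / (of_real t * of_real ?S)"
      using t by simp
    also have "of_real t * (\<Sum>\<alpha>\<in>?\<Lambda>. of_real (?w \<alpha>) * f (?x \<alpha>)) = (\<Sum>\<alpha>\<in>?\<Lambda>. of_real (q k \<alpha>) * f (?x \<alpha>))"
      unfolding q_def t_def[symmetric] by (simp add: sum_distrib_left mult.assoc)
    also have "of_real t * complex_of_real ?S = of_real (\<Sum>\<alpha>\<in>?\<Lambda>. q k \<alpha>)"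
      unfolding q_def t_def[symmetric] szego_density_def by (simp add: sum_distrib_left)
    finally show ?thesis unfolding cellpt_eq[OF k1] .
  qed
  show ?thesis
  proof (rule bigoI[of _ Kc])
    show "eventually (\<lambda>k. norm (norm ((LINT x|rescaled_measure act p0 L h vol e P s z k. f x)
                   - (LINT x|gaussian_measure 0 (potential_hessian act p0 L h e z). f x))) \<le> Kc * norm (1 / sqrt (real k))) sequentially"
      using ev eventually_ge_at_top[of k0]
    proof eventually_elim
      case (elim k)
      show ?case using elim(1) unfolding ph gauss resc[OF elim(2)] by simp
    qed
  qed
qed

end

theorem theorem1p3:
  fixes M :: "('i, 'a::t2_space, 'm::finite) atlas"
    and act :: "complex^'m \<Rightarrow> 'a \<Rightarrow> 'a"
    and p0 :: 'a
    and L :: "('j, 'a) cocycle"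
    and lift :: "complex^'m \<Rightarrow> 'j \<Rightarrow> 'j \<Rightarrow> 'a \<Rightarrow> complex"
    and h :: "'j \<Rightarrow> 'a \<Rightarrow> real"
    and vol :: "'a measure"
    and e :: "'j \<Rightarrow> 'a \<Rightarrow> complex"
    and P :: "(real^'m) set"
    and s :: "nat \<Rightarrow> int^'m \<Rightarrow> 'j \<Rightarrow> 'a \<Rightarrow> complex"
    and z :: "complex^'m"
    and f fhat :: "real^'m \<Rightarrow> complex"
  assumes "polarized_toric_kaehler M act p0 L lift h vol"
    and "invariant_frame M act p0 L lift e"
    and "delzant_polytope P"
    and "monomial_basis M act p0 L e P s"
    and "z \<in> ctorus"
    and "C0 f"
    and "fourier_transform_L1 f fhat"
    and "radially_dominated fhat"
  shows "(\<lambda>k. norm ((LINT x|rescaled_measure act p0 L h vol e P s z k. f x)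
                   - (LINT x|gaussian_measure 0 (potential_hessian act p0 L h e z). f x)))
         \<in> O(\<lambda>k. 1 / sqrt (real k))"
proof -
  interpret toric M act p0 L lift h vol e P s
    using assms(1-4) by unfold_locales
  show ?thesis by (rule clt[OF assms(5-8)])
qed

end
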